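(* Let $0<\beta<1$ and let $\Omega\subset\mathbb{C}$ be a bounded doubly-connected domain with $C^{3,\alpha}$ outermost boundary component. If $\Omega$ is biholomorphic to $B_1-\overline{B}_\beta=\{z:\beta<|z|<1\}$ and $$\lambda(\Omega,v)=\frac{2\pi^2}{3}\Bigl[\Bigl(\frac{\pi}{\ln\beta}\Bigr)^2+1\Bigr],$$ then $\Omega$ can be obtained from $B_1-\overline{B}_\beta$ by a composition of translations and homotheties.
   Context: For a bounded domain $\Omega\subset\mathbb{C}$, let $u$ be the solution of $\Delta u=e^{2u}$ in $\Omega$ with $u\to+\infty$ at $\partial\Omega$ (the conformal factor of the complete hyperbolic metric $e^{2u}g_E$), and set $v=e^{-u}$, so $v\Delta v=|\nabla v|^2-1$ in $\Omega$, $v=0$ on $\partial\Omega$. Near the $C^{3,\alpha}$ outermost boundary component $\mathcal{C}$, $v(z)=d(z)-\tfrac12\kappa(y)d(z)^2+c_3(y)d(z)^3+O(d(z)^{3+\alpha})$, where $d(z)$ is the Euclidean distance to $\partial\Omega$, $y\in\partial\Omega$ is the point with $d(z)=|z-y|$, and $\kappa(y)$ is the boundary curvature at $y$; this defines $c_3$ on $\mathcal{C}$. Then $\lambda(\Omega,v)=-\int_{\mathcal{C}}dl\cdot\int_{\mathcal{C}}c_3\,dl$, with Euclidean arc length. *)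

theory Defs
  imports "HOL-Analysis.Analysis"
begin

text \<open>Classical (C^2) solution of Delta u = e^(2u) in Omega. The Laplacian is the trace
  of the second Frechet derivative in the orthonormal basis 1, i of the complex plane.\<close>
definition solves_liouville :: "complex set \<Rightarrow> (complex \<Rightarrow> real) \<Rightarrow> bool" where
  "solves_liouville \<Omega> u \<longleftrightarrow>
     (\<exists>Du :: complex \<Rightarrow> complex \<Rightarrow>\<^sub>L real.
      \<exists>D2u :: complex \<Rightarrow> complex \<Rightarrow>\<^sub>L (complex \<Rightarrow>\<^sub>L real).
        (\<forall>z\<in>\<Omega>. (u has_derivative blinfun_apply (Du z)) (at z)) \<and>
        (\<forall>z\<in>\<Omega>. (Du has_derivative blinfun_apply (D2u z)) (at z)) \<and>
        continuous_on \<Omega> D2u \<and>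
        (\<forall>z\<in>\<Omega>. blinfun_apply (blinfun_apply (D2u z) 1) 1
                 + blinfun_apply (blinfun_apply (D2u z) \<i>) \<i> = exp (2 * u z)))"

definition blows_up_at_boundary :: "complex set \<Rightarrow> (complex \<Rightarrow> real) \<Rightarrow> bool" where
  "blows_up_at_boundary \<Omega> u \<longleftrightarrow> (\<forall>y\<in>frontier \<Omega>. filterlim u at_top (at y within \<Omega>))"

definition doubly_connected_domain :: "complex set \<Rightarrow> bool" where
  "doubly_connected_domain \<Omega> \<longleftrightarrow> open \<Omega> \<and> connected \<Omega> \<and> \<Omega> \<noteq> {} \<and>
     finite (components (- \<Omega>)) \<and> card (components (- \<Omega>)) = 2"

definition outer_boundary :: "complex set \<Rightarrow> complex set" where
  "outer_boundary \<Omega> = frontier (\<Union>{K \<in> components (- \<Omega>). \<not> bounded K})"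

definition biholomorphic :: "complex set \<Rightarrow> complex set \<Rightarrow> bool" where
  "biholomorphic S T \<longleftrightarrow> (\<exists>f g. f holomorphic_on S \<and> g holomorphic_on T \<and>
      f ` S \<subseteq> T \<and> g ` T \<subseteq> S \<and> (\<forall>z\<in>S. g (f z) = z) \<and> (\<forall>w\<in>T. f (g w) = w))"

definition annulus :: "real \<Rightarrow> complex set" where
  "annulus \<beta> = {z. \<beta> < norm z \<and> norm z < 1}"

text \<open>gamma is a positively oriented (Omega on the left) L-periodic arc-length
  parametrisation of the curve C of class C^{3,alpha}, with derivatives g1, g2, g3.\<close>
definition C3alpha_arclength_param ::
  "complex set \<Rightarrow> complex set \<Rightarrow> real \<Rightarrow> (real \<Rightarrow> complex) \<Rightarrow> real \<Rightarrow>
   (real \<Rightarrow> complex) \<Rightarrow> (real \<Rightarrow> complex) \<Rightarrow> (real \<Rightarrow> complex) \<Rightarrow> bool" where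
  "C3alpha_arclength_param \<Omega> C \<alpha> \<gamma> L g1 g2 g3 \<longleftrightarrow>
     0 < L \<and>
     (\<forall>s. \<gamma> (s + L) = \<gamma> s) \<and>
     inj_on \<gamma> {0..<L} \<and>
     \<gamma> ` {0..L} = C \<and>
     (\<forall>s. (\<gamma> has_vector_derivative g1 s) (at s)) \<and>
     (\<forall>s. (g1 has_vector_derivative g2 s) (at s)) \<and>
     (\<forall>s. (g2 has_vector_derivative g3 s) (at s)) \<and>
     (\<exists>H. \<forall>s t. norm (g3 s - g3 t) \<le> H * \<bar>s - t\<bar> powr \<alpha>) \<and>
     (\<forall>s. norm (g1 s) = 1) \<and>
     (\<forall>s. \<exists>e>0. \<forall>t. 0 < t \<and> t < e \<longrightarrow> \<gamma> s + of_real t * \<i> * g1 s \<in> \<Omega>)"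

text \<open>Signed curvature at gamma(s) (positive for convex outer boundary, e.g. 1 for the unit circle).\<close>
definition curv :: "(real \<Rightarrow> complex) \<Rightarrow> (real \<Rightarrow> complex) \<Rightarrow> real \<Rightarrow> real" where
  "curv g1 g2 s = Im (cnj (g1 s) * g2 s)"

definition third_coeff ::
  "complex set \<Rightarrow> (complex \<Rightarrow> real) \<Rightarrow> real \<Rightarrow> (real \<Rightarrow> complex) \<Rightarrow>
   (real \<Rightarrow> complex) \<Rightarrow> (real \<Rightarrow> complex) \<Rightarrow> (complex \<Rightarrow> real) \<Rightarrow> bool" where
  "third_coeff \<Omega> v \<alpha> \<gamma> g1 g2 c3 \<longleftrightarrow>
     (\<exists>\<delta>>0. \<exists>M. \<forall>z\<in>\<Omega>. \<forall>s.
        let d = infdist z (frontier \<Omega>) in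
        d < \<delta> \<and> dist z (\<gamma> s) = d \<longrightarrow>
        \<bar>v z - (d - curv g1 g2 s / 2 * d ^ 2 + c3 (\<gamma> s) * d ^ 3)\<bar> \<le> M * d powr (3 + \<alpha>))"

end

theory Submission
  imports Defs "HOL-Complex_Analysis.Complex_Analysis"
begin

text \<open>
  Uniformise \<open>\<Omega>\<close> by a covering \<open>G\<close> of the strip \<open>0 < Im z < - ln \<beta>\<close> with period \<open>2 * pi\<close>. By comparison with
  explicit sub- and supersolutions, the Liouville equation pulls back to
  \<open>exp (- u (G z)) = \<bar>G' z\<bar> * sin (k * Im z) / k\<close> with \<open>k = pi / \<bar>ln \<beta>\<bar>\<close>. Near a boundary point, a cubic polynomial
  built from the curvature, its derivative and \<open>c\<^sub>3\<close> maps \<open>\<Omega>\<close> to the upper half plane isometrically up to third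
  order, so the Schwarzian derivative of \<open>G\<close> tends at the boundary to \<open>- k\<^sup>2 / 2 - (3 * c\<^sub>3 - \<i> * \<kappa>') * \<bar>G'\<bar>\<^sup>2\<close>.
  The function \<open>\<phi> = G' powr (- 1/2)\<close> solves \<open>\<phi>'' = - S\<^sub>G * \<phi> / 2\<close> and is antiperiodic, because the tangent of a simple
  closed curve has rotation number \<open>\<plusminus>1\<close>. Integrating \<open>\<bar>\<phi>'\<bar>\<^sup>2\<close> along the boundary turns the hypothesis into
  \<open>(\<integral> \<bar>\<phi>\<bar>\<^sup>-\<^sup>2) * (\<integral> 4 * \<bar>\<phi>'\<bar>\<^sup>2 + k\<^sup>2 * \<bar>\<phi>\<bar>\<^sup>2) = 4 * pi\<^sup>2 * (1 + k\<^sup>2)\<close>, the equality case of a Cauchy--Schwarz inequality for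
  antiperiodic functions. Hence \<open>G'\<close> is a multiple of \<open>exp (\<plusminus> \<i> * z)\<close>, and the sign is determined by the outer boundary.
\<close>

section \<open>Laplacians and the maximum principle\<close>

text \<open>Two obstacles shape the argument. The hypothesis controls \<open>v\<close> only in size,
  not its derivatives, so the expansion cannot be differentiated. Instead the pulled-back metric is
  compared with the half-plane metric on discs of fixed hyperbolic radius: an error o(d^3) in
  \<open>v\<close> is a relative error o(d^2), and a Schwarz-type estimate that is linear in the
  relative error bounds the error of the Schwarzian by o(d^2) / d^2. So the third order is exactly
  the one needed to read off \<open>c3\<close>. Secondly, no boundary smoothness of \<open>G\<close>
  is known beforehand: barriers give two-sided bounds for \<open>|G'|\<close>, the Schwarzian limit
  gives a bounded Schwarzian, and the linear equation for \<phi> then makes \<phi>' Lipschitz up to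
  the boundary. The inner boundary may be irregular, so comparison there rests on interior estimates
  for univalent maps. In the final inequality the constant 4 pi^2 (1 + k^2) splits: the 1 is the
  least square of an odd winding number of \<phi>, counted in half turns, and k^2 comes from
  Cauchy-Schwarz for |\<phi>|^2 and its reciprocal.\<close>

definition twice_diff :: "(real \<Rightarrow> real) \<Rightarrow> real \<Rightarrow> real \<Rightarrow> bool" where
 "twice_diff f p q \<longleftrightarrow> (\<exists>g. (\<forall>\<^sub>F t in nhds 0. (f has_real_derivative g t) (at t)) \<and>
   g 0 = p \<and> (g has_real_derivative q) (at 0))"

lemma twice_diff_add:
 assumes "twice_diff f p q" "twice_diff f' p' q'"
 shows "twice_diff (%t. f t + f' t) (p + p') (q + q')"
proof -
 obtain g where g: "\<forall>\<^sub>F t in nhds 0. (f has_real_derivative g t) (at t)" "g 0 = p"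
   "(g has_real_derivative q) (at 0)"
  using assms(1) by (auto simp: twice_diff_def)
 obtain g' where g': "\<forall>\<^sub>F t in nhds 0. (f' has_real_derivative g' t) (at t)" "g' 0 = p'"
   "(g' has_real_derivative q') (at 0)"
  using assms(2) by (auto simp: twice_diff_def)
 show ?thesis
  unfolding twice_diff_def
 proof (intro exI[of _ "%t. g t + g' t"] conjI)
  show "\<forall>\<^sub>F t in nhds 0. ((%t. f t + f' t) has_real_derivative g t + g' t) (at t)"
   using g(1) g'(1) by eventually_elim (rule DERIV_add)
  show "((%t. g t + g' t) has_real_derivative q + q') (at 0)"
   using g(3) g'(3) by (rule DERIV_add)
 qed (use g g' in auto)
qed

lemma filterlim_line_nhds:
 "filterlim (%t. z + of_real t * e) (nhds z) (nhds (0::real))" for z e :: complex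
proof -
 have "isCont (%t. z + of_real t * e) (0::real)" by (intro continuous_intros)
 then show ?thesis
  unfolding isCont_def by (subst (asm) tendsto_at_iff_tendsto_nhds) simp
qed

lemma twice_diff_compose:
 assumes f: "twice_diff f p q"
  and F: "\<forall>\<^sub>F x in nhds (f 0). (F has_real_derivative F' x) (at x)"
  and F': "(F' has_real_derivative F'') (at (f 0))"
 shows "twice_diff (%t. F (f t)) (F' (f 0) * p) (F'' * p\<^sup>2 + F' (f 0) * q)"
proof -
 obtain g where g: "\<forall>\<^sub>F t in nhds 0. (f has_real_derivative g t) (at t)" "g 0 = p"
   "(g has_real_derivative q) (at 0)"
  using assms(1) by (auto simp: twice_diff_def)
 have f0: "(f has_real_derivative g 0) (at 0)"
  using eventually_nhds_x_imp_x[OF g(1)] .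
 have "isCont f 0" using f0 DERIV_isCont by blast
 then have fl: "filterlim f (nhds (f 0)) (nhds 0)"
  unfolding isCont_def by (subst (asm) tendsto_at_iff_tendsto_nhds)
 have ev: "\<forall>\<^sub>F t in nhds 0. (F has_real_derivative F' (f t)) (at (f t))"
  using eventually_compose_filterlim[OF F fl] .
 show ?thesis
  unfolding twice_diff_def
 proof (intro exI[of _ "%t. F' (f t) * g t"] conjI)
  show "\<forall>\<^sub>F t in nhds 0. ((%t. F (f t)) has_real_derivative F' (f t) * g t) (at t)"
   using g(1) ev by eventually_elim (rule DERIV_chain2)
  have "((%t. F' (f t)) has_real_derivative F'' * g 0) (at 0)"
   using F' f0 by (rule DERIV_chain2)
  then have "((%t. F' (f t) * g t) has_real_derivative (F'' * g 0) * g 0 + q * F' (f 0)) (at 0)"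
   using g(3) by (rule DERIV_mult)
  then show "((%t. F' (f t) * g t) has_real_derivative F'' * p\<^sup>2 + F' (f 0) * q) (at 0)"
   by (simp add: g(2) power2_eq_square algebra_simps)
 qed (use g in auto)
qed

lemma twice_diff_cong:
 assumes "twice_diff f p q" "\<forall>\<^sub>F t in nhds 0. f t = f' t"
 shows "twice_diff f' p q"
proof -
 obtain g where g: "\<forall>\<^sub>F t in nhds 0. (f has_real_derivative g t) (at t)" "g 0 = p"
   "(g has_real_derivative q) (at 0)"
  using assms(1) by (auto simp: twice_diff_def)
 have "\<forall>\<^sub>F t in nhds 0. \<forall>\<^sub>F s in nhds t. f s = f' s"
  using assms(2) by (simp add: eventually_eventually)
 with g(1) have "\<forall>\<^sub>F t in nhds 0. (f' has_real_derivative g t) (at t)"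
  by eventually_elim (metis DERIV_cong_ev)
 with g show ?thesis by (auto simp: twice_diff_def)
qed

text \<open>If \<open>q\<close> were positive, \<open>g\<close> would be positive just to the right
  of 0, and the mean value theorem would push \<open>f\<close> above its local maximum.\<close>

lemma twice_diff_local_max:
 assumes f: "twice_diff f p q" and mx: "\<forall>\<^sub>F t in nhds 0. f t \<le> f 0"
 shows "q \<le> 0"
proof (rule ccontr)
 assume "\<not> q \<le> 0"
 then have q: "q > 0" by simp
 obtain g where g: "\<forall>\<^sub>F t in nhds 0. (f has_real_derivative g t) (at t)" "g 0 = p"
   "(g has_real_derivative q) (at 0)"
  using assms(1) by (auto simp: twice_diff_def)
 obtain d where d: "d > 0" "\<And>t. \<bar>t\<bar> < d ==> (f has_real_derivative g t) (at t) \<and> f t \<le> f 0"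
  using eventually_conj[OF g(1) mx] by (auto simp: eventually_nhds_metric dist_real_def)
 have g0: "g 0 = 0"
  using DERIV_local_max[of f "g 0" 0 d] d by auto
 obtain e where e: "e > 0" "\<And>h. 0 < h ==> h < e ==> g 0 < g (0 + h)"
  using DERIV_pos_inc_right[OF g(3) q] by auto
 define t where "t = min d e / 2"
 have t: "0 < t" "t < d" "t < e" using d e by (auto simp: t_def)
 have "\<exists>z>0. z < t \<and> f t - f 0 = (t - 0) * g z"
  using MVT2[of 0 t f g] t d by auto
 then obtain z where z: "0 < z" "z < t" "f t - f 0 = t * g z" by auto
 then have "g z > 0" using e(2)[of z] g0 t by auto
 then have "f t > f 0" using z t by (metis diff_gt_0_iff_gt mult_pos_pos)
 then show False using d(2)[of t] t by auto
qed

text \<open>Only the second derivatives along the two coordinate lines through the point are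
  recorded, with the gradient \<open>p1\<close>, \<open>p2\<close> that the chain rule consumes.
  This pointwise notion is all that the maximum principle uses.\<close>

definition has_laplacian :: "(complex \<Rightarrow> real) \<Rightarrow> complex \<Rightarrow> real \<Rightarrow> real \<Rightarrow> real \<Rightarrow> bool" where
 "has_laplacian w z p1 p2 l \<longleftrightarrow> (\<exists>q1 q2. twice_diff (%t. w (z + of_real t)) p1 q1 \<and>
   twice_diff (%t. w (z + of_real t * \<i>)) p2 q2 \<and> l = q1 + q2)"

lemma has_laplacian_add:
 assumes "has_laplacian w z p1 p2 l" "has_laplacian w' z p1' p2' l'"
 shows "has_laplacian (%z. w z + w' z) z (p1 + p1') (p2 + p2') (l + l')"
proof -
 obtain q1 q2 where q: "twice_diff (%t. w (z + of_real t)) p1 q1"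
   "twice_diff (%t. w (z + of_real t * \<i>)) p2 q2" "l = q1 + q2"
  using assms(1) by (auto simp: has_laplacian_def)
 obtain r1 r2 where r: "twice_diff (%t. w' (z + of_real t)) p1' r1"
   "twice_diff (%t. w' (z + of_real t * \<i>)) p2' r2" "l' = r1 + r2"
  using assms(2) by (auto simp: has_laplacian_def)
 show ?thesis
  unfolding has_laplacian_def
  by (intro exI[of _ "q1 + r1"] exI[of _ "q2 + r2"] conjI
     twice_diff_add[OF q(1) r(1)] twice_diff_add[OF q(2) r(2)]) (simp add: q r)
qed

lemma has_laplacian_compose:
 assumes f: "has_laplacian w z p1 p2 l"
  and F: "\<forall>\<^sub>F x in nhds (w z). (F has_real_derivative F' x) (at x)"
  and F': "(F' has_real_derivative F'') (at (w z))"
 shows "has_laplacian (%z. F (w z)) z (F' (w z) * p1) (F' (w z) * p2)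
      (F'' * (p1\<^sup>2 + p2\<^sup>2) + F' (w z) * l)"
proof -
 obtain q1 q2 where q: "twice_diff (%t. w (z + of_real t)) p1 q1"
   "twice_diff (%t. w (z + of_real t * \<i>)) p2 q2" "l = q1 + q2"
  using f by (auto simp: has_laplacian_def)
 have "twice_diff (%t. F (w (z + of_real t))) (F' (w z) * p1) (F'' * p1\<^sup>2 + F' (w z) * q1)"
  using twice_diff_compose[OF q(1), of F F' F''] F F' by simp
 moreover have "twice_diff (%t. F (w (z + of_real t * \<i>))) (F' (w z) * p2) (F'' * p2\<^sup>2 + F' (w z) * q2)"
  using twice_diff_compose[OF q(2), of F F' F''] F F' by simp
 ultimately show ?thesis
  unfolding has_laplacian_def q(3)
  by (intro exI[of _ "F'' * p1\<^sup>2 + F' (w z) * q1"] exI[of _ "F'' * p2\<^sup>2 + F' (w z) * q2"])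
    (simp add: algebra_simps)
qed

lemma has_laplacian_cmult:
 assumes "has_laplacian w z p1 p2 l"
 shows "has_laplacian (%z. c * w z) z (c * p1) (c * p2) (c * l)"
proof -
 have "has_laplacian (%z. c * w z) z (c * p1) (c * p2) (0 * (p1\<^sup>2 + p2\<^sup>2) + c * l)"
  by (rule has_laplacian_compose[OF assms]) (auto intro!: derivative_eq_intros always_eventually)
 then show ?thesis by simp
qed

lemma has_laplacian_minus:
 assumes "has_laplacian w z p1 p2 l"
 shows "has_laplacian (%z. - w z) z (- p1) (- p2) (- l)"
 using has_laplacian_cmult[OF assms, of "-1"] by simp

lemma has_laplacian_diff:
 assumes "has_laplacian w z p1 p2 l" "has_laplacian w' z p1' p2' l'"
 shows "has_laplacian (%z. w z - w' z) z (p1 - p1') (p2 - p2') (l - l')"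
 using has_laplacian_add[OF assms(1) has_laplacian_minus[OF assms(2)]] by simp

lemma has_laplacian_add_const:
 assumes "has_laplacian w z p1 p2 l"
 shows "has_laplacian (%z. w z + c) z p1 p2 l"
proof -
 have "has_laplacian (%z. w z + c) z (1 * p1) (1 * p2) (0 * (p1\<^sup>2 + p2\<^sup>2) + 1 * l)"
  by (rule has_laplacian_compose[OF assms]) (auto intro!: derivative_eq_intros always_eventually)
 then show ?thesis by simp
qed

lemma has_laplacian_cong:
 assumes "has_laplacian w z p1 p2 l" "\<forall>\<^sub>F x in nhds z. w x = w' x"
 shows "has_laplacian w' z p1 p2 l"
proof -
 have 2: "\<forall>\<^sub>F t in nhds (0::real). w (z + of_real t * e) = w' (z + of_real t * e)" for e
  using eventually_compose_filterlim[OF assms(2) filterlim_line_nhds[of z e]] .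
 from assms(1) show ?thesis
  unfolding has_laplacian_def
  using twice_diff_cong[OF _ 2[of 1, simplified]] twice_diff_cong[OF _ 2[of \<i>]] by blast
qed

text \<open>The second derivative of \<open>Re b\<close> in direction \<open>e\<close> is
  \<open>Re (b'' * e * e)\<close>, and the squares of 1 and \<open>\<i>\<close> cancel.\<close>

lemma has_laplacian_Re_holomorphic:
 assumes hol: "b holomorphic_on S" "open S" "z \<in> S"
 shows "has_laplacian (%z. Re (b z)) z (Re (deriv b z)) (- Im (deriv b z)) 0"
proof -
 have line: "twice_diff (%t. Re (b (z + of_real t * e))) (Re (deriv b z * e)) (Re (deriv (deriv b) z * e * e))" for e
 proof -
  have hd: "deriv b holomorphic_on S" using hol by (intro holomorphic_deriv)
  have D: "(b has_field_derivative deriv b x) (at x)" "(deriv b has_field_derivative deriv (deriv b) x) (at x)"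
   if "x \<in> S" for x
   using that hol hd holomorphic_derivI by blast+
  have L: "((%t. Re (c (z + of_real t * e) * a)) has_real_derivative Re (c' * e * a)) (at t)"
   if "(c has_field_derivative c') (at (z + of_real t * e))" for c c' t a
  proof -
   have "((%t::real. z + of_real t * e) has_vector_derivative e) (at t)"
    by (auto intro!: derivative_eq_intros)
   then have "((c \<circ> (%t. z + of_real t * e)) has_vector_derivative (e * c')) (at t)"
    using that by (intro field_vector_diff_chain_at)
   then have "((%t. c (z + of_real t * e) * a) has_vector_derivative (c' * e * a)) (at t)"
    unfolding o_def by (auto intro!: derivative_eq_intros simp: mult_ac)
   then have "((%t. Re (c (z + of_real t * e) * a)) has_vector_derivative Re (c' * e * a)) (at t)"
    by (rule bounded_linear.has_vector_derivative[OF bounded_linear_Re])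
   then show ?thesis by (simp add: has_real_derivative_iff_has_vector_derivative)
  qed
  have "\<forall>\<^sub>F x in nhds z. x \<in> S" using hol eventually_nhds_in_open by blast
  then have ev: "\<forall>\<^sub>F t in nhds (0::real). z + of_real t * e \<in> S"
   by (rule eventually_compose_filterlim[OF _ filterlim_line_nhds])
  show ?thesis
   unfolding twice_diff_def
  proof (intro exI[of _ "%t. Re (deriv b (z + of_real t * e) * e)"] conjI)
   show "\<forall>\<^sub>F t in nhds 0. ((%t. Re (b (z + of_real t * e))) has_real_derivative
       Re (deriv b (z + of_real t * e) * e)) (at t)"
    using ev by eventually_elim (use L[OF D(1), of _ 1] in simp)
   show "((%t. Re (deriv b (z + of_real t * e) * e)) has_real_derivative Re (deriv (deriv b) z * e * e)) (at 0)"
    using L[of "deriv b" "deriv (deriv b) z" 0 e] D(2)[OF hol(3)] by simp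
  qed simp
 qed
 show ?thesis
  unfolding has_laplacian_def using line[of 1] line[of \<i>]
  by (intro exI[of _ "Re (deriv (deriv b) z)"] exI[of _ "- Re (deriv (deriv b) z)"]) simp
qed

text \<open>At an interior maximum both axis derivatives of second order are nonpositive, against
  \<open>l > 0\<close>. Positivity of the Laplacian is asked only where \<open>w > 0\<close>, which
  is what the nonlinear comparisons can supply, and the boundary condition is one-sided so that
  \<open>w\<close> may tend to minus infinity there.\<close>

lemma max_principle:
 fixes w :: "complex \<Rightarrow> real"
 assumes S: "open S" "bounded S" and cont: "continuous_on S w"
  and lap: "\<And>z. z \<in> S ==> w z > 0 ==> \<exists>p1 p2 l. has_laplacian w z p1 p2 l \<and> l > 0"
  and bdry: "\<And>y e. y \<in> frontier S ==> e > 0 ==> \<forall>\<^sub>F z in at y within S. w z < e"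
  and z: "z \<in> S"
 shows "w z \<le> 0"
proof (rule ccontr)
 assume "\<not> w z \<le> 0"
 then have wz: "w z > 0" by simp
 \<comment> \<open>The boundary condition keeps this superlevel set away from the frontier, so it is
   compact and \<open>w\<close> attains its maximum over the whole of \<open>S\<close> in
   it.\<close>
 define K where "K = {x \<in> S. w x \<ge> w z}"
 have "closed K"
 proof (unfold closed_sequential_limits, intro allI impI, elim conjE)
  fix X l assume X: "\<forall>n. X n \<in> K" "X \<longlonglongrightarrow> l"
  have "l \<in> S"
  proof (rule ccontr)
   assume "l \<notin> S"
   have XS: "X n \<in> S" for n using X(1) by (auto simp: K_def)
   have "l \<in> closure S" using X(2) XS by (auto simp: closure_sequential)
   then have "l \<in> frontier S" using \<open>l \<notin> S\<close> S(1) by (auto simp: frontier_def interior_open)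
   then have "\<forall>\<^sub>F x in at l within S. w x < w z" using bdry wz by blast
   moreover have "filterlim X (at l within S) sequentially"
    unfolding filterlim_at using X(2) XS \<open>l \<notin> S\<close> by (auto intro!: always_eventually)
   ultimately have "\<forall>\<^sub>F n in sequentially. w (X n) < w z" by (auto simp: filterlim_iff)
   then show False using X(1) by (auto simp: K_def eventually_sequentially) (metis leD order_refl)
  qed
  have "(%n. w (X n)) \<longlonglongrightarrow> w l"
  proof -
   have "isCont w l" using cont S \<open>l \<in> S\<close> continuous_on_eq_continuous_at by blast
   then show ?thesis using X(2) isCont_tendsto_compose by blast
  qed
  then have "w z \<le> w l"
   using X(1) by (intro LIMSEQ_le_const) (auto simp: K_def)
  then show "l \<in> K" using \<open>l \<in> S\<close> by (simp add: K_def)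
 qed
 moreover have "bounded K" using S(2) by (rule bounded_subset) (auto simp: K_def)
 ultimately have "compact K" by (simp add: compact_eq_bounded_closed)
 moreover have "K \<noteq> {}" using z by (auto simp: K_def)
 moreover have "continuous_on K w" using cont by (rule continuous_on_subset) (auto simp: K_def)
 ultimately obtain m where m: "m \<in> K" "\<And>x. x \<in> K ==> w x \<le> w m"
  using continuous_attains_sup[of K w] by auto
 have mS: "m \<in> S" and wm: "w m > 0" using m(1) wz by (auto simp: K_def)
 have mm: "w x \<le> w m" if "x \<in> S" for x
  using m(2)[of x] m(1) that by (cases "w x \<ge> w z") (auto simp: K_def)
 obtain p1 p2 l where l: "has_laplacian w m p1 p2 l" "l > 0" using lap[OF mS wm] by blast
 obtain q1 q2 where q: "twice_diff (%t. w (m + of_real t)) p1 q1"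
   "twice_diff (%t. w (m + of_real t * \<i>)) p2 q2" "l = q1 + q2"
  using l by (auto simp: has_laplacian_def)
 have ev: "\<forall>\<^sub>F t in nhds (0::real). w (m + of_real t * e) \<le> w m" for e
 proof -
  have "\<forall>\<^sub>F x in nhds m. x \<in> S" using S mS eventually_nhds_in_open by blast
  then have "\<forall>\<^sub>F t in nhds (0::real). m + of_real t * e \<in> S"
   by (rule eventually_compose_filterlim[OF _ filterlim_line_nhds])
  then show ?thesis by eventually_elim (rule mm)
 qed
 have "q1 \<le> 0" using twice_diff_local_max[OF q(1)] ev[of 1] by simp
 moreover have "q2 \<le> 0" using twice_diff_local_max[OF q(2)] ev[of \<i>] by simp
 ultimately show False using l(2) q(3) by simp
qed

section \<open>The Schwarzian derivative of nearly isometric maps\<close>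

text \<open>A crude form of Bieberbach's coefficient bound. A normalised univalent \<open>g\<close>
  omits a value \<open>w0\<close> of modulus at most 2; a square root of \<open>1 - g / w0\<close>
  then omits 0 and -1, Schottky's theorem bounds it near the centre, and Cauchy's inequality bounds
  the second derivative.\<close>

lemma univalent_second_derivative_bound:
 obtains C where "C > 0"
  and "\<And>g. g holomorphic_on ball 0 1 ==> inj_on g (ball 0 1) ==> g 0 = 0 ==> deriv g 0 = 1
     ==> norm (deriv (deriv g) 0) \<le> C"
proof -
 \<comment> \<open>Schottky's bound on the disc of radius 1/2 for a function whose value at the
   centre has modulus at most 1.\<close>
 define M :: real where "M = exp (pi * exp (pi * (2 + 2 * 1 + 12 * (1/2) / (1 - 1/2))))"
 have bd: "norm (deriv (deriv g) 0) \<le> 64 * (1 + M\<^sup>2)"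
  if g: "g holomorphic_on ball 0 1" "inj_on g (ball 0 1)" "g 0 = 0" "deriv g 0 = 1" for g :: "complex \<Rightarrow> complex"
 proof -
  obtain j where j: "j holomorphic_on (g ` ball 0 1)" "\<And>z. z \<in> ball 0 1 ==> deriv g z * deriv j (g z) = 1"
    "\<And>z. z \<in> ball 0 1 ==> j (g z) = z"
   using holomorphic_has_inverse[OF g(1) _ g(2)] by auto
  \<comment> \<open>Otherwise the inverse \<open>j\<close>, rescaled by 2, would map the unit disc
    into itself with derivative 2 at 0, against the Schwarz lemma.\<close>
  have "\<not> cball 0 2 \<subseteq> g ` ball 0 1"
  proof
   assume sub: "cball 0 2 \<subseteq> g ` ball 0 1"
   have hF: "(%x. j (2 * x)) holomorphic_on ball 0 1"
    by (rule holomorphic_on_compose_gen[OF _ j(1), unfolded o_def])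
      (use sub in \<open>auto intro!: holomorphic_intros subsetD[OF sub] simp: norm_mult\<close>)
   have F0: "j (2 * 0) = 0" using j(3)[of 0] g(3) by simp
   have nF: "norm (j (2 * x)) < 1" if "norm x < 1" for x
   proof -
    have "2 * x \<in> g ` ball 0 1" using that by (intro subsetD[OF sub]) (auto simp: norm_mult)
    then obtain y where "y \<in> ball 0 1" "2 * x = g y" by auto
    then show ?thesis using j(3) by auto
   qed
   have "norm (deriv (%x. j (2 * x)) 0) \<le> 1"
    using Schwarz_Lemma(2)[OF hF F0 nF, of 0] by simp
   moreover have "deriv (%x. j (2 * x)) 0 = 2"
   proof -
    have "0 \<in> g ` ball 0 1" using g(3) by (metis centre_in_ball image_eqI zero_less_one)
    then have "(j has_field_derivative deriv j 0) (at (2 * 0))"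
     using holomorphic_derivI[OF j(1) open_mapping_thm3[OF g(1) _ g(2)], of 0] by simp
    then have "((%x. j (2 * x)) has_field_derivative deriv j 0 * 2) (at 0)"
     by (rule DERIV_chain2) (auto intro!: derivative_eq_intros)
    moreover have "deriv j 0 = 1" using j(2)[of 0] g by simp
    ultimately show ?thesis by (simp add: DERIV_imp_deriv)
   qed
   ultimately show False by simp
  qed
  then obtain w0 where "w0 \<in> cball 0 2" and w0n: "w0 \<notin> g ` ball 0 1" by blast
  then have w0: "norm w0 \<le> 2" "w0 \<notin> g ` ball 0 1" by auto
  have w0nz: "w0 \<noteq> 0" using w0(2) g(3) by (metis centre_in_ball image_eqI zero_less_one)
  have "1 - g x / w0 \<noteq> 0" if "x \<in> ball 0 1" for x using that w0 w0nz by auto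
  moreover have "(%x. 1 - g x / w0) holomorphic_on ball 0 1"
   using w0nz by (intro holomorphic_intros g(1))
  ultimately obtain l where l: "l holomorphic_on ball 0 1" "\<And>x. x \<in> ball 0 1 ==> exp (l x) = 1 - g x / w0"
   using holomorphic_logarithm_exists[of "ball 0 1" "%x. 1 - g x / w0" 0] by (metis centre_in_ball convex_ball open_ball zero_less_one)
  define h where "h x = exp ((l x - l 0) / 2)" for x
  have h2: "h x ^ 2 = 1 - g x / w0" if "x \<in> ball 0 1" for x
  proof -
   have "h x ^ 2 = exp (l x - l 0)" by (simp add: h_def power2_eq_square exp_add[symmetric])
   also have "\<dots> = exp (l x) / exp (l 0)" by (rule exp_diff)
   finally show ?thesis using l(2)[OF that] l(2)[of 0] g(3) by simp
  qed
  have hh: "h holomorphic_on ball 0 1" unfolding h_def by (intro holomorphic_intros l) auto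
  have hb: "norm (h x) \<le> M" if x: "norm x \<le> 1/4" for x
  proof -
   have "norm ((%z. - h (z / 2)) (2 * x)) \<le> exp (pi * exp (pi * (2 + 2 * 1 + 12 * (1/2) / (1 - 1/2))))"
   proof (rule Schottky[of "%z. - h (z / 2)" 1 "1/2" "2 * x"])
    have "(%z. h (z / 2)) holomorphic_on cball 0 1"
     by (rule holomorphic_on_compose_gen[OF _ hh, unfolded o_def]) (auto intro!: holomorphic_intros)
    then show "(%z. - h (z / 2)) holomorphic_on cball 0 1" by (intro holomorphic_intros)
    show "\<not> (- h (z / 2) = 0 \<or> - h (z / 2) = 1)" if "z \<in> cball 0 1" for z
    proof -
     have zb: "z / 2 \<in> ball 0 1" using that by (simp add: norm_divide)
     \<comment> \<open>The value -1 of the root means \<open>g = 0\<close>; univalence then leaves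
       only the centre, where the root is 1.\<close>
     have "h (z / 2) \<noteq> -1"
     proof
      assume a: "h (z / 2) = -1"
      then have "g (z / 2) = 0" using h2[OF zb] w0nz by simp
      then have "z / 2 = 0" using inj_onD[OF g(2) _ zb, of 0] g(3) by simp
      then show False using a by (simp add: h_def)
     qed
     then show ?thesis by (auto simp: h_def) (metis add.inverse_inverse h_def)
    qed
   qed (use x in \<open>auto simp: h_def norm_mult\<close>)
   then show ?thesis by (simp add: M_def)
  qed
  have gb: "norm (g x) \<le> 2 * (1 + M\<^sup>2)" if x: "norm x \<le> 1/4" for x
  proof -
   have "g x = w0 * (1 - h x ^ 2)" using h2[of x] x w0nz by simp
   then have "norm (g x) \<le> 2 * norm (1 - h x ^ 2)" using w0(1) by (simp add: norm_mult mult_right_mono)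
   also have "norm (1 - h x ^ 2) \<le> 1 + norm (h x) ^ 2"
    by (metis norm_one norm_power norm_triangle_ineq4)
   also have "\<dots> \<le> 1 + M\<^sup>2" using hb[OF x] by (simp add: power_mono)
   finally show ?thesis by simp
  qed
  have "norm ((deriv ^^ 2) g 0) \<le> fact 2 * (2 * (1 + M\<^sup>2)) / (1/4) ^ 2"
  proof (rule Cauchy_inequality)
   show "g holomorphic_on ball 0 (1/4)" by (rule holomorphic_on_subset[OF g(1)]) auto
   show "continuous_on (cball 0 (1/4)) g"
    by (rule holomorphic_on_imp_continuous_on[OF holomorphic_on_subset[OF g(1)]]) auto
  qed (use gb in auto)
  then show ?thesis by (simp add: numeral_2_eq_2 power2_eq_square)
 qed
 show ?thesis by (rule that[of "64 * (1 + M\<^sup>2)"]) (use bd in \<open>auto intro: add_pos_nonneg\<close>)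
qed

text \<open>The previous bound after rescaling, now in a form invariant under affine changes. It
  replaces boundary regularity in the gradient estimate for the explicit solution.\<close>

lemma univalent_distortion:
 obtains C where "C > 0"
  and "\<And>G z r. 0 < r ==> G holomorphic_on ball z r ==> inj_on G (ball z r)
     ==> r * norm (deriv (deriv G) z) \<le> C * norm (deriv G z)"
proof -
 obtain C where C: "C > 0" "\<And>g. g holomorphic_on ball 0 1 ==> inj_on g (ball 0 1) ==> g 0 = 0 ==> deriv g 0 = 1
     ==> norm (deriv (deriv g) 0) \<le> C"
  using univalent_second_derivative_bound by blast
 have "r * norm (deriv (deriv G) z) \<le> C * norm (deriv G z)"
  if r: "0 < r" and G: "G holomorphic_on ball z r" "inj_on G (ball z r)" for G z and r :: real
 proof -
  define d where "d = deriv G z"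
  have d: "d \<noteq> 0" unfolding d_def
   by (rule holomorphic_injective_imp_regular[OF G(1) _ G(2)]) (use r in auto)
  define g where "g x = (G (z + of_real r * x) - G z) / (of_real r * d)" for x
  have mem: "z + of_real r * x \<in> ball z r" if "x \<in> ball 0 1" for x
   using that r by (simp add: dist_norm norm_mult)
  have D1: "(g has_field_derivative deriv G (z + of_real r * x) / d) (at x)" if "x \<in> ball 0 1" for x
  proof -
   have "(G has_field_derivative deriv G (z + of_real r * x)) (at (z + of_real r * x))"
    using holomorphic_derivI[OF G(1) open_ball mem[OF that]] by simp
   then have "((%x. G (z + of_real r * x)) has_field_derivative deriv G (z + of_real r * x) * of_real r) (at x)"
    by (rule DERIV_chain2) (auto intro!: derivative_eq_intros)
   then show ?thesis unfolding g_def using r d by (auto intro!: derivative_eq_intros simp: field_simps)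
  qed
  have hg: "g holomorphic_on ball 0 1"
   unfolding holomorphic_on_open[OF open_ball] using D1 by blast
  have ig: "inj_on g (ball 0 1)"
  proof (rule inj_onI)
   fix x y assume xy: "x \<in> ball 0 1" "y \<in> ball 0 1" "g x = g y"
   then have "G (z + of_real r * x) = G (z + of_real r * y)" using r d by (simp add: g_def)
   then have "z + of_real r * x = z + of_real r * y" using G(2) mem xy by (meson inj_onD)
   then show "x = y" using r by simp
  qed
  have dg: "deriv g x = deriv G (z + of_real r * x) / d" if "x \<in> ball 0 1" for x
   using D1[OF that] by (rule DERIV_imp_deriv)
  have "deriv (deriv g) 0 = of_real r * deriv (deriv G) z / d"
  proof (rule DERIV_imp_deriv)
   have "(deriv G has_field_derivative deriv (deriv G) z) (at (z + of_real r * 0))"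
    using holomorphic_derivI[OF holomorphic_deriv[OF G(1) open_ball] open_ball, of z] r by simp
   then have "((%x. deriv G (z + of_real r * x)) has_field_derivative deriv (deriv G) z * of_real r) (at 0)"
    by (rule DERIV_chain2) (auto intro!: derivative_eq_intros)
   then have "((%x. deriv G (z + of_real r * x) / d) has_field_derivative of_real r * deriv (deriv G) z / d) (at 0)"
    using DERIV_cdivide[of "%x. deriv G (z + of_real r * x)" _ 0 UNIV d] by (simp add: mult.commute)
   moreover have "\<forall>\<^sub>F x in nhds 0. deriv G (z + of_real r * x) / d = deriv g x"
    using eventually_nhds_in_open[of "ball 0 1" "0::complex"] by (auto elim!: eventually_mono simp: dg)
   ultimately show "(deriv g has_field_derivative of_real r * deriv (deriv G) z / d) (at 0)"
    using DERIV_cong_ev[OF refl _ refl, of "%x. deriv G (z + of_real r * x) / d" "deriv g" 0] by simp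
  qed
  then have "norm (of_real r * deriv (deriv G) z / d) \<le> C"
   using C(2)[OF hg ig] dg[of 0] d by (simp add: g_def d_def)
  then show ?thesis using r d by (simp add: norm_mult norm_divide d_def field_simps)
 qed
 then show ?thesis using C(1) that by blast
qed

definition schwarzian :: "(complex \<Rightarrow> complex) \<Rightarrow> complex \<Rightarrow> complex" where
 "schwarzian f z = deriv (deriv (deriv f)) z / deriv f z - 3/2 * (deriv (deriv f) z / deriv f z)\<^sup>2"

lemma schwarzian_compose:
 assumes g: "g holomorphic_on S" "open S" and f: "f holomorphic_on T" "open T"
  and gS: "g ` S \<subseteq> T" and z: "z \<in> S" and nz: "deriv g z \<noteq> 0" "deriv f (g z) \<noteq> 0"
 shows "schwarzian (%x. f (g x)) z = schwarzian f (g z) * (deriv g z)\<^sup>2 + schwarzian g z"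
proof -
 have hg: "deriv g holomorphic_on S" "deriv (deriv g) holomorphic_on S"
  using g by (auto intro!: holomorphic_deriv)
 have hf: "deriv f holomorphic_on T" "deriv (deriv f) holomorphic_on T"
  using f by (auto intro!: holomorphic_deriv)
 have Dg: "(g has_field_derivative deriv g x) (at x)" "(deriv g has_field_derivative deriv (deriv g) x) (at x)"
  "(deriv (deriv g) has_field_derivative deriv (deriv (deriv g)) x) (at x)" if "x \<in> S" for x
  using holomorphic_derivI[OF _ g(2) that] g hg by blast+
 have Df: "((%x. f (g x)) has_field_derivative deriv f (g x) * deriv g x) (at x)"
  "((%x. deriv f (g x)) has_field_derivative deriv (deriv f) (g x) * deriv g x) (at x)"
  "((%x. deriv (deriv f) (g x)) has_field_derivative deriv (deriv (deriv f)) (g x) * deriv g x) (at x)" if "x \<in> S" for x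
  using that gS holomorphic_derivI[OF _ f(2)] f(1) hf
  by (auto intro!: DERIV_chain2[OF _ Dg(1)] simp: image_subset_iff)
 have 1: "deriv (%x. f (g x)) x = deriv f (g x) * deriv g x" if "x \<in> S" for x
  using Df(1)[OF that] by (rule DERIV_imp_deriv)
 have ev: "\<forall>\<^sub>F y in nhds x. y \<in> S" if "x \<in> S" for x using g(2) that by (rule eventually_nhds_in_open)
 have 2: "deriv (deriv (%x. f (g x))) x = deriv (deriv f) (g x) * (deriv g x)\<^sup>2 + deriv f (g x) * deriv (deriv g) x"
  if x: "x \<in> S" for x
 proof -
  have "deriv (deriv (%x. f (g x))) x = deriv (%x. deriv f (g x) * deriv g x) x"
   by (rule deriv_cong_ev[OF eventually_mono[OF ev[OF x]] refl]) (rule 1)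
  also have "((%x. deriv f (g x) * deriv g x) has_field_derivative
    deriv (deriv f) (g x) * deriv g x * deriv g x + deriv (deriv g) x * deriv f (g x)) (at x)"
   by (rule DERIV_mult[OF Df(2)[OF x] Dg(2)[OF x]])
  from DERIV_imp_deriv[OF this] have "deriv (%x. deriv f (g x) * deriv g x) x =
    deriv (deriv f) (g x) * (deriv g x)\<^sup>2 + deriv f (g x) * deriv (deriv g) x"
   by (simp add: power2_eq_square)
  finally show ?thesis .
 qed
 have 3: "deriv (deriv (deriv (%x. f (g x)))) z = deriv (deriv (deriv f)) (g z) * (deriv g z)^3 +
   3 * deriv (deriv f) (g z) * deriv g z * deriv (deriv g) z + deriv f (g z) * deriv (deriv (deriv g)) z"
 proof -
  have "deriv (deriv (deriv (%x. f (g x)))) z =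
    deriv (%x. deriv (deriv f) (g x) * (deriv g x)\<^sup>2 + deriv f (g x) * deriv (deriv g) x) z"
   by (rule deriv_cong_ev[OF eventually_mono[OF ev[OF z]] refl]) (rule 2)
  also have "((%x. deriv (deriv f) (g x) * (deriv g x)\<^sup>2 + deriv f (g x) * deriv (deriv g) x) has_field_derivative
   deriv (deriv (deriv f)) (g z) * (deriv g z)^3 +
   3 * deriv (deriv f) (g z) * deriv g z * deriv (deriv g) z + deriv f (g z) * deriv (deriv (deriv g)) z) (at z)"
   using Df(2,3)[OF z] Dg(2,3)[OF z]
   by (auto intro!: derivative_eq_intros simp: power2_eq_square power3_eq_cube algebra_simps)
  from DERIV_imp_deriv[OF this] have "deriv (%x. deriv (deriv f) (g x) * (deriv g x)\<^sup>2 + deriv f (g x) * deriv (deriv g) x) z =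
   deriv (deriv (deriv f)) (g z) * (deriv g z)^3 +
   3 * deriv (deriv f) (g z) * deriv g z * deriv (deriv g) z + deriv f (g z) * deriv (deriv (deriv g)) z" .
  finally show ?thesis .
 qed
 show ?thesis
  unfolding schwarzian_def 1[OF z] 2[OF z] 3 using nz
  by (simp add: field_simps power2_eq_square power3_eq_cube)
qed

section \<open>Near isometries of the hyperbolic disc\<close>

text \<open>Ahlfors' form of the Schwarz lemma, made local. At a point \<open>x1\<close> where
  \<open>|Y(x) / x|\<close> is largest on the closed disc, comparison along the ray gives
  \<open>|Y(x1) / x1| <= |Y'(x1)|\<close>. If this quotient exceeded \<open>1 + e\<close>, then
  \<open>|Y(x1)|\<close> would exceed \<open>|x1|\<close> and the metric inequality would force
  \<open>|Y'(x1)| <= 1 + e\<close>.\<close>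

lemma near_isometry_factor_bound:
 assumes Y: "Y holomorphic_on ball 0 rh" "Y 0 = 0" and rh: "0 < rh" "rh < 1" and e: "0 \<le> e"
  and bd: "\<And>x. norm x < rh ==> norm (Y x) < 1 \<and>
    (1 - (norm x)\<^sup>2) * norm (deriv Y x) \<le> (1 + e) * (1 - (norm (Y x))\<^sup>2)"
  and x: "norm x < rh"
 shows "norm (Y x) \<le> (1 + e) * norm x"
proof (cases "x = 0")
 case True then show ?thesis using Y by simp
next
 case False
 obtain b where b: "b holomorphic_on ball 0 rh" "\<And>z. norm z < rh ==> Y z = z * b z"
  using Schwarz3[OF Y] by metis
 define si where "si = norm x"
 have si: "0 < si" "si < rh" using False x by (auto simp: si_def)
 have "continuous_on (cball 0 si) (%z. norm (b z))"
  by (intro continuous_on_norm holomorphic_on_imp_continuous_on holomorphic_on_subset[OF b(1)]) (use si in auto)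
 then obtain x1 where x1: "x1 \<in> cball 0 si" "\<And>z. z \<in> cball 0 si ==> norm (b z) \<le> norm (b x1)"
  using continuous_attains_sup[of "cball 0 si" "%z. norm (b z)"] si by auto
 have m: "norm (b x1) \<le> 1 + e"
 proof (rule ccontr)
  assume nle: "\<not> norm (b x1) \<le> 1 + e"
  then have m1: "norm (b x1) > 1" using e by simp
  show False
  proof (cases "x1 = 0")
   case True
   have "deriv Y 0 = b 0"
   proof (rule DERIV_imp_deriv)
    have "((%z. z * b z) has_field_derivative 1 * b 0 + deriv b 0 * 0) (at 0)"
     using rh by (intro DERIV_mult DERIV_ident holomorphic_derivI[OF b(1)]) auto
    moreover have "\<forall>\<^sub>F z in nhds 0. z * b z = Y z"
     using eventually_nhds_in_open[of "ball 0 rh" "0::complex"] rh by (auto elim!: eventually_mono simp: b(2))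
    ultimately show "(Y has_field_derivative b 0) (at 0)"
     using DERIV_cong_ev[OF refl _ refl, of "%z. z * b z" Y 0] by simp
   qed
   then show False using bd[of 0] rh Y(2) nle True by simp
  next
   case False
   have x1rh: "norm x1 < rh" using x1(1) si by simp
   define F where "F t = (norm (Y (of_real t * x1)))\<^sup>2" for t :: real
   define D where "D = deriv Y x1"
   have DY: "(Y has_field_derivative D) (at x1)"
    unfolding D_def using holomorphic_derivI[OF Y(1)] x1rh by simp
   have "((%t::real. of_real t * x1) has_vector_derivative x1) (at 1)"
    by (auto intro!: derivative_eq_intros)
   then have "((Y \<circ> (%t::real. of_real t * x1)) has_vector_derivative x1 * D) (at 1)"
    using DY by (intro field_vector_diff_chain_at) auto
   then have V: "((%t::real. Y (of_real t * x1)) has_vector_derivative x1 * D) (at 1)"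
    by (simp add: o_def)
   have Fd: "(F has_real_derivative 2 * (Y x1 \<bullet> (x1 * D))) (at 1)"
   proof -
    have "((%t::real. Y (of_real t * x1) \<bullet> Y (of_real t * x1)) has_derivative
      (%h. Y (of_real 1 * x1) \<bullet> (h *\<^sub>R (x1 * D)) + (h *\<^sub>R (x1 * D)) \<bullet> Y (of_real 1 * x1))) (at 1)"
     by (rule has_derivative_inner) (use V in \<open>simp_all add: has_vector_derivative_def\<close>)
    then show ?thesis
     unfolding F_def has_field_derivative_def dot_square_norm[symmetric]
     by (rule has_derivative_eq_rhs) (auto simp: inner_commute)
   qed
   have Fle: "F t \<le> t\<^sup>2 * F 1" if "0 \<le> t" "t \<le> 1" for t
   proof -
    have nt: "norm (of_real t * x1) \<le> norm x1" using that by (simp add: norm_mult mult_left_le_one_le)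
    then have "norm (b (of_real t * x1)) \<le> norm (b x1)" using x1 by auto
    then have "norm (Y (of_real t * x1)) \<le> t * norm (Y x1)"
     using nt x1rh that by (simp add: b(2) norm_mult mult_left_mono mult.assoc)
    then have "F t \<le> (t * norm (Y x1))\<^sup>2" unfolding F_def by (intro power_mono) auto
    then show ?thesis by (simp add: F_def power_mult_distrib)
   qed
   \<comment> \<open>By \<open>Fle\<close>, \<open>t\<^sup>2 * F 1 - F t\<close> is nonnegative on
     [0, 1] and vanishes at 1, so its derivative at 1 cannot be positive.\<close>
   have "2 * F 1 \<le> 2 * (Y x1 \<bullet> (x1 * D))"
   proof (rule ccontr)
    assume n: "\<not> ?thesis"
    have "((%t. t\<^sup>2 * F 1 - F t) has_real_derivative 2 * F 1 - 2 * (Y x1 \<bullet> (x1 * D))) (at 1)"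
     using Fd by (auto intro!: derivative_eq_intros)
    from DERIV_pos_inc_left[OF this] n obtain d where d: "d > 0"
     "\<And>h. 0 < h ==> h < d ==> (1 - h)\<^sup>2 * F 1 - F (1 - h) < 1\<^sup>2 * F 1 - F 1" by force
    define h where "h = min (d/2) (1/2)"
    have "0 < h" "h < d" "h \<le> 1/2" using d by (auto simp: h_def)
    then show False using d(2)[of h] Fle[of "1 - h"] by simp
   qed
   also have "Y x1 \<bullet> (x1 * D) \<le> norm (Y x1) * (norm x1 * norm D)"
    using norm_cauchy_schwarz[of "Y x1" "x1 * D"] by (simp add: norm_mult)
   finally have "norm (Y x1) * norm (Y x1) \<le> norm (Y x1) * (norm x1 * norm D)"
    by (simp add: F_def power2_eq_square)
   moreover have Ypos: "norm (Y x1) > 0" using False m1 x1rh by (auto simp: b(2))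
   ultimately have "norm (Y x1) \<le> norm x1 * norm D" by simp
   then have bD: "norm (b x1) \<le> norm D" using False x1rh by (simp add: b(2) norm_mult)
   have sm: "(norm x1)\<^sup>2 \<le> (norm (Y x1))\<^sup>2"
    using m1 x1rh by (intro power_mono) (auto simp: b(2) norm_mult mult_le_cancel_left1)
   have n1: "1 - (norm x1)\<^sup>2 > 0" using x1rh rh by (simp add: abs_square_less_1)
   have "(1 - (norm x1)\<^sup>2) * norm (b x1) \<le> (1 - (norm x1)\<^sup>2) * norm D"
    using bD n1 by (simp add: mult_left_mono)
   also have "\<dots> \<le> (1 + e) * (1 - (norm (Y x1))\<^sup>2)" using bd[OF x1rh] by (simp add: D_def)
   also have "\<dots> \<le> (1 + e) * (1 - (norm x1)\<^sup>2)" using sm e by (intro mult_left_mono) auto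
   finally show False using nle n1 by (simp add: mult.commute)
  qed
 qed
 have "norm (b x) \<le> 1 + e" using x1(2)[of x] m by (auto simp: si_def)
 then have "norm x * norm (b x) \<le> norm x * (1 + e)" by (rule mult_left_mono) simp
 then show ?thesis using x by (simp add: b(2) norm_mult mult.commute)
qed

text \<open>The factor \<open>b = Y / x\<close> stays in a disc of radius \<open>1 + e\<close> and
  starts within \<open>e\<close> of its boundary, so after a rotation it is pinned by Harnack's
  inequality. The decisive point is that the estimate is linear in \<open>e\<close>: the maximum
  principle alone would only give a square root. The constant is generous.\<close>

lemma near_isometry_schwarzian:
 assumes Y: "Y holomorphic_on ball 0 rh" "Y 0 = 0" and rh: "0 < rh" "rh < 1" and e: "0 < e" "e \<le> 1/2"
  and bd: "\<And>x. norm x < rh ==> norm (Y x) < 1 \<and>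
    (1 - (norm x)\<^sup>2) * norm (deriv Y x) \<le> (1 + e) * (1 - (norm (Y x))\<^sup>2)"
  and Y1: "1 - e \<le> norm (deriv Y 0)"
 shows "norm (schwarzian Y 0) \<le> 40000 / rh\<^sup>2 * e"
proof -
 obtain b where b: "b holomorphic_on ball 0 rh" "\<And>z. norm z < rh ==> Y z = z * b z" "deriv Y 0 = b 0"
  using Schwarz3[OF Y] by metis
 have bn: "norm (b x) \<le> 1 + e" if "norm x < rh" for x
 proof (cases "x = 0")
  case True
  then show ?thesis using bd[of 0] rh Y(2) b(3) by simp
 next
  case False
  then show ?thesis
   using near_isometry_factor_bound[OF Y rh _ bd that] e that by (simp add: b(2) norm_mult mult.commute)
 qed
 define \<omega> where "\<omega> = cnj (sgn (b 0))"
 have b0: "norm (b 0) \<ge> 1/2" using Y1 e b(3) by simp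
 have \<omega>: "norm \<omega> = 1" "\<omega> * b 0 = of_real (norm (b 0))"
 proof -
  show "norm \<omega> = 1" using b0 by (auto simp: \<omega>_def norm_sgn)
  have "\<omega> * b 0 = cnj (b 0) * b 0 / of_real (norm (b 0))"
   by (simp add: \<omega>_def sgn_div_norm scaleR_conv_of_real divide_inverse)
  also have "\<dots> = of_real (norm (b 0))"
   using b0 by (subst mult.commute, subst complex_norm_square[symmetric]) (auto simp: power2_eq_square)
  finally show "\<omega> * b 0 = of_real (norm (b 0))" .
 qed
 \<comment> \<open>\<open>B\<close> has nonnegative real part and is \<open>O(e)\<close> at the centre, hence \<open>O(e)\<close> on the half disc.\<close>
 define B where "B x = of_real (1 + 2 * e) - \<omega> * b x" for x
 define B0 where "B0 = 1 + 2 * e - norm (b 0)"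
 have B00: "B 0 = of_real B0" by (simp add: B_def B0_def \<omega>)
 have B0: "0 < B0" "B0 \<le> 3 * e" using bn[of 0] rh e Y1 b(3) by (auto simp: B0_def)
 have ReB: "Re (B x) > 0" if "norm x < rh" for x
 proof -
  have "Re (\<omega> * b x) \<le> norm (\<omega> * b x)" by (rule complex_Re_le_cmod)
  also have "\<dots> \<le> 1 + e" using bn[OF that] \<omega> by (simp add: norm_mult)
  finally show ?thesis using e by (simp add: B_def)
 qed
 \<comment> \<open>The Cayley transform taking \<open>B\<close> from the right half plane to the
   disc, with \<open>B 0\<close> sent to the centre. The Schwarz lemma for \<open>E\<close> gives
   the Harnack estimate \<open>bdiff\<close>.\<close>
 define E where "E x = (B (of_real rh * x) - of_real B0) / (B (of_real rh * x) + of_real B0)" for x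
 have mem: "norm (of_real rh * x) < rh" if "norm x < 1" for x :: complex
  using that rh by (simp add: norm_mult)
 have hB: "(%x. B (of_real rh * x)) holomorphic_on ball 0 1"
  unfolding B_def
  by (intro holomorphic_intros holomorphic_on_compose_gen[OF _ b(1), unfolded o_def]) (use mem in auto)
 have den: "B (of_real rh * x) + of_real B0 \<noteq> 0" if "norm x < 1" for x
 proof -
  have "Re (B (of_real rh * x) + of_real B0) > 0" using ReB[OF mem[OF that]] B0 by simp
  then show ?thesis by (metis less_irrefl zero_complex.simps(1))
 qed
 have hE: "E holomorphic_on ball 0 1"
  unfolding E_def by (intro holomorphic_intros hB) (use den in auto)
 have nE: "norm (E x) < 1" if "norm x < 1" for x
 proof -
  have "(norm (B (of_real rh * x) - of_real B0))\<^sup>2 < (norm (B (of_real rh * x) + of_real B0))\<^sup>2"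
   using ReB[OF mem[OF that]] B0 unfolding cmod_power2 by (simp add: power2_eq_square algebra_simps)
  then have "norm (B (of_real rh * x) - of_real B0) < norm (B (of_real rh * x) + of_real B0)"
   by (simp add: power2_less_imp_less)
  then show ?thesis using den[OF that] by (simp add: E_def norm_divide)
 qed
 have bdiff: "norm (b x - b 0) \<le> 12 * e" if x: "norm x \<le> rh/2" for x
 proof -
  define y where "y = x / of_real rh"
  have y: "norm y \<le> 1/2" "of_real rh * y = x" using x rh by (auto simp: y_def norm_divide field_simps)
  have Ey: "norm (E y) \<le> 1/2"
   using Schwarz_Lemma(1)[OF hE _ nE, of y] y B00 by (simp add: E_def)
  have BE: "(B x - of_real B0) = E y * (B x + of_real B0)"
   using den[of y] y by (simp add: E_def)
  have "norm (B x - of_real B0) = norm (E y) * norm (B x + of_real B0)"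
   by (subst BE) (simp add: norm_mult)
  also have "\<dots> \<le> 1/2 * norm (B x + of_real B0)"
   using Ey by (rule mult_right_mono) simp
  also have "norm (B x + of_real B0) \<le> norm (B x - of_real B0) + 2 * B0"
   using norm_triangle_ineq[of "B x - of_real B0" "2 * of_real B0"] B0 by (simp add: norm_mult add.commute)
  finally have "norm (B x - of_real B0) \<le> 2 * B0" by simp
  moreover have "norm (B x - of_real B0) = norm (\<omega> * (b x - b 0))"
   using \<omega>(2) by (simp add: B_def B0_def algebra_simps norm_minus_commute)
  ultimately show ?thesis using \<omega> B0 by (simp add: norm_mult)
 qed
 have hb': "(%x. b x - b 0) holomorphic_on cball 0 (rh/2)"
  by (intro holomorphic_intros holomorphic_on_subset[OF b(1)]) (use rh in auto)
 have cau: "norm ((deriv ^^ n) (%x. b x - b 0) 0) \<le> fact n * (12 * e) / (rh/2) ^ n" for n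
  by (rule Cauchy_inequality) (use rh bdiff in \<open>auto intro: holomorphic_on_subset[OF hb'] holomorphic_on_imp_continuous_on[OF hb']\<close>)
 have hb: "deriv b holomorphic_on ball 0 rh" "deriv (deriv b) holomorphic_on ball 0 rh"
  using b by (auto intro!: holomorphic_deriv)
 have Db: "(b has_field_derivative deriv b x) (at x)" "(deriv b has_field_derivative deriv (deriv b) x) (at x)"
  "(deriv (deriv b) has_field_derivative deriv (deriv (deriv b)) x) (at x)" if "norm x < rh" for x
  using holomorphic_derivI[OF _ open_ball] b(1) hb that by auto
 have d1: "deriv (%x. b x - b 0) x = deriv b x" if "norm x < rh" for x
  by (rule DERIV_imp_deriv) (use Db(1)[OF that] in \<open>auto intro!: derivative_eq_intros\<close>)
 have ev: "\<forall>\<^sub>F y in nhds x. norm y < rh" if "norm x < rh" for x :: complex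
  using eventually_nhds_in_open[of "ball 0 rh" x] that by simp
 have d2: "deriv (deriv (%x. b x - b 0)) 0 = deriv (deriv b) 0"
  by (rule deriv_cong_ev[OF eventually_mono[OF ev]]) (use rh d1 in auto)
 have b1: "norm (deriv b 0) \<le> 24 * e / rh" using cau[of 1] d1[of 0] rh by simp
 have b2: "norm (deriv (deriv b) 0) \<le> 96 * e / rh\<^sup>2"
  using cau[of 2] d2 rh by (simp add: numeral_2_eq_2 power2_eq_square)
 have Y1': "deriv Y x = b x + x * deriv b x" if x: "norm x < rh" for x
 proof -
  have "deriv Y x = deriv (%z. z * b z) x"
   by (rule deriv_cong_ev[OF eventually_mono[OF ev[OF x]] refl]) (rule b(2))
  also have "\<dots> = b x + x * deriv b x"
   by (rule DERIV_imp_deriv) (use Db(1)[OF x] in \<open>auto intro!: derivative_eq_intros\<close>)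
  finally show ?thesis .
 qed
 have Y2': "deriv (deriv Y) x = 2 * deriv b x + x * deriv (deriv b) x" if x: "norm x < rh" for x
 proof -
  have "deriv (deriv Y) x = deriv (%x. b x + x * deriv b x) x"
   by (rule deriv_cong_ev[OF eventually_mono[OF ev[OF x]] refl]) (rule Y1')
  also have "\<dots> = 2 * deriv b x + x * deriv (deriv b) x"
   by (rule DERIV_imp_deriv) (use Db(1,2)[OF x] in \<open>auto intro!: derivative_eq_intros\<close>)
  finally show ?thesis .
 qed
 have Y3': "deriv (deriv (deriv Y)) 0 = 3 * deriv (deriv b) 0"
 proof -
  have "deriv (deriv (deriv Y)) 0 = deriv (%x. 2 * deriv b x + x * deriv (deriv b) x) 0"
   by (rule deriv_cong_ev[OF eventually_mono[OF ev] refl]) (use Y2' rh in auto)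
  also have "\<dots> = 3 * deriv (deriv b) 0"
   by (rule DERIV_imp_deriv) (use Db(2,3)[of 0] rh in \<open>auto intro!: derivative_eq_intros\<close>)
  finally show ?thesis .
 qed
 \<comment> \<open>The derivatives of \<open>z * b z\<close> at 0 are \<open>b\<close>,
   \<open>2 b'\<close> and \<open>3 b''\<close>; the second term is quadratic in \<open>e\<close>
   and is absorbed by \<open>e \<le> 1/2\<close>.\<close>
 have S: "schwarzian Y 0 = 3 * deriv (deriv b) 0 / b 0 - 6 * (deriv b 0 / b 0)\<^sup>2"
  using Y1'[of 0] Y2'[of 0] Y3' rh by (simp add: schwarzian_def power2_eq_square)
 have q1: "norm (deriv b 0 / b 0) \<le> 48 * e / rh"
 proof -
  have "norm (deriv b 0 / b 0) \<le> (24 * e / rh) / (1/2)"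
   unfolding norm_divide by (rule frac_le) (use b1 b0 rh e in auto)
  then show ?thesis by simp
 qed
 have q2: "norm (3 * deriv (deriv b) 0 / b 0) \<le> 576 * e / rh\<^sup>2"
 proof -
  have "norm (3 * deriv (deriv b) 0 / b 0) \<le> (3 * (96 * e / rh\<^sup>2)) / (1/2)"
   unfolding norm_divide by (rule frac_le) (use b2 b0 rh e in \<open>auto simp: norm_mult\<close>)
  then show ?thesis by simp
 qed
 have "norm (6 * (deriv b 0 / b 0)\<^sup>2) \<le> 6 * (48 * e / rh)\<^sup>2"
  unfolding norm_mult norm_power using power_mono[OF q1, of 2] by simp
 also have "\<dots> = 13824 * e * e / rh\<^sup>2" by (simp add: power2_eq_square)
 also have "\<dots> \<le> 13824 * e * 1 / rh\<^sup>2" using e by (intro divide_right_mono mult_left_mono) auto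
 finally have "norm (schwarzian Y 0) \<le> 576 * e / rh\<^sup>2 + 13824 * e / rh\<^sup>2"
  unfolding S using q2 norm_triangle_ineq4[of "3 * deriv (deriv b) 0 / b 0" "6 * (deriv b 0 / b 0)\<^sup>2"] by linarith
 also have "\<dots> = 14400 / rh\<^sup>2 * e" by (simp add: field_simps)
 also have "\<dots> \<le> 40000 / rh\<^sup>2 * e" using e by (intro mult_right_mono divide_right_mono) auto
 finally show ?thesis .
qed

section \<open>Closed curves, boundary uniqueness and the energy inequality\<close>

text \<open>Logarithms of a fixed number are at least 1 apart, so a continuous choice on a connected
  set cannot jump.\<close>

lemma exp_constant_imp_constant:
 fixes f :: "'a::topological_space \<Rightarrow> complex"
 assumes "connected S" "continuous_on S f" "\<And>x. x \<in> S ==> exp (f x) = c"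
 obtains a where "\<And>x. x \<in> S ==> f x = a"
proof -
 have "f constant_on S"
 proof (rule continuous_discrete_range_constant[OF assms(1,2)])
  fix x assume x: "x \<in> S"
  have "1 \<le> norm (f y - f x)" if "y \<in> S" "f y \<noteq> f x" for y
  proof -
   have "exp (f y) = exp (f x)" using assms(3) x that by simp
   then obtain n :: int where n: "f y = f x + of_int (2 * n) * of_real pi * \<i>" by (auto simp: exp_eq)
   then have "n \<noteq> 0" using that by auto
   then have "\<bar>real_of_int n\<bar> \<ge> 1" by linarith
   moreover have "norm (f y - f x) = 2 * \<bar>real_of_int n\<bar> * pi" by (simp add: n norm_mult)
   ultimately show ?thesis using pi_ge_two mult_mono[of 1 "2 * \<bar>real_of_int n\<bar>" 1 pi] by simp
  qed
  then show "\<exists>e>0. \<forall>y. y \<in> S \<and> f y \<noteq> f x \<longrightarrow> e \<le> norm (f y - f x)"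
   by (intro exI[of _ 1]) auto
 qed
 then show ?thesis using that by (auto simp: constant_on_def)
qed

lemma has_vector_derivative_affine:
 fixes u th t :: real
 assumes "(Ga has_vector_derivative D) (at (th + u * t))"
 shows "((%u. Ga (th + u * t)) has_vector_derivative t *\<^sub>R D) (at u)"
proof -
 have "((%u. th + u * t) has_vector_derivative t) (at u)"
  by (auto intro!: derivative_eq_intros simp: has_real_derivative_iff_has_vector_derivative[symmetric])
 from vector_diff_chain_at[OF this assms] show ?thesis by (simp add: o_def)
qed

text \<open>Hopf's secant trick modulo 2: the normalised secant map of a simple closed curve
 deforms its tangent to the half-turn chord, which is odd under the half turn.\<close>

lemma simple_closed_curve_tangent_root_antiperiodic:
 fixes Ga D ph :: "real \<Rightarrow> complex"
 assumes deriv: "\<And>th. (Ga has_vector_derivative D th) (at th)" and contD: "continuous_on UNIV D"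
  and per: "\<And>th. Ga (th + 2 * pi) = Ga th"
  and inj: "\<And>th t. 0 < t ==> t < 2 * pi ==> Ga (th + t) \<noteq> Ga th"
  and contph: "continuous_on UNIV ph" and ph: "\<And>th. (ph th)\<^sup>2 * D th = 1"
 shows "ph (th + 2 * pi) = - ph th"
proof -
 define P where "P = (UNIV :: real set) \<times> {0..pi}"
 have convP: "convex P" unfolding P_def by (intro convex_Times) auto
 \<comment> \<open>Mean of the tangent over \<open>[th, th + t]\<close>, that is, the secant divided
   by \<open>t\<close>. This form extends continuously to \<open>t = 0\<close>, where it is the
   tangent itself, and it is nonzero on all of \<open>P\<close> by injectivity.\<close>
 define F where "F x = integral (cbox 0 (1::real)) (%u. D (fst x + u * snd x))" for x :: "real \<times> real"
 have contF: "continuous_on P F"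
 proof -
  have "continuous_on (P \<times> cbox 0 1) (%q. D (fst (fst q) + snd q * snd (fst q)))"
   by (rule continuous_on_compose2[OF contD _ subset_UNIV]) (intro continuous_intros)
  then have "continuous_on (P \<times> cbox 0 1) (%(x, u). D (fst x + u * snd x))"
   by (simp add: case_prod_unfold)
  from integral_continuous_on_param[OF this] show ?thesis by (simp add: F_def[abs_def])
 qed
 have Fsec: "of_real t * F (th, t) = Ga (th + t) - Ga th" for th t
 proof -
  have d: "((%u. Ga (th + u * t)) has_vector_derivative t *\<^sub>R D (th + u * t)) (at u within {0..1})" for u
   by (rule has_vector_derivative_at_within[OF has_vector_derivative_affine[OF deriv]])
  have "((%u. t *\<^sub>R D (th + u * t)) has_integral (Ga (th + 1 * t) - Ga (th + 0 * t))) {0..1}"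
   by (rule fundamental_theorem_of_calculus) (use d in auto)
  then have "integral {0..1} (%u. t *\<^sub>R D (th + u * t)) = Ga (th + 1 * t) - Ga (th + 0 * t)"
   by (rule integral_unique)
  then show ?thesis by (simp add: F_def scaleR_conv_of_real)
 qed
 have F0: "F (th, 0) = D th" for th by (simp add: F_def)
 have Dnz: "D th \<noteq> 0" for th using ph[of th] by auto
 have phnz: "ph th \<noteq> 0" for th using ph[of th] by auto
 have Fnz: "F x \<noteq> 0" if xP: "x \<in> P" for x
 proof (cases "snd x = 0")
  case True then show ?thesis using F0[of "fst x"] Dnz by (metis prod.collapse)
 next
  case False
  then have "0 < snd x" "snd x < 2 * pi" using xP pi_gt_zero by (auto simp: P_def)
  then show ?thesis using Fsec[of "snd x" "fst x"] inj[of "snd x" "fst x"] by auto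
 qed
 obtain l where l: "continuous_on P l" "\<And>x. x \<in> P ==> F x = exp (l x)"
  using continuous_logarithm_on_contractible[OF contF convex_imp_contractible[OF convP]] Fnz by blast
 have Dper: "D (th + 2 * pi) = D th" for th
 proof -
  have "((%x. Ga (2 * pi + x * 1)) has_vector_derivative 1 *\<^sub>R D (2 * pi + th * 1)) (at th)"
   by (rule has_vector_derivative_affine[OF deriv])
  then have "(Ga has_vector_derivative D (th + 2 * pi)) (at th)"
   by (simp add: per add.commute)
  then show ?thesis using deriv vector_derivative_unique_at by blast
 qed
 have Fper: "F (th + 2 * pi, t) = F (th, t)" for th t
  using Dper[of "th + _ * t"] by (simp add: F_def algebra_simps)
 have shift: "continuous_on P (%x. l (fst x + a, snd x))" for a
  by (rule continuous_on_compose2[OF l(1)]) (auto intro!: continuous_intros simp: P_def)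
 obtain a where a: "\<And>x. x \<in> P ==> l (fst x + 2 * pi, snd x) - l x = a"
 proof (rule exp_constant_imp_constant[of P "%x. l (fst x + 2 * pi, snd x) - l x" 1])
  show "connected P" using convP by (rule convex_connected)
  show "exp (l (fst x + 2 * pi, snd x) - l x) = 1" if "x \<in> P" for x
  proof -
   have "(fst x + 2 * pi, snd x) \<in> P" using that by (auto simp: P_def)
   then show ?thesis using l(2)[OF that] l(2)[of "(fst x + 2 * pi, snd x)"] Fper[of "fst x" "snd x"]
    by (simp add: exp_diff)
  qed
 qed (auto intro!: continuous_intros shift l)
 have Ppi: "(th, pi) \<in> P" "(th, 0) \<in> P" for th by (auto simp: P_def)
 have lc: "continuous_on UNIV (%th. l (th + b, c))" if "0 \<le> c" "c \<le> pi" for b c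
  by (rule continuous_on_compose2[OF l(1)]) (use that in \<open>auto intro!: continuous_intros simp: P_def\<close>)
 \<comment> \<open>Two consecutive half-period chords close up, so the second is the negative of the
   first.\<close>
 have half: "F (th + pi, pi) = - F (th, pi)" for th
 proof -
  have "of_real pi * (F (th + pi, pi) + F (th, pi)) = Ga (th + pi + pi) - Ga th"
   by (simp add: distrib_left Fsec)
  also have "\<dots> = 0" using per[of th] by (simp add: add.assoc)
  finally show ?thesis by (simp add: eq_neg_iff_add_eq_0)
 qed
 obtain w where w: "\<And>th. l (th + pi, pi) - l (th, pi) = w"
 proof (rule exp_constant_imp_constant[of UNIV "%th. l (th + pi, pi) - l (th, pi)" "-1"])
  show "exp (l (th + pi, pi) - l (th, pi)) = -1" for th
  proof -
   have "exp (l (th + pi, pi)) = - exp (l (th, pi))" using half l(2)[OF Ppi(1)] by metis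
   then show ?thesis by (simp add: exp_diff)
  qed
  show "continuous_on UNIV (%th. l (th + pi, pi) - l (th, pi))"
   using lc[of pi pi] lc[of pi 0] by (auto intro!: continuous_intros)
 qed auto
 have expw: "exp w = -1"
 proof -
  have "exp (l (0 + pi, pi)) = - exp (l (0, pi))" using half l(2)[OF Ppi(1)] by metis
  then show ?thesis using w[of 0] by (simp add: exp_diff flip: w[of 0])
 qed
 \<comment> \<open>A full period consists of two half turns with the same increment
   \<open>w\<close>. Only \<open>exp w = -1\<close> is known about \<open>w\<close>, and only that
   is used.\<close>
 have aw: "a = 2 * w"
 proof -
  have "a = (l (pi + pi, pi) - l (pi, pi)) + (l (0 + pi, pi) - l (0, pi))"
   using a[OF Ppi(1)[of 0]] by simp
  also have "\<dots> = w + w" by (simp only: w)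
  finally show ?thesis by simp
 qed
 obtain m where m: "continuous_on UNIV m" "\<And>th. ph th = exp (m th)"
  using continuous_logarithm_on_contractible[OF contph convex_imp_contractible[OF convex_UNIV] phnz] by (metis UNIV_I)
 obtain e where e: "\<And>th. 2 * m th + l (th, 0) = e"
 proof (rule exp_constant_imp_constant[of UNIV "%th. 2 * m th + l (th, 0)" 1])
  show "exp (2 * m th + l (th, 0)) = 1" for th
  proof -
   have "exp (2 * m th) = (ph th)\<^sup>2" by (simp add: m exp_double)
   moreover have "exp (l (th, 0)) = D th" using l(2)[OF Ppi(2)[of th]] F0[of th] by simp
   ultimately show ?thesis using ph[of th] by (simp add: exp_add)
  qed
  show "continuous_on UNIV (%th. 2 * m th + l (th, 0))"
   using lc[of 0 0] m(1) by (auto intro!: continuous_intros)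
 qed auto
 \<comment> \<open>The increment of \<open>m\<close> is minus half that of the logarithm of the
   tangent, hence \<open>- w\<close>, which produces the sign -1.\<close>
 have "m (th + 2 * pi) = m th - w"
 proof -
  have 1: "2 * m (th + 2 * pi) + l (th + 2 * pi, 0) = 2 * m th + l (th, 0)" by (simp only: e)
  have 2: "l (th + 2 * pi, 0) - l (th, 0) = 2 * w" using a[OF Ppi(2)[of th]] aw by simp
  have "2 * (m (th + 2 * pi) - (m th - w)) = 0" using 1 2 by algebra
  then have "m (th + 2 * pi) - (m th - w) = 0" by (metis mult_eq_0_iff zero_neq_numeral)
  then show ?thesis by simp
 qed
 then show ?thesis using m(2) expw by (simp add: exp_diff)
qed

text \<open>Extension by 0 below the real segment is continuous, hence holomorphic across it. The
  extension vanishes on an open set, so the identity theorem kills \<open>R\<close> on the whole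
  strip.\<close>

lemma holomorphic_zero_from_boundary:
 fixes R :: "complex \<Rightarrow> complex"
 assumes R: "R holomorphic_on {z. 0 < Im z \<and> Im z < h}" and h: "0 < h" and ab: "a < b"
  and lim: "\<And>x. a < x ==> x < b ==> (R \<longlongrightarrow> 0) (at (of_real x) within {z. 0 < Im z})"
  and z: "0 < Im z" "Im z < h"
 shows "R z = 0"
proof -
 define S where "S = {z. a < Re z \<and> Re z < b \<and> - h < Im z \<and> Im z < h}"
 have S_eq: "S = box (Complex a (-h)) (Complex b h)"
  by (auto simp: S_def in_box_complex_iff)
 have openS: "open S" and convS: "convex S" unfolding S_eq by auto
 define F where "F z = (if 0 < Im z then R z else 0)" for z
 have Fup: "F holomorphic_on (S \<inter> {z. 0 < \<i> \<bullet> z})"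
  by (rule holomorphic_transform[OF holomorphic_on_subset[OF R]]) (auto simp: S_def F_def inner_complex_def)
 have Flo: "F holomorphic_on (S \<inter> {z. \<i> \<bullet> z < 0})"
  by (rule holomorphic_transform[of "%_. 0"]) (auto simp: S_def F_def inner_complex_def)
 have opens: "open {z. 0 < Im z \<and> Im z < h}"
  by (intro open_Collect_conj open_Collect_less continuous_intros)
 have contF: "continuous_on S F"
 proof (rule continuous_at_imp_continuous_on, rule ballI)
  fix w assume w: "w \<in> S"
  consider "Im w > 0" | "Im w < 0" | "Im w = 0" by linarith
  then show "isCont F w"
  proof cases
   case 1
   have "isCont R w" using R opens w 1 by (intro holomorphic_on_imp_continuous_on[THEN continuous_on_interior] ) (auto simp: interior_open S_def)
   moreover have "\<forall>\<^sub>F z in nhds w. F z = R z"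
    using eventually_nhds_in_open[of "{z. 0 < Im z}" w] 1
    by (auto elim!: eventually_mono simp: F_def open_Collect_less continuous_intros)
   ultimately show ?thesis using isCont_cong by blast
  next
   case 2
   have "\<forall>\<^sub>F z in nhds w. F z = 0"
    using eventually_nhds_in_open[of "{z. Im z < 0}" w] 2
    by (auto elim!: eventually_mono simp: F_def open_Collect_less continuous_intros)
   then show ?thesis using isCont_cong[of F "%_. 0"] by simp
  next
   case 3
   then have weq: "w = of_real (Re w)" by (simp add: complex_eq_iff)
   have l0: "(R \<longlongrightarrow> 0) (at w within {z. 0 < Im z})"
    using lim[of "Re w"] w weq by (auto simp: S_def)
   have "(F \<longlongrightarrow> 0) (at w)"
   proof (rule tendstoI)
    fix e :: real assume "e > 0"
    then have "\<forall>\<^sub>F z in at w within {z. 0 < Im z}. dist (R z) 0 < e" using l0 tendstoD by blast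
    then show "\<forall>\<^sub>F z in at w. dist (F z) 0 < e"
     unfolding eventually_at_filter using \<open>e > 0\<close> by (auto elim!: eventually_mono simp: F_def)
   qed
   then show ?thesis using 3 by (simp add: isCont_def F_def)
  qed
 qed
 have holF: "F holomorphic_on S"
  by (rule holomorphic_on_paste_across_line[OF openS, of \<i> F 0]) (use Fup Flo contF in auto)
 define c where "c = Complex ((a + b) / 2) (- h / 2)"
 define c' where "c' = Complex ((a + b) / 2) (h / 2)"
 have F0: "F x = 0" if "x \<in> S" for x
 proof (rule analytic_continuation_open[of "S \<inter> {z. Im z < 0}" S F "%_. 0"])
  show "open (S \<inter> {z. Im z < 0})" using openS by (intro open_Int open_Collect_less continuous_intros)
  show "S \<inter> {z. Im z < 0} \<noteq> {}"
  proof -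
   have "c \<in> S \<inter> {z. Im z < 0}" using ab h by (simp add: S_def c_def)
   then show ?thesis by blast
  qed
 qed (use openS convS that holF in \<open>auto simp: F_def convex_connected\<close>)
 show ?thesis
 proof (rule analytic_continuation_open[of "S \<inter> {z. 0 < Im z}" "{z. 0 < Im z \<and> Im z < h}" R "%_. 0"])
  show "open (S \<inter> {z. 0 < Im z})" using openS by (intro open_Int open_Collect_less continuous_intros)
  show "S \<inter> {z. 0 < Im z} \<noteq> {}"
  proof -
   have "c' \<in> S \<inter> {z. 0 < Im z}" using ab h by (simp add: S_def c'_def)
   then show ?thesis by blast
  qed
  have "convex ({z. 0 < Im z} \<inter> {z. Im z < h})"
   by (intro convex_Int convex_halfspace_Im_gt convex_halfspace_Im_lt)
  then show "connected {z. 0 < Im z \<and> Im z < h}"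
   by (simp add: Collect_conj_eq convex_connected)
  show "R x = 0" if "x \<in> S \<inter> {z. 0 < Im z}" for x using F0[of x] that by (auto simp: F_def)
 qed (use opens R z in \<open>auto simp: S_def\<close>)
qed

section \<open>The sharp energy inequality for antiperiodic functions\<close>

text \<open>Writing \<open>ps = y * ph\<close>, antiperiodicity makes the integral of
  \<open>Im y\<close> an odd multiple of pi. Cauchy-Schwarz bounds both energy terms below, and the
  hypothesis leaves no room: the modulus of \<open>ph\<close> is constant and its logarithmic
  derivative is constant and imaginary, equal to plus or minus half of the unit.\<close>

lemma antiperiodic_energy_rigidity:
 fixes ph ps :: "real \<Rightarrow> complex"
 assumes deriv: "\<And>th. (ph has_vector_derivative ps th) (at th)" and cont: "continuous_on UNIV ps"
  and nz: "\<And>th. ph th \<noteq> 0" and anti: "ph (2 * pi) = - ph 0" and k: "k \<noteq> 0"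
  and L: "integral {0..2 * pi} (%th. 1 / (norm (ph th))\<^sup>2) = L"
  and energy: "L * (4 * integral {0..2 * pi} (%th. (norm (ps th))\<^sup>2) +
    k\<^sup>2 * integral {0..2 * pi} (%th. (norm (ph th))\<^sup>2)) \<le> 4 * pi\<^sup>2 * (1 + k\<^sup>2)"
 obtains c s where "s = 1 \<or> s = -1" "c \<noteq> 0"
  "\<And>th. 0 \<le> th ==> th \<le> 2 * pi ==> ph th = c * exp (\<i> * of_real s * of_real th / 2)"
proof -
 let ?I = "{0..2 * pi}"
 have cph: "continuous_on UNIV ph"
  using deriv by (meson continuous_at_imp_continuous_on has_vector_derivative_continuous)
 define y where "y th = ps th / ph th" for th
 define q where "q th = (norm (ph th))\<^sup>2" for th
 have q: "q th > 0" for th using nz by (simp add: q_def)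
 have cy: "continuous_on UNIV y" unfolding y_def by (intro continuous_intros cont cph) (use nz in auto)
 have cq: "continuous_on UNIV q" unfolding q_def by (intro continuous_intros cph)
 have cyI[continuous_intros]: "continuous_on ?I y" by (rule continuous_on_subset[OF cy]) auto
 have cqI[continuous_intros]: "continuous_on ?I q" by (rule continuous_on_subset[OF cq]) auto
 have ii: "f integrable_on ?I" if "continuous_on ?I f" for f :: "real \<Rightarrow> real"
  using that by (rule integrable_continuous_interval)
 have qn: "q th \<noteq> 0" for th using q[of th] by simp
 define A where "A = integral ?I (%th. Im (y th))"
 have "ph (2 * pi) = ph 0 * exp (integral {0..2 * pi} y)"
 proof -
  define Y where "Y th = integral {0..th} y" for th
  have dY: "(Y has_vector_derivative y th) (at th within ?I)" if "th \<in> ?I" for th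
   unfolding Y_def by (rule integral_has_vector_derivative[OF cyI that])
  have "((%th. ph th * exp (- Y th)) has_vector_derivative 0) (at th within ?I)" if "th \<in> ?I" for th
  proof -
   have "((exp \<circ> (%th. - Y th)) has_vector_derivative (- y th) * exp (- Y th)) (at th within ?I)"
    by (rule field_vector_diff_chain_within)
      (auto intro!: derivative_eq_intros dY that DERIV_exp[THEN has_field_derivative_at_within])
   then have "((%th. ph th * exp (- Y th)) has_vector_derivative
     ph th * ((- y th) * exp (- Y th)) + ps th * exp (- Y th)) (at th within ?I)"
    by (intro has_vector_derivative_mult has_vector_derivative_at_within[OF deriv]) (simp add: o_def)
   then show ?thesis using nz[of th] by (simp add: y_def)
  qed
  then obtain c where c: "\<And>th. th \<in> ?I ==> ph th * exp (- Y th) = c"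
   using has_vector_derivative_zero_constant[of ?I "%th. ph th * exp (- Y th)"] by auto
  have "ph 0 = ph (2 * pi) * exp (- Y (2 * pi))" using c[of 0] c[of "2 * pi"] by (simp add: Y_def)
  then show ?thesis by (simp add: Y_def exp_minus field_simps)
 qed
 then have "ph 0 * exp (integral ?I y) = ph 0 * (-1)" using anti by simp
 then have "exp (integral ?I y) = -1" using nz[of 0] mult_cancel_left by blast
 then have "exp (integral ?I y) = exp (\<i> * of_real pi)" by simp
 then obtain n :: int where n: "integral ?I y = \<i> * of_real pi + of_real (real_of_int (2 * n) * pi) * \<i>"
  unfolding exp_eq by blast
 have Aeq: "A = (1 + 2 * real_of_int n) * pi"
 proof -
  have "A = Im (integral ?I y)"
   unfolding A_def using integrable_continuous_interval[OF cyI]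
   by (subst integral_linear[OF _ bounded_linear_Im, symmetric]) (auto simp: o_def)
  also have "\<dots> = (1 + 2 * real_of_int n) * pi" unfolding n by (simp add: algebra_simps)
  finally show ?thesis .
 qed
 \<comment> \<open>This is where antiperiodicity counts: a periodic function could have winding
   number 0, and the lower bound would be lost.\<close>
 have "1 \<le> \<bar>1 + 2 * n\<bar>" by presburger
 then have odd: "1 \<le> \<bar>1 + 2 * real_of_int n\<bar>" by linarith
 have A2: "A\<^sup>2 \<ge> pi\<^sup>2"
  unfolding Aeq power_mult_distrib using power_mono[OF odd, of 2] by simp
 have Lpos: "L > 0"
 proof -
  have "L \<ge> 0" unfolding L[symmetric]
   by (rule integral_nonneg) (use cqI qn q[THEN less_imp_le] in \<open>auto intro!: ii continuous_intros simp: q_def[symmetric]\<close>)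
  moreover have "L \<noteq> 0"
  proof
   assume "L = 0"
   moreover have "continuous_on ?I (%th. 1 / q th)" using qn by (intro continuous_intros) auto
   moreover have "integral ?I (%th. 1 / q th) = L" using L by (simp add: q_def)
   ultimately have "\<forall>th\<in>?I. 1 / q th = 0"
    using integral_eq_0_iff[of 0 "2 * pi" "%th. 1 / q th"] q[THEN less_imp_le] by auto
   then show False using qn[of 0] by force
  qed
  ultimately show ?thesis by simp
 qed
 \<comment> \<open>With these values of \<open>a\<close> and \<open>c\<close>, expanding the squares
   in \<open>J1\<close> and \<open>J3\<close> gives exactly the deficits in the two Cauchy-Schwarz
   inequalities; \<open>J2\<close> is the energy of the varying modulus.\<close>
 define a where "a = A / L"
 define c where "c = 2 * pi / L"
 define J1 where "J1 = integral ?I (%th. (q th * Im (y th) - a)\<^sup>2 / q th)"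
 define J2 where "J2 = integral ?I (%th. q th * (Re (y th))\<^sup>2)"
 define J3 where "J3 = integral ?I (%th. (q th - c)\<^sup>2 / q th)"
 note CI = continuous_intros
 have Lq: "integral ?I (%th. 1 / q th) = L" using L by (simp add: q_def)
 define iq where "iq th = 1 / q th" for th
 have Liq: "integral ?I iq = L" unfolding iq_def[abs_def] by (rule Lq)
 have ciq[continuous_intros]: "continuous_on ?I iq" unfolding iq_def using qn by (intro continuous_intros) auto
 have J1e: "J1 = integral ?I (%th. q th * (Im (y th))\<^sup>2) - A\<^sup>2 / L"
 proof -
  have "J1 = integral ?I (%th. q th * (Im (y th))\<^sup>2 - 2 * a * Im (y th) + a\<^sup>2 * iq th)"
   unfolding J1_def by (rule integral_cong) (use qn in \<open>simp add: field_simps power2_eq_square iq_def\<close>)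
  also have "\<dots> = integral ?I (%th. q th * (Im (y th))\<^sup>2) - 2 * a * A + a\<^sup>2 * L"
   by (simp add: integral_add integral_diff ii CI A_def cyI cqI ciq flip: Liq)
  finally show ?thesis using Lpos by (simp add: a_def power2_eq_square field_simps)
 qed
 have J3e: "J3 = integral ?I q - 4 * pi\<^sup>2 / L"
 proof -
  have "J3 = integral ?I (%th. q th - 2 * c + c\<^sup>2 * iq th)"
   unfolding J3_def by (rule integral_cong) (use qn in \<open>simp add: field_simps power2_eq_square iq_def\<close>)
  also have "\<dots> = integral ?I q - 2 * c * (2 * pi) + c\<^sup>2 * L"
   by (simp add: integral_add integral_diff ii CI cyI cqI ciq flip: Liq)
  finally show ?thesis using Lpos by (simp add: c_def power2_eq_square field_simps)
 qed
 have I1: "integral ?I (%th. (norm (ps th))\<^sup>2) = integral ?I (%th. q th * (Im (y th))\<^sup>2) + J2"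
 proof -
  have "integral ?I (%th. (norm (ps th))\<^sup>2) = integral ?I (%th. q th * (Im (y th))\<^sup>2 + q th * (Re (y th))\<^sup>2)"
  proof (rule integral_cong)
   fix th
   have "ps th = y th * ph th" using nz by (simp add: y_def)
   then have "(norm (ps th))\<^sup>2 = (norm (y th))\<^sup>2 * q th" by (simp add: norm_mult power_mult_distrib q_def)
   then show "(norm (ps th))\<^sup>2 = q th * (Im (y th))\<^sup>2 + q th * (Re (y th))\<^sup>2"
    by (simp add: cmod_power2 algebra_simps)
  qed
  then show ?thesis unfolding J2_def by (simp add: integral_add ii CI)
 qed
 have cont1: "continuous_on ?I (%th. (q th * Im (y th) - a)\<^sup>2 / q th)"
  and cont2: "continuous_on ?I (%th. q th * (Re (y th))\<^sup>2)"
  and cont3: "continuous_on ?I (%th. (q th - c)\<^sup>2 / q th)"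
  using qn by (auto intro!: CI)
 have J: "J1 \<ge> 0" "J2 \<ge> 0" "J3 \<ge> 0"
  unfolding J1_def J2_def J3_def using q[THEN less_imp_le]
  by (auto intro!: integral_nonneg ii cont1 cont2 cont3)
 \<comment> \<open>The energy bound minus its minimal value, written as a sum of four nonnegative
   deficits; hence each of them vanishes.\<close>
 have "4 * L * J1 + 4 * L * J2 + k\<^sup>2 * L * J3 + 4 * (A\<^sup>2 - pi\<^sup>2) \<le> 0"
 proof -
  have "L * (4 * (J1 + A\<^sup>2 / L + J2) + k\<^sup>2 * (J3 + 4 * pi\<^sup>2 / L)) \<le> 4 * pi\<^sup>2 * (1 + k\<^sup>2)"
   using energy unfolding I1 using J1e J3e by (simp add: q_def[abs_def])
  moreover have "L * (4 * (J1 + A\<^sup>2 / L + J2) + k\<^sup>2 * (J3 + 4 * pi\<^sup>2 / L)) =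
    4 * L * J1 + 4 * L * J2 + k\<^sup>2 * L * J3 + 4 * A\<^sup>2 + k\<^sup>2 * (4 * pi\<^sup>2)"
   using Lpos by (simp add: field_simps)
  ultimately show ?thesis by (simp add: algebra_simps)
 qed
 moreover have "4 * L * J1 \<ge> 0" "4 * L * J2 \<ge> 0" "k\<^sup>2 * L * J3 \<ge> 0" using Lpos J by auto
 moreover have "A\<^sup>2 - pi\<^sup>2 \<ge> 0" using A2 by simp
 moreover have "a = 0 \<and> b = 0 \<and> c = 0 \<and> d = 0"
  if "a + b + c + 4 * d \<le> 0" "a \<ge> 0" "b \<ge> 0" "c \<ge> 0" "d \<ge> 0" for a b c d :: real
  using that by linarith
 ultimately have "4 * L * J1 = 0 \<and> 4 * L * J2 = 0 \<and> k\<^sup>2 * L * J3 = 0 \<and> A\<^sup>2 - pi\<^sup>2 = 0" by blast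
 then have z: "4 * L * J1 = 0" "4 * L * J2 = 0" "k\<^sup>2 * L * J3 = 0" "A\<^sup>2 = pi\<^sup>2" by auto
 then have J0: "J1 = 0" "J2 = 0" "J3 = 0" using Lpos k by auto
 have q3: "q th = c" if "th \<in> ?I" for th
  using integral_eq_0_iff[OF cont3] J0(3) q[THEN less_imp_le] qn that by (auto simp: J3_def)
 have y2: "Re (y th) = 0" if "th \<in> ?I" for th
  using integral_eq_0_iff[OF cont2] J0(2) q[THEN less_imp_le] qn that by (auto simp: J2_def)
 have y1: "q th * Im (y th) = a" if "th \<in> ?I" for th
  using integral_eq_0_iff[OF cont1] J0(1) q[THEN less_imp_le] qn that by (auto simp: J1_def)
 define s where "s = A / pi"
 have s: "s = 1 \<or> s = -1" using z(4) by (auto simp: s_def power2_eq_iff)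
 have ys: "y th = \<i> * of_real s / 2" if "th \<in> ?I" for th
 proof -
  have "c * Im (y th) = a" using y1[OF that] q3[OF that] by simp
  then have "Im (y th) = s / 2" using Lpos by (simp add: c_def a_def s_def field_simps)
  then show ?thesis using y2[OF that] by (simp add: complex_eq_iff)
 qed
 have "((%th. ph th * exp (- (\<i> * of_real s * of_real th / 2))) has_vector_derivative 0) (at th within ?I)" if "th \<in> ?I" for th
 proof -
  have "((exp \<circ> (%th. - (\<i> * of_real s * of_real th / 2))) has_vector_derivative
    (- (\<i> * of_real s / 2)) * exp (- (\<i> * of_real s * of_real th / 2))) (at th within ?I)"
   by (rule field_vector_diff_chain_within)
     (auto intro!: derivative_eq_intros DERIV_exp[THEN has_field_derivative_at_within])
  then have "((%th. ph th * exp (- (\<i> * of_real s * of_real th / 2))) has_vector_derivative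
    ph th * ((- (\<i> * of_real s / 2)) * exp (- (\<i> * of_real s * of_real th / 2))) +
    ps th * exp (- (\<i> * of_real s * of_real th / 2))) (at th within ?I)"
   by (intro has_vector_derivative_mult has_vector_derivative_at_within[OF deriv]) (simp add: o_def)
  moreover have "ps th = \<i> * of_real s / 2 * ph th" using ys[OF that] nz[of th] by (simp add: y_def field_simps)
  ultimately show ?thesis by (simp add: algebra_simps)
 qed
 then obtain d where d: "\<And>th. th \<in> ?I ==> ph th * exp (- (\<i> * of_real s * of_real th / 2)) = d"
  using has_vector_derivative_zero_constant[of ?I "%th. ph th * exp (- (\<i> * of_real s * of_real th / 2))"] by auto
 show ?thesis
 proof (rule that[OF s, of d])
  show "d \<noteq> 0" using d[of 0] nz[of 0] by auto
  show "ph th = d * exp (\<i> * of_real s * of_real th / 2)" if "0 \<le> th" "th \<le> 2 * pi" for th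
   using d[of th] that by (auto simp: exp_minus field_simps)
 qed
qed

section \<open>Third order contact with the half plane\<close>

text \<open>Cubic coefficient of the osculating map. Its imaginary part cancels the term of third
  order by which the curve leaves the real axis. Its real part is fixed by requiring that
  \<open>v\<close> times the modulus of the derivative agree with the height in the half plane up to
  third order.\<close>

definition model_coeff :: "real \<Rightarrow> real \<Rightarrow> real \<Rightarrow> complex" where
 "model_coeff ka ka' c = of_real (c / 2 - ka\<^sup>2 / 4) - \<i> * of_real (ka' / 6)"

definition model_map :: "real \<Rightarrow> real \<Rightarrow> real \<Rightarrow> complex \<Rightarrow> complex" where
 "model_map ka ka' c et = et - \<i> * of_real ka * et\<^sup>2 / 2 + model_coeff ka ka' c * et ^ 3"

definition model_deriv :: "real \<Rightarrow> real \<Rightarrow> real \<Rightarrow> complex \<Rightarrow> complex" where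
 "model_deriv ka ka' c et = 1 - \<i> * of_real ka * et + 3 * model_coeff ka ka' c * et\<^sup>2"

text \<open>With \<open>N\<close> the norm and \<open>X\<close> the quadratic approximation,
  \<open>N^2 - X^2\<close> is of third order in \<open>w\<close> and
  \<open>N + X >= 1\<close>.\<close>

lemma cmod_one_plus_expansion:
 assumes "norm w \<le> 1/2"
 shows "\<bar>norm (1 + w) - (1 + Re w + (Im w)\<^sup>2 / 2)\<bar> \<le> 2 * norm w ^ 3"
proof -
 define a where "a = Re w"
 define b where "b = Im w"
 define X where "X = 1 + a + b\<^sup>2 / 2"
 define N where "N = norm (1 + w)"
 have a: "\<bar>a\<bar> \<le> norm w" and b: "\<bar>b\<bar> \<le> norm w"
  using abs_Re_le_cmod[of w] abs_Im_le_cmod[of w] by (auto simp: a_def b_def)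
 have N2: "N\<^sup>2 = (1 + a)\<^sup>2 + b\<^sup>2" by (simp add: N_def cmod_power2 a_def b_def)
 have "N \<ge> 1/2" using norm_diff_ineq[of 1 w] assms by (simp add: N_def)
 moreover have "X \<ge> 1/2" using a assms by (simp add: X_def) (smt (verit) zero_le_power2)
 ultimately have s: "N + X \<ge> 1" by simp
 have "(N - X) * (N + X) = N\<^sup>2 - X\<^sup>2" by (simp add: power2_eq_square algebra_simps)
 also have "\<dots> = - (a * b\<^sup>2) - b ^ 4 / 4"
  unfolding N2 X_def by (simp add: power2_eq_square power4_eq_xxxx field_simps)
 finally have e: "\<bar>N - X\<bar> * (N + X) = \<bar>- (a * b\<^sup>2) - b ^ 4 / 4\<bar>" using s by (metis abs_mult abs_of_pos less_le_trans zero_less_one)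
 have "\<bar>N - X\<bar> \<le> \<bar>N - X\<bar> * (N + X)" using s by (simp add: mult_le_cancel_left1)
 also have "\<dots> \<le> \<bar>a\<bar> * \<bar>b\<bar>\<^sup>2 + \<bar>b\<bar> ^ 4 / 4" unfolding e
  using abs_triangle_ineq4[of "- (a * b\<^sup>2)" "b ^ 4 / 4"] by (simp add: abs_mult)
 also have "\<dots> \<le> norm w * (norm w)\<^sup>2 + norm w ^ 4 / 4"
  using a b by (intro add_mono mult_mono power_mono divide_right_mono) auto
 also have "\<dots> = norm w ^ 3 + norm w ^ 3 * norm w / 4" by (simp add: eval_nat_numeral)
 also have "\<dots> \<le> norm w ^ 3 + norm w ^ 3 * 1" using assms
  by (intro add_mono) (auto simp: mult_left_le intro: order_trans[OF _ mult_left_mono])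
 finally show ?thesis by (simp add: N_def X_def a_def b_def)
qed

lemma compact_norm_bound:
 fixes F :: "'a::topological_space \<Rightarrow> 'b::real_normed_vector"
 assumes "compact K" "continuous_on K F"
 obtains C where "C > 0" "\<And>x. x \<in> K ==> norm (F x) \<le> C"
proof -
 have "bounded (F ` K)" using assms compact_continuous_image compact_imp_bounded by blast
 then show ?thesis using that by (auto simp: bounded_pos)
qed

text \<open>The complex argument is the third-order Taylor position, in the frame of the base point,
  of the point at normal distance \<open>x\<close> over arc length \<open>si\<close>; the first
  factor is the corresponding expansion of \<open>v\<close>. The claim is that the model map is a
  hyperbolic isometry up to relative third order, proved by rescaling with \<open>h\<close> and
  matching powers of \<open>h\<close>.\<close>

lemma model_defect_bound:
 fixes B :: real
 obtains C h0 where "C > 0" "h0 > 0" "h0 \<le> 1"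
  "\<And>ka ka' c si x h. \<bar>ka\<bar> \<le> B ==> \<bar>ka'\<bar> \<le> B ==> \<bar>c\<bar> \<le> B ==> \<bar>si\<bar> \<le> h ==> 0 \<le> x ==> x \<le> h ==> 0 < h ==> h \<le> h0 ==>
   \<bar>(x - (ka + ka' * si) * x\<^sup>2 / 2 + c * x ^ 3) *
    norm (model_deriv ka ka' c (Complex si x + (\<i> * of_real ka * of_real si ^ 2 / 2 - of_real (ka * si * x))
     + (\<i> * of_real ka' - of_real ka ^ 2) * (of_real si ^ 3 / 6 + \<i> * of_real si ^ 2 * of_real x / 2)))
    - Im (model_map ka ka' c (Complex si x + (\<i> * of_real ka * of_real si ^ 2 / 2 - of_real (ka * si * x))
     + (\<i> * of_real ka' - of_real ka ^ 2) * (of_real si ^ 3 / 6 + \<i> * of_real si ^ 2 * of_real x / 2)))\<bar> \<le> C * h ^ 4"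
proof -
 \<comment> \<open>Range of \<open>(ka, ka', c, si / h, x / h, h)\<close>. Every remainder is
   continuous in these six variables, so compactness supplies all constants.\<close>
 define K :: "(real \<times> real \<times> real \<times> real \<times> real \<times> real) set"
  where "K = {-B..B} \<times> {-B..B} \<times> {-B..B} \<times> {-1..1} \<times> {0..1} \<times> {0..1}"
 have cK: "compact K" unfolding K_def by (intro compact_Times compact_Icc)
 define P where "P = model_coeff"
 define X :: "real \<Rightarrow> real \<Rightarrow> complex" where "X a b = of_real a + \<i> * of_real b" for a b
 define H2 :: "real \<Rightarrow> real \<Rightarrow> real \<Rightarrow> complex" where "H2 ka a b = \<i> * of_real ka * of_real a ^ 2 / 2 - of_real (ka * a * b)" for ka a b
 define H3 :: "real \<Rightarrow> real \<Rightarrow> real \<Rightarrow> real \<Rightarrow> complex" where "H3 ka ka' a b = (\<i> * of_real ka' - of_real ka ^ 2) * (of_real a ^ 3 / 6 + \<i> * of_real a ^ 2 * of_real b / 2)" for ka ka' a b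
 define N where "N ka ka' a b h = X a b + of_real h * H2 ka a b + of_real h ^ 2 * H3 ka ka' a b" for ka ka' a b h
 define FQ where "FQ ka ka' c a b h = - \<i> * of_real ka * (2 * X a b * H3 ka ka' a b + (H2 ka a b)\<^sup>2 + 2 * of_real h * H2 ka a b * H3 ka ka' a b
   + of_real h ^ 2 * (H3 ka ka' a b)\<^sup>2) / 2 + P ka ka' c * ((H2 ka a b + of_real h * H3 ka ka' a b) *
   ((N ka ka' a b h)\<^sup>2 + N ka ka' a b h * X a b + (X a b)\<^sup>2))" for ka ka' c a b h
 define Fw where "Fw ka ka' c a b h = - \<i> * of_real ka * N ka ka' a b h + of_real h * (3 * P ka ka' c * (N ka ka' a b h)\<^sup>2)" for ka ka' c a b h
 define Fr where "Fr ka ka' c a b h = - \<i> * of_real ka * H3 ka ka' a b + 3 * P ka ka' c * ((H2 ka a b + of_real h * H3 ka ka' a b) * (N ka ka' a b h + X a b))" for ka ka' c a b h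
 \<comment> \<open>Second-order coefficient of the norm of the derivative: half of
   \<open>ka\<^sup>2 * a\<^sup>2\<close> comes from the real part, the other half from the square of
   the imaginary part.\<close>
 define B2 where "B2 ka ka' c a b = ka\<^sup>2 * a\<^sup>2 + 3 * Re (P ka ka' c * (X a b)\<^sup>2)" for ka ka' c a b
 define A3 where "A3 ka' c a b = - ka' * a * b\<^sup>2 / 2 + c * b ^ 3" for ka' c a b :: real
 define Fv where "Fv ka ka' c a b h = b - (ka + ka' * a * h) * b\<^sup>2 * h / 2 + c * b ^ 3 * h\<^sup>2" for ka ka' c a b h :: real
 define Fs where "Fs ka ka' c a b h = (- ka * b\<^sup>2 / 2) * B2 ka ka' c a b + A3 ka' c a b * (ka * b + h * B2 ka ka' c a b)" for ka ka' c a b h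
 \<comment> \<open>the imaginary part of the derivative correction beyond first order\<close>
 define Fi where "Fi ka ka' c a b h = Im (- \<i> * of_real ka * H2 ka a b + 3 * P ka ka' c * (X a b)\<^sup>2) + h * Im (Fr ka ka' c a b h)" for ka ka' c a b h
 note defs = P_def model_coeff_def X_def H2_def H3_def N_def
 have ex: "\<exists>C>0. \<forall>ka ka' c a b h. (ka, ka', c, a, b, h) \<in> K \<longrightarrow> norm (F ka ka' c a b h) \<le> C"
  if "continuous_on K (%y. F (fst y) (fst (snd y)) (fst (snd (snd y))) (fst (snd (snd (snd y)))) (fst (snd (snd (snd (snd y))))) (snd (snd (snd (snd (snd y))))))"
  for F :: "real \<Rightarrow> real \<Rightarrow> real \<Rightarrow> real \<Rightarrow> real \<Rightarrow> real \<Rightarrow> 'x::real_normed_vector"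
  using compact_norm_bound[OF cK that] by (metis fst_conv snd_conv)
 have "\<exists>C>0. \<forall>ka ka' c a b h. (ka, ka', c, a, b, h) \<in> K \<longrightarrow> norm (FQ ka ka' c a b h) \<le> C"
  by (rule ex) (unfold FQ_def defs, intro continuous_intros, simp_all)
 then obtain C1 where C1: "C1 > 0" "\<And>ka ka' c a b h. (ka, ka', c, a, b, h) \<in> K ==> norm (FQ ka ka' c a b h) \<le> C1"
  by blast
 have "\<exists>C>0. \<forall>ka ka' c a b h. (ka, ka', c, a, b, h) \<in> K \<longrightarrow> norm (Fw ka ka' c a b h) \<le> C"
  by (rule ex) (unfold Fw_def defs, intro continuous_intros, simp_all)
 then obtain C2 where C2: "C2 > 0" "\<And>ka ka' c a b h. (ka, ka', c, a, b, h) \<in> K ==> norm (Fw ka ka' c a b h) \<le> C2"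
  by blast
 have "\<exists>C>0. \<forall>ka ka' c a b h. (ka, ka', c, a, b, h) \<in> K \<longrightarrow> norm (Fr ka ka' c a b h) \<le> C"
  by (rule ex) (unfold Fr_def defs, intro continuous_intros, simp_all)
 then obtain C3 where C3: "C3 > 0" "\<And>ka ka' c a b h. (ka, ka', c, a, b, h) \<in> K ==> norm (Fr ka ka' c a b h) \<le> C3"
  by blast
 have "\<exists>C>0. \<forall>ka ka' c a b h. (ka, ka', c, a, b, h) \<in> K \<longrightarrow> norm (Fv ka ka' c a b h) \<le> C"
  by (rule ex) (unfold Fv_def, intro continuous_intros, simp_all)
 then obtain C4 where C4: "C4 > 0" "\<And>ka ka' c a b h. (ka, ka', c, a, b, h) \<in> K ==> norm (Fv ka ka' c a b h) \<le> C4"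
  by blast
 have "\<exists>C>0. \<forall>ka ka' c a b h. (ka, ka', c, a, b, h) \<in> K \<longrightarrow> norm (Fs ka ka' c a b h) \<le> C"
  by (rule ex) (unfold Fs_def B2_def A3_def defs, intro continuous_intros, simp_all)
 then obtain C5 where C5: "C5 > 0" "\<And>ka ka' c a b h. (ka, ka', c, a, b, h) \<in> K ==> norm (Fs ka ka' c a b h) \<le> C5"
  by blast
 have "\<exists>C>0. \<forall>ka ka' c a b h. (ka, ka', c, a, b, h) \<in> K \<longrightarrow> norm (Fi ka ka' c a b h) \<le> C"
  by (rule ex) (unfold Fi_def Fr_def defs, intro continuous_intros, simp_all)
 then obtain C6 where C6: "C6 > 0" "\<And>ka ka' c a b h. (ka, ka', c, a, b, h) \<in> K ==> norm (Fi ka ka' c a b h) \<le> C6"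
  by blast
 \<comment> \<open>Keeps the deviation \<open>W\<close> of the derivative from 1 below 1/2, as
   \<open>cmod_one_plus_expansion\<close> demands.\<close>
 define h0 where "h0 = min 1 (1 / (2 * C2))"
 define E where "E = C3 + (\<bar>B\<bar> * C6 + C6\<^sup>2 / 2) + 2 * C2 ^ 3"
 have h0: "h0 > 0" "h0 \<le> 1" "h0 * C2 \<le> 1/2" using C2(1) by (auto simp: h0_def min_def field_simps)
 have E: "E > 0" using C2(1) C3(1) C6(1) by (auto simp: E_def intro!: add_pos_pos add_nonneg_pos)
 show ?thesis
 proof (rule that[of "C1 + C5 + C4 * E" h0])
  show "C1 + C5 + C4 * E > 0" using C1 C4 C5 E by (simp add: add_pos_pos)
  fix ka ka' c si x h
  assume as: "\<bar>ka\<bar> \<le> B" "\<bar>ka'\<bar> \<le> B" "\<bar>c\<bar> \<le> B" "\<bar>si\<bar> \<le> h" "0 \<le> x" "x \<le> h" "0 < h" "h \<le> h0"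
  define a where "a = si / h"
  define b where "b = x / h"
  have ab: "si = h * a" "x = h * b" using as by (auto simp: a_def b_def)
  have inK: "(ka, ka', c, a, b, h) \<in> K"
   using as h0 by (auto simp: K_def a_def b_def abs_le_iff field_simps)
  let ?H = "of_real h :: complex"
  define p where "p = P ka ka' c"
  define et where "et = Complex si x + (\<i> * of_real ka * of_real si ^ 2 / 2 - of_real (ka * si * x))
     + (\<i> * of_real ka' - of_real ka ^ 2) * (of_real si ^ 3 / 6 + \<i> * of_real si ^ 2 * of_real x / 2)"
  define n where "n = N ka ka' a b h"
  define \<xi> where "\<xi> = X a b"
  define u where "u = H2 ka a b"
  define w where "w = H3 ka ka' a b"
  have n: "n = \<xi> + ?H * u + ?H ^ 2 * w" by (simp add: n_def N_def \<xi>_def u_def w_def)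
  have etn: "et = ?H * n"
   unfolding et_def n \<xi>_def u_def w_def ab X_def H2_def H3_def Complex_eq
   by (simp add: power2_eq_square power3_eq_cube algebra_simps)
  \<comment> \<open>third-order Taylor coefficient: this identity dictates \<open>model_coeff\<close>\<close>
  have third: "Im (w - \<i> * of_real ka * \<xi> * u + p * \<xi> ^ 3) = A3 ka' c a b - ka\<^sup>2 * b ^ 3 / 2 + b * B2 ka ka' c a b"
   unfolding \<xi>_def u_def w_def p_def B2_def A3_def defs
   by (simp add: power2_eq_square power3_eq_cube field_simps)
  have second: "Im (u - \<i> * of_real ka * \<xi>\<^sup>2 / 2) = ka * b\<^sup>2 / 2"
   unfolding \<xi>_def u_def defs by (simp add: power2_eq_square field_simps)
  have QQ: "model_map ka ka' c et = ?H * \<xi> + ?H ^ 2 * (u - \<i> * of_real ka * \<xi>\<^sup>2 / 2)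
    + ?H ^ 3 * (w - \<i> * of_real ka * \<xi> * u + p * \<xi> ^ 3) + ?H ^ 4 * FQ ka ka' c a b h"
   unfolding model_map_def etn FQ_def P_def[symmetric] p_def[symmetric] n_def[symmetric] \<xi>_def[symmetric] u_def[symmetric] w_def[symmetric]
   unfolding n by (simp add: field_simps) algebra
  have re: "Im (?H ^ m * z) = h ^ m * Im z" for m z by (simp flip: of_real_power)
  have ImQ: "Im (model_map ka ka' c et) = h * b + h\<^sup>2 * (ka * b\<^sup>2 / 2)
    + h ^ 3 * (A3 ka' c a b - ka\<^sup>2 * b ^ 3 / 2 + b * B2 ka ka' c a b) + h ^ 4 * Im (FQ ka ka' c a b h)"
  proof -
   have "Im (?H * A + ?H ^ 2 * A2 + ?H ^ 3 * A3 + ?H ^ 4 * A4) = h * Im A + h ^ 2 * Im A2 + h ^ 3 * Im A3 + h ^ 4 * Im A4"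
    for A A2 A3 A4 by (simp add: re)
   note this[of \<xi> "u - \<i> * of_real ka * \<xi>\<^sup>2 / 2" "w - \<i> * of_real ka * \<xi> * u + p * \<xi> ^ 3" "FQ ka ka' c a b h"]
   moreover have "Im \<xi> = b" by (simp add: \<xi>_def X_def)
   ultimately show ?thesis unfolding QQ third second by simp
  qed
  define W where "W = ?H * Fw ka ka' c a b h"
  have DW: "model_deriv ka ka' c et = 1 + W"
   unfolding model_deriv_def W_def etn Fw_def P_def n_def by (simp add: power2_eq_square algebra_simps)
  have W2: "W = ?H * (- \<i> * of_real ka * \<xi>) + ?H ^ 2 * (- \<i> * of_real ka * u + 3 * p * \<xi>\<^sup>2) + ?H ^ 3 * Fr ka ka' c a b h"
   unfolding W_def Fw_def Fr_def p_def[symmetric] n_def[symmetric] \<xi>_def[symmetric] u_def[symmetric] w_def[symmetric]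
   unfolding n by (simp add: power2_eq_square power3_eq_cube algebra_simps)
  have re2: "Re (?H ^ m * z) = h ^ m * Re z" for m z by (simp flip: of_real_power)
  have ReW: "Re W = h * (ka * b) + h\<^sup>2 * (ka\<^sup>2 * a\<^sup>2 / 2 + 3 * Re (p * \<xi>\<^sup>2)) + h ^ 3 * Re (Fr ka ka' c a b h)"
  proof -
   have f1: "Re (- \<i> * of_real ka * u + 3 * p * \<xi>\<^sup>2) = ka\<^sup>2 * a\<^sup>2 / 2 + 3 * Re (p * \<xi>\<^sup>2)"
    by (simp add: u_def H2_def power2_eq_square algebra_simps)
   have f2: "Re (- \<i> * of_real ka * \<xi>) = ka * b" by (simp add: \<xi>_def X_def)
   have f3: "Re (?H * A + ?H ^ 2 * A2 + ?H ^ 3 * A3) = h * Re A + h ^ 2 * Re A2 + h ^ 3 * Re A3"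
    for A A2 A3 by (simp add: re2)
   show ?thesis unfolding W2 f3 f1 f2 ..
  qed
  have ImW: "Im W = - (h * (ka * a)) + h\<^sup>2 * Fi ka ka' c a b h"
  proof -
   have f3: "Im (?H * A + ?H ^ 2 * A2 + ?H ^ 3 * A3) = h * Im A + h ^ 2 * Im A2 + h ^ 3 * Im A3"
    for A A2 A3 by (simp add: re)
   have f2: "Im (- \<i> * of_real ka * \<xi>) = - (ka * a)" by (simp add: \<xi>_def X_def)
   have "Im W = h * (- (ka * a)) + h ^ 2 * Im (- \<i> * of_real ka * u + 3 * p * \<xi>\<^sup>2) + h ^ 3 * Im (Fr ka ka' c a b h)"
    unfolding W2 f3 f2 ..
   then show ?thesis
    unfolding Fi_def \<xi>_def[symmetric] u_def[symmetric] p_def[symmetric]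
    by (simp only: power2_eq_square power3_eq_cube distrib_left mult.assoc mult_minus_right)
  qed
  have hW: "norm W \<le> h * C2" using C2(2)[OF inK] as by (simp add: W_def norm_mult)
  also have "\<dots> \<le> 1/2" using h0 as C2(1) by (meson mult_right_mono less_imp_le order_trans)
  finally have W12: "norm W \<le> 1/2" .
  define E1 where "E1 = norm (1 + W) - (1 + h * (ka * b) + h\<^sup>2 * B2 ka ka' c a b)"
  have E1: "\<bar>E1\<bar> \<le> E * h ^ 3"
  proof -
   have Imsq: "(Im W)\<^sup>2 / 2 = h\<^sup>2 * (ka\<^sup>2 * a\<^sup>2 / 2) + h ^ 3 * (- (ka * a) * Fi ka ka' c a b h + h * (Fi ka ka' c a b h)\<^sup>2 / 2)"
    unfolding ImW by (simp add: power2_eq_square power3_eq_cube field_simps)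
   have "E1 = (norm (1 + W) - (1 + Re W + (Im W)\<^sup>2 / 2)) + h ^ 3 * Re (Fr ka ka' c a b h)
     + h ^ 3 * (- (ka * a) * Fi ka ka' c a b h + h * (Fi ka ka' c a b h)\<^sup>2 / 2)"
    unfolding E1_def Imsq unfolding ReW B2_def p_def \<xi>_def by (simp add: algebra_simps)
   moreover have "\<bar>norm (1 + W) - (1 + Re W + (Im W)\<^sup>2 / 2)\<bar> \<le> 2 * C2 ^ 3 * h ^ 3"
   proof -
    have "\<bar>norm (1 + W) - (1 + Re W + (Im W)\<^sup>2 / 2)\<bar> \<le> 2 * norm W ^ 3"
     by (rule cmod_one_plus_expansion[OF W12])
    also have "\<dots> \<le> 2 * (h * C2) ^ 3" using hW by (simp add: power_mono)
    finally show ?thesis by (simp add: power_mult_distrib mult_ac)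
   qed
   moreover have "\<bar>h ^ 3 * Re (Fr ka ka' c a b h)\<bar> \<le> C3 * h ^ 3"
    using order_trans[OF abs_Re_le_cmod C3(2)[OF inK]] as by (simp add: abs_mult)
   moreover have "\<bar>h ^ 3 * (- (ka * a) * Fi ka ka' c a b h + h * (Fi ka ka' c a b h)\<^sup>2 / 2)\<bar> \<le> (\<bar>B\<bar> * C6 + C6\<^sup>2 / 2) * h ^ 3"
   proof -
    have f: "\<bar>Fi ka ka' c a b h\<bar> \<le> C6" using C6(2)[OF inK] by simp
    have "\<bar>- (ka * a) * Fi ka ka' c a b h\<bar> \<le> \<bar>B\<bar> * 1 * C6"
     unfolding abs_mult abs_minus using f as inK by (intro mult_mono) (auto simp: K_def abs_le_iff)
    moreover have "\<bar>h * (Fi ka ka' c a b h)\<^sup>2 / 2\<bar> \<le> C6\<^sup>2 / 2"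
    proof -
     have "(Fi ka ka' c a b h)\<^sup>2 \<le> C6\<^sup>2" using f by (simp add: abs_le_square_iff[symmetric])
     moreover have "h * (Fi ka ka' c a b h)\<^sup>2 \<le> 1 * (Fi ka ka' c a b h)\<^sup>2" using as h0 by (intro mult_right_mono) auto
     ultimately show ?thesis using as by simp
    qed
    ultimately have "\<bar>- (ka * a) * Fi ka ka' c a b h + h * (Fi ka ka' c a b h)\<^sup>2 / 2\<bar> \<le> \<bar>B\<bar> * C6 + C6\<^sup>2 / 2"
     by linarith
    then show ?thesis using as by (simp add: abs_mult mult.commute mult_left_mono)
   qed
   ultimately have "\<bar>E1\<bar> \<le> 2 * C2 ^ 3 * h ^ 3 + C3 * h ^ 3 + (\<bar>B\<bar> * C6 + C6\<^sup>2 / 2) * h ^ 3" by linarith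
   then show ?thesis by (simp add: E_def algebra_simps)
  qed
  define V where "V = x - (ka + ka' * si) * x\<^sup>2 / 2 + c * x ^ 3"
  have VF: "V = h * Fv ka ka' c a b h"
   unfolding V_def ab Fv_def by (simp add: power2_eq_square power3_eq_cube algebra_simps)
  have Vb: "\<bar>V\<bar> \<le> C4 * h" using C4(2)[OF inK] as unfolding VF by (simp add: abs_mult mult.commute mult_left_mono)
  \<comment> \<open>The coefficients up to \<open>h ^ 3\<close> coincide with those in
    \<open>ImQ\<close>; this agreement is the heart of the lemma.\<close>
  have VD: "V * (1 + h * (ka * b) + h\<^sup>2 * B2 ka ka' c a b) = h * b + h\<^sup>2 * (ka * b\<^sup>2 / 2)
    + h ^ 3 * (A3 ka' c a b - ka\<^sup>2 * b ^ 3 / 2 + b * B2 ka ka' c a b) + h ^ 4 * Fs ka ka' c a b h"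
   unfolding VF Fv_def Fs_def A3_def by (simp add: power2_eq_square power3_eq_cube power4_eq_xxxx field_simps)
  have "V * norm (model_deriv ka ka' c et) - Im (model_map ka ka' c et)
    = h ^ 4 * Fs ka ka' c a b h - h ^ 4 * Im (FQ ka ka' c a b h) + V * E1"
  proof -
   have "norm (model_deriv ka ka' c et) = (1 + h * (ka * b) + h\<^sup>2 * B2 ka ka' c a b) + E1"
    by (simp add: DW E1_def)
   then show ?thesis unfolding ImQ using VD by (simp only: distrib_left)
  qed
  moreover have "\<bar>h ^ 4 * Fs ka ka' c a b h\<bar> \<le> C5 * h ^ 4"
   using C5(2)[OF inK] as by (simp add: abs_mult mult.commute mult_left_mono)
  moreover have "\<bar>h ^ 4 * Im (FQ ka ka' c a b h)\<bar> \<le> C1 * h ^ 4"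
   using order_trans[OF abs_Im_le_cmod C1(2)[OF inK]] as by (simp add: abs_mult mult.commute mult_left_mono)
  moreover have "\<bar>V * E1\<bar> \<le> C4 * E * h ^ 4"
  proof -
   have "\<bar>V * E1\<bar> \<le> (C4 * h) * (E * h ^ 3)" unfolding abs_mult
    using Vb E1 C4(1) as by (intro mult_mono) auto
   then show ?thesis by (simp add: eval_nat_numeral mult_ac)
  qed
  ultimately have "\<bar>V * norm (model_deriv ka ka' c et) - Im (model_map ka ka' c et)\<bar> \<le> C5 * h ^ 4 + C1 * h ^ 4 + C4 * E * h ^ 4"
   by linarith
  then show "\<bar>(x - (ka + ka' * si) * x\<^sup>2 / 2 + c * x ^ 3) *
    norm (model_deriv ka ka' c (Complex si x + (\<i> * of_real ka * of_real si ^ 2 / 2 - of_real (ka * si * x))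
     + (\<i> * of_real ka' - of_real ka ^ 2) * (of_real si ^ 3 / 6 + \<i> * of_real si ^ 2 * of_real x / 2)))
    - Im (model_map ka ka' c (Complex si x + (\<i> * of_real ka * of_real si ^ 2 / 2 - of_real (ka * si * x))
     + (\<i> * of_real ka' - of_real ka ^ 2) * (of_real si ^ 3 / 6 + \<i> * of_real si ^ 2 * of_real x / 2)))\<bar> \<le> (C1 + C5 + C4 * E) * h ^ 4"
   unfolding et_def[symmetric] V_def[symmetric] by (simp add: algebra_simps)
 qed (use h0 in auto)
qed

section \<open>Arc length curves\<close>

lemma periodic_int_shift:
 fixes f :: "real \<Rightarrow> 'a"
 assumes "\<And>s. f (s + L) = f s"
 shows "f (s + of_int n * L) = f s"
proof (induction n rule: int_induct[of _ 0])
 case base then show ?case by simp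
next
 case (step1 i)
 then show ?case using assms[of "s + of_int i * L"] by (simp add: algebra_simps)
next
 case (step2 i)
 then show ?case using assms[of "s + of_int (i - 1) * L"] by (simp add: algebra_simps)
qed

lemma periodic_reduce:
 fixes L s t :: real
 assumes "L > 0"
 obtains n :: int where "\<bar>t + of_int n * L - s\<bar> \<le> L / 2"
proof
 have "\<bar>of_int (round ((t - s) / L)) - (t - s) / L\<bar> \<le> 1/2" by (rule of_int_round_abs_le)
 then have "\<bar>(of_int (round ((t - s) / L)) - (t - s) / L) * L\<bar> \<le> 1/2 * L"
  using assms by (simp add: abs_mult)
 moreover have "(of_int (round ((t - s) / L)) - (t - s) / L) * L = of_int (round ((t - s) / L)) * L - (t - s)"
  using assms by (simp only: left_diff_distrib) (simp add: diff_divide_distrib left_diff_distrib)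
 ultimately have "\<bar>of_int (round ((t - s) / L)) * L - (t - s)\<bar> \<le> 1/2 * L" by (simp only:)
 moreover have "\<bar>t + of_int (- round ((t - s) / L)) * L - s\<bar> = \<bar>of_int (round ((t - s) / L)) * L - (t - s)\<bar>"
  by (subst abs_minus_commute) (simp add: algebra_simps)
 ultimately show "\<bar>t + of_int (- round ((t - s) / L)) * L - s\<bar> \<le> L / 2" by simp
qed

lemma vector_mean_value_bound:
 fixes f :: "real \<Rightarrow> 'a::real_normed_vector"
 assumes d: "\<And>x. x \<in> closed_segment s t ==> (f has_vector_derivative f' x) (at x)"
  and b: "\<And>x. x \<in> closed_segment s t ==> norm (f' x - c) \<le> e"
 shows "norm (f t - f s - (t - s) *\<^sub>R c) \<le> e * \<bar>t - s\<bar>"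
proof -
 have "norm ((f t - t *\<^sub>R c) - (f s - s *\<^sub>R c)) \<le> e * norm (t - s)"
 proof (rule differentiable_bound[where S = "closed_segment s t" and f' = "%x h. h *\<^sub>R (f' x - c)"])
  fix x assume x: "x \<in> closed_segment s t"
  have "((%x. f x - x *\<^sub>R c) has_vector_derivative (f' x - c)) (at x)"
   by (auto intro!: derivative_eq_intros d[OF x])
  then show "((%x. f x - x *\<^sub>R c) has_derivative (%h. h *\<^sub>R (f' x - c))) (at x within closed_segment s t)"
   using has_derivative_at_withinI by (auto simp: has_vector_derivative_def)
  show "onorm (%h. h *\<^sub>R (f' x - c)) \<le> e"
   by (rule onorm_le) (use mult_right_mono[OF b[OF x] abs_ge_zero] in \<open>simp add: mult.commute\<close>)
 qed auto
 then show ?thesis by (simp add: algebra_simps)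
qed

locale arclength_curve =
 fixes \<gamma> g1 g2 g3 :: "real \<Rightarrow> complex" and L :: real
 assumes L: "0 < L" and per: "\<And>s. \<gamma> (s + L) = \<gamma> s" and inj: "inj_on \<gamma> {0..<L}"
  and d1: "\<And>s. (\<gamma> has_vector_derivative g1 s) (at s)"
  and d2: "\<And>s. (g1 has_vector_derivative g2 s) (at s)"
  and d3: "\<And>s. (g2 has_vector_derivative g3 s) (at s)"
  and cont3: "continuous_on UNIV g3" and unit: "\<And>s. norm (g1 s) = 1"
begin

abbreviation "curve \<equiv> range \<gamma>"

definition kap :: "real \<Rightarrow> real" where "kap s = Im (cnj (g1 s) * g2 s)"
definition kap' :: "real \<Rightarrow> real" where "kap' s = Im (cnj (g1 s) * g3 s)"

lemma deriv_periodic: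
 assumes "\<And>s. (f has_vector_derivative f' s) (at s)" "\<And>s. f (s + L) = f s"
 shows "f' (s + L) = f' s"
proof -
 have "((%x. f (L + x * 1)) has_vector_derivative 1 *\<^sub>R f' (L + s * 1)) (at s)"
  by (rule has_vector_derivative_affine[OF assms(1)])
 then have "(f has_vector_derivative f' (s + L)) (at s)" by (simp add: assms(2) add.commute)
 then show ?thesis using assms(1) vector_derivative_unique_at by blast
qed

lemma per1: "g1 (s + L) = g1 s" and per2: "g2 (s + L) = g2 s" and per3: "g3 (s + L) = g3 s"
proof -
 show 1: "g1 (s + L) = g1 s" for s using deriv_periodic[OF d1 per] .
 show 2: "g2 (s + L) = g2 s" for s using deriv_periodic[OF d2 1] .
 show "g3 (s + L) = g3 s" using deriv_periodic[OF d3 2] .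
qed

lemma shift: "\<gamma> (s + of_int n * L) = \<gamma> s" "g1 (s + of_int n * L) = g1 s" "g2 (s + of_int n * L) = g2 s"
  "g3 (s + of_int n * L) = g3 s"
 by (auto intro: periodic_int_shift per per1 per2 per3)

lemma \<gamma>_eqD: assumes "\<gamma> s = \<gamma> t" obtains n :: int where "t = s + of_int n * L"
proof -
 define red where "red s = s + of_int (- \<lfloor>s / L\<rfloor>) * L" for s
 have red: "red s \<in> {0..<L}" for s
  using L floor_divide_lower[OF L, of s] floor_divide_upper[OF L, of s] by (simp add: red_def algebra_simps)
 have "\<gamma> (red s) = \<gamma> (red t)" using assms unfolding red_def by (simp only: shift)
 then have "red s = red t" using inj red by (meson inj_onD)
 then have "t = s + of_int (- \<lfloor>s / L\<rfloor> + \<lfloor>t / L\<rfloor>) * L" by (simp add: red_def algebra_simps)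
 then show ?thesis using that by blast
qed

lemma frame_eq: assumes "\<gamma> s = \<gamma> t" shows "g1 s = g1 t" "g2 s = g2 t" "g3 s = g3 t"
 using \<gamma>_eqD[OF assms] shift by metis+

lemma image_period: "curve = \<gamma> ` {0..L}"
proof -
 have "\<gamma> s \<in> \<gamma> ` {0..L}" for s
 proof -
  have "s + of_int (- \<lfloor>s / L\<rfloor>) * L \<in> {0..L}"
   using L floor_divide_lower[OF L, of s] floor_divide_upper[OF L, of s] by (simp add: algebra_simps)
  then show ?thesis using shift(1) by (metis image_eqI)
 qed
 then show ?thesis by auto
qed

lemma cont0: "continuous_on S \<gamma>" and cont1: "continuous_on S g1" and cont2: "continuous_on S g2"
 using d1 d2 d3 by (meson continuous_at_imp_continuous_on has_vector_derivative_continuous)+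

lemma compact_curve: "compact curve"
 unfolding image_period by (intro compact_continuous_image cont0) auto

text \<open>Differentiating \<open>|g1|^2 = 1\<close> shows that \<open>cnj g1 * g2\<close> is
  purely imaginary: the Frenet equation in complex form.\<close>

lemma frame2: "g2 s = \<i> * of_real (kap s) * g1 s"
proof -
 have u: "g1 t * cnj (g1 t) = 1" for t using unit[of t] by (simp add: complex_norm_square[symmetric])
 have "((%t. Re (g1 t * cnj (g1 t))) has_vector_derivative Re (g1 s * cnj (g2 s) + g2 s * cnj (g1 s))) (at s)"
  by (rule bounded_linear.has_vector_derivative[OF bounded_linear_Re
     has_vector_derivative_mult[OF d2 has_vector_derivative_cnj[OF d2]]])
 then have "((%t. 1) has_vector_derivative Re (g1 s * cnj (g2 s) + g2 s * cnj (g1 s))) (at s)" by (simp only: u one_complex.sel)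
 then have "Re (g1 s * cnj (g2 s) + g2 s * cnj (g1 s)) = 0"
  using vector_derivative_unique_at[OF _ has_vector_derivative_const] by blast
 then have R: "Re (cnj (g1 s) * g2 s) = 0" by simp
 have "cnj (g1 s) * g2 s = \<i> * of_real (kap s)" using R by (simp add: complex_eq_iff kap_def)
 moreover have "g2 s = g1 s * (cnj (g1 s) * g2 s)" using u[of s] by (simp add: mult.assoc[symmetric])
 ultimately show ?thesis by (simp add: mult_ac)
qed

lemma kap_deriv: "(kap has_vector_derivative kap' s) (at s)"
proof -
 have "((%t. Im (cnj (g1 t) * g2 t)) has_vector_derivative Im (cnj (g1 s) * g3 s + cnj (g2 s) * g2 s)) (at s)"
  by (rule bounded_linear.has_vector_derivative[OF bounded_linear_Im])
    (rule has_vector_derivative_mult[OF has_vector_derivative_cnj[OF d2] d3])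
 then show ?thesis by (simp add: kap_def[abs_def] kap'_def)
qed

lemma frame3: "g3 s = (\<i> * of_real (kap' s) - of_real (kap s) ^ 2) * g1 s"
proof -
 have "((%t. \<i> * of_real (kap t) * g1 t) has_vector_derivative \<i> * of_real (kap s) * g2 s + \<i> * of_real (kap' s) * g1 s) (at s)"
 proof -
  have "((%t. \<i> * of_real (kap t)) has_vector_derivative \<i> * of_real (kap' s)) (at s)"
   by (rule has_vector_derivative_mult_right[OF has_vector_derivative_of_real
     [OF kap_deriv[unfolded has_real_derivative_iff_has_vector_derivative[symmetric]]]])
  from has_vector_derivative_mult[OF this d2] show ?thesis by simp
 qed
 then have "(g2 has_vector_derivative \<i> * of_real (kap s) * g2 s + \<i> * of_real (kap' s) * g1 s) (at s)"
  by (simp only: frame2[symmetric])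
 then have "g3 s = \<i> * of_real (kap s) * g2 s + \<i> * of_real (kap' s) * g1 s"
  using d3 vector_derivative_unique_at by blast
 then show ?thesis by (simp add: frame2 algebra_simps power2_eq_square)
qed

lemma periodic_bounded:
 fixes f :: "real \<Rightarrow> 'a::real_normed_vector"
 assumes "continuous_on UNIV f" "\<And>s. f (s + L) = f s"
 obtains B where "B > 0" "\<And>s. norm (f s) \<le> B"
proof -
 obtain B where B: "B > 0" "\<And>s. s \<in> {0..L} ==> norm (f s) \<le> B"
  using compact_norm_bound[of "{0..L}" f] assms(1) continuous_on_subset by blast
 have "norm (f s) \<le> B" for s
 proof -
  have "s + of_int (- \<lfloor>s / L\<rfloor>) * L \<in> {0..L}"
   using L floor_divide_lower[OF L, of s] floor_divide_upper[OF L, of s] by (simp add: algebra_simps)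
  then show ?thesis using B(2) periodic_int_shift[of f L, OF assms(2)] by metis
 qed
 then show ?thesis using that B by blast
qed

lemma periodic_uniformly_continuous:
 fixes f :: "real \<Rightarrow> 'a::metric_space"
 assumes c: "continuous_on UNIV f" and p: "\<And>s. f (s + L) = f s" and e: "e > 0"
 obtains d where "d > 0" "\<And>s t. \<bar>s - t\<bar> < d ==> dist (f s) (f t) < e"
proof -
 have "uniformly_continuous_on {-1..L + 1} f"
  by (rule compact_uniformly_continuous) (auto intro: continuous_on_subset[OF c])
 then obtain d where d: "d > 0" "\<And>s t. s \<in> {-1..L+1} ==> t \<in> {-1..L+1} ==> dist s t < d ==> dist (f s) (f t) < e"
  using e unfolding uniformly_continuous_on_def by (metis dist_commute)
 show ?thesis
 proof (rule that[of "min d 1"])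
  show "min d 1 > 0" using d by simp
  fix s t assume st: "\<bar>s - t\<bar> < min d 1"
  define n where "n = - \<lfloor>s / L\<rfloor>"
  have "s + of_int n * L \<in> {0..L}"
   unfolding n_def using L floor_divide_lower[OF L, of s] floor_divide_upper[OF L, of s] by (simp add: algebra_simps)
  then have "dist (f (s + of_int n * L)) (f (t + of_int n * L)) < e"
   using st by (intro d(2)) (auto simp: dist_real_def abs_less_iff)
  then show "dist (f s) (f t) < e" by (simp add: periodic_int_shift[of f L, OF p])
 qed
qed

lemma bounds: obtains B where "B \<ge> 1" "\<And>s. norm (g2 s) \<le> B" "\<And>s. norm (g3 s) \<le> B" "\<And>s. \<bar>kap s\<bar> \<le> B" "\<And>s. \<bar>kap' s\<bar> \<le> B"
proof -
 obtain B2 where B2: "B2 > 0" "\<And>s. norm (g2 s) \<le> B2" using periodic_bounded[OF cont2 per2] by blast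
 obtain B3 where B3: "B3 > 0" "\<And>s. norm (g3 s) \<le> B3" using periodic_bounded[OF cont3 per3] by blast
 define B where "B = max 1 (max B2 B3)"
 have b: "norm (g2 s) \<le> B" "norm (g3 s) \<le> B" for s
  using B2(2)[of s] B3(2)[of s] by (auto simp: B_def)
 have k: "\<bar>kap s\<bar> \<le> B" for s
  unfolding kap_def using order_trans[OF abs_Im_le_cmod[of "cnj (g1 s) * g2 s"]] b by (simp add: norm_mult unit)
 have k': "\<bar>kap' s\<bar> \<le> B" for s
  unfolding kap'_def using order_trans[OF abs_Im_le_cmod[of "cnj (g1 s) * g3 s"]] b by (simp add: norm_mult unit)
 show ?thesis by (rule that[OF _ b k k']) (simp add: B_def)
qed

text \<open>Close to the diagonal the tangent barely turns and the chord is at least half the arc;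
  away from it injectivity and compactness give a positive minimum.\<close>

lemma chord_lower: obtains c where "c > 0" "\<And>s t. \<bar>t - s\<bar> \<le> L / 2 ==> c * \<bar>t - s\<bar> \<le> norm (\<gamma> t - \<gamma> s)"
proof -
 obtain B where B: "B \<ge> 1" "\<And>s. norm (g2 s) \<le> B" using bounds by metis
 have g1L: "norm (g1 x - g1 s) \<le> B * \<bar>x - s\<bar>" for x s
  using vector_mean_value_bound[of s x g1 g2 0 B] d2 B by auto
 have near: "1/2 * \<bar>t - s\<bar> \<le> norm (\<gamma> t - \<gamma> s)" if "\<bar>t - s\<bar> \<le> 1 / (2 * B)" for s t
 proof -
  have "norm (g1 x - g1 s) \<le> 1/2" if x: "x \<in> closed_segment s t" for x
  proof -
   have "\<bar>x - s\<bar> \<le> 1 / (2 * B)"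
    using x \<open>\<bar>t - s\<bar> \<le> 1 / (2 * B)\<close> by (auto simp: closed_segment_eq_real_ivl split: if_splits)
   then have "B * \<bar>x - s\<bar> \<le> B * (1 / (2 * B))" using B by (intro mult_left_mono) auto
   then show ?thesis using g1L[of x s] B by simp
  qed
  then have "norm (\<gamma> t - \<gamma> s - (t - s) *\<^sub>R g1 s) \<le> 1/2 * \<bar>t - s\<bar>"
   by (intro vector_mean_value_bound[where f' = g1]) (rule d1)
  moreover have "norm ((t - s) *\<^sub>R g1 s) = \<bar>t - s\<bar>" by (simp add: unit)
  moreover have "norm ((t - s) *\<^sub>R g1 s) - norm (\<gamma> t - \<gamma> s) \<le> norm (\<gamma> t - \<gamma> s - (t - s) *\<^sub>R g1 s)"
   using norm_triangle_ineq2[of "(t - s) *\<^sub>R g1 s" "\<gamma> t - \<gamma> s"] by (metis norm_minus_commute)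
  moreover have "1/2 * y \<le> w" if "x \<le> 1/2 * y" "z = y" "z - w \<le> x" for x y z w :: real
   using that by linarith
  ultimately show ?thesis by blast
 qed
 define et where "et = 1 / (2 * B)"
 have et: "et > 0" using B by (simp add: et_def)
 \<comment> \<open>Offsets are limited to half a period, so the only offset that is a multiple of
   \<open>L\<close> is 0, and that one is excluded.\<close>
 define K where "K = {p \<in> {0..L} \<times> {- L/2..L/2}. et \<le> \<bar>snd p\<bar>}"
 have cK: "compact K"
 proof -
  have "K = ({0..L} \<times> {- L/2..L/2}) \<inter> {p. et \<le> \<bar>snd p\<bar>}" by (auto simp: K_def)
  moreover have "closed {p :: real \<times> real. et \<le> \<bar>snd p\<bar>}" by (intro closed_Collect_le continuous_intros)
  ultimately show ?thesis by (simp add: compact_Times compact_Int_closed)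
 qed
 have contK: "continuous_on K (%p. norm (\<gamma> (fst p + snd p) - \<gamma> (fst p)))"
 proof -
  have "continuous_on K (%p. \<gamma> (fst p + snd p))" "continuous_on K (%p. \<gamma> (fst p))"
   by (rule continuous_on_compose2[OF cont0[of UNIV] _ subset_UNIV], intro continuous_intros)+
  then show ?thesis by (intro continuous_intros)
 qed
 have "\<exists>m>0. \<forall>p\<in>K. m \<le> norm (\<gamma> (fst p + snd p) - \<gamma> (fst p))"
 proof (cases "K = {}")
  case False
  obtain p where p: "p \<in> K" "\<And>q. q \<in> K ==> norm (\<gamma> (fst p + snd p) - \<gamma> (fst p)) \<le> norm (\<gamma> (fst q + snd q) - \<gamma> (fst q))"
   using continuous_attains_inf[OF cK False contK] by blast
  have "\<gamma> (fst p + snd p) \<noteq> \<gamma> (fst p)"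
  proof
   assume "\<gamma> (fst p + snd p) = \<gamma> (fst p)"
   then obtain n :: int where n: "fst p = fst p + snd p + of_int n * L" using \<gamma>_eqD by metis
   then have sn: "snd p = - of_int n * L" by simp
   have "\<bar>snd p\<bar> \<ge> et" "\<bar>snd p\<bar> \<le> L / 2" using p(1) by (auto simp: K_def abs_le_iff)
   then have "\<bar>of_int n :: real\<bar> * L \<le> L / 2" "n \<noteq> 0" using et L sn by (auto simp: abs_mult)
   then have "\<bar>of_int n :: real\<bar> \<le> 1/2" "1 \<le> \<bar>n\<bar>" using L by (auto simp: field_simps)
   then show False by linarith
  qed
  then show ?thesis using p(2) by (intro exI[of _ "norm (\<gamma> (fst p + snd p) - \<gamma> (fst p))"]) auto
 qed (auto intro: exI[of _ 1])
 then obtain m where m: "m > 0" "\<And>p. p \<in> K ==> m \<le> norm (\<gamma> (fst p + snd p) - \<gamma> (fst p))" by blast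
 define c where "c = min (1/2) (2 * m / L)"
 have "c * \<bar>t - s\<bar> \<le> norm (\<gamma> t - \<gamma> s)" if st: "\<bar>t - s\<bar> \<le> L / 2" for s t
 proof (cases "\<bar>t - s\<bar> \<le> et")
  case True
  then have "1/2 * \<bar>t - s\<bar> \<le> norm (\<gamma> t - \<gamma> s)" using near et_def by simp
  moreover have "c * \<bar>t - s\<bar> \<le> 1/2 * \<bar>t - s\<bar>" by (intro mult_right_mono) (auto simp: c_def)
  ultimately show ?thesis by linarith
 next
  case False
  define n where "n = - \<lfloor>s / L\<rfloor>"
  have "s + of_int n * L \<in> {0..L}"
   unfolding n_def using L floor_divide_lower[OF L, of s] floor_divide_upper[OF L, of s] by (simp add: algebra_simps)
  moreover have "- (L / 2) \<le> t - s" "t - s \<le> L / 2" using st by linarith+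
  ultimately have "(s + of_int n * L, t - s) \<in> K" using False by (simp add: K_def)
  then have "m \<le> norm (\<gamma> (s + of_int n * L + (t - s)) - \<gamma> (s + of_int n * L))" using m(2) by fastforce
  then have "m \<le> norm (\<gamma> t - \<gamma> s)" using shift(1)[of t n] shift(1)[of s n] by (simp add: algebra_simps)
  moreover have "c * \<bar>t - s\<bar> \<le> (2 * m / L) * (L / 2)" using st m L by (intro mult_mono) (auto simp: c_def)
  ultimately show ?thesis using L by simp
 qed
 then show ?thesis using that[of c] m L by (auto simp: c_def)
qed

lemma near_param:
 obtains A where "A > 0" "\<And>s z. z \<in> curve ==> \<exists>t. z = \<gamma> t \<and> \<bar>t - s\<bar> \<le> A * norm (z - \<gamma> s) \<and> \<bar>t - s\<bar> \<le> L / 2"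
proof -
 obtain c where c: "c > 0" "\<And>s t. \<bar>t - s\<bar> \<le> L / 2 ==> c * \<bar>t - s\<bar> \<le> norm (\<gamma> t - \<gamma> s)" using chord_lower by blast
 have "\<exists>t. z = \<gamma> t \<and> \<bar>t - s\<bar> \<le> 1 / c * norm (z - \<gamma> s) \<and> \<bar>t - s\<bar> \<le> L / 2" if zc: "z \<in> curve" for s z
 proof -
  obtain t where t: "z = \<gamma> t" using zc by auto
  obtain n where n: "\<bar>t + of_int n * L - s\<bar> \<le> L / 2" using periodic_reduce[OF L] by blast
  have "\<bar>t + of_int n * L - s\<bar> \<le> 1 / c * norm (z - \<gamma> s)"
   using c(2)[OF n, unfolded shift] c(1) by (simp add: t field_simps)
  then show ?thesis using n t by (intro exI[of _ "t + of_int n * L"]) (simp add: shift)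
 qed
 then show ?thesis using that[of "1 / c"] c by auto
qed

text \<open>The curve leaves its tangent only to second order, and the tangent is a Lipschitz
  function of the point itself, not only of the parameter. The second fact makes the curve the
  solution of a uniquely solvable equation.\<close>

lemma normal_chord:
 obtains K where "K > 0" "\<And>s z. z \<in> curve ==> \<bar>Re (cnj (\<i> * g1 s) * (z - \<gamma> s))\<bar> \<le> K * (norm (z - \<gamma> s))\<^sup>2"
  "\<And>s t. norm (g1 t - g1 s) \<le> K * norm (\<gamma> t - \<gamma> s)"
proof -
 obtain B where B: "B \<ge> 1" "\<And>s. norm (g2 s) \<le> B" using bounds by metis
 have g1L: "norm (g1 x - g1 s) \<le> B * \<bar>x - s\<bar>" for x s
  using vector_mean_value_bound[of s x g1 g2 0 B] d2 B by auto
 obtain A where A: "A > 0" "\<And>s z. z \<in> curve ==> \<exists>t. z = \<gamma> t \<and> \<bar>t - s\<bar> \<le> A * norm (z - \<gamma> s) \<and> \<bar>t - s\<bar> \<le> L / 2"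
  using near_param by blast
 have 1: "\<bar>Re (cnj (\<i> * g1 s) * (z - \<gamma> s))\<bar> \<le> B * A\<^sup>2 * (norm (z - \<gamma> s))\<^sup>2" if z: "z \<in> curve" for s z
 proof -
  obtain t where t: "z = \<gamma> t" "\<bar>t - s\<bar> \<le> A * norm (z - \<gamma> s)" using A(2)[OF z, of s] by blast
  have "norm (g1 x - g1 s) \<le> B * \<bar>t - s\<bar>" if x: "x \<in> closed_segment s t" for x
  proof -
   have "\<bar>x - s\<bar> \<le> \<bar>t - s\<bar>" using x by (auto simp: closed_segment_eq_real_ivl split: if_splits)
   then have "B * \<bar>x - s\<bar> \<le> B * \<bar>t - s\<bar>" using B by (intro mult_left_mono) auto
   then show ?thesis using g1L[of x s] by simp
  qed
  then have T: "norm (\<gamma> t - \<gamma> s - (t - s) *\<^sub>R g1 s) \<le> B * \<bar>t - s\<bar> * \<bar>t - s\<bar>"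
   by (intro vector_mean_value_bound[where f' = g1]) (rule d1)
  have "Re (cnj (\<i> * g1 s) * (z - \<gamma> s)) = Re (cnj (\<i> * g1 s) * (\<gamma> t - \<gamma> s - (t - s) *\<^sub>R g1 s))"
   by (simp add: t scaleR_conv_of_real algebra_simps)
  also have "\<bar>\<dots>\<bar> \<le> norm (cnj (\<i> * g1 s) * (\<gamma> t - \<gamma> s - (t - s) *\<^sub>R g1 s))" by (rule abs_Re_le_cmod)
  also have "\<dots> \<le> B * \<bar>t - s\<bar> * \<bar>t - s\<bar>" using T by (simp add: norm_mult unit)
  also have "\<dots> \<le> B * (A * norm (z - \<gamma> s)) * (A * norm (z - \<gamma> s))"
   using t(2) B A by (intro mult_mono) auto
  finally show ?thesis by (simp add: power2_eq_square mult_ac)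
 qed
 have 2: "norm (g1 t - g1 s) \<le> B * A * norm (\<gamma> t - \<gamma> s)" for s t
 proof -
  obtain t' where t': "\<gamma> t = \<gamma> t'" "\<bar>t' - s\<bar> \<le> A * norm (\<gamma> t - \<gamma> s)" using A(2)[of "\<gamma> t" s] by blast
  have "norm (g1 t - g1 s) = norm (g1 t' - g1 s)" using frame_eq[OF t'(1)] by simp
  also have "\<dots> \<le> B * \<bar>t' - s\<bar>" by (rule g1L)
  also have "\<dots> \<le> B * (A * norm (\<gamma> t - \<gamma> s))" using t'(2) B by (intro mult_left_mono) auto
  finally show ?thesis by (simp add: mult_ac)
 qed
 define K where "K = B * A\<^sup>2 + B * A"
 have "B * A\<^sup>2 \<ge> 0" "B * A > 0" using A B by auto
 then have K: "K > 0" "B * A\<^sup>2 \<le> K" "B * A \<le> K" by (auto simp: K_def)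
 show ?thesis
 proof (rule that[OF K(1)])
  show "\<bar>Re (cnj (\<i> * g1 s) * (z - \<gamma> s))\<bar> \<le> K * (norm (z - \<gamma> s))\<^sup>2" if z: "z \<in> curve" for s z
   using order_trans[OF 1[OF z] mult_right_mono[OF K(2)]] by simp
  show "norm (g1 t - g1 s) \<le> K * norm (\<gamma> t - \<gamma> s)" for s t
   using order_trans[OF 2 mult_right_mono[OF K(3)]] by simp
 qed
qed

text \<open>Uniform tangent discs on both sides. Expanding the squared distance to the centre, the
  mixed term is at most half of \<open>|z - \<gamma> s|^2\<close> once \<open>|x|\<close> is at most
  \<open>1 / (4 * K)\<close>.\<close>

lemma tangent_balls:
 obtains r0 where "r0 > 0"
  "\<And>s z x. z \<in> curve ==> \<bar>x\<bar> \<le> r0 ==> \<bar>x\<bar> \<le> norm (z - (\<gamma> s + \<i> * of_real x * g1 s))"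
  "\<And>s z x. z \<in> curve ==> \<bar>x\<bar> \<le> r0 ==> norm (z - (\<gamma> s + \<i> * of_real x * g1 s)) \<le> \<bar>x\<bar> ==> z = \<gamma> s"
proof -
 obtain K where K: "K > 0" "\<And>s z. z \<in> curve ==> \<bar>Re (cnj (\<i> * g1 s) * (z - \<gamma> s))\<bar> \<le> K * (norm (z - \<gamma> s))\<^sup>2"
  using normal_chord by metis
 have main: "(norm (z - (\<gamma> s + \<i> * of_real x * g1 s)))\<^sup>2 \<ge> x\<^sup>2 + (norm (z - \<gamma> s))\<^sup>2 / 2" if z: "z \<in> curve" and x: "\<bar>x\<bar> \<le> 1 / (4 * K)" for s z x
 proof -
  define w where "w = z - \<gamma> s"
  have u: "Re (g1 s) * Re (g1 s) + Im (g1 s) * Im (g1 s) = 1" using unit[of s] by (simp add: cmod_def power2_eq_square)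
  have "(norm (w - \<i> * of_real x * g1 s))\<^sup>2 = (norm w)\<^sup>2 + x\<^sup>2 * (Re (g1 s) * Re (g1 s) + Im (g1 s) * Im (g1 s)) - 2 * x * Re (cnj (\<i> * g1 s) * w)"
   unfolding cmod_power2 by (simp add: power2_eq_square algebra_simps)
  moreover have "z - (\<gamma> s + \<i> * of_real x * g1 s) = w - \<i> * of_real x * g1 s" by (simp add: w_def)
  ultimately have e: "(norm (z - (\<gamma> s + \<i> * of_real x * g1 s)))\<^sup>2 = (norm w)\<^sup>2 + x\<^sup>2 - 2 * x * Re (cnj (\<i> * g1 s) * w)"
   unfolding u by (simp only: mult_1_right)
  have "2 * x * Re (cnj (\<i> * g1 s) * w) \<le> 2 * \<bar>x\<bar> * \<bar>Re (cnj (\<i> * g1 s) * w)\<bar>"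
   by (metis abs_ge_self abs_mult abs_numeral)
  also have "\<dots> \<le> 2 * (1 / (4 * K)) * (K * (norm w)\<^sup>2)"
   using x K(2)[OF z, of s] K(1) by (intro mult_mono) (auto simp: w_def)
  also have "\<dots> = (norm w)\<^sup>2 / 2" using K(1) by simp
  finally show ?thesis using e by (simp add: w_def)
 qed
 show ?thesis
 proof (rule that[of "1 / (4 * K)"])
  show "1 / (4 * K) > 0" using K by simp
  fix s z x assume z: "z \<in> curve" and x: "\<bar>x\<bar> \<le> 1 / (4 * K)"
  have "x\<^sup>2 \<le> (norm (z - (\<gamma> s + \<i> * of_real x * g1 s)))\<^sup>2"
   using main[OF z x, of s] zero_le_power2[of "norm (z - \<gamma> s)"] by linarith
  then show "\<bar>x\<bar> \<le> norm (z - (\<gamma> s + \<i> * of_real x * g1 s))"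
   using abs_le_square_iff[of x "norm (z - (\<gamma> s + \<i> * of_real x * g1 s))"] by simp
  assume "norm (z - (\<gamma> s + \<i> * of_real x * g1 s)) \<le> \<bar>x\<bar>"
  then have "(norm (z - (\<gamma> s + \<i> * of_real x * g1 s)))\<^sup>2 \<le> x\<^sup>2"
   using power_mono[of "norm (z - (\<gamma> s + \<i> * of_real x * g1 s))" "\<bar>x\<bar>" 2] by simp
  then have "(norm (z - \<gamma> s))\<^sup>2 / 2 \<le> 0" using main[OF z x, of s] by linarith
  then show "z = \<gamma> s" by simp
 qed
qed

text \<open>At a nearest point of the curve the connecting vector is orthogonal to the tangent. The
  sign of \<open>x\<close>, that is the side of the curve, stays open here.\<close>

lemma nearest_point:
 obtains s x where "z = \<gamma> s + \<i> * of_real x * g1 s" "\<bar>x\<bar> = infdist z curve"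
proof -
 obtain y where y: "y \<in> curve" "infdist z curve = dist z y"
  using infdist_attains_inf[of curve z] compact_curve compact_imp_closed by auto
 then obtain s where s: "y = \<gamma> s" by auto
 define F where "F t = (norm (z - \<gamma> t))\<^sup>2" for t
 have "((%t. (z - \<gamma> t) \<bullet> (z - \<gamma> t)) has_derivative (%h. (z - \<gamma> s) \<bullet> (- (h *\<^sub>R g1 s)) + (- (h *\<^sub>R g1 s)) \<bullet> (z - \<gamma> s))) (at s)"
  using d1[of s] unfolding has_vector_derivative_def by (auto intro!: derivative_eq_intros)
 then have Fd: "(F has_real_derivative - 2 * ((z - \<gamma> s) \<bullet> g1 s)) (at s)"
  unfolding F_def has_field_derivative_def dot_square_norm[symmetric]
  by (rule has_derivative_eq_rhs) (auto simp: inner_commute)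
 have "F s \<le> F t" for t
  unfolding F_def using y s infdist_le[of "\<gamma> t" curve z] by (intro power_mono) (auto simp: dist_norm)
 then have "- 2 * ((z - \<gamma> s) \<bullet> g1 s) = 0"
  using DERIV_local_min[OF Fd, of 1] by auto
 then have 0: "(z - \<gamma> s) \<bullet> g1 s = 0" by simp
 define w where "w = cnj (g1 s) * (z - \<gamma> s)"
 have "Re w = 0" using 0 by (simp add: w_def inner_complex_def algebra_simps)
 then have wi: "w = \<i> * of_real (Im w)" by (simp add: complex_eq_iff)
 have "g1 s * w = z - \<gamma> s"
  unfolding w_def using unit[of s] by (simp add: mult.assoc[symmetric] complex_norm_square[symmetric])
 then have zs: "z = \<gamma> s + \<i> * of_real (Im w) * g1 s" using wi by (metis add.commute diff_add_cancel mult.commute)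
 moreover have "\<bar>Im w\<bar> = infdist z curve"
 proof -
  have "dist z y = norm (\<i> * of_real (Im w) * g1 s)" by (subst zs) (simp add: dist_norm s)
  then show ?thesis using y(2) by (simp add: norm_mult unit)
 qed
 ultimately show ?thesis using that by blast
qed

end

context arclength_curve
begin

lemma kap'_props: "continuous_on UNIV kap'" "kap' (s + L) = kap' s"
 unfolding kap'_def[abs_def]
 by (intro continuous_intros cont1 cont3) (simp add: per1 per3)

lemma kap_continuous: "continuous_on UNIV kap"
 unfolding kap_def[abs_def] by (intro continuous_intros cont1 cont2)

text \<open>Uniform continuity of \<open>g3\<close> and \<open>kap'\<close> over a period gives
  remainders that are uniformly small, and integrating once or twice more raises the order.\<close>

lemma taylor:
 assumes e: "e > 0"
 obtains d where "d > 0"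
  "\<And>s si. \<bar>si\<bar> \<le> d ==> norm (\<gamma> (s + si) - \<gamma> s - of_real si * g1 s - of_real si ^ 2 / 2 * g2 s - of_real si ^ 3 / 6 * g3 s) \<le> e * \<bar>si\<bar> ^ 3"
  "\<And>s si. \<bar>si\<bar> \<le> d ==> norm (g1 (s + si) - g1 s - of_real si * g2 s - of_real si ^ 2 / 2 * g3 s) \<le> e * \<bar>si\<bar> ^ 2"
  "\<And>s si. \<bar>si\<bar> \<le> d ==> \<bar>kap (s + si) - kap s - si * kap' s\<bar> \<le> e * \<bar>si\<bar>"
proof -
 obtain d1' where d1': "d1' > 0" "\<And>s t. \<bar>s - t\<bar> < d1' ==> dist (g3 s) (g3 t) < e"
  using periodic_uniformly_continuous[OF cont3 per3 e] by blast
 obtain d2' where d2': "d2' > 0" "\<And>s t. \<bar>s - t\<bar> < d2' ==> dist (kap' s) (kap' t) < e"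
  using periodic_uniformly_continuous[OF kap'_props e] by blast
 define d where "d = min d1' d2' / 2"
 have d: "d > 0" "d < d1'" "d < d2'" using d1' d2' by (auto simp: d_def)
 have seg: "\<bar>x - s\<bar> \<le> \<bar>si\<bar>" if "x \<in> closed_segment s (s + si)" for x s si :: real
  using that by (auto simp: closed_segment_eq_real_ivl split: if_splits)
 have T2: "norm (g2 (s + si) - g2 s - of_real si * g3 s) \<le> e * \<bar>si\<bar>" if si: "\<bar>si\<bar> \<le> d" for s si
 proof -
  have "norm (g3 x - g3 s) \<le> e" if "x \<in> closed_segment s (s + si)" for x
  proof -
   have "\<bar>x - s\<bar> < d1'" using seg[OF that] si d by linarith
   then show ?thesis using d1'(2)[of x s] by (simp add: dist_norm)
  qed
  then have "norm (g2 (s + si) - g2 s - (s + si - s) *\<^sub>R g3 s) \<le> e * \<bar>s + si - s\<bar>"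
   by (intro vector_mean_value_bound[where f' = g3]) (rule d3)
  then show ?thesis by (simp add: scaleR_conv_of_real)
 qed
 have T1: "norm (g1 (s + si) - g1 s - of_real si * g2 s - of_real si ^ 2 / 2 * g3 s) \<le> e * \<bar>si\<bar> ^ 2" if si: "\<bar>si\<bar> \<le> d" for s si
 proof -
  define F where "F x = g1 x - of_real (x - s) * g2 s - of_real (x - s) ^ 2 / 2 * g3 s" for x
  have dF: "(F has_vector_derivative (g2 x - g2 s - of_real (x - s) * g3 s)) (at x)" for x
  proof -
   have "((%x. of_real (x - s) * g2 s) has_vector_derivative g2 s) (at x)"
    by (auto intro!: derivative_eq_intros)
   moreover have "((%x. of_real (x - s) ^ 2 / 2 * g3 s) has_vector_derivative of_real (x - s) * g3 s) (at x)"
   proof -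
    have "((%x. (x - s) ^ 2 / 2) has_real_derivative (x - s)) (at x)" by (auto intro!: derivative_eq_intros)
    from has_vector_derivative_mult_left[OF has_vector_derivative_of_real[OF this], of "g3 s"]
    show ?thesis by simp
   qed
   ultimately show ?thesis unfolding F_def by (intro has_vector_derivative_diff d2)
  qed
  have "norm ((g2 x - g2 s - of_real (x - s) * g3 s) - 0) \<le> e * \<bar>si\<bar>" if x: "x \<in> closed_segment s (s + si)" for x
  proof -
   have "norm (g2 (s + (x - s)) - g2 s - of_real (x - s) * g3 s) \<le> e * \<bar>x - s\<bar>"
    using seg[OF x] si by (intro T2) auto
   also have "\<dots> \<le> e * \<bar>si\<bar>" using seg[OF x] e by simp
   finally show ?thesis by simp
  qed
  then have "norm (F (s + si) - F s - (s + si - s) *\<^sub>R 0) \<le> e * \<bar>si\<bar> * \<bar>s + si - s\<bar>"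
   by (intro vector_mean_value_bound) (rule dF)
  then show ?thesis by (simp add: F_def power2_eq_square algebra_simps)
 qed
 have T0: "norm (\<gamma> (s + si) - \<gamma> s - of_real si * g1 s - of_real si ^ 2 / 2 * g2 s - of_real si ^ 3 / 6 * g3 s) \<le> e * \<bar>si\<bar> ^ 3" if si: "\<bar>si\<bar> \<le> d" for s si
 proof -
  define F where "F x = \<gamma> x - of_real (x - s) * g1 s - of_real (x - s) ^ 2 / 2 * g2 s - of_real (x - s) ^ 3 / 6 * g3 s" for x
  have dF: "(F has_vector_derivative (g1 x - g1 s - of_real (x - s) * g2 s - of_real (x - s) ^ 2 / 2 * g3 s)) (at x)" for x
  proof -
   have "((%x. of_real (x - s) * g1 s) has_vector_derivative g1 s) (at x)"
    by (auto intro!: derivative_eq_intros)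
   moreover have "((%x. of_real (x - s) ^ 2 / 2 * g2 s) has_vector_derivative of_real (x - s) * g2 s) (at x)"
   proof -
    have "((%x. (x - s) ^ 2 / 2) has_real_derivative (x - s)) (at x)" by (auto intro!: derivative_eq_intros)
    from has_vector_derivative_mult_left[OF has_vector_derivative_of_real[OF this], of "g2 s"]
    show ?thesis by simp
   qed
   moreover have "((%x. of_real (x - s) ^ 3 / 6 * g3 s) has_vector_derivative of_real (x - s) ^ 2 / 2 * g3 s) (at x)"
   proof -
    have "((%x. (x - s) ^ 3 / 6) has_real_derivative (x - s) ^ 2 / 2) (at x)" by (auto intro!: derivative_eq_intros)
    from has_vector_derivative_mult_left[OF has_vector_derivative_of_real[OF this], of "g3 s"]
    show ?thesis by simp
   qed
   ultimately show ?thesis unfolding F_def by (intro has_vector_derivative_diff d1)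
  qed
  have "norm ((g1 x - g1 s - of_real (x - s) * g2 s - of_real (x - s) ^ 2 / 2 * g3 s) - 0) \<le> e * \<bar>si\<bar> ^ 2" if x: "x \<in> closed_segment s (s + si)" for x
  proof -
   have "norm (g1 (s + (x - s)) - g1 s - of_real (x - s) * g2 s - of_real (x - s) ^ 2 / 2 * g3 s) \<le> e * \<bar>x - s\<bar> ^ 2"
    using seg[OF x] si by (intro T1) auto
   also have "\<dots> \<le> e * \<bar>si\<bar> ^ 2" using power_mono[OF seg[OF x], of 2] e by simp
   finally show ?thesis by simp
  qed
  then have "norm (F (s + si) - F s - (s + si - s) *\<^sub>R 0) \<le> e * \<bar>si\<bar> ^ 2 * \<bar>s + si - s\<bar>"
   by (intro vector_mean_value_bound) (rule dF)
  then show ?thesis by (simp add: F_def power2_eq_square power3_eq_cube algebra_simps)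
 qed
 have K: "\<bar>kap (s + si) - kap s - si * kap' s\<bar> \<le> e * \<bar>si\<bar>" if si: "\<bar>si\<bar> \<le> d" for s si
 proof -
  have "norm (kap' x - kap' s) \<le> e" if "x \<in> closed_segment s (s + si)" for x
  proof -
   have "\<bar>x - s\<bar> < d2'" using seg[OF that] si d by linarith
   then show ?thesis using d2'(2)[of x s] by (simp add: dist_norm)
  qed
  then have "norm (kap (s + si) - kap s - (s + si - s) *\<^sub>R kap' s) \<le> e * \<bar>s + si - s\<bar>"
   by (intro vector_mean_value_bound[where f' = kap']) (rule kap_deriv)
  then show ?thesis by simp
 qed
 show ?thesis by (rule that[OF d(1) T0 T1 K])
qed

text \<open>Three errors are combined at scale \<open>h\<close>: the curve differs from its cubic
  Taylor polynomial by o(h^3), \<open>vv\<close> differs from its expansion by o(h^3), and the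
  polynomial defect is O(h^4). The base point \<open>s0\<close> and the foot point \<open>s\<close>
  are distinct, since a whole disc of points has to be compared with one model map.\<close>

lemma boundary_expansion_model:
 fixes cc :: "real \<Rightarrow> real" and vv :: "real \<Rightarrow> real \<Rightarrow> real"
 assumes cc: "continuous_on UNIV cc" "\<And>s. cc (s + L) = cc s"
  and vv: "\<And>e. e > 0 ==> \<exists>d>0. \<forall>s x. 0 < x \<longrightarrow> x \<le> d \<longrightarrow> \<bar>vv s x - (x - kap s * x\<^sup>2 / 2 + cc s * x ^ 3)\<bar> \<le> e * x ^ 3"
  and ep: "ep > 0"
 obtains d where "d > 0" "\<And>s0 s x h. 0 < h ==> h \<le> d ==> \<bar>s - s0\<bar> \<le> h ==> 0 < x ==> x \<le> h ==>
   \<bar>vv s x * norm (model_deriv (kap s0) (kap' s0) (cc s0) ((\<gamma> s + \<i> * of_real x * g1 s - \<gamma> s0) / g1 s0))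
    - Im (model_map (kap s0) (kap' s0) (cc s0) ((\<gamma> s + \<i> * of_real x * g1 s - \<gamma> s0) / g1 s0))\<bar> \<le> ep * h ^ 3"
proof -
 note \<gamma>_deriv = d1
 obtain B1 where B1: "B1 \<ge> 1" "\<And>s. \<bar>kap s\<bar> \<le> B1" "\<And>s. \<bar>kap' s\<bar> \<le> B1" using bounds by metis
 obtain B2 where B2: "B2 > 0" "\<And>s. norm (cc s) \<le> B2" using periodic_bounded[OF cc] by blast
 define B where "B = max B1 B2"
 have B: "B \<ge> 1" "\<bar>kap s\<bar> \<le> B" "\<bar>kap' s\<bar> \<le> B" "\<bar>cc s\<bar> \<le> B" for s
  using B1(1) B1(2)[of s] B1(3)[of s] B2(2)[of s] by (auto simp: B_def)
 obtain C h0 where C: "C > 0" "h0 > 0" "h0 \<le> 1"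
  "\<And>ka ka' c si x h. \<bar>ka\<bar> \<le> B ==> \<bar>ka'\<bar> \<le> B ==> \<bar>c\<bar> \<le> B ==> \<bar>si\<bar> \<le> h ==> 0 \<le> x ==> x \<le> h ==> 0 < h ==> h \<le> h0 ==>
   \<bar>(x - (ka + ka' * si) * x\<^sup>2 / 2 + c * x ^ 3) *
    norm (model_deriv ka ka' c (Complex si x + (\<i> * of_real ka * of_real si ^ 2 / 2 - of_real (ka * si * x))
     + (\<i> * of_real ka' - of_real ka ^ 2) * (of_real si ^ 3 / 6 + \<i> * of_real si ^ 2 * of_real x / 2)))
    - Im (model_map ka ka' c (Complex si x + (\<i> * of_real ka * of_real si ^ 2 / 2 - of_real (ka * si * x))
     + (\<i> * of_real ka' - of_real ka ^ 2) * (of_real si ^ 3 / 6 + \<i> * of_real si ^ 2 * of_real x / 2)))\<bar> \<le> C * h ^ 4"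
  using model_defect_bound[of B] by blast
 define P where "P = B + B\<^sup>2"
 have P: "norm (model_coeff (kap s) (kap' s) (cc s)) \<le> P" for s
 proof -
  have "norm (model_coeff (kap s) (kap' s) (cc s)) \<le> \<bar>cc s / 2 - (kap s)\<^sup>2 / 4\<bar> + \<bar>kap' s / 6\<bar>"
   unfolding model_coeff_def using norm_triangle_ineq4[of "of_real (cc s / 2 - (kap s)\<^sup>2 / 4)" "\<i> * of_real (kap' s / 6)"]
   by (simp add: norm_mult norm_of_real del: of_real_diff of_real_divide)
  also have "\<dots> \<le> (\<bar>cc s\<bar> / 2 + (kap s)\<^sup>2 / 4) + \<bar>kap' s\<bar> / 6"
   using abs_triangle_ineq4[of "cc s / 2" "(kap s)\<^sup>2 / 4"] by simp
  also have "\<dots> \<le> (B / 2 + B\<^sup>2 / 4) + B / 6"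
   using B(2-4)[of s] power_mono[of "\<bar>kap s\<bar>" B 2] by (intro add_mono divide_right_mono) auto
  also have "\<dots> \<le> P" using B(1) zero_le_power2[of B] unfolding P_def by linarith
  finally show ?thesis .
 qed
 have P0: "P \<ge> 0" using B(1) by (simp add: P_def)
 \<comment> \<open>Bounds the model derivative and the difference quotients of the model map on the
   unit disc.\<close>
 define D where "D = 1 + B + 3 * P"
 define E0 where "E0 = 5 * D + (1 + 2 * B) * (B + 6 * P) * 2"
 have D: "D \<ge> 1" using B(1) P0 by (simp add: D_def)
 have E0: "E0 \<ge> 1" using D B(1) P0 by (simp add: E0_def add_increasing2)
 define e where "e = min 1 (ep / (E0 + C))"
 have EC: "E0 + C > 0" using E0 C(1) by simp
 then have "e \<le> ep / (E0 + C)" by (simp add: e_def)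
 then have "(E0 + C) * e \<le> ep" using EC by (simp add: pos_le_divide_eq mult.commute)
 then have e: "e > 0" "e \<le> 1" "(E0 + C) * e \<le> ep" using EC ep by (auto simp: e_def)
 obtain d1 where d1: "d1 > 0"
  "\<And>s si. \<bar>si\<bar> \<le> d1 ==> norm (\<gamma> (s + si) - \<gamma> s - of_real si * g1 s - of_real si ^ 2 / 2 * g2 s - of_real si ^ 3 / 6 * g3 s) \<le> e * \<bar>si\<bar> ^ 3"
  "\<And>s si. \<bar>si\<bar> \<le> d1 ==> norm (g1 (s + si) - g1 s - of_real si * g2 s - of_real si ^ 2 / 2 * g3 s) \<le> e * \<bar>si\<bar> ^ 2"
  "\<And>s si. \<bar>si\<bar> \<le> d1 ==> \<bar>kap (s + si) - kap s - si * kap' s\<bar> \<le> e * \<bar>si\<bar>"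
  using taylor[OF e(1)] by blast
 obtain d2 where d2: "d2 > 0" "\<And>s x. 0 < x ==> x \<le> d2 ==> \<bar>vv s x - (x - kap s * x\<^sup>2 / 2 + cc s * x ^ 3)\<bar> \<le> e * x ^ 3"
  using vv[OF e(1)] by blast
 obtain d3 where d3: "d3 > 0" "\<And>s t. \<bar>s - t\<bar> < d3 ==> dist (cc s) (cc t) < e"
  using periodic_uniformly_continuous[OF cc e(1)] by blast
 \<comment> \<open>The entry \<open>e\<close> turns the defect \<open>C * h ^ 4\<close> into
   \<open>C * e * h ^ 3\<close>; the entry 1/8 keeps both the true and the Taylor position in the
   unit disc.\<close>
 define d where "d = Min {d1, d2, d3 / 2, h0, e, 1/8}"
 have d: "d > 0" "d \<le> d1" "d \<le> d2" "d < d3" "d \<le> h0" "d \<le> e" "d \<le> 1/8"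
  using d1(1) d2(1) d3(1) C(2) e(1) by (auto simp: d_def min_less_iff_disj)
 show ?thesis
 proof (rule that[OF d(1)])
  fix s0 s x h assume as: "0 < h" "h \<le> d" "\<bar>s - s0\<bar> \<le> h" "0 < x" "x \<le> h"
  define si where "si = s - s0"
  have s: "s = s0 + si" and si: "\<bar>si\<bar> \<le> h" "\<bar>si\<bar> \<le> d1" using as d by (auto simp: si_def)
  have h1: "h \<le> 1" "h \<le> e" "h \<le> 1/8" "h \<le> h0" using as d by auto
  let ?k = "kap s0" and ?k' = "kap' s0" and ?c = "cc s0"
  let ?Q = "model_map ?k ?k' ?c" and ?D = "model_deriv ?k ?k' ?c"
  define et where "et = (\<gamma> s + \<i> * of_real x * g1 s - \<gamma> s0) / g1 s0"
  define et3 where "et3 = Complex si x + (\<i> * of_real ?k * of_real si ^ 2 / 2 - of_real (?k * si * x))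
     + (\<i> * of_real ?k' - of_real ?k ^ 2) * (of_real si ^ 3 / 6 + \<i> * of_real si ^ 2 * of_real x / 2)"
  define r where "r = et - et3"
  have g0: "g1 s0 \<noteq> 0" using unit[of s0] by auto
  define R0 where "R0 = \<gamma> (s0 + si) - \<gamma> s0 - of_real si * g1 s0 - of_real si ^ 2 / 2 * g2 s0 - of_real si ^ 3 / 6 * g3 s0"
  define R1 where "R1 = g1 (s0 + si) - g1 s0 - of_real si * g2 s0 - of_real si ^ 2 / 2 * g3 s0"
  have "\<gamma> s + \<i> * of_real x * g1 s - \<gamma> s0 = et3 * g1 s0 + (R0 + \<i> * of_real x * R1)"
  proof -
   have aux: "Ga + \<i> * x * G - Ga0 = (si + \<i> * x + (\<i> * k * si ^ 2 / 2 - k * si * x) + w * (si ^ 3 / 6 + \<i> * si ^ 2 * x / 2)) * e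
     + ((Ga - Ga0 - si * e - si ^ 2 / 2 * (\<i> * k * e) - si ^ 3 / 6 * (w * e)) + \<i> * x * (G - e - si * (\<i> * k * e) - si ^ 2 / 2 * (w * e)))"
    for Ga Ga0 G e x si k w :: complex
    using i_squared by algebra
   show ?thesis
    unfolding R0_def R1_def et3_def frame2[of s0] frame3[of s0] Complex_eq s[symmetric] of_real_mult by (rule aux)
  qed
  then have r_eq: "r = (R0 + \<i> * of_real x * R1) / g1 s0"
   unfolding r_def et_def using g0 by (simp add: field_simps)
  have r: "norm r \<le> 2 * e * h ^ 3"
  proof -
   have "norm R0 \<le> e * \<bar>si\<bar> ^ 3" unfolding R0_def by (rule d1(2)[OF si(2)])
   also have "\<dots> \<le> e * h ^ 3" using si e by (simp add: power_mono)
   finally have a: "norm R0 \<le> e * h ^ 3" .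
   have "norm R1 \<le> e * \<bar>si\<bar> ^ 2" unfolding R1_def by (rule d1(3)[OF si(2)])
   also have "\<dots> \<le> e * h ^ 2" using power_mono[OF si(1), of 2] e by simp
   finally have "x * norm R1 \<le> h * (e * h ^ 2)" using as by (intro mult_mono) auto
   then have b: "norm (\<i> * of_real x * R1) \<le> e * h ^ 3" using as by (simp add: norm_mult power2_eq_square power3_eq_cube mult_ac)
   have "norm r = norm (R0 + \<i> * of_real x * R1)" unfolding r_eq by (simp add: norm_divide unit)
   then show ?thesis using norm_triangle_ineq[of R0 "\<i> * of_real x * R1"] a b by linarith
  qed
  have rs: "norm r \<le> 1/2"
  proof -
   have "2 * e * h ^ 3 \<le> 2 * 1 * (1/8) ^ 3" using e h1 as by (intro mult_mono power_mono) auto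
   also have "\<dots> \<le> (1/2 :: real)" by (simp add: power3_eq_cube)
   finally show ?thesis using r by linarith
  qed
  have "norm et \<le> 1/2"
  proof -
   have "norm (\<gamma> s - \<gamma> s0 - (s - s0) *\<^sub>R 0) \<le> 1 * \<bar>s - s0\<bar>"
    by (intro vector_mean_value_bound[where f' = g1] \<gamma>_deriv) (simp add: unit)
   then have "norm (\<gamma> s - \<gamma> s0) \<le> h" using as by simp
   moreover have "norm (\<i> * of_real x * g1 s) \<le> h" using as by (simp add: norm_mult unit)
   ultimately have "norm (\<gamma> s + \<i> * of_real x * g1 s - \<gamma> s0) \<le> 2 * h"
    using norm_triangle_ineq[of "\<gamma> s - \<gamma> s0" "\<i> * of_real x * g1 s"] by (simp add: algebra_simps)
   then show ?thesis using h1 by (simp add: et_def norm_divide unit)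
  qed
  then have n1: "norm et \<le> 1" by simp
  have n3: "norm et3 \<le> 1" using \<open>norm et \<le> 1/2\<close> rs norm_triangle_ineq4[of et r] by (simp add: r_def)
  let ?p = "model_coeff ?k ?k' ?c"
  have nm: "norm (a * b) \<le> M * norm a" if "norm b \<le> M" for a b :: complex and M
   using mult_left_mono[OF that norm_ge_zero[of a]] by (simp add: norm_mult mult.commute)
  have DQ: "norm (?Q et - ?Q et3) \<le> D * norm r"
  proof -
   have "?Q et - ?Q et3 = r * (1 - \<i> * of_real ?k * (et + et3) / 2 + ?p * (et\<^sup>2 + et * et3 + et3\<^sup>2))"
    unfolding model_map_def r_def by (simp add: field_simps power2_eq_square power3_eq_cube)
   moreover have "norm (1 - \<i> * of_real ?k * (et + et3) / 2 + ?p * (et\<^sup>2 + et * et3 + et3\<^sup>2)) \<le> D"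
   proof -
    have "norm (\<i> * of_real ?k * (et + et3) / 2) \<le> B * 2 / 2"
     unfolding norm_mult norm_divide using B(2)[of s0] n1 n3 norm_triangle_ineq[of et et3]
     by (intro divide_mono mult_mono) auto
    moreover have "norm (?p * (et\<^sup>2 + et * et3 + et3\<^sup>2)) \<le> P * 3"
    proof -
     have "norm (et\<^sup>2) \<le> 1" "norm (et * et3) \<le> 1" "norm (et3\<^sup>2) \<le> 1"
      using n1 n3 by (auto simp: norm_mult norm_power power_le_one mult_le_one)
     then have "norm (et\<^sup>2 + et * et3 + et3\<^sup>2) \<le> 3"
      using norm_triangle_ineq[of "et\<^sup>2 + et * et3" "et3\<^sup>2"] norm_triangle_ineq[of "et\<^sup>2" "et * et3"] by linarith
     then show ?thesis unfolding norm_mult using P[of s0] P0 by (intro mult_mono) auto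
    qed
    ultimately show ?thesis
     using norm_triangle_ineq[of "1 - \<i> * of_real ?k * (et + et3) / 2" "?p * (et\<^sup>2 + et * et3 + et3\<^sup>2)"]
      norm_triangle_ineq4[of 1 "\<i> * of_real ?k * (et + et3) / 2"] by (simp add: D_def)
   qed
   ultimately show ?thesis by (simp only: nm)
  qed
  have DD: "norm (?D et - ?D et3) \<le> (B + 6 * P) * norm r"
  proof -
   have "?D et - ?D et3 = r * (- (\<i> * of_real ?k) + 3 * ?p * (et + et3))"
    unfolding model_deriv_def r_def by (simp add: algebra_simps power2_eq_square)
   moreover have "norm (- (\<i> * of_real ?k) + 3 * ?p * (et + et3)) \<le> B + 6 * P"
   proof -
    have "norm (3 * ?p * (et + et3)) \<le> 3 * P * 2"
     unfolding norm_mult using P[of s0] P0 n1 n3 norm_triangle_ineq[of et et3] by (intro mult_mono) auto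
    moreover have "norm (- (\<i> * of_real ?k)) \<le> B" using B(2)[of s0] by (simp add: norm_mult)
    ultimately show ?thesis using norm_triangle_ineq[of "- (\<i> * of_real ?k)" "3 * ?p * (et + et3)"]
     by linarith
   qed
   ultimately show ?thesis by (simp only: nm)
  qed
  have D1: "norm (?D et) \<le> D"
  proof -
   have "norm (\<i> * of_real ?k * et) \<le> B * 1" unfolding norm_mult using B(1) B(2)[of s0] n1 by (intro mult_mono) auto
   moreover have "norm (3 * ?p * et\<^sup>2) \<le> 3 * P * 1"
    unfolding norm_mult using P[of s0] P0 n1 by (intro mult_mono) (auto simp: norm_power power_le_one)
   ultimately show ?thesis unfolding model_deriv_def D_def
    using norm_triangle_ineq[of "1 - \<i> * of_real ?k * et" "3 * ?p * et\<^sup>2"] norm_triangle_ineq4[of 1 "\<i> * of_real ?k * et"] by simp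
  qed
  define v3 where "v3 = x - (?k + ?k' * si) * x\<^sup>2 / 2 + ?c * x ^ 3"
  have x3: "x ^ 3 \<le> h ^ 3" "x\<^sup>2 \<le> h\<^sup>2" using as by (auto simp: power_mono)
  have V: "\<bar>vv s x - v3\<bar> \<le> 3 * e * h ^ 3"
  proof -
   have a: "\<bar>vv s x - (x - kap s * x\<^sup>2 / 2 + cc s * x ^ 3)\<bar> \<le> e * h ^ 3"
    using d2(2)[of x s] as d mult_left_mono[OF x3(1), of e] e by linarith
   have b: "\<bar>(kap s - ?k - si * ?k') * x\<^sup>2 / 2\<bar> \<le> e * h ^ 3"
   proof -
    have "\<bar>kap s - ?k - si * ?k'\<bar> \<le> e * h"
     using d1(4)[OF si(2), of s0] si(1) e mult_left_mono[OF si(1), of e] unfolding s by linarith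
    then have "\<bar>kap s - ?k - si * ?k'\<bar> * x\<^sup>2 \<le> e * h * h\<^sup>2" using x3 e as by (intro mult_mono) auto
    moreover have "e * h * h\<^sup>2 = e * h ^ 3" by (simp add: power2_eq_square power3_eq_cube)
    moreover have "0 \<le> e * h ^ 3" using e as by simp
    ultimately show ?thesis by (simp add: abs_mult)
   qed
   have c: "\<bar>(cc s - ?c) * x ^ 3\<bar> \<le> e * h ^ 3"
   proof -
    have "\<bar>cc s - ?c\<bar> \<le> e" using d3(2)[of s s0] as d by (simp add: dist_real_def)
    then show ?thesis unfolding abs_mult using x3 as e by (intro mult_mono) auto
   qed
   have "vv s x - v3 = (vv s x - (x - kap s * x\<^sup>2 / 2 + cc s * x ^ 3)) - (kap s - ?k - si * ?k') * x\<^sup>2 / 2 + (cc s - ?c) * x ^ 3"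
    unfolding v3_def by (simp add: field_simps)
   then show ?thesis using a b c by linarith
  qed
  have v3b: "\<bar>v3\<bar> \<le> (1 + 2 * B) * h"
  proof -
   have "\<bar>(?k + ?k' * si) * x\<^sup>2 / 2\<bar> \<le> B * h"
   proof -
    have "\<bar>?k' * si\<bar> \<le> B * 1" unfolding abs_mult using B(3)[of s0] si h1 B(1) by (intro mult_mono) auto
    then have "\<bar>?k + ?k' * si\<bar> \<le> 2 * B" using B(2)[of s0] by linarith
    moreover have "x\<^sup>2 \<le> h"
    proof -
     have "h * h \<le> h * 1" using h1 as by (intro mult_left_mono) auto
     then show ?thesis using x3(2) by (simp add: power2_eq_square)
    qed
    ultimately have "\<bar>?k + ?k' * si\<bar> * x\<^sup>2 \<le> 2 * B * h" using B(1) by (intro mult_mono) auto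
    then show ?thesis by (simp add: abs_mult)
   qed
   moreover have "\<bar>?c * x ^ 3\<bar> \<le> B * h"
   proof -
    have "h ^ 3 \<le> h ^ 1" using h1 as by (intro power_decreasing) auto
    then have "x ^ 3 \<le> h" using order_trans[OF x3(1), of h] by simp
    then have "\<bar>x ^ 3\<bar> \<le> h" using as by simp
    then show ?thesis unfolding abs_mult using B(4)[of s0] B(1) by (intro mult_mono) auto
   qed
   moreover have "\<bar>v3\<bar> \<le> x + \<bar>(?k + ?k' * si) * x\<^sup>2 / 2\<bar> + \<bar>?c * x ^ 3\<bar>" unfolding v3_def using as by linarith
   ultimately show ?thesis using as by (simp add: algebra_simps)
  qed
  have main: "\<bar>v3 * norm (?D et3) - Im (?Q et3)\<bar> \<le> C * h ^ 4"
   unfolding v3_def et3_def by (rule C(4)) (use B as si h1 in auto)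
  have "\<bar>vv s x * norm (?D et) - Im (?Q et)\<bar> \<le> \<bar>vv s x - v3\<bar> * norm (?D et) + \<bar>v3\<bar> * norm (?D et - ?D et3)
    + \<bar>v3 * norm (?D et3) - Im (?Q et3)\<bar> + norm (?Q et - ?Q et3)"
  proof -
   have "vv s x * norm (?D et) - Im (?Q et) = (vv s x - v3) * norm (?D et) + v3 * (norm (?D et) - norm (?D et3))
    + (v3 * norm (?D et3) - Im (?Q et3)) - Im (?Q et - ?Q et3)" by (simp add: algebra_simps)
   moreover have "\<bar>v3 * (norm (?D et) - norm (?D et3))\<bar> \<le> \<bar>v3\<bar> * norm (?D et - ?D et3)"
    unfolding abs_mult by (intro mult_left_mono norm_triangle_ineq3) auto
   moreover have "\<bar>Im (?Q et - ?Q et3)\<bar> \<le> norm (?Q et - ?Q et3)" by (rule abs_Im_le_cmod)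
   moreover have "\<bar>(vv s x - v3) * norm (?D et)\<bar> = \<bar>vv s x - v3\<bar> * norm (?D et)" by (simp add: abs_mult)
   ultimately show ?thesis by linarith
  qed
  also have "\<dots> \<le> 3 * e * h ^ 3 * D + (1 + 2 * B) * h * ((B + 6 * P) * (2 * e * h ^ 3)) + C * h ^ 4 + D * (2 * e * h ^ 3)"
  proof (intro add_mono)
   show "\<bar>vv s x - v3\<bar> * norm (?D et) \<le> 3 * e * h ^ 3 * D" using V D1 D e as by (intro mult_mono) auto
   have BP: "B + 6 * P \<ge> 0" using B(1) P0 by auto
   have "norm (?D et - ?D et3) \<le> (B + 6 * P) * (2 * e * h ^ 3)"
    using order_trans[OF DD mult_left_mono[OF r BP]] .
   then show "\<bar>v3\<bar> * norm (?D et - ?D et3) \<le> (1 + 2 * B) * h * ((B + 6 * P) * (2 * e * h ^ 3))"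
    using v3b B(1) as by (intro mult_mono) auto
   show "norm (?Q et - ?Q et3) \<le> D * (2 * e * h ^ 3)"
    using order_trans[OF DQ mult_left_mono[OF r]] D by simp
  qed (rule main)
  also have "\<dots> \<le> 3 * e * h ^ 3 * D + (1 + 2 * B) * 1 * ((B + 6 * P) * (2 * e * h ^ 3)) + C * (e * h ^ 3) + D * (2 * e * h ^ 3)"
  proof (intro add_mono order_refl)
   show "(1 + 2 * B) * h * ((B + 6 * P) * (2 * e * h ^ 3)) \<le> (1 + 2 * B) * 1 * ((B + 6 * P) * (2 * e * h ^ 3))"
    using h1 as B(1) P0 e by (intro mult_right_mono mult_left_mono) auto
   have "h * h ^ 3 \<le> e * h ^ 3" using h1 as by (intro mult_right_mono) auto
   then show "C * h ^ 4 \<le> C * (e * h ^ 3)" using C(1) by (simp add: eval_nat_numeral)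
  qed
  also have "\<dots> = (E0 + C) * e * h ^ 3" by (simp add: E0_def algebra_simps)
  also have "\<dots> \<le> ep * h ^ 3" using e as by (intro mult_right_mono) auto
  finally show "\<bar>vv s x * norm (?D ((\<gamma> s + \<i> * of_real x * g1 s - \<gamma> s0) / g1 s0))
    - Im (?Q ((\<gamma> s + \<i> * of_real x * g1 s - \<gamma> s0) / g1 s0))\<bar> \<le> ep * h ^ 3"
   unfolding et_def .
 qed
qed

end

section \<open>The Liouville equation on annular domains\<close>

text \<open>Locally \<open>F = exp b\<close>, and the logarithm of the norm is the real part of
  \<open>b\<close>.\<close>

lemma has_laplacian_ln_norm:
 assumes F: "F holomorphic_on S" "open S" "\<And>z. z \<in> S ==> F z \<noteq> 0" and z: "z \<in> S"
 shows "has_laplacian (%z. ln (norm (F z))) z (Re (deriv F z / F z)) (- Im (deriv F z / F z)) 0"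
proof -
 obtain r where r: "r > 0" "ball z r \<subseteq> S" using F(2) z open_contains_ball by blast
 have Fb: "F holomorphic_on ball z r" using F(1) r(2) holomorphic_on_subset by blast
 obtain b where b: "b holomorphic_on ball z r" "\<And>x. x \<in> ball z r ==> exp (b x) = F x"
  using holomorphic_logarithm_exists[of "ball z r" F z] Fb r F(3) by (metis centre_in_ball convex_ball open_ball subsetD)
 have "has_laplacian (%z. Re (b z)) z (Re (deriv b z)) (- Im (deriv b z)) 0"
  by (rule has_laplacian_Re_holomorphic[OF b(1)]) (use r in auto)
 moreover have "\<forall>\<^sub>F x in nhds z. Re (b x) = ln (norm (F x))"
 proof -
  have "\<forall>\<^sub>F x in nhds z. x \<in> ball z r" using r by (intro eventually_nhds_in_open) auto
  then show ?thesis by eventually_elim (simp flip: b(2))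
 qed
 moreover have "deriv b z = deriv F z / F z"
 proof -
  have "(b has_field_derivative deriv b z) (at z)" using holomorphic_derivI[OF b(1)] r by simp
  then have "((%x. exp (b x)) has_field_derivative exp (b z) * deriv b z) (at z)"
   by (rule DERIV_fun_exp)
  moreover have "\<forall>\<^sub>F x in nhds z. exp (b x) = F x"
   using eventually_nhds_in_open[of "ball z r" z] r by (auto elim!: eventually_mono simp: b(2))
  ultimately have "(F has_field_derivative exp (b z) * deriv b z) (at z)"
   using DERIV_cong_ev[OF refl _ refl, of "%x. exp (b x)" F z] by simp
  then have "deriv F z = F z * deriv b z" using b(2)[of z] r by (simp add: DERIV_imp_deriv)
  moreover have "F z \<noteq> 0" using F(3) z .
  ultimately show ?thesis by simp
 qed
 ultimately show ?thesis using has_laplacian_cong by metis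
qed

lemma solves_liouville_laplacian:
 assumes "solves_liouville \<Omega> u" "open \<Omega>" "z \<in> \<Omega>"
 obtains p1 p2 where "has_laplacian u z p1 p2 (exp (2 * u z))" "isCont u z"
proof -
 obtain Du :: "complex \<Rightarrow> complex \<Rightarrow>\<^sub>L real" and D2u :: "complex \<Rightarrow> complex \<Rightarrow>\<^sub>L (complex \<Rightarrow>\<^sub>L real)" where
  D: "\<And>z. z \<in> \<Omega> ==> (u has_derivative blinfun_apply (Du z)) (at z)"
    "\<And>z. z \<in> \<Omega> ==> (Du has_derivative blinfun_apply (D2u z)) (at z)"
    "\<And>z. z \<in> \<Omega> ==> blinfun_apply (blinfun_apply (D2u z) 1) 1 + blinfun_apply (blinfun_apply (D2u z) \<i>) \<i> = exp (2 * u z)"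
  using assms(1) unfolding solves_liouville_def by blast
 have line: "twice_diff (%t. u (z + of_real t * e)) (Du z e) (D2u z e e)" for e
  unfolding twice_diff_def
 proof (intro exI[of _ "%t. Du (z + of_real t * e) e"] conjI)
  have dl: "((%t::real. z + of_real t * e) has_derivative (%h. of_real h * e)) (at t)" for t
   by (auto intro!: derivative_eq_intros)
  have sm: "of_real h * e = h *\<^sub>R e" for h by (simp add: scaleR_conv_of_real)
  have "\<forall>\<^sub>F t in nhds (0::real). z + of_real t * e \<in> \<Omega>"
   by (rule eventually_compose_filterlim[OF eventually_nhds_in_open[OF assms(2,3)] filterlim_line_nhds])
  then show "\<forall>\<^sub>F t in nhds 0. ((%t. u (z + of_real t * e)) has_real_derivative Du (z + of_real t * e) e) (at t)"
  proof eventually_elim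
   case (elim t)
   have "((%t. u (z + of_real t * e)) has_derivative (%h. Du (z + of_real t * e) (of_real h * e))) (at t)"
    by (rule has_derivative_compose[OF dl D(1)[OF elim]])
   then show ?case
    unfolding has_field_derivative_def
    by (rule has_derivative_eq_rhs) (rule ext, simp only: sm blinfun.scaleR_right real_scaleR_def, rule mult.commute)
  qed
  have "((%t. Du (z + of_real t * e)) has_derivative (%h. D2u z (of_real h * e))) (at 0)"
   using has_derivative_compose[OF dl[of 0], of Du "blinfun_apply (D2u z)"] D(2)[OF assms(3)] by simp
  then have "((%t. Du (z + of_real t * e) e) has_derivative (%h. D2u z (of_real h * e) e)) (at 0)"
   by (auto intro!: derivative_eq_intros)
  then show "((%t. Du (z + of_real t * e) e) has_real_derivative D2u z e e) (at 0)"
   unfolding has_field_derivative_def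
   by (rule has_derivative_eq_rhs) (rule ext, simp only: sm blinfun.scaleR_right blinfun.scaleR_left real_scaleR_def, rule mult.commute)
 qed simp
 have "has_laplacian u z (Du z 1) (Du z \<i>) (exp (2 * u z))"
  unfolding has_laplacian_def using line[of 1] line[of \<i>] D(3)[OF assms(3)]
  by (intro exI[of _ "D2u z 1 1"] exI[of _ "D2u z \<i> \<i>"]) simp
 moreover have "isCont u z" using D(1)[OF assms(3)] has_derivative_continuous by blast
 ultimately show ?thesis using that by blast
qed

locale annular_domain =
 fixes \<Omega> :: "complex set" and \<beta> :: real and f g :: "complex \<Rightarrow> complex"
 assumes \<beta>: "0 < \<beta>" "\<beta> < 1" and open\<Omega>: "open \<Omega>" and bounded\<Omega>: "bounded \<Omega>"
  and f: "f holomorphic_on \<Omega>" and g: "g holomorphic_on annulus \<beta>"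
  and fim: "f ` \<Omega> \<subseteq> annulus \<beta>" and gim: "g ` annulus \<beta> \<subseteq> \<Omega>"
  and gf: "\<And>z. z \<in> \<Omega> ==> g (f z) = z" and fg: "\<And>w. w \<in> annulus \<beta> ==> f (g w) = w"
begin

definition c0 :: real where "c0 = - ln \<beta>"
text \<open>The scale for which \<open>exp (k * z)\<close> maps the strip onto the upper half plane,
  so that its hyperbolic metric has density \<open>k / sin (k * Im z)\<close>.\<close>

definition k :: real where "k = pi / c0"
definition tau :: "complex \<Rightarrow> real" where "tau z = - ln (norm (f z))"
definition strip :: "complex set" where "strip = {ze. 0 < Im ze \<and> Im ze < c0}"
definition G :: "complex \<Rightarrow> complex" where "G ze = g (exp (\<i> * ze))"
text \<open>The derivative of \<open>ln f\<close>: single-valued although the logarithm is not, and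
  equal to \<open>\<i> / G'\<close> along the covering \<open>G\<close>.\<close>

definition F :: "complex \<Rightarrow> complex" where "F z = deriv f z / f z"

lemma c0: "c0 > 0" using \<beta> by (simp add: c0_def)
lemma k: "k > 0" using c0 by (simp add: k_def)
lemma kc0: "k * c0 = pi" using c0 by (simp add: k_def)

lemma open_strip: "open strip"
 unfolding strip_def by (intro open_Collect_conj open_Collect_less continuous_intros)

lemma convex_strip: "convex strip"
proof -
 have "strip = {z. 0 < Im z} \<inter> {z. Im z < c0}" by (auto simp: strip_def)
 then show ?thesis by (simp add: convex_Int convex_halfspace_Im_gt convex_halfspace_Im_lt)
qed

lemma exp_strip: "ze \<in> strip ==> exp (\<i> * ze) \<in> annulus \<beta>"
proof -
 assume ze: "ze \<in> strip"
 have "norm (exp (\<i> * ze)) = exp (- Im ze)" by (simp add: norm_exp_eq_Re)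
 moreover have "\<beta> = exp (- c0)" using \<beta> by (simp add: c0_def)
 moreover have "exp (- c0) < exp (- Im ze)" "exp (- Im ze) < 1" using ze by (auto simp: strip_def)
 ultimately show ?thesis unfolding annulus_def by (simp only: mem_Collect_eq)
qed

lemma holG: "G holomorphic_on strip"
 unfolding G_def[abs_def]
proof (rule holomorphic_on_compose_gen[OF _ g, unfolded o_def])
 show "(%ze. exp (\<i> * ze)) holomorphic_on strip" by (intro holomorphic_intros)
 show "(%ze. exp (\<i> * ze)) ` strip \<subseteq> annulus \<beta>" using exp_strip by blast
qed

lemma G_in: "ze \<in> strip ==> G ze \<in> \<Omega>" using exp_strip gim by (auto simp: G_def)
lemma f_G: "ze \<in> strip ==> f (G ze) = exp (\<i> * ze)" using exp_strip fg by (auto simp: G_def)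
lemma tau_G: "ze \<in> strip ==> tau (G ze) = Im ze" by (simp add: tau_def f_G)

lemma f_in: "z \<in> \<Omega> ==> \<beta> < norm (f z) \<and> norm (f z) < 1" using fim by (auto simp: annulus_def)
lemma f_nz: "z \<in> \<Omega> ==> f z \<noteq> 0" using f_in[of z] \<beta> by auto

lemma tau_bounds: "z \<in> \<Omega> ==> 0 < tau z \<and> tau z < c0"
 using f_in[of z] f_nz[of z] \<beta> by (simp add: tau_def c0_def ln_less_zero)

lemma G_surj: assumes "z \<in> \<Omega>" obtains ze where "ze \<in> strip" "G ze = z" "Im ze = tau z"
proof -
 define ze where "ze = - \<i> * Ln (f z)"
 have e: "exp (\<i> * ze) = f z" using f_nz[OF assms] by (simp add: ze_def)
 have i: "Im ze = tau z" using f_nz[OF assms] by (simp add: ze_def tau_def)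
 have "ze \<in> strip" using tau_bounds[OF assms] i by (simp add: strip_def)
 moreover have "G ze = z" using gf[OF assms] by (simp add: G_def e)
 ultimately show ?thesis using that i by blast
qed

lemma G_periodic: "G (ze + 2 * of_real pi) = G ze"
proof -
 have "exp (\<i> * (ze + 2 * of_real pi)) = exp (\<i> * ze) * exp (2 * of_real pi * \<i>)"
  by (simp add: distrib_left exp_add mult_ac)
 then show ?thesis by (simp add: G_def)
qed

lemma G_eqD: assumes "ze \<in> strip" "ze' \<in> strip" "G ze = G ze'" shows "exp (\<i> * ze) = exp (\<i> * ze')"
 using f_G[OF assms(1)] f_G[OF assms(2)] assms(3) by simp

text \<open>Points of the disc differ by less than 2 pi, so no nontrivial deck translation relates
  two of them.\<close>

lemma G_inj_ball: assumes "ball ze r \<subseteq> strip" "r \<le> pi" shows "inj_on G (ball ze r)"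
proof (rule inj_onI)
 fix x y assume xy: "x \<in> ball ze r" "y \<in> ball ze r" "G x = G y"
 then have "exp (\<i> * x) = exp (\<i> * y)" using assms(1) G_eqD by blast
 then obtain n :: int where n: "\<i> * x = \<i> * y + of_real (of_int (2 * n) * pi) * \<i>" unfolding exp_eq by blast
 then have "\<i> * (x - y) = \<i> * of_real (2 * of_int n * pi)" by (simp add: algebra_simps)
 then have d: "x - y = of_real (2 * of_int n * pi)" by simp
 have "dist x y < 2 * pi" using xy assms(2) dist_triangle_half_r[of ze x "2 * r" y] by (simp add: dist_commute)
 then have "\<bar>of_int n :: real\<bar> * (2 * pi) < 1 * (2 * pi)" unfolding dist_norm d norm_of_real by (simp add: abs_mult)
 then have "\<bar>of_int n :: real\<bar> < 1" by (subst (asm) mult_less_cancel_right) auto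
 then have "n = 0" by linarith
 then show "x = y" using d by simp
qed

lemma strip_ball: assumes "ze \<in> strip" shows "ball ze (min (Im ze) (c0 - Im ze)) \<subseteq> strip"
proof
 fix x assume "x \<in> ball ze (min (Im ze) (c0 - Im ze))"
 then have "\<bar>Im x - Im ze\<bar> < min (Im ze) (c0 - Im ze)"
  using abs_Im_le_cmod[of "x - ze"] by (simp add: dist_norm norm_minus_commute)
 then show "x \<in> strip" by (auto simp: strip_def abs_less_iff)
qed

lemma derivG: assumes "ze \<in> strip"
 shows "(G has_field_derivative deriv G ze) (at ze)" "(deriv G has_field_derivative deriv (deriv G) ze) (at ze)"
  "deriv G ze \<noteq> 0"
proof -
 show "(G has_field_derivative deriv G ze) (at ze)" using holomorphic_derivI[OF holG open_strip assms] by simp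
 show "(deriv G has_field_derivative deriv (deriv G) ze) (at ze)"
  using holomorphic_derivI[OF holomorphic_deriv[OF holG open_strip] open_strip assms] by simp
 define r where "r = min (min (Im ze) (c0 - Im ze)) pi"
 have r: "r > 0" "r \<le> pi" using assms by (auto simp: r_def strip_def)
 have sub: "ball ze r \<subseteq> strip" using strip_ball[OF assms] by (rule order_trans[rotated]) (auto simp: r_def)
 show "deriv G ze \<noteq> 0"
  by (rule holomorphic_injective_imp_regular[OF holomorphic_on_subset[OF holG sub] open_ball G_inj_ball[OF sub r(2)]])
    (simp add: r(1))
qed

lemma holF: "F holomorphic_on \<Omega>"
 unfolding F_def[abs_def] by (rule holomorphic_on_divide[OF holomorphic_deriv[OF f open\<Omega>] f f_nz])

lemma F_G: assumes "ze \<in> strip" shows "F (G ze) * deriv G ze = \<i>"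
proof -
 have "((%x. f (G x)) has_field_derivative deriv f (G ze) * deriv G ze) (at ze)"
  by (rule DERIV_chain2[OF holomorphic_derivI[OF f open\<Omega> G_in[OF assms]] derivG(1)[OF assms]])
 moreover have "((%x. exp (\<i> * x)) has_field_derivative exp (\<i> * ze) * \<i>) (at ze)"
  by (auto intro!: derivative_eq_intros)
 moreover have "\<forall>\<^sub>F x in nhds ze. f (G x) = exp (\<i> * x)"
  using eventually_nhds_in_open[OF open_strip assms] by eventually_elim (rule f_G)
 ultimately have "deriv f (G ze) * deriv G ze = exp (\<i> * ze) * \<i>"
  using DERIV_cong_ev[OF refl _ refl, of "%x. f (G x)" "%x. exp (\<i> * x)" ze] DERIV_unique by blast
 then show ?thesis using f_G[OF assms] by (simp add: F_def)
qed

lemma F_nz: assumes "z \<in> \<Omega>" shows "F z \<noteq> 0"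
proof -
 obtain ze where "ze \<in> strip" "G ze = z" by (rule G_surj[OF assms])
 then show ?thesis using F_G[of ze] by auto
qed

text \<open>Differentiate \<open>F (G ze) * deriv G ze = \<i>\<close>. The identity transfers
  distortion estimates for \<open>G\<close> to the logarithmic derivative of
  \<open>F\<close>.\<close>

lemma F_deriv_G: assumes "ze \<in> strip"
 shows "deriv F (G ze) / (F (G ze))\<^sup>2 = \<i> * deriv (deriv G) ze / deriv G ze"
proof -
 have "((%x. F (G x)) has_field_derivative deriv F (G ze) * deriv G ze) (at ze)"
  by (rule DERIV_chain2[OF holomorphic_derivI[OF holF open\<Omega> G_in[OF assms]] derivG(1)[OF assms]])
 then have "((%x. F (G x) * deriv G x) has_field_derivative
   deriv F (G ze) * deriv G ze * deriv G ze + deriv (deriv G) ze * F (G ze)) (at ze)"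
  using derivG(2)[OF assms] by (rule DERIV_mult)
 moreover have "\<forall>\<^sub>F x in nhds ze. F (G x) * deriv G x = \<i>"
  using eventually_nhds_in_open[OF open_strip assms] by eventually_elim (rule F_G)
 ultimately have "((%x. \<i>) has_field_derivative
   deriv F (G ze) * deriv G ze * deriv G ze + deriv (deriv G) ze * F (G ze)) (at ze)"
  using DERIV_cong_ev[OF refl _ refl, of "%x. F (G x) * deriv G x" "%x. \<i>"] by simp
 then have e: "deriv F (G ze) * deriv G ze * deriv G ze + deriv (deriv G) ze * F (G ze) = 0"
  using DERIV_unique[OF _ DERIV_const] by blast
 have FG: "F (G ze) = \<i> / deriv G ze" using F_G[OF assms] derivG(3)[OF assms] by (simp add: field_simps)
 define A where "A = deriv F (G ze)"
 define d where "d = deriv G ze"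
 define d2 where "d2 = deriv (deriv G) ze"
 have d: "d \<noteq> 0" using derivG(3)[OF assms] by (simp add: d_def)
 have "A * d * d + d2 * (\<i> / d) = 0" using e unfolding FG A_def d_def d2_def .
 then have "A * d * d = - (d2 * \<i> / d)" by (simp add: add_eq_0_iff)
 then have "A * d\<^sup>2 = - \<i> * d2 / d" by (simp add: power2_eq_square mult_ac)
 then show ?thesis unfolding FG A_def[symmetric] d_def[symmetric] d2_def[symmetric]
  using d by (simp add: power_divide)
qed

text \<open>Logarithm of the hyperbolic density of the narrower strip
  \<open>e < Im z < c0 - e\<close>, carried over to the band \<open>e < tau < c0 - e\<close>; for
  \<open>e = 0\<close> it is the expected solution on all of \<open>\<Omega>\<close>.\<close>

definition Uf :: "real \<Rightarrow> complex \<Rightarrow> real" where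
 "Uf e z = ln (norm (F z)) - ln (sin (pi / (c0 - 2 * e) * (tau z - e)) / (pi / (c0 - 2 * e)))"

text \<open>Both \<open>ln |F|\<close> and \<open>tau\<close> are harmonic, \<open>tau\<close> has
  gradient of length \<open>|F|\<close>, and the one-dimensional profile \<open>\<Psi>\<close>
  satisfies \<open>\<Psi>'' = exp (2 * \<Psi>)\<close>. The gradient is kept for the truncation
  argument.\<close>

lemma laplacian_Uf:
 assumes z: "z \<in> \<Omega>" and e: "0 \<le> e" "e < tau z" "tau z < c0 - e"
 obtains p1 p2 where "has_laplacian (Uf e) z p1 p2 (exp (2 * Uf e z))"
  "p1\<^sup>2 + p2\<^sup>2 = (norm (deriv F z / F z + pi / (c0 - 2 * e) * cot (pi / (c0 - 2 * e) * (tau z - e)) * F z))\<^sup>2"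
proof -
 define ka where "ka = pi / (c0 - 2 * e)"
 have ce: "c0 - 2 * e > 0" using e by linarith
 then have ka: "ka > 0" by (simp add: ka_def)
 have ang: "0 < ka * (tau z - e)" "ka * (tau z - e) < pi"
 proof -
  show "0 < ka * (tau z - e)" using ka e by simp
  have "tau z - e < c0 - 2 * e" using e by linarith
  then have "ka * (tau z - e) < ka * (c0 - 2 * e)" using ka by (rule mult_strict_left_mono)
  also have "ka * (c0 - 2 * e) = pi" using ce by (simp add: ka_def)
  finally show "ka * (tau z - e) < pi" .
 qed
 then have sp: "sin (ka * (tau z - e)) > 0" by (rule sin_gt_zero)
 define \<Psi> where "\<Psi> t = - ln (sin (ka * (t - e)) / ka)" for t
 define \<Psi>' where "\<Psi>' t = - (ka * cos (ka * (t - e)) / sin (ka * (t - e)))" for t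
 have d1: "\<forall>\<^sub>F t in nhds (tau z). (\<Psi> has_real_derivative \<Psi>' t) (at t)"
 proof -
  have "open {t. 0 < sin (ka * (t - e))}" by (intro open_Collect_less continuous_intros)
  then have "\<forall>\<^sub>F t in nhds (tau z). t \<in> {t. 0 < sin (ka * (t - e))}"
   using sp by (intro eventually_nhds_in_open) auto
  then show ?thesis
  proof eventually_elim
   case (elim t)
   then show ?case unfolding \<Psi>_def \<Psi>'_def using ka by (auto intro!: derivative_eq_intros simp: field_simps)
  qed
 qed
 have d2: "(\<Psi>' has_real_derivative (ka / sin (ka * (tau z - e)))\<^sup>2) (at (tau z))"
 proof -
  define s where "s = sin (ka * (tau z - e))"
  define c where "c = cos (ka * (tau z - e))"
  have "s * s + c * c = 1" using sin_cos_squared_add[of "ka * (tau z - e)"] by (simp add: s_def c_def power2_eq_square)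
  then have key: "ka * (ka * (c * c)) + ka * (ka * (s * s)) = ka * ka" by (metis distrib_left add.commute mult_1_right)
  show ?thesis
   unfolding \<Psi>'_def
   apply (rule derivative_eq_intros refl | use sp in force)+
   using sp key unfolding s_def[symmetric] c_def[symmetric]
   by (simp add: field_simps power2_eq_square) algebra
 qed
 have lt: "has_laplacian tau z (- Re (F z)) (Im (F z)) 0"
  unfolding tau_def using has_laplacian_minus[OF has_laplacian_ln_norm[OF f open\<Omega> f_nz z]]
  by (simp add: F_def)
 have nF: "(Re (F z))\<^sup>2 + (Im (F z))\<^sup>2 = (norm (F z))\<^sup>2" by (simp add: cmod_power2)
 have l1: "has_laplacian (%z. \<Psi> (tau z)) z (\<Psi>' (tau z) * - Re (F z)) (\<Psi>' (tau z) * Im (F z))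
   ((ka / sin (ka * (tau z - e)))\<^sup>2 * (norm (F z))\<^sup>2)"
  using has_laplacian_compose[OF lt d1 d2] nF by simp
 have l2: "has_laplacian (%z. ln (norm (F z))) z (Re (deriv F z / F z)) (- Im (deriv F z / F z)) 0"
  by (rule has_laplacian_ln_norm[OF holF open\<Omega> F_nz z])
 have Ueq: "Uf e = (%z. ln (norm (F z)) + \<Psi> (tau z))" by (auto simp: Uf_def \<Psi>_def ka_def)
 have ex: "exp (2 * Uf e z) = (ka / sin (ka * (tau z - e)))\<^sup>2 * (norm (F z))\<^sup>2"
 proof -
  have "exp (Uf e z) = norm (F z) / (sin (ka * (tau z - e)) / ka)"
   using F_nz[OF z] sp ka by (simp add: Uf_def ka_def[symmetric] exp_diff)
  moreover have "exp (2 * Uf e z) = (exp (Uf e z))\<^sup>2" by (simp add: exp_double)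
  ultimately show ?thesis by (simp add: power_mult_distrib power_divide)
 qed
 define q where "q = deriv F z / F z - of_real (\<Psi>' (tau z)) * F z"
 show ?thesis
 proof (rule that)
  show "has_laplacian (Uf e) z (Re (deriv F z / F z) + \<Psi>' (tau z) * - Re (F z))
    (- Im (deriv F z / F z) + \<Psi>' (tau z) * Im (F z)) (exp (2 * Uf e z))"
   unfolding Ueq[of] ex[symmetric] using has_laplacian_add[OF l2 l1] unfolding ex[symmetric] Ueq by simp
  have "(Re (deriv F z / F z) + \<Psi>' (tau z) * - Re (F z))\<^sup>2 + (- Im (deriv F z / F z) + \<Psi>' (tau z) * Im (F z))\<^sup>2
    = (Re q)\<^sup>2 + (Im q)\<^sup>2" by (simp add: q_def power2_eq_square algebra_simps)
  also have "\<dots> = (norm q)\<^sup>2" by (simp add: cmod_power2)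
  also have "q = deriv F z / F z + pi / (c0 - 2 * e) * cot (pi / (c0 - 2 * e) * (tau z - e)) * F z"
   by (simp add: q_def \<Psi>'_def ka_def cot_def)
  finally show "(Re (deriv F z / F z) + \<Psi>' (tau z) * - Re (F z))\<^sup>2 + (- Im (deriv F z / F z) + \<Psi>' (tau z) * Im (F z))\<^sup>2 =
    (norm (deriv F z / F z + pi / (c0 - 2 * e) * cot (pi / (c0 - 2 * e) * (tau z - e)) * F z))\<^sup>2" .
 qed
qed

end

section \<open>Comparison with the explicit hyperbolic metric\<close>

context annular_domain
begin

lemma cont_f: "continuous_on \<Omega> f" using f by (rule holomorphic_on_imp_continuous_on)

lemma cont_tau: "continuous_on \<Omega> tau"
 unfolding tau_def[abs_def] by (intro continuous_intros cont_f) (use f_nz in auto)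

text \<open>The set is the image under \<open>g\<close> of a compact annulus, which settles
  compactness even at an irregular frontier.\<close>

lemma compact_levels:
 assumes "0 < e" shows "compact {z \<in> \<Omega>. e \<le> tau z \<and> tau z \<le> c0 - e}"
proof -
 define A where "A = {w :: complex. exp (- (c0 - e)) \<le> norm w \<and> norm w \<le> exp (- e)}"
 have b: "\<beta> = exp (- c0)" using \<beta> by (simp add: c0_def)
 have sub: "A \<subseteq> annulus \<beta>"
 proof
  fix w assume w: "w \<in> A"
  have "exp (- c0) < exp (- (c0 - e))" "exp (- e) < 1" using assms by auto
  moreover have "exp (- (c0 - e)) \<le> norm w" "norm w \<le> exp (- e)" using w by (auto simp: A_def)
  ultimately have "\<beta> < norm w" "norm w < 1" using b by linarith+
  then show "w \<in> annulus \<beta>" by (simp add: annulus_def)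
 qed
 have "A = cball 0 (exp (- e)) \<inter> {w. exp (- (c0 - e)) \<le> norm w}" by (auto simp: A_def)
 moreover have "closed {w :: complex. exp (- (c0 - e)) \<le> norm w}" by (intro closed_Collect_le continuous_intros)
 ultimately have "compact A" by (simp add: compact_Int_closed)
 then have "compact (g ` A)"
  by (intro compact_continuous_image continuous_on_subset[OF holomorphic_on_imp_continuous_on[OF g] sub])
 moreover have "g ` A = {z \<in> \<Omega>. e \<le> tau z \<and> tau z \<le> c0 - e}"
 proof (intro equalityI subsetI)
  fix z assume "z \<in> g ` A"
  then obtain w where w: "w \<in> A" "z = g w" by blast
  have z: "z \<in> \<Omega>" using w sub gim by blast
  have fz: "f z = w" using w sub fg by blast
  have "norm w > 0" using w(1) unfolding A_def by (metis (mono_tags, lifting) exp_gt_zero less_le_trans mem_Collect_eq)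
  then have "exp (- tau z) = norm w" by (simp add: tau_def fz)
  then show "z \<in> {z \<in> \<Omega>. e \<le> tau z \<and> tau z \<le> c0 - e}" using w(1) z by (simp add: A_def flip: \<open>exp (- tau z) = norm w\<close>)
 next
  fix z assume z: "z \<in> {z \<in> \<Omega>. e \<le> tau z \<and> tau z \<le> c0 - e}"
  then have "exp (- tau z) = norm (f z)" using f_nz by (simp add: tau_def)
  then have "f z \<in> A" using z by (simp add: A_def flip: \<open>exp (- tau z) = norm (f z)\<close>)
  moreover have "z = g (f z)" using gf z by simp
  ultimately show "z \<in> g ` A" by blast
 qed
 ultimately show ?thesis by simp
qed

lemma sin_strip:
 assumes "0 < t" "t < c0"
 shows "0 < sin (k * t)" "sin (k * t) / k \<le> t" "sin (k * t) / k \<le> c0 - t" "sin (k * t) / k \<le> 1 / k"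
proof -
 have kt: "0 < k * t" using k assms by simp
 have kt2: "k * t < pi" using mult_strict_left_mono[OF assms(2) k] kc0 by simp
 show "0 < sin (k * t)" using kt kt2 by (rule sin_gt_zero)
 show "sin (k * t) / k \<le> t" using sin_x_le_x[of "k * t"] kt k by (simp add: field_simps)
 have "sin (k * t) = sin (pi - k * t)" by simp
 also have "pi - k * t = k * (c0 - t)" using kc0 by (simp add: right_diff_distrib)
 finally have "sin (k * t) \<le> k * (c0 - t)" using sin_x_le_x[of "k * (c0 - t)"] k assms by simp
 then show "sin (k * t) / k \<le> c0 - t" using k by (simp add: field_simps)
 show "sin (k * t) / k \<le> 1 / k" using k by (simp add: divide_right_mono)
qed

lemma exp_Uf0_G: assumes "ze \<in> strip"
 shows "exp (- Uf 0 (G ze)) = norm (deriv G ze) * (sin (k * Im ze) / k)"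
proof -
 have t: "0 < Im ze" "Im ze < c0" using assms by (auto simp: strip_def)
 have nF: "norm (F (G ze)) = 1 / norm (deriv G ze)"
  using arg_cong[OF F_G[OF assms], of norm] derivG(3)[OF assms] by (simp add: norm_mult field_simps)
 define s where "s = sin (k * Im ze) / k"
 have s: "s > 0" using sin_strip(1)[OF t] k by (simp add: s_def)
 have "Uf 0 (G ze) = ln (1 / norm (deriv G ze)) - ln s"
  by (simp add: Uf_def k_def[symmetric] tau_G[OF assms] nF s_def)
 then have "exp (- Uf 0 (G ze)) = exp (ln s - ln (1 / norm (deriv G ze)))" by simp
 also have "\<dots> = exp (ln s) / exp (ln (1 / norm (deriv G ze)))" by (rule exp_diff)
 also have "\<dots> = norm (deriv G ze) * s" using s derivG(3)[OF assms] by simp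
 finally show ?thesis by (simp add: s_def)
qed

text \<open>\<open>G\<close> takes values in a bounded set, so Cauchy's inequality bounds its
  derivative by the reciprocal distance to the edges, and the sine factor compensates for
  that.\<close>

lemma Uf0_lower: obtains m where "\<And>z. z \<in> \<Omega> ==> - m \<le> Uf 0 z"
proof -
 obtain R where R: "R > 0" "\<And>z. z \<in> \<Omega> ==> norm z \<le> R" using bounded\<Omega> by (auto simp: bounded_pos)
 have "exp (- Uf 0 z) \<le> 2 * R" if z: "z \<in> \<Omega>" for z
 proof -
  obtain ze where ze: "ze \<in> strip" "G ze = z" by (rule G_surj[OF z])
  have t: "0 < Im ze" "Im ze < c0" using ze(1) by (auto simp: strip_def)
  define r where "r = min (Im ze) (c0 - Im ze) / 2"
  have r: "r > 0" using t by (auto simp: r_def)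
  have sub: "cball ze r \<subseteq> strip" using strip_ball[OF ze(1)] t by (rule_tac order_trans[rotated]) (auto simp: r_def)
  have "norm ((deriv ^^ 1) G ze) \<le> fact 1 * R / r ^ 1"
  proof (rule Cauchy_inequality)
   show "G holomorphic_on ball ze r" using holG sub by (meson ball_subset_cball holomorphic_on_subset order_trans)
   show "continuous_on (cball ze r) G" using holG sub holomorphic_on_imp_continuous_on holomorphic_on_subset by blast
   show "norm (G x) \<le> R" if "norm (ze - x) = r" for x
    using that sub G_in R(2) by (auto simp: dist_norm subset_iff)
  qed (rule r)
  then have d: "norm (deriv G ze) \<le> R / r" by simp
  have s: "sin (k * Im ze) / k \<le> 2 * r" "sin (k * Im ze) / k \<ge> 0"
   using sin_strip[OF t] k by (auto simp: r_def)
  have "norm (deriv G ze) * (sin (k * Im ze) / k) \<le> R / r * (2 * r)" using d s R(1) r by (intro mult_mono) auto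
  then show ?thesis using exp_Uf0_G[OF ze(1)] ze(2) r by simp
 qed
 then have "- ln (2 * R) \<le> Uf 0 z" if "z \<in> \<Omega>" for z
  using that R(1) by (metis exp_gt_zero exp_le_cancel_iff exp_ln minus_le_iff mult_pos_pos zero_less_numeral)
 then show ?thesis using that by blast
qed

text \<open>The gradient is \<open>O(exp U)\<close>: the part \<open>F' / F\<close> equals
  \<open>\<i> * (G'' / G') * F\<close>, controlled by the distortion bound on a disc comparable to
  the distance from the edges, and the cotangent part is controlled directly.\<close>

lemma laplacian_Uf0:
 obtains C where "C > 0" "\<And>z. z \<in> \<Omega> ==> \<exists>p1 p2. has_laplacian (Uf 0) z p1 p2 (exp (2 * Uf 0 z)) \<and>
   p1\<^sup>2 + p2\<^sup>2 \<le> C * exp (2 * Uf 0 z)"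
proof -
 obtain C where C: "C > 0" "\<And>G z r. 0 < r ==> G holomorphic_on ball z r ==> inj_on G (ball z r)
     ==> r * norm (deriv (deriv G) z) \<le> C * norm (deriv G z)"
  using univalent_distortion by blast
 \<comment> \<open>The factor \<open>pi * k\<close> is needed because the discs on which
   \<open>G\<close> is injective are capped at radius pi, while \<open>s\<close> can be as large as
   \<open>1 / k\<close>.\<close>
 define M where "M = min 1 (pi * k)"
 have M: "M > 0" using k by (simp add: M_def)
 have "\<exists>p1 p2. has_laplacian (Uf 0) z p1 p2 (exp (2 * Uf 0 z)) \<and> p1\<^sup>2 + p2\<^sup>2 \<le> (C / M + 1)\<^sup>2 * exp (2 * Uf 0 z)"
  if z: "z \<in> \<Omega>" for z
 proof -
  obtain ze where ze: "ze \<in> strip" "G ze = z" "Im ze = tau z" by (rule G_surj[OF z])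
  have t: "0 < Im ze" "Im ze < c0" using ze(1) by (auto simp: strip_def)
  define s where "s = sin (k * Im ze) / k"
  have s: "0 < s" "s \<le> Im ze" "s \<le> c0 - Im ze" "s \<le> 1 / k" using sin_strip[OF t] k by (auto simp: s_def)
  define r where "r = min (min (Im ze) (c0 - Im ze)) pi"
  have r: "r > 0" "r \<le> pi" using t by (auto simp: r_def)
  have sub: "ball ze r \<subseteq> strip" using strip_ball[OF ze(1)] by (rule order_trans[rotated]) (auto simp: r_def)
  have D: "r * norm (deriv (deriv G) ze) \<le> C * norm (deriv G ze)"
   by (rule C(2)[OF r(1) holomorphic_on_subset[OF holG sub] G_inj_ball[OF sub r(2)]])
  have Ms: "M * s \<le> r"
  proof -
   have "M * s \<le> 1 * s" using s by (intro mult_right_mono) (auto simp: M_def)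
   moreover have "M * s \<le> (pi * k) * (1 / k)" using s k by (intro mult_mono) (auto simp: M_def)
   moreover have "(pi * k) * (1 / k) = pi" using k by simp
   ultimately have "M * s \<le> Im ze" "M * s \<le> c0 - Im ze" "M * s \<le> pi" using s by linarith+
   then show ?thesis by (simp add: r_def)
  qed
  have Q: "norm (deriv (deriv G) ze / deriv G ze) \<le> C / M / s"
  proof -
   have "M * s * norm (deriv (deriv G) ze) \<le> r * norm (deriv (deriv G) ze)" by (rule mult_right_mono[OF Ms norm_ge_zero])
   then have "M * s * norm (deriv (deriv G) ze) \<le> C * norm (deriv G ze)" using D by linarith
   then show ?thesis using M s derivG(3)[OF ze(1)] by (simp add: norm_divide field_simps)
  qed
  have e0: "0 \<le> (0::real)" "0 < tau z" "tau z < c0 - 0" using tau_bounds[OF z] by auto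
  obtain p1 p2 where p: "has_laplacian (Uf 0) z p1 p2 (exp (2 * Uf 0 z))"
   "p1\<^sup>2 + p2\<^sup>2 = (norm (deriv F z / F z + pi / (c0 - 2 * 0) * cot (pi / (c0 - 2 * 0) * (tau z - 0)) * F z))\<^sup>2"
   by (rule laplacian_Uf[OF z e0])
  have nF: "norm (F z) > 0" using F_nz[OF z] by simp
  have eU: "exp (Uf 0 z) = norm (F z) / s"
  proof -
   have "exp (Uf 0 z) = exp (ln (norm (F z)) - ln s)"
    using ze(3) by (simp add: Uf_def k_def[symmetric] s_def)
   then show ?thesis using nF s by (simp add: exp_diff)
  qed
  have "norm (deriv F z / F z) \<le> C / M * exp (Uf 0 z)"
  proof -
   have "deriv F z / F z = \<i> * (deriv (deriv G) ze / deriv G ze) * F z"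
    using F_deriv_G[OF ze(1)] ze(2) F_nz[OF z] by (simp add: field_simps power2_eq_square)
   then have "norm (deriv F z / F z) = norm (deriv (deriv G) ze / deriv G ze) * norm (F z)"
    by (simp add: norm_mult norm_divide)
   also have "\<dots> \<le> C / M / s * norm (F z)" using Q by (rule mult_right_mono) simp
   finally show ?thesis by (simp add: eU)
  qed
  moreover have "norm (of_real (k * cot (k * tau z)) * F z) \<le> exp (Uf 0 z)"
  proof -
   have "\<bar>k * cot (k * tau z)\<bar> \<le> 1 / s"
   proof -
    have "\<bar>k * cot (k * tau z)\<bar> = k * \<bar>cos (k * tau z)\<bar> / sin (k * tau z)"
     using sin_strip(1)[OF t] k ze(3) by (simp add: cot_def abs_mult)
    also have "\<dots> \<le> k * 1 / sin (k * tau z)"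
     using sin_strip(1)[OF t] k ze(3) by (intro divide_right_mono mult_left_mono) auto
    finally show ?thesis by (simp add: s_def ze(3))
   qed
   then have "\<bar>k * cot (k * tau z)\<bar> * norm (F z) \<le> 1 / s * norm (F z)" by (rule mult_right_mono) simp
   then show ?thesis unfolding norm_mult norm_of_real eU by simp
  qed
  ultimately have "norm (deriv F z / F z + of_real (k * cot (k * tau z)) * F z) \<le> (C / M + 1) * exp (Uf 0 z)"
   using norm_triangle_ineq[of "deriv F z / F z" "of_real (k * cot (k * tau z)) * F z"] by (simp add: algebra_simps)
  then have "(norm (deriv F z / F z + of_real (k * cot (k * tau z)) * F z))\<^sup>2 \<le> ((C / M + 1) * exp (Uf 0 z))\<^sup>2"
   by (rule power_mono) simp
  moreover have "p1\<^sup>2 + p2\<^sup>2 = (norm (deriv F z / F z + of_real (k * cot (k * tau z)) * F z))\<^sup>2"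
   using p(2) by (simp add: k_def)
  ultimately have "p1\<^sup>2 + p2\<^sup>2 \<le> (C / M + 1)\<^sup>2 * exp (2 * Uf 0 z)"
   by (simp add: power_mult_distrib exp_double)
  then show ?thesis using p(1) by blast
 qed
 moreover have "C / M > 0" using C(1) M by simp
 then have "(C / M + 1)\<^sup>2 > 0" by simp
 ultimately show ?thesis using that by blast
qed

lemma cont_F: "continuous_on \<Omega> F" using holF by (rule holomorphic_on_imp_continuous_on)

lemma cont_Uf0: "continuous_on \<Omega> (Uf 0)"
proof -
 have "0 < sin (pi / c0 * tau z)" if "z \<in> \<Omega>" for z
  using sin_strip(1)[of "tau z"] tau_bounds[OF that] by (simp add: k_def)
 then show ?thesis
  unfolding Uf_def[abs_def] using F_nz c0
  by (intro continuous_intros cont_F cont_tau) (auto simp: less_imp_neq[symmetric])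
qed

text \<open>On the band, whose closure lies in \<open>\<Omega>\<close>, the solution is continuous
  up to the edge while \<open>Uf e\<close> tends to plus infinity there, so the maximum principle
  applies to the difference.\<close>

lemma solution_le_Uf:
 assumes u: "solves_liouville \<Omega> u" and z: "z \<in> \<Omega>" and e: "0 < e" "e < tau z" "tau z < c0 - e"
 shows "u z \<le> Uf e z"
proof -
 define S where "S = {z \<in> \<Omega>. e < tau z \<and> tau z < c0 - e}"
 define ka where "ka = pi / (c0 - 2 * e)"
 have ce: "c0 - 2 * e > 0" using e by linarith
 have ka: "ka > 0" using ce by (simp add: ka_def)
 have contu: "continuous_on \<Omega> u"
  by (rule continuous_at_imp_continuous_on) (metis solves_liouville_laplacian[OF u open\<Omega>])
 have openS: "open S"
 proof -
  have "open (\<Omega> \<inter> tau -` {e<..<c0 - e})" using cont_tau open\<Omega> by (intro continuous_open_preimage) auto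
  moreover have "S = \<Omega> \<inter> tau -` {e<..<c0 - e}" by (auto simp: S_def)
  ultimately show ?thesis by simp
 qed
 have ang: "0 < sin (ka * (tau x - e))" if "x \<in> S" for x
 proof (rule sin_gt_zero)
  show "0 < ka * (tau x - e)" using that ka by (simp add: S_def)
  have "tau x - e < c0 - 2 * e" using that by (simp add: S_def)
  then have "ka * (tau x - e) < ka * (c0 - 2 * e)" using ka by (rule mult_strict_left_mono)
  then show "ka * (tau x - e) < pi" using ce by (simp add: ka_def)
 qed
 have "u z - Uf e z \<le> 0"
 proof (rule max_principle[of S "%z. u z - Uf e z"])
  show "open S" by (rule openS)
  show "bounded S" using bounded\<Omega> by (rule bounded_subset) (auto simp: S_def)
  show "z \<in> S" using z e by (simp add: S_def)
  have sub: "S \<subseteq> \<Omega>" by (auto simp: S_def)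
  show "continuous_on S (%z. u z - Uf e z)"
   unfolding Uf_def ka_def[symmetric]
   using sub ang F_nz ka
   by (intro continuous_intros continuous_on_subset[OF contu sub] continuous_on_subset[OF cont_F sub] continuous_on_subset[OF cont_tau sub])
     (auto simp: less_imp_neq[symmetric])
  show "\<exists>p1 p2 l. has_laplacian (%z. u z - Uf e z) x p1 p2 l \<and> 0 < l" if x: "x \<in> S" and w: "0 < u x - Uf e x" for x
  proof -
   have x\<Omega>: "x \<in> \<Omega>" using x sub by auto
   obtain p1 p2 where p: "has_laplacian u x p1 p2 (exp (2 * u x))" by (rule solves_liouville_laplacian[OF u open\<Omega> x\<Omega>])
   have xe: "0 \<le> e" "e < tau x" "tau x < c0 - e" using x e by (auto simp: S_def)
   obtain q1 q2 where q: "has_laplacian (Uf e) x q1 q2 (exp (2 * Uf e x))" by (rule laplacian_Uf[OF x\<Omega> xe])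
   show ?thesis using has_laplacian_diff[OF p q] w
    by (intro exI[of _ "p1 - q1"] exI[of _ "p2 - q2"] exI[of _ "exp (2 * u x) - exp (2 * Uf e x)"]) simp
  qed
  show "\<forall>\<^sub>F x in at y within S. u x - Uf e x < ep" if y: "y \<in> frontier S" and ep: "ep > 0" for y ep
  proof -
   have "closure S \<subseteq> {z \<in> \<Omega>. e \<le> tau z \<and> tau z \<le> c0 - e}"
    by (rule closure_minimal) (auto simp: S_def intro!: compact_imp_closed compact_levels e)
   then have y\<Omega>: "y \<in> \<Omega>" and ty: "e \<le> tau y" "tau y \<le> c0 - e" and yS: "y \<notin> S"
    using y openS by (auto simp: frontier_def interior_open)
   then have ty2: "tau y = e \<or> tau y = c0 - e" by (auto simp: S_def)
   have s0: "sin (ka * (tau y - e)) = 0"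
   proof (cases "tau y = e")
    case False
    then have "tau y - e = c0 - 2 * e" using ty2 by simp
    then have "ka * (tau y - e) = ka * (c0 - 2 * e)" by (rule arg_cong)
    also have "\<dots> = pi" using ce by (simp add: ka_def)
    finally have "ka * (tau y - e) = pi" .
    then show ?thesis by simp
   qed simp
   have tt: "(tau \<longlongrightarrow> tau y) (at y within S)"
    using continuous_on_subset[OF cont_tau] y\<Omega> openS sub cont_tau open\<Omega>
    by (metis continuous_on_eq_continuous_at isCont_def tendsto_within_subset subset_UNIV)
   have "((%x. sin (ka * (tau x - e)) / ka) \<longlongrightarrow> sin (ka * (tau y - e)) / ka) (at y within S)"
    using ka by (intro tendsto_intros tt) auto
   then have "((%x. sin (ka * (tau x - e)) / ka) \<longlongrightarrow> 0) (at y within S)" by (simp add: s0)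
   moreover have "\<forall>\<^sub>F x in at y within S. 0 < sin (ka * (tau x - e)) / ka"
    using ang ka by (auto simp: eventually_at_filter)
   ultimately have "filterlim (%x. sin (ka * (tau x - e)) / ka) (at_right 0) (at y within S)"
    by (auto simp: filterlim_at elim!: eventually_mono)
   then have l1: "filterlim (%x. ln (sin (ka * (tau x - e)) / ka)) at_bot (at y within S)"
    by (rule filterlim_compose[OF ln_at_0])
   have "isCont (%x. u x - ln (norm (F x))) y"
   proof -
    have "isCont u y" "isCont F y" using contu cont_F open\<Omega> y\<Omega> continuous_on_eq_continuous_at by blast+
    then show ?thesis using F_nz[OF y\<Omega>] by (intro continuous_intros) auto
   qed
   then have "((%x. u x - ln (norm (F x))) \<longlongrightarrow> u y - ln (norm (F y))) (at y within S)"
    by (meson continuous_within_subset isCont_def subset_UNIV tendsto_within_subset)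
   from filterlim_tendsto_add_at_bot_iff[OF this, THEN iffD2, OF l1]
   have "filterlim (%x. (u x - ln (norm (F x))) + ln (sin (ka * (tau x - e)) / ka)) at_bot (at y within S)" .
   moreover have "(%x. u x - Uf e x) = (%x. (u x - ln (norm (F x))) + ln (sin (ka * (tau x - e)) / ka))"
    unfolding Uf_def ka_def[symmetric] by (simp add: fun_eq_iff)
   ultimately have "filterlim (%x. u x - Uf e x) at_bot (at y within S)" by simp
   then show ?thesis by (simp add: filterlim_at_bot_dense)
  qed
 qed
 then show ?thesis by simp
qed

lemma solution_le:
 assumes u: "solves_liouville \<Omega> u" and z: "z \<in> \<Omega>"
 shows "u z \<le> Uf 0 z"
proof -
 define b where "b = min (tau z) (c0 - tau z)"
 have b: "b > 0" using tau_bounds[OF z] by (simp add: b_def)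
 have "((%e. Uf e z) \<longlongrightarrow> Uf 0 z) (at_right 0)"
 proof -
  have "0 < sin (pi / c0 * tau z)" using sin_strip(1)[of "tau z"] tau_bounds[OF z] by (simp add: k_def)
  then have "isCont (%e. Uf e z) 0" unfolding Uf_def using F_nz[OF z] c0 by (intro continuous_intros) auto
  then show ?thesis by (simp add: isCont_def filterlim_at_split)
 qed
 moreover have "\<forall>\<^sub>F e in at_right 0. u z \<le> Uf e z"
  unfolding eventually_at_right_field
  using b solution_le_Uf[OF u z] by (intro exI[of _ b]) (auto simp: b_def)
 ultimately show ?thesis by (intro tendsto_lowerbound[of "%e. Uf e z"]) auto
qed

text \<open>Both functions blow up and no rate is known for \<open>u\<close>, so their difference
  has no boundary control. A bounded increasing function of \<open>U\<close> does have it, and the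
  difference of the Laplacians is still positive wherever that function exceeds
  \<open>u + K\<close>; the excess of \<open>K\<close> over the shift \<open>m\<close> vanishes in
  the limit.\<close>

lemma solution_ge:
 assumes u: "solves_liouville \<Omega> u" and blow: "blows_up_at_boundary \<Omega> u" and z: "z \<in> \<Omega>"
 shows "Uf 0 z \<le> u z"
proof -
 obtain C where C: "C > 0" "\<And>z. z \<in> \<Omega> ==> \<exists>p1 p2. has_laplacian (Uf 0) z p1 p2 (exp (2 * Uf 0 z)) \<and>
   p1\<^sup>2 + p2\<^sup>2 \<le> C * exp (2 * Uf 0 z)"
  using laplacian_Uf0 by blast
 obtain m where m: "\<And>z. z \<in> \<Omega> ==> - m \<le> Uf 0 z" using Uf0_lower by blast
 have contu: "continuous_on \<Omega> u"
  by (rule continuous_at_imp_continuous_on) (metis solves_liouville_laplacian[OF u open\<Omega>])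
 \<comment> \<open>Truncating \<open>U\<close> by the bounded function \<open>x / (1 + dt x)\<close> costs only a factor \<open>1 - O(dt)\<close> in the
  differential inequality, because the gradient of \<open>U\<close> is \<open>O(exp U)\<close>.\<close>
 have main: "(Uf 0 z + m) / (1 + dt * (Uf 0 z + m)) - u z \<le> m + 2 * dt - ln (1 - 2 * dt * C) / 2"
  if dt: "0 < dt" "dt \<le> 1/2" "2 * dt * C < 1" for dt
 proof -
  \<comment> \<open>Collects the shift \<open>m\<close>, the loss \<open>2 * dt\<close> in
    \<open>lnY\<close>, and half the logarithm of the factor lost in the differential
    inequality.\<close>
  define K where "K = m + 2 * dt - ln (1 - 2 * dt * C) / 2"
  define X where "X x = Uf 0 x + m" for x
  have X0: "X x \<ge> 0" if "x \<in> \<Omega>" for x using m[OF that] by (simp add: X_def)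
  define \<Phi> where "\<Phi> x = x / (1 + dt * x)" for x
  define \<Phi>' where "\<Phi>' x = 1 / (1 + dt * x)\<^sup>2" for x
  have d1: "(\<Phi> has_real_derivative \<Phi>' x) (at x)" if "1 + dt * x > 0" for x
   unfolding \<Phi>_def \<Phi>'_def using that by (auto intro!: derivative_eq_intros simp: field_simps power2_eq_square)
  have d2: "(\<Phi>' has_real_derivative - 2 * dt / (1 + dt * x) ^ 3) (at x)" if "1 + dt * x > 0" for x
  proof -
   define q where "q = 1 + dt * x"
   have q: "q > 0" using that by (simp add: q_def)
   have "((%x. (1 + dt * x)\<^sup>2) has_real_derivative 2 * q * dt) (at x)"
    by (auto intro!: derivative_eq_intros simp: q_def)
   then have "((%x. inverse ((1 + dt * x)\<^sup>2)) has_real_derivative - (inverse (q\<^sup>2) * (2 * q * dt) * inverse (q\<^sup>2))) (at x)"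
    using DERIV_inverse'[of "%x. (1 + dt * x)\<^sup>2" "2 * q * dt" x UNIV] q by (simp add: q_def)
   moreover have "- (inverse (q\<^sup>2) * (2 * q * dt) * inverse (q\<^sup>2)) = - 2 * dt / q ^ 3"
    using q by (simp add: field_simps eval_nat_numeral)
   ultimately show ?thesis by (simp add: \<Phi>'_def[abs_def] q_def inverse_eq_divide)
  qed
  have pos: "1 + dt * x > 0" if "x \<ge> 0" for x using that dt by (simp add: add_pos_nonneg)
  have "\<Phi> (X z) - u z - K \<le> 0"
  proof (rule max_principle[of \<Omega> "%z. \<Phi> (X z) - u z - K"])
   show "continuous_on \<Omega> (%z. \<Phi> (X z) - u z - K)"
    unfolding \<Phi>_def X_def
    by (intro continuous_intros cont_Uf0 contu) (use pos X0 in \<open>auto simp: X_def less_imp_neq[symmetric]\<close>)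
   show "\<forall>\<^sub>F x in at y within \<Omega>. \<Phi> (X x) - u x - K < e" if y: "y \<in> frontier \<Omega>" and e: "e > 0" for y e
   proof -
    have "filterlim u at_top (at y within \<Omega>)" using blow y by (simp add: blows_up_at_boundary_def)
    then have "\<forall>\<^sub>F x in at y within \<Omega>. 1 / dt - K - e < u x" by (simp add: filterlim_at_top_dense)
    moreover have "\<forall>\<^sub>F x in at y within \<Omega>. x \<in> \<Omega>" by (simp add: eventually_at_filter)
    ultimately show ?thesis
    proof eventually_elim
     case (elim x)
     have "\<Phi> (X x) \<le> 1 / dt"
      using pos[OF X0[OF elim(2)]] dt by (simp add: \<Phi>_def field_simps)
     then show ?case using elim(1) by linarith
    qed
   qed
   show "\<exists>p1 p2 l. has_laplacian (%z. \<Phi> (X z) - u z - K) x p1 p2 l \<and> 0 < l"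
    if x: "x \<in> \<Omega>" and w: "0 < \<Phi> (X x) - u x - K" for x
   proof -
    obtain q1 q2 where q: "has_laplacian u x q1 q2 (exp (2 * u x))" by (rule solves_liouville_laplacian[OF u open\<Omega> x])
    obtain p1 p2 where p: "has_laplacian (Uf 0) x p1 p2 (exp (2 * Uf 0 x))" "p1\<^sup>2 + p2\<^sup>2 \<le> C * exp (2 * Uf 0 x)"
     using C(2)[OF x] by blast
    have pX: "has_laplacian X x p1 p2 (exp (2 * Uf 0 x))"
     unfolding X_def by (rule has_laplacian_add_const[OF p(1)])
    define Y where "Y = 1 + dt * X x"
    have Y: "Y \<ge> 1" using X0[OF x] dt by (simp add: Y_def)
    have ev: "\<forall>\<^sub>F t in nhds (X x). (\<Phi> has_real_derivative \<Phi>' t) (at t)"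
    proof -
     have "open {t. 0 < 1 + dt * t}" by (intro open_Collect_less continuous_intros)
     then have "\<forall>\<^sub>F t in nhds (X x). t \<in> {t. 0 < 1 + dt * t}"
      using pos[OF X0[OF x]] by (intro eventually_nhds_in_open) auto
     then show ?thesis by eventually_elim (auto intro: d1)
    qed
    define l where "l = - 2 * dt / Y ^ 3 * (p1\<^sup>2 + p2\<^sup>2) + \<Phi>' (X x) * exp (2 * Uf 0 x)"
    have L: "has_laplacian (%z. \<Phi> (X z)) x (\<Phi>' (X x) * p1) (\<Phi>' (X x) * p2) l"
     unfolding l_def Y_def by (rule has_laplacian_compose[OF pX ev d2[OF pos[OF X0[OF x]]]])
    have "has_laplacian (%z. \<Phi> (X z) - u z - K) x (\<Phi>' (X x) * p1 - q1) (\<Phi>' (X x) * p2 - q2) (l - exp (2 * u x))"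
     using has_laplacian_add_const[OF has_laplacian_diff[OF L q], of "- K"] by simp
    moreover have "l - exp (2 * u x) > 0"
    proof -
     define E where "E = exp (2 * Uf 0 x)"
     have E: "E > 0" by (simp add: E_def)
     have "2 * dt / Y ^ 3 * (p1\<^sup>2 + p2\<^sup>2) \<le> 2 * dt / Y\<^sup>2 * (C * E)"
     proof (rule mult_mono)
      show "2 * dt / Y ^ 3 \<le> 2 * dt / Y\<^sup>2" using Y dt by (intro divide_left_mono power_increasing) auto
     qed (use p(2) dt Y in \<open>auto simp: E_def\<close>)
     moreover have "l = - (2 * dt / Y ^ 3 * (p1\<^sup>2 + p2\<^sup>2)) + E / Y\<^sup>2"
      unfolding l_def \<Phi>'_def Y_def[symmetric] E_def[symmetric] by simp
     moreover have "(1 - 2 * dt * C) * E / Y\<^sup>2 = E / Y\<^sup>2 - 2 * dt / Y\<^sup>2 * (C * E)"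
      by (simp add: algebra_simps diff_divide_distrib)
     ultimately have "l \<ge> (1 - 2 * dt * C) * E / Y\<^sup>2" by linarith
     moreover have "exp (2 * u x) < (1 - 2 * dt * C) * E / Y\<^sup>2"
     proof -
      \<comment> \<open>The derivative of \<open>\<Phi>\<close> at \<open>X\<close> is
        \<open>1 / Y\<^sup>2\<close>. This bound says that \<open>\<Phi> X\<close> falls below
        \<open>X\<close> by at least \<open>ln Y\<close>, up to \<open>2 * dt\<close>, so
        \<open>exp (2 * \<Phi> X)\<close> is dominated by
        \<open>exp (2 * X) / Y\<^sup>2\<close>.\<close>
      have lnY: "ln Y \<le> X x - \<Phi> (X x) + 2 * dt"
      proof -
       define y where "y = dt * X x"
       have y: "y \<ge> 0" "Y = 1 + y" "X x = y / dt" using X0[OF x] dt by (auto simp: y_def Y_def)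
       have e: "X x - \<Phi> (X x) = y / dt * (y / (1 + y))"
       proof -
        have "y / (1 + y) = 1 - 1 / (1 + y)" using y by (simp add: field_simps)
        then have "t * (y / (1 + y)) = t - t / (1 + y)" for t by (simp add: right_diff_distrib)
        from this[of "y / dt", symmetric] show ?thesis
         unfolding \<Phi>_def Y_def[symmetric] y(2) unfolding y(3) .
       qed
       have ln: "ln Y \<le> y" using y ln_add_one_self_le_self[of y] by simp
       show ?thesis
       proof (cases "y \<le> 2 * dt")
        case True
        have "y / dt * (y / (1 + y)) \<ge> 0" using y dt by simp
        then show ?thesis using True ln e by linarith
       next
        case False
        have "y \<le> y / dt * (y / (1 + y))"
        proof -
         have "dt * (1 + y) \<le> y"
         proof -
          have "dt * y \<le> 1/2 * y" using dt y by (intro mult_right_mono) auto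
          then show ?thesis using False by (simp add: distrib_left)
         qed
         then have "y * (dt * (1 + y)) \<le> y * y" using y by (intro mult_left_mono) auto
         moreover have "dt * (1 + y) > 0" using dt y by simp
         ultimately have "y \<le> y * y / (dt * (1 + y))" by (simp only: pos_le_divide_eq)
         then show ?thesis by simp
        qed
        then show ?thesis using ln e dt by linarith
       qed
      qed
      have "2 * u x < 2 * (X x - m) - 2 * ln Y + ln (1 - 2 * dt * C)"
      proof -
       define lam where "lam = ln (1 - 2 * dt * C)"
       show ?thesis using w lnY unfolding K_def lam_def[symmetric] by argo
      qed
      then have "exp (2 * u x) < exp (2 * Uf 0 x - 2 * ln Y + ln (1 - 2 * dt * C))" by (simp add: X_def)
      also have "\<dots> = E / (exp (ln Y))\<^sup>2 * (1 - 2 * dt * C)"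
       using dt by (simp add: exp_add exp_diff E_def exp_double)
      also have "\<dots> = (1 - 2 * dt * C) * E / Y\<^sup>2" using Y by simp
      finally show ?thesis .
     qed
     ultimately show ?thesis by linarith
    qed
    ultimately show ?thesis by blast
   qed
  qed (use open\<Omega> bounded\<Omega> z in auto)
  then show ?thesis by (simp add: \<Phi>_def X_def K_def)
 qed
 define x where "x = Uf 0 z + m"
 have x: "x \<ge> 0" using m[OF z] by (simp add: x_def)
 have "((%dt. x / (1 + dt * x) - u z) \<longlongrightarrow> x / (1 + 0 * x) - u z) (at_right 0)"
  by (intro tendsto_intros) auto
 moreover have "((%dt. m + 2 * dt - ln (1 - 2 * dt * C) / 2) \<longlongrightarrow> m + 2 * 0 - ln (1 - 2 * 0 * C) / 2) (at_right 0)"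
  by (intro tendsto_intros) auto
 moreover have "\<forall>\<^sub>F dt in at_right 0. x / (1 + dt * x) - u z \<le> m + 2 * dt - ln (1 - 2 * dt * C) / 2"
  unfolding eventually_at_right_field
 proof (intro exI[of _ "min (1/2) (1 / (2 * C))"] conjI allI impI)
  show "0 < min (1/2) (1 / (2 * C))" using C by simp
  fix dt assume "0 < dt" "dt < min (1/2) (1 / (2 * C))"
  then show "x / (1 + dt * x) - u z \<le> m + 2 * dt - ln (1 - 2 * dt * C) / 2"
   unfolding x_def using C(1) by (intro main) (auto simp: field_simps)
 qed
 ultimately have "x / (1 + 0 * x) - u z \<le> m + 2 * 0 - ln (1 - 2 * 0 * C) / 2"
  by (intro tendsto_le[of "at_right 0"]) auto
 then show ?thesis by (simp add: x_def)
qed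

theorem conformal_factor_strip:
 assumes "solves_liouville \<Omega> u" "blows_up_at_boundary \<Omega> u" "ze \<in> strip"
 shows "exp (- u (G ze)) = norm (deriv G ze) * (sin (k * Im ze) / k)"
 using solution_le[OF assms(1) G_in[OF assms(3)]] solution_ge[OF assms(1,2) G_in[OF assms(3)]]
  exp_Uf0_G[OF assms(3)] by (metis order_antisym)

end

section \<open>Boundary correspondence\<close>

lemma infdist_Un_cases:
 fixes A B :: "complex set"
 assumes "compact A" "compact B" "A \<noteq> {}" "B \<noteq> {}" "infdist z (A \<union> B) < d"
 shows "infdist z A < d \<or> infdist z B < d"
proof -
 obtain y where "y \<in> A \<union> B" "infdist z (A \<union> B) = dist z y"
  using infdist_attains_inf[of "A \<union> B" z] assms compact_imp_closed by blast
 then show ?thesis using assms(5) infdist_le[of y A z] infdist_le[of y B z] by auto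
qed

lemma infdist_pos_compact:
 fixes K A :: "complex set"
 assumes "compact K" "closed A" "A \<noteq> {}" "K \<inter> A = {}"
 obtains d where "d > 0" "\<And>z. z \<in> K ==> d \<le> infdist z A"
proof (cases "K = {}")
 case False
 obtain x where x: "x \<in> K" "\<And>z. z \<in> K ==> infdist x A \<le> infdist z A"
  using continuous_attains_inf[OF assms(1) False, of "%z. infdist z A"]
   continuous_on_infdist[OF continuous_on_id, of K A] by blast
 have "infdist x A > 0" using infdist_pos_not_in_closed[OF assms(2,3)] x assms(4) by blast
 then show ?thesis using that x by blast
qed (use that[of 1] in auto)

text \<open>Each end of the annular domain is connected, so it can accumulate at only one of the two
 boundary pieces; both pieces are reached, hence the ends and the pieces correspond.\<close>

lemma ends_correspond:
 fixes T :: "complex \<Rightarrow> real" and c :: real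
 assumes op: "open \<Omega>" and bd: "bounded \<Omega>" and cT: "continuous_on \<Omega> T" and c: "c > 0"
  and T: "\<And>z. z \<in> \<Omega> ==> 0 < T z \<and> T z < c"
  and lev: "\<And>e. 0 < e ==> compact {z \<in> \<Omega>. e \<le> T z \<and> T z \<le> c - e}"
  and con: "\<And>e. 0 < e ==> e \<le> c ==> connected {z \<in> \<Omega>. T z < e}" "\<And>e. 0 < e ==> e \<le> c ==> connected {z \<in> \<Omega>. c - e < T z}"
  and fr: "frontier \<Omega> = A \<union> B" and AB: "compact A" "compact B" "A \<noteq> {}" "B \<noteq> {}" "A \<inter> B = {}"
 shows "((\<forall>e>0. \<exists>d>0. \<forall>z\<in>\<Omega>. infdist z A < d \<longrightarrow> T z < e) \<and> (\<forall>d>0. \<exists>e>0. \<forall>z\<in>\<Omega>. T z < e \<longrightarrow> infdist z A < d) \<and>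
     (\<forall>e>0. \<exists>d>0. \<forall>z\<in>\<Omega>. infdist z B < d \<longrightarrow> c - e < T z))
    \<or> ((\<forall>e>0. \<exists>d>0. \<forall>z\<in>\<Omega>. infdist z A < d \<longrightarrow> c - e < T z) \<and> (\<forall>d>0. \<exists>e>0. \<forall>z\<in>\<Omega>. c - e < T z \<longrightarrow> infdist z A < d) \<and>
     (\<forall>e>0. \<exists>d>0. \<forall>z\<in>\<Omega>. infdist z B < d \<longrightarrow> T z < e))"
proof -
 have clA: "closed A" and clB: "closed B" using AB compact_imp_closed by blast+
 have clF: "closed (A \<union> B)" "A \<union> B \<noteq> {}" using clA clB AB by auto
 \<comment> \<open>Near an end of \<open>T\<close> means near the frontier: points at distance at
   least \<open>d\<close> from the frontier form a compact set, on which \<open>T\<close> keeps away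
   from 0 and \<open>c\<close>.\<close>
 have P1: "\<exists>e>0. e \<le> c \<and> (\<forall>z\<in>\<Omega>. T z < e \<or> c - e < T z \<longrightarrow> infdist z (A \<union> B) < d)" if d: "d > 0" for d
 proof -
  define K where "K = {z \<in> \<Omega>. d \<le> infdist z (A \<union> B)}"
  have Keq: "K = closure \<Omega> \<inter> {z. d \<le> infdist z (A \<union> B)}"
  proof -
   have "z \<in> \<Omega>" if "z \<in> closure \<Omega>" "d \<le> infdist z (A \<union> B)" for z
   proof (rule ccontr)
    assume "z \<notin> \<Omega>"
    then have "z \<in> A \<union> B" using that(1) fr op by (auto simp: frontier_def interior_open)
    then have "infdist z (A \<union> B) = 0" by simp
    then show False using that(2) d by simp
   qed
   then show ?thesis using closure_subset by (auto simp: K_def)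
  qed
  have "closed {z. d \<le> infdist z (A \<union> B)}" by (intro closed_Collect_le continuous_intros)
  then have cK: "compact K" unfolding Keq using bd by (intro compact_Int_closed) (auto simp: compact_closure)
  show ?thesis
  proof (cases "K = {}")
   case True
   then show ?thesis using c by (intro exI[of _ c]) (force simp: K_def not_le)
  next
   case False
   have cTK: "continuous_on K T" using cT by (rule continuous_on_subset) (auto simp: K_def)
   obtain x where x: "x \<in> K" "\<And>z. z \<in> K ==> T x \<le> T z" using continuous_attains_inf[OF cK False cTK] by blast
   obtain y where y: "y \<in> K" "\<And>z. z \<in> K ==> T z \<le> T y" using continuous_attains_sup[OF cK False cTK] by blast
   have Tx: "0 < T x" "T x < c" and Ty: "0 < T y" "T y < c" using x(1) y(1) T by (auto simp: K_def)
   define e where "e = min (T x) (c - T y)"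
   have e: "e > 0" "e \<le> c" using Tx Ty by (auto simp: e_def)
   have "infdist z (A \<union> B) < d" if "z \<in> \<Omega>" "T z < e \<or> c - e < T z" for z
   proof (rule ccontr)
    assume "\<not> infdist z (A \<union> B) < d"
    then have "z \<in> K" using that by (simp add: K_def)
    then show False using x(2)[of z] y(2)[of z] that(2) by (auto simp: e_def)
   qed
   then show ?thesis using e by blast
  qed
 qed
 \<comment> \<open>The converse: the middle levels are compact inside \<open>\<Omega>\<close>, hence
   at positive distance from the frontier.\<close>
 have P2: "\<exists>d>0. \<forall>z\<in>\<Omega>. infdist z (A \<union> B) < d \<longrightarrow> T z < e \<or> c - e < T z" if e: "e > 0" for e
 proof -
  have "{z \<in> \<Omega>. e \<le> T z \<and> T z \<le> c - e} \<inter> (A \<union> B) = {}"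
   using fr[symmetric] op by (auto simp: frontier_def interior_open)
  then obtain d where d: "d > 0" "\<And>z. z \<in> {z \<in> \<Omega>. e \<le> T z \<and> T z \<le> c - e} ==> d \<le> infdist z (A \<union> B)"
   using infdist_pos_compact[OF lev[OF e] clF] by blast
  show ?thesis
  proof (intro exI[of _ d] conjI ballI impI)
   fix z assume z: "z \<in> \<Omega>" "infdist z (A \<union> B) < d"
   show "T z < e \<or> c - e < T z" using d(2)[of z] z by force
  qed (rule d)
 qed
 \<comment> \<open>Half the separation of the two pieces makes their neighbourhoods of size
   \<open>d0\<close> disjoint, as needed for the connectedness argument.\<close>
 obtain d1 where d1: "d1 > 0" "\<And>z. z \<in> A ==> d1 \<le> infdist z B"
  using infdist_pos_compact[OF AB(1) clB AB(4,5)] by blast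
 define d0 where "d0 = d1 / 2"
 have d0: "d0 > 0" using d1 by (simp add: d0_def)
 have excl: "\<not> (infdist z A < d0 \<and> infdist z B < d0)" for z
 proof
  assume a: "infdist z A < d0 \<and> infdist z B < d0"
  obtain x where x: "x \<in> A" "infdist z A = dist z x" using infdist_attains_inf[OF clA AB(3)] by metis
  have "infdist x B \<le> infdist z B + dist x z" by (rule infdist_triangle)
  then show False using d1(2)[OF x(1)] a x(2) by (simp add: d0_def dist_commute)
 qed
 obtain e0 where e0: "e0 > 0" "e0 \<le> c" "\<And>z. z \<in> \<Omega> ==> T z < e0 \<or> c - e0 < T z ==> infdist z (A \<union> B) < d0"
  using P1[OF d0] by blast
 have side: "(\<forall>z\<in>E. infdist z A < d0) \<or> (\<forall>z\<in>E. infdist z B < d0)"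
  if E: "connected E" "\<And>z. z \<in> E ==> infdist z (A \<union> B) < d0" for E
 proof -
  have oA: "open {z. infdist z A < d0}" and oB: "open {z. infdist z B < d0}"
   by (intro open_Collect_less continuous_intros)+
  have "E \<subseteq> {z. infdist z A < d0} \<union> {z. infdist z B < d0}"
   using E(2) infdist_Un_cases[OF AB(1-4)] by blast
  moreover have "{z. infdist z A < d0} \<inter> {z. infdist z B < d0} \<inter> E = {}" using excl by auto
  ultimately have "{z. infdist z A < d0} \<inter> E = {} \<or> {z. infdist z B < d0} \<inter> E = {}"
   using E(1) oA oB unfolding connected_def by blast
  then show ?thesis using \<open>E \<subseteq> _\<close> by blast
 qed
 \<comment> \<open>Both pieces lie in the closure of \<open>\<Omega>\<close>, so neither can be
   missed by both ends; this rules out that the two ends accumulate at the same piece.\<close>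
 have reach: "\<exists>z\<in>\<Omega>. infdist z X < d0 \<and> (T z < e0 \<or> c - e0 < T z)" if X: "X \<noteq> {}" "X \<subseteq> A \<union> B" for X
 proof -
  obtain x where x: "x \<in> X" using X by auto
  obtain d where d: "d > 0" "\<And>z. z \<in> \<Omega> ==> infdist z (A \<union> B) < d ==> T z < e0 \<or> c - e0 < T z"
   using P2[OF e0(1)] by blast
  have "x \<in> closure \<Omega>" using x X(2) fr by (auto simp: frontier_def)
  then obtain z where z: "z \<in> \<Omega>" "dist z x < min d d0"
   using d d0 unfolding closure_approachable by (metis min_less_iff_conj)
  have "infdist z X < d0" "infdist z (A \<union> B) < d"
   using z(2) infdist_le[OF x, of z] infdist_le[of x "A \<union> B" z] x X(2) by auto
  then show ?thesis using d(2) z(1) by blast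
 qed
 \<comment> \<open>the consequences of a matching, for \<open>T\<close> as well as for \<open>c - T\<close>\<close>
 have near: "(\<forall>e>0. \<exists>d>0. \<forall>z\<in>\<Omega>. infdist z X < d \<longrightarrow> t z < e) \<and> (\<forall>d>0. \<exists>e>0. \<forall>z\<in>\<Omega>. t z < e \<longrightarrow> infdist z X < d)"
  if XY: "A \<union> B = X \<union> Y" "compact X" "compact Y" "X \<noteq> {}" "Y \<noteq> {}" and ex: "\<And>z. \<not> (infdist z X < d0 \<and> infdist z Y < d0)"
   and t: "\<And>e z. T z < e \<or> c - e < T z \<longleftrightarrow> t z < e \<or> c - e < t z"
   and EX: "\<forall>z\<in>\<Omega>. t z < e0 \<longrightarrow> infdist z X < d0" and EY: "\<forall>z\<in>\<Omega>. c - e0 < t z \<longrightarrow> infdist z Y < d0" for X Y t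
 proof (intro conjI allI impI)
  fix e :: real assume e: "e > 0"
  obtain d where d: "d > 0" "\<And>z. z \<in> \<Omega> ==> infdist z (A \<union> B) < d ==> T z < min e e0 \<or> c - min e e0 < T z"
   using P2[of "min e e0"] e e0 by (metis min_less_iff_conj)
  show "\<exists>d>0. \<forall>z\<in>\<Omega>. infdist z X < d \<longrightarrow> t z < e"
  proof (intro exI[of _ "min d d0"] conjI ballI impI)
   fix z assume z: "z \<in> \<Omega>" "infdist z X < min d d0"
   have "infdist z (A \<union> B) \<le> infdist z X" unfolding XY(1) using XY(4) by (intro infdist_mono) auto
   then have "t z < min e e0 \<or> c - min e e0 < t z" using d(2)[OF z(1)] z(2) t by (metis le_less_trans min_less_iff_conj)
   moreover have "\<not> c - e0 < t z" using EY z ex by auto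
   ultimately show "t z < e" by auto
  qed (use d d0 in auto)
 next
  fix d :: real assume d: "d > 0"
  obtain e where e: "e > 0" "\<And>z. z \<in> \<Omega> ==> T z < e \<or> c - e < T z ==> infdist z (A \<union> B) < min d d0"
   using P1[of "min d d0"] d d0 by (metis min_less_iff_conj)
  show "\<exists>e>0. \<forall>z\<in>\<Omega>. t z < e \<longrightarrow> infdist z X < d"
  proof (intro exI[of _ "min e e0"] conjI ballI impI)
   fix z assume z: "z \<in> \<Omega>" "t z < min e e0"
   then have "infdist z (X \<union> Y) < min d d0" using e(2)[OF z(1)] t XY(1) by (metis min_less_iff_conj)
   then have "infdist z X < min d d0 \<or> infdist z Y < min d d0" using infdist_Un_cases XY by blast
   moreover have "\<not> infdist z Y < d0" using EX z ex by auto
   ultimately show "infdist z X < d" by auto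
  qed (use e e0 in auto)
 qed
 define E0 where "E0 = {z \<in> \<Omega>. T z < e0}"
 define E1 where "E1 = {z \<in> \<Omega>. c - e0 < T z}"
 have s0: "(\<forall>z\<in>E0. infdist z A < d0) \<or> (\<forall>z\<in>E0. infdist z B < d0)"
  by (rule side) (use con(1)[OF e0(1,2)] e0(3) in \<open>auto simp: E0_def\<close>)
 have s1: "(\<forall>z\<in>E1. infdist z A < d0) \<or> (\<forall>z\<in>E1. infdist z B < d0)"
  by (rule side) (use con(2)[OF e0(1,2)] e0(3) in \<open>auto simp: E1_def\<close>)
 obtain zA where zA: "zA \<in> E0 \<union> E1" "infdist zA A < d0" using reach[of A] AB by (auto simp: E0_def E1_def)
 obtain zB where zB: "zB \<in> E0 \<union> E1" "infdist zB B < d0" using reach[of B] AB by (auto simp: E0_def E1_def)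
 have cases: "(\<forall>z\<in>E0. infdist z A < d0) \<and> (\<forall>z\<in>E1. infdist z B < d0) \<or> (\<forall>z\<in>E0. infdist z B < d0) \<and> (\<forall>z\<in>E1. infdist z A < d0)"
  using s0 s1 zA zB excl by blast
 have ex2: "\<not> (infdist z B < d0 \<and> infdist z A < d0)" for z using excl[of z] by blast
 have t2: "T z < e \<or> c - e < T z \<longleftrightarrow> c - T z < e \<or> c - e < c - T z" for e z by auto
 from cases show ?thesis
 proof
  assume a: "(\<forall>z\<in>E0. infdist z A < d0) \<and> (\<forall>z\<in>E1. infdist z B < d0)"
  have n1: "(\<forall>e>0. \<exists>d>0. \<forall>z\<in>\<Omega>. infdist z A < d \<longrightarrow> T z < e) \<and> (\<forall>d>0. \<exists>e>0. \<forall>z\<in>\<Omega>. T z < e \<longrightarrow> infdist z A < d)"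
   by (rule near[of A B T]) (use a AB excl in \<open>auto simp: E0_def E1_def\<close>)
  have "(\<forall>e>0. \<exists>d>0. \<forall>z\<in>\<Omega>. infdist z B < d \<longrightarrow> c - T z < e)"
   by (rule conjunct1[OF near[of B A "%z. c - T z"]]) (use a AB ex2 t2 in \<open>auto simp: E0_def E1_def\<close>)
  then have "(\<forall>e>0. \<exists>d>0. \<forall>z\<in>\<Omega>. infdist z B < d \<longrightarrow> c - e < T z)" by (simp add: algebra_simps)
  then show ?thesis using n1 by blast
 next
  assume a: "(\<forall>z\<in>E0. infdist z B < d0) \<and> (\<forall>z\<in>E1. infdist z A < d0)"
  have n1: "(\<forall>e>0. \<exists>d>0. \<forall>z\<in>\<Omega>. infdist z B < d \<longrightarrow> T z < e)"
   by (rule conjunct1[OF near[of B A T]]) (use a AB ex2 in \<open>auto simp: E0_def E1_def\<close>)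
  have "(\<forall>e>0. \<exists>d>0. \<forall>z\<in>\<Omega>. infdist z A < d \<longrightarrow> c - T z < e) \<and> (\<forall>d>0. \<exists>e>0. \<forall>z\<in>\<Omega>. c - T z < e \<longrightarrow> infdist z A < d)"
   by (rule near[of A B "%z. c - T z"]) (use a AB excl t2 in \<open>auto simp: E0_def E1_def\<close>)
  then have "(\<forall>e>0. \<exists>d>0. \<forall>z\<in>\<Omega>. infdist z A < d \<longrightarrow> c - e < T z) \<and> (\<forall>d>0. \<exists>e>0. \<forall>z\<in>\<Omega>. c - e < T z \<longrightarrow> infdist z A < d)"
   by (simp add: algebra_simps)
  then show ?thesis using n1 by blast
 qed
qed

text \<open>The complement has exactly one unbounded component \<open>K0\<close>, because its own
  complement is bounded. The two components are closed and disjoint, so the frontier of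
  \<open>\<Omega>\<close> is the disjoint union of theirs.\<close>

lemma doubly_connected_frontier:
 assumes "doubly_connected_domain \<Omega>" "bounded \<Omega>"
 obtains K0 B where "outer_boundary \<Omega> = frontier K0" "K0 \<in> components (- \<Omega>)" "\<not> bounded K0"
  "frontier \<Omega> = outer_boundary \<Omega> \<union> B" "compact (outer_boundary \<Omega>)" "compact B"
  "outer_boundary \<Omega> \<noteq> {}" "B \<noteq> {}" "outer_boundary \<Omega> \<inter> B = {}"
proof -
 have op: "open \<Omega>" and ne: "\<Omega> \<noteq> {}" and card: "card (components (- \<Omega>)) = 2"
  using assms(1) by (auto simp: doubly_connected_domain_def)
 obtain K0 where K0: "K0 \<in> components (- \<Omega>)" "\<not> bounded K0"
  using cobounded_unbounded_components[of "- \<Omega>"] assms(2) by auto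
 obtain K1 where K1: "components (- \<Omega>) = {K0, K1}" "K0 \<noteq> K1"
  using card K0(1) by (metis card_2_iff doubleton_eq_iff insert_iff singletonD)
 have b1: "bounded K1"
 proof (rule ccontr)
  assume "\<not> bounded K1"
  then have "K0 = K1"
   using cobounded_unique_unbounded_components[of "- \<Omega>" K0 K1] K0 K1 assms(2) by simp
  then show False using K1 by simp
 qed
 have ob: "outer_boundary \<Omega> = frontier K0"
 proof -
  have "{K \<in> components (- \<Omega>). \<not> bounded K} = {K0}" using K0 K1 b1 by auto
  then show ?thesis by (simp add: outer_boundary_def)
 qed
 have cl: "closed K0" "closed K1" using closed_components[of "- \<Omega>"] op K1 by auto
 have dj: "K0 \<inter> K1 = {}" using pairwise_disjoint_components[of "- \<Omega>"] K1 by (auto simp: pairwise_def disjnt_def)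
 have un: "- \<Omega> = K0 \<union> K1" using Union_components[of "- \<Omega>"] K1 by auto
 \<comment> \<open>Near a point of a closed set a disjoint closed set is absent, so adding it does
   not turn frontier points into interior ones.\<close>
 have sub: "frontier X \<subseteq> frontier (X \<union> Y)" if "closed X" "closed Y" "X \<inter> Y = {}" for X Y :: "complex set"
 proof
  fix x assume x: "x \<in> frontier X"
  then have xX: "x \<in> X" "x \<notin> interior X" using that(1) by (auto simp: frontier_def)
  have "x \<notin> interior (X \<union> Y)"
  proof
   assume "x \<in> interior (X \<union> Y)"
   then have "x \<in> interior (X \<union> Y) - Y" using xX that(3) by auto
   moreover have "open (interior (X \<union> Y) - Y)" using that(2) by (simp add: open_Diff)
   moreover have "interior (X \<union> Y) - Y \<subseteq> X" using interior_subset by blast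
   ultimately have "x \<in> interior X" using interior_maximal by blast
   then show False using xX by simp
  qed
  then show "x \<in> frontier (X \<union> Y)" using xX(1) closure_subset by (auto simp: frontier_def)
 qed
 have fr: "frontier \<Omega> = frontier K0 \<union> frontier K1"
 proof -
  have "frontier \<Omega> = frontier (K0 \<union> K1)" by (metis frontier_complement un)
  moreover have "frontier (K0 \<union> K1) \<subseteq> frontier K0 \<union> frontier K1" by (rule frontier_Un_subset)
  moreover have "frontier K0 \<subseteq> frontier (K0 \<union> K1)" by (rule sub[OF cl dj])
  moreover have "frontier K1 \<subseteq> frontier (K0 \<union> K1)" using sub[of K1 K0] cl dj by (simp add: Un_commute Int_commute)
  ultimately show ?thesis by blast
 qed
 have bf: "bounded (frontier \<Omega>)" using bounded_closure[OF assms(2)] by (rule bounded_subset) (auto simp: frontier_def)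
 have cp: "compact (frontier K0)" "compact (frontier K1)"
  using bf unfolding fr by (auto simp: compact_eq_bounded_closed)
 have nn: "frontier X \<noteq> {}" if "X \<noteq> {}" "X \<noteq> UNIV" for X :: "complex set" using that frontier_eq_empty by blast
 have "K0 \<noteq> {}" "K1 \<noteq> {}" using in_components_nonempty K1 by blast+
 moreover have "K0 \<noteq> UNIV" "K1 \<noteq> UNIV" using un ne by auto
 ultimately have "frontier K0 \<noteq> {}" "frontier K1 \<noteq> {}" using nn by blast+
 moreover have "frontier K0 \<inter> frontier K1 = {}" using cl dj frontier_subset_closed by blast
 ultimately show ?thesis using that[OF ob K0, of "frontier K1"] fr cp unfolding ob by blast
qed

text \<open>The band is the continuous image under \<open>G\<close> of a convex horizontal
  strip.\<close>

lemma (in annular_domain) connected_level_band: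
 assumes "0 \<le> a" "b \<le> c0" shows "connected {z \<in> \<Omega>. a < tau z \<and> tau z < b}"
proof -
 have "{z \<in> \<Omega>. a < tau z \<and> tau z < b} = G ` ({ze. a < Im ze} \<inter> {ze. Im ze < b})"
 proof (intro equalityI subsetI)
  fix z assume z: "z \<in> {z \<in> \<Omega>. a < tau z \<and> tau z < b}"
  then obtain ze where "ze \<in> strip" "G ze = z" "Im ze = tau z" using G_surj by blast
  then show "z \<in> G ` ({ze. a < Im ze} \<inter> {ze. Im ze < b})" using z by auto
 next
  fix z assume "z \<in> G ` ({ze. a < Im ze} \<inter> {ze. Im ze < b})"
  then obtain ze where ze: "a < Im ze" "Im ze < b" "z = G ze" by auto
  then have "ze \<in> strip" using assms by (auto simp: strip_def)
  then show "z \<in> {z \<in> \<Omega>. a < tau z \<and> tau z < b}" using ze G_in tau_G by auto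
 qed
 moreover have "connected ({ze. a < Im ze} \<inter> {ze. Im ze < b})"
  by (intro convex_connected convex_Int convex_halfspace_Im_gt convex_halfspace_Im_lt)
 moreover have "continuous_on ({ze. a < Im ze} \<inter> {ze. Im ze < b}) G"
  by (rule continuous_on_subset[OF holomorphic_on_imp_continuous_on[OF holG]]) (use assms in \<open>auto simp: strip_def\<close>)
 ultimately show ?thesis by (simp add: connected_continuous_image)
qed

text \<open>\<open>T1\<close>, \<open>T2\<close> and \<open>T3\<close> say that the smooth curve
  corresponds to the end \<open>tau = 0\<close>, that is \<open>|f| = 1\<close>, and the other piece
  \<open>B\<close> to \<open>tau = c0\<close>. The opposite matching is reduced to this one by an
  inversion of the annulus.\<close>

locale annular_collar = annular_domain \<Omega> \<beta> f g + arclength_curve \<gamma> g1 g2 g3 L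
 for \<Omega> \<beta> f g \<gamma> g1 g2 g3 L +
 fixes B :: "complex set"
 assumes fr: "frontier \<Omega> = range \<gamma> \<union> B" and B: "compact B" "range \<gamma> \<inter> B = {}" "B \<noteq> {}"
  and inward: "\<And>s. \<exists>e>0. \<forall>t. 0 < t \<and> t < e \<longrightarrow> \<gamma> s + of_real t * \<i> * g1 s \<in> \<Omega>"
  and T1: "\<And>e. e > 0 ==> \<exists>d>0. \<forall>z\<in>\<Omega>. infdist z (range \<gamma>) < d \<longrightarrow> tau z < e"
  and T2: "\<And>d. d > 0 ==> \<exists>e>0. \<forall>z\<in>\<Omega>. tau z < e \<longrightarrow> infdist z (range \<gamma>) < d"
  and T3: "\<And>e. e > 0 ==> \<exists>d>0. \<forall>z\<in>\<Omega>. infdist z B < d \<longrightarrow> c0 - e < tau z"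
begin

definition npt :: "real \<Rightarrow> real \<Rightarrow> complex" where "npt s x = \<gamma> s + \<i> * of_real x * g1 s"

lemma npt_dist: "dist (npt s x) (npt s y) = \<bar>x - y\<bar>"
proof -
 have "npt s x - npt s y = \<i> * of_real (x - y) * g1 s" by (simp add: npt_def algebra_simps)
 then show ?thesis unfolding dist_norm by (simp only: norm_mult unit norm_of_real) simp
qed

lemma npt_0: "npt s 0 = \<gamma> s" by (simp add: npt_def)

text \<open>The interior disc property follows from the tangent discs and the inward normal. The
  exterior one needs a global argument, since local geometry does not exclude that
  \<open>\<Omega>\<close> lies on both sides of the curve; connectedness of the end
  \<open>tau < e\<close> excludes it.\<close>

lemma collar:
 obtains r where "r > 0"
  "\<And>s. ball (npt s r) r \<subseteq> \<Omega>"
  "\<And>s. ball (npt s (- r)) r \<inter> \<Omega> = {}"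
  "\<And>z. z \<in> \<Omega> ==> infdist z curve < r ==> \<exists>s. z = npt s (infdist z curve)"
  "\<And>s x. \<bar>x\<bar> \<le> r ==> infdist (npt s x) curve = \<bar>x\<bar>"
  "\<And>z. infdist z curve < r ==> infdist z (frontier \<Omega>) = infdist z curve"
  "\<And>s y. y \<in> B ==> 4 * r \<le> dist y (\<gamma> s)"
  "\<And>s t x. \<bar>x\<bar> \<le> r ==> norm (\<gamma> t - npt s x) \<le> \<bar>x\<bar> ==> \<gamma> t = \<gamma> s"
proof -
 obtain r0 where r0: "r0 > 0"
  "\<And>s z x. z \<in> curve ==> \<bar>x\<bar> \<le> r0 ==> \<bar>x\<bar> \<le> norm (z - (\<gamma> s + \<i> * of_real x * g1 s))"
  "\<And>s z x. z \<in> curve ==> \<bar>x\<bar> \<le> r0 ==> norm (z - (\<gamma> s + \<i> * of_real x * g1 s)) \<le> \<bar>x\<bar> ==> z = \<gamma> s"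
  using tangent_balls by blast
 have clB: "closed B" using B compact_imp_closed by blast
 obtain dB where dB: "dB > 0" "\<And>z. z \<in> curve ==> dB \<le> infdist z B"
  using infdist_pos_compact[OF compact_curve clB B(3,2)] by blast
 define r where "r = min r0 (dB / 4)"
 have r: "r > 0" "r \<le> r0" "4 * r \<le> dB" using r0(1) dB(1) by (auto simp: r_def)
 have uniq: "\<gamma> t = \<gamma> s" if "\<bar>x\<bar> \<le> r" "norm (\<gamma> t - npt s x) \<le> \<bar>x\<bar>" for s t x
  using r0(3)[of "\<gamma> t" x s] that r by (auto simp: npt_def)
 have Bfar: "4 * r \<le> dist y (\<gamma> s)" if "y \<in> B" for y s
  using dB(2)[of "\<gamma> s"] infdist_le[OF that, of "\<gamma> s"] r(3) by (auto simp: dist_commute)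
 have idist: "infdist (npt s x) curve = \<bar>x\<bar>" if x: "\<bar>x\<bar> \<le> r" for s x
 proof (rule antisym)
  show "infdist (npt s x) curve \<le> \<bar>x\<bar>" using infdist_le[of "\<gamma> s" curve "npt s x"] npt_dist[of s x 0] by (simp add: npt_0)
  obtain y where y: "y \<in> curve" "infdist (npt s x) curve = dist (npt s x) y"
   using infdist_attains_inf[of curve "npt s x"] compact_curve compact_imp_closed by auto
  show "\<bar>x\<bar> \<le> infdist (npt s x) curve"
   using r0(2)[OF y(1), of x s] x r y(2) by (simp add: npt_def dist_norm norm_minus_commute)
 qed
 have frd: "infdist z (frontier \<Omega>) = infdist z curve" if z: "infdist z curve < r" for z
 proof (rule antisym)
  show "infdist z (frontier \<Omega>) \<le> infdist z curve" unfolding fr by (intro infdist_mono) auto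
  obtain y where y: "y \<in> curve \<union> B" "infdist z (curve \<union> B) = dist z y"
   using infdist_attains_inf[of "curve \<union> B" z] compact_curve clB compact_imp_closed by auto
  show "infdist z curve \<le> infdist z (frontier \<Omega>)"
  proof (cases "y \<in> curve")
   case True then show ?thesis using y fr infdist_le by metis
  next
   case False
   then have yB: "y \<in> B" using y by auto
   obtain w where w: "w \<in> curve" "infdist z curve = dist z w"
    using infdist_attains_inf[of curve z] compact_curve compact_imp_closed by auto
   then obtain s where s: "w = \<gamma> s" by auto
   have "4 * r \<le> dist y z + dist z w" using Bfar[OF yB, of s] dist_triangle[of y "\<gamma> s" z] s by (simp add: dist_commute)
   moreover have "dist z w < r" using w(2) z by simp
   ultimately have "dist z w \<le> dist z y" using r(1) dist_commute[of y z] by linarith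
   then show ?thesis using w(2) y(2) fr by simp
  qed
 qed
 \<comment> \<open>The curve stays outside the tangent disc, and \<open>B\<close> is too far away to
   meet it.\<close>
 have nofr: "ball (npt s x) \<bar>x\<bar> \<inter> frontier \<Omega> = {}" if x: "\<bar>x\<bar> \<le> r" for s x
 proof -
  have False if y: "y \<in> ball (npt s x) \<bar>x\<bar>" "y \<in> frontier \<Omega>" for y
  proof -
   have d: "dist (npt s x) y < \<bar>x\<bar>" using y by simp
   show False
   proof (cases "y \<in> curve")
    case True
    then show False using infdist_le[OF True, of "npt s x"] idist[OF x, of s] d by simp
   next
    case False
    then have "y \<in> B" using y fr by auto
    then have "4 * r \<le> dist y (npt s x) + dist (npt s x) (npt s 0)"
     using Bfar[of y s] dist_triangle[of y "\<gamma> s" "npt s x"] by (simp add: npt_0)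
    then show False using d x r by (simp add: npt_dist dist_commute)
   qed
  qed
  then show ?thesis by blast
 qed
 \<comment> \<open>The disc misses the frontier and contains points of the inward normal, so by
   connectedness it lies in \<open>\<Omega>\<close>.\<close>
 have inO: "ball (npt s x) x \<subseteq> \<Omega>" if x: "0 < x" "x \<le> r" for s x
 proof (rule ccontr)
  assume "\<not> ball (npt s x) x \<subseteq> \<Omega>"
  then have a: "ball (npt s x) x - \<Omega> \<noteq> {}" by blast
  obtain e where e: "e > 0" "\<And>t. 0 < t ==> t < e ==> \<gamma> s + of_real t * \<i> * g1 s \<in> \<Omega>" using inward by blast
  define t where "t = min e x / 2"
  have t: "0 < t" "t < e" "t < x" using e x by (auto simp: t_def)
  have "npt s t \<in> \<Omega>" using e(2)[OF t(1,2)] by (simp add: npt_def mult.commute)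
  moreover have "npt s t \<in> ball (npt s x) x" using t by (simp add: npt_dist)
  ultimately have "ball (npt s x) x \<inter> \<Omega> \<noteq> {}" by blast
  then have "ball (npt s x) x \<inter> frontier \<Omega> \<noteq> {}"
   using connected_Int_frontier[OF connected_ball _ a] by blast
  then show False using nofr[of x s] x by simp
 qed
 have nptO: "npt s x \<in> \<Omega>" if "0 < x" "x \<le> r" for s x using inO[OF that, of s] that by auto
 obtain e1 where e1: "e1 > 0" "\<And>z. z \<in> \<Omega> ==> tau z < e1 ==> infdist z curve < r" using T2[OF r(1)] by blast
 \<comment> \<open>This end of the domain is connected and close to the curve, hence covered by the
   two closed one-sided collars \<open>Fp\<close> and \<open>Fm\<close>.\<close>
 define E where "E = {z \<in> \<Omega>. 0 < tau z \<and> tau z < min e1 c0}"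
 have conE: "connected E" unfolding E_def by (rule connected_level_band) auto
 define Fp where "Fp = (%p. npt (fst p) (snd p)) ` ({0..L} \<times> {0..r})"
 define Fm where "Fm = (%p. npt (fst p) (- snd p)) ` ({0..L} \<times> {0..r})"
 have "compact Fp" "compact Fm"
  unfolding Fp_def Fm_def npt_def
  by (intro compact_continuous_image compact_Times compact_Icc continuous_intros
    continuous_on_compose2[OF cont0[of UNIV]] continuous_on_compose2[OF cont1[of UNIV]] subset_UNIV)+
 then have clF: "closed Fp" "closed Fm" using compact_imp_closed by blast+
 have split: "z \<in> Fp \<or> z \<in> Fm" if z: "infdist z curve < r" for z
 proof -
  obtain s x where sx: "z = \<gamma> s + \<i> * of_real x * g1 s" "\<bar>x\<bar> = infdist z curve" using nearest_point by blast
  define s' where "s' = s + of_int (- \<lfloor>s / L\<rfloor>) * L"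
  have s': "s' \<in> {0..L}"
   using L floor_divide_lower[OF L, of s] floor_divide_upper[OF L, of s] by (simp add: s'_def algebra_simps)
  have zs: "z = npt s' x" using sx(1) unfolding npt_def s'_def shift .
  show ?thesis
  proof (cases "x \<ge> 0")
   case True
   then have "z \<in> Fp" unfolding Fp_def using zs s' sx(2) z by (intro image_eqI[of _ _ "(s', x)"]) auto
   then show ?thesis ..
  next
   case False
   then have "(s', - x) \<in> {0..L} \<times> {0..r}" using s' sx(2) z by simp
   then have "z \<in> Fm" unfolding Fm_def by (rule image_eqI[rotated]) (simp add: zs)
   then show ?thesis ..
  qed
 qed
 have opp: "x = 0" if "npt s x = npt t (- y)" "0 \<le> x" "x \<le> r" "0 \<le> y" "y \<le> r" for s t x y
 proof -
  have xy: "x = y" using idist[of x s] idist[of "- y" t] that by simp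
  have "norm (\<gamma> t - npt s x) \<le> \<bar>x\<bar>"
   using npt_dist[of t 0 "- y"] that xy by (simp add: npt_0 dist_norm)
  then have "\<gamma> t = \<gamma> s" using uniq[of x t s] that by simp
  then have "g1 t = g1 s" by (rule frame_eq)
  then have "npt t (- y) = npt s (- x)" using \<open>\<gamma> t = \<gamma> s\<close> xy by (simp add: npt_def)
  then have "dist (npt s x) (npt s (- x)) = 0" using that(1) by simp
  then show ?thesis by (simp add: npt_dist)
 qed
 have curve\<Omega>: "z \<notin> \<Omega>" if "z \<in> curve" for z
  using that fr open\<Omega> by (auto simp: frontier_def interior_open)
 \<comment> \<open>The two collars meet only on the curve, which is outside \<open>\<Omega>\<close>;
   so the connected set \<open>E\<close> lies in one of them, and it contains points of the inner
   side.\<close>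
 have EFp: "E \<subseteq> Fp"
 proof -
  have "Fp \<inter> Fm \<inter> E = {}"
  proof -
   have False if z: "z \<in> Fp" "z \<in> Fm" "z \<in> E" for z
   proof -
    obtain s x where "z = npt s x" "0 \<le> x" "x \<le> r" using z(1) by (auto simp: Fp_def)
    moreover obtain t y where "z = npt t (- y)" "0 \<le> y" "y \<le> r" using z(2) by (auto simp: Fm_def)
    ultimately have "z = npt s x" "z = npt t (- y)" "0 \<le> x" "x \<le> r" "0 \<le> y" "y \<le> r" by auto
    then have "z = \<gamma> s" using opp[of s x t y] by (simp add: npt_0)
    then show False using curve\<Omega>[of z] z(3) by (auto simp: E_def)
   qed
   then show ?thesis by blast
  qed
  moreover have "E \<subseteq> Fp \<union> Fm" using split e1(2) by (auto simp: E_def)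
  ultimately have "Fp \<inter> E = {} \<or> Fm \<inter> E = {}" using conE clF unfolding connected_closed by blast
  moreover have "Fp \<inter> E \<noteq> {}"
  proof -
   obtain d where d: "d > 0" "\<And>z. z \<in> \<Omega> ==> infdist z curve < d ==> tau z < min e1 c0"
    using T1[of "min e1 c0"] e1(1) c0 by auto
   define x where "x = min d r / 2"
   have x: "0 < x" "x < d" "x < r" using d r by (auto simp: x_def)
   have xO: "npt 0 x \<in> \<Omega>" using nptO x by simp
   moreover have "tau (npt 0 x) < min e1 c0" by (rule d(2)[OF xO]) (use idist[of x 0] x in simp)
   moreover have "npt 0 x \<in> Fp" unfolding Fp_def using x L by (intro image_eqI[of _ _ "(0, x)"]) auto
   ultimately show ?thesis using tau_bounds by (auto simp: E_def)
  qed
  ultimately show ?thesis using \<open>E \<subseteq> Fp \<union> Fm\<close> by blast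
 qed
 obtain d1 where d1: "d1 > 0" "\<And>z. z \<in> \<Omega> ==> infdist z curve < d1 ==> tau z < min e1 c0"
  using T1[of "min e1 c0"] e1(1) c0 by auto
 define R where "R = min r d1"
 have R: "R > 0" "R \<le> r" "R \<le> d1" using r d1 by (auto simp: R_def)
 have nearR: "\<exists>s. z = npt s (infdist z curve)" if z: "z \<in> \<Omega>" "infdist z curve < R" for z
 proof -
  have "z \<in> E" using d1(2)[of z] z R tau_bounds by (auto simp: E_def)
  then obtain s x where sx: "z = npt s x" "0 \<le> x" "x \<le> r" using EFp by (auto simp: Fp_def)
  then show ?thesis using idist[of x s] by auto
 qed
 \<comment> \<open>An exterior disc meeting \<open>\<Omega>\<close> would lie inside it. Its points
   near the curve would then be on the inner side as well, and the two sides share only the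
   curve.\<close>
 have outR: "ball (npt s (- R)) R \<inter> \<Omega> = {}" for s
 proof (rule ccontr)
  assume a: "ball (npt s (- R)) R \<inter> \<Omega> \<noteq> {}"
  have "ball (npt s (- R)) R \<inter> frontier \<Omega> = {}" using nofr[of "- R" s] R by simp
  then have "ball (npt s (- R)) R \<subseteq> \<Omega>" using connected_Int_frontier[OF connected_ball a] by blast
  moreover have "npt s (- (R / 2)) \<in> ball (npt s (- R)) R" using R by (simp add: npt_dist)
  ultimately have "npt s (- (R / 2)) \<in> \<Omega>" by blast
  moreover have id: "infdist (npt s (- (R / 2))) curve = R / 2" using idist[of "- (R / 2)" s] R by simp
  ultimately have "\<exists>t. npt s (- (R / 2)) = npt t (R / 2)" using nearR[of "npt s (- (R / 2))"] R unfolding id by simp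
  then obtain t where "npt s (- (R / 2)) = npt t (R / 2)" by blast
  then have "R / 2 = 0" using opp[of t "R / 2" s "R / 2"] R by simp
  then show False using R by simp
 qed
 show ?thesis
 proof (rule that[OF R(1)])
  show "ball (npt s R) R \<subseteq> \<Omega>" for s using inO[OF R(1,2)] .
  show "ball (npt s (- R)) R \<inter> \<Omega> = {}" for s by (rule outR)
  show "\<exists>s. z = npt s (infdist z curve)" if "z \<in> \<Omega>" "infdist z curve < R" for z using nearR that .
  show "infdist (npt s x) curve = \<bar>x\<bar>" if "\<bar>x\<bar> \<le> R" for s x using idist that R by simp
  show "infdist z (frontier \<Omega>) = infdist z curve" if "infdist z curve < R" for z using frd that R by simp
  show "4 * R \<le> dist y (\<gamma> s)" if "y \<in> B" for s y using Bfar[OF that, of s] R by simp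
  show "\<gamma> t = \<gamma> s" if "\<bar>x\<bar> \<le> R" "norm (\<gamma> t - npt s x) \<le> \<bar>x\<bar>" for s t x using uniq[of x t s] that R by simp
 qed
qed

text \<open>The composition of exp (-2 t) with the harmonic function \<open>ln (dist z m)\<close>.
  Its Laplacian is strictly positive, which makes it a barrier on both sides.\<close>

lemma has_laplacian_inverse_square:
 assumes "z \<noteq> m"
 obtains p1 p2 where "has_laplacian (%z. 1 / (dist z m)\<^sup>2) z p1 p2 (4 / (dist z m) ^ 4)"
proof -
 have h: "(%z. z - m) holomorphic_on - {m}" by (intro holomorphic_intros)
 have "has_laplacian (%z. ln (norm (z - m))) z (Re (deriv (%z. z - m) z / (z - m))) (- Im (deriv (%z. z - m) z / (z - m))) 0"
  by (rule has_laplacian_ln_norm[OF h]) (use assms in auto)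
 moreover have "deriv (%z. z - m) z = 1" by (rule DERIV_imp_deriv) (auto intro!: derivative_eq_intros)
 ultimately have l: "has_laplacian (%z. ln (norm (z - m))) z (Re (1 / (z - m))) (- Im (1 / (z - m))) 0" by simp
 define N where "N = norm (z - m)"
 have N: "N > 0" using assms by (simp add: N_def)
 have "has_laplacian (%z. exp (- 2 * ln (norm (z - m)))) z (- 2 * exp (- 2 * ln N) * Re (1 / (z - m))) (- 2 * exp (- 2 * ln N) * - Im (1 / (z - m)))
   (4 * exp (- 2 * ln N) * ((Re (1 / (z - m)))\<^sup>2 + (- Im (1 / (z - m)))\<^sup>2) + - 2 * exp (- 2 * ln N) * 0)"
  unfolding N_def
  by (rule has_laplacian_compose[OF l, of "%x. exp (- 2 * x)" "%x. - 2 * exp (- 2 * x)"])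
    (auto intro!: derivative_eq_intros always_eventually)
 moreover have "4 * exp (- 2 * ln N) * ((Re (1 / (z - m)))\<^sup>2 + (- Im (1 / (z - m)))\<^sup>2) + - 2 * exp (- 2 * ln N) * 0 = 4 / N ^ 4"
 proof -
  have "(Re (1 / (z - m)))\<^sup>2 + (- Im (1 / (z - m)))\<^sup>2 = (norm (1 / (z - m)))\<^sup>2" by (simp only: cmod_power2 power2_minus)
  also have "\<dots> = 1 / N\<^sup>2" by (simp add: norm_divide N_def power_divide)
  finally have "(Re (1 / (z - m)))\<^sup>2 + (- Im (1 / (z - m)))\<^sup>2 = 1 / N\<^sup>2" .
  moreover have "exp (- 2 * ln N) = 1 / N\<^sup>2"
   using N by (simp add: exp_minus exp_double[symmetric] inverse_eq_divide) (simp add: exp_double)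
  ultimately show ?thesis by (simp add: eval_nat_numeral)
 qed
 moreover have "\<forall>\<^sub>F x in nhds z. exp (- 2 * ln (norm (x - m))) = 1 / (dist x m)\<^sup>2"
 proof -
  have "\<forall>\<^sub>F x in nhds z. x \<in> - {m}" using assms by (intro eventually_nhds_in_open) auto
  then show ?thesis
  proof eventually_elim
   case (elim x)
   then have "norm (x - m) > 0" by simp
   then show ?case by (simp add: dist_norm exp_minus exp_double inverse_eq_divide)
  qed
 qed
 ultimately have "has_laplacian (%z. 1 / (dist z m)\<^sup>2) z (- 2 * exp (- 2 * ln N) * Re (1 / (z - m)))
   (- 2 * exp (- 2 * ln N) * - Im (1 / (z - m))) (4 / N ^ 4)"
  using has_laplacian_cong by (simp only:)
 then show ?thesis unfolding N_def dist_norm[symmetric] by (rule that)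
qed

lemma tau_laplacian: "z \<in> \<Omega> ==> \<exists>p1 p2. has_laplacian tau z p1 p2 0"
 unfolding tau_def[abs_def] using has_laplacian_minus[OF has_laplacian_ln_norm[OF f open\<Omega> f_nz]] by fastforce

text \<open>A two-sided Hopf lemma: \<open>tau\<close> is comparable to the distance from the curve.
  The bounds come from strictly subharmonic barriers centred in the exterior and interior tangent
  discs.\<close>

lemma tau_linear:
 obtains a A d where "a > 0" "A > 0" "d > 0"
  "\<And>z. z \<in> \<Omega> ==> infdist z curve < d ==> a * infdist z curve \<le> tau z \<and> tau z \<le> A * infdist z curve"
proof -
 obtain r where r: "r > 0"
  "\<And>s. ball (npt s r) r \<subseteq> \<Omega>"
  "\<And>s. ball (npt s (- r)) r \<inter> \<Omega> = {}"
  "\<And>z. z \<in> \<Omega> ==> infdist z curve < r ==> \<exists>s. z = npt s (infdist z curve)"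
  "\<And>s x. \<bar>x\<bar> \<le> r ==> infdist (npt s x) curve = \<bar>x\<bar>"
  "\<And>z. infdist z curve < r ==> infdist z (frontier \<Omega>) = infdist z curve"
  "\<And>s y. y \<in> B ==> 4 * r \<le> dist y (\<gamma> s)"
  using collar by metis
 \<comment> \<open>The upper barrier then reaches \<open>c0\<close>, the supremum of
   \<open>tau\<close>, at distance \<open>2 * r\<close> from its centre, and near \<open>B\<close>
   the distance is at least that.\<close>
 define A where "A = c0 / (1 / r\<^sup>2 - 1 / (2 * r)\<^sup>2)"
 have diff: "1 / r\<^sup>2 - 1 / (2 * r)\<^sup>2 = 3 / (4 * r\<^sup>2)" using r(1) by (simp add: field_simps power2_eq_square)
 have A: "A > 0" unfolding A_def diff using c0 r(1) by simp
 \<comment> \<open>barrier from the exterior tangent disc\<close>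
 have upper: "tau z \<le> A * (1 / r\<^sup>2 - 1 / (dist z (npt s (- r)))\<^sup>2)" if z: "z \<in> \<Omega>" for z s
 proof -
  define m where "m = npt s (- r)"
  have far: "r \<le> dist x m" if "x \<in> \<Omega>" for x
  proof (rule ccontr)
   assume "\<not> r \<le> dist x m"
   then have "x \<in> ball m r" by (simp add: dist_commute)
   then show False using r(3)[of s] that by (auto simp: m_def)
  qed
  define w where "w x = tau x - A * (1 / r\<^sup>2 - 1 / (dist x m)\<^sup>2)" for x
  have "w z \<le> 0"
  proof (rule max_principle[of \<Omega> w])
   have "dist x m \<noteq> 0" if "x \<in> \<Omega>" for x using far[OF that] r(1) by linarith
   then show "continuous_on \<Omega> w" unfolding w_def by (intro continuous_intros cont_tau) auto
   show "\<exists>p1 p2 l. has_laplacian w x p1 p2 l \<and> 0 < l" if x: "x \<in> \<Omega>" for x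
   proof -
    have xm: "x \<noteq> m" using far[OF x] r(1) by auto
    obtain p1 p2 where p: "has_laplacian tau x p1 p2 0" using tau_laplacian[OF x] by blast
    obtain q1 q2 where q: "has_laplacian (%z. 1 / (dist z m)\<^sup>2) x q1 q2 (4 / (dist x m) ^ 4)"
     by (rule has_laplacian_inverse_square[OF xm])
    have "has_laplacian (%x. (tau x + A * (1 / (dist x m)\<^sup>2)) + (- A / r\<^sup>2)) x (p1 + A * q1) (p2 + A * q2) (0 + A * (4 / (dist x m) ^ 4))"
     by (rule has_laplacian_add_const[OF has_laplacian_add[OF p has_laplacian_cmult[OF q]]])
    moreover have "w = (%x. (tau x + A * (1 / (dist x m)\<^sup>2)) + (- A / r\<^sup>2))"
     by (simp add: w_def fun_eq_iff right_diff_distrib)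
    moreover have "0 + A * (4 / (dist x m) ^ 4) > 0" using A xm by simp
    ultimately show ?thesis by metis
   qed
   show "\<forall>\<^sub>F x in at y within \<Omega>. w x < e" if y: "y \<in> frontier \<Omega>" and e: "e > 0" for y e
   proof (cases "y \<in> curve")
    case True
    obtain d where d: "d > 0" "\<And>z. z \<in> \<Omega> ==> infdist z curve < d ==> tau z < e" using T1[OF e] by blast
    have "w x < e" if x: "x \<in> \<Omega>" "dist x y < d" for x
    proof -
     have "infdist x curve < d" using infdist_le[OF True, of x] x(2) by simp
     then have "tau x < e" using d(2) x(1) by blast
     moreover have "1 / (dist x m)\<^sup>2 \<le> 1 / r\<^sup>2" using far[OF x(1)] r(1) by (intro frac_le power_mono) auto
     then have "A * (1 / r\<^sup>2 - 1 / (dist x m)\<^sup>2) \<ge> 0" using A by simp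
     ultimately show ?thesis by (simp add: w_def)
    qed
    then show ?thesis unfolding eventually_at using d(1) by blast
   next
    case False
    then have yB: "y \<in> B" using y fr by auto
    have "w x < e" if x: "x \<in> \<Omega>" "dist x y < r" for x
    proof -
     have "4 * r \<le> dist y (\<gamma> s)" by (rule r(7)[OF yB])
     also have "\<dots> \<le> dist y x + dist x m + dist m (\<gamma> s)"
      using dist_triangle[of y "\<gamma> s" x] dist_triangle[of x "\<gamma> s" m] by linarith
     also have "dist m (\<gamma> s) = r" using npt_dist[of s "- r" 0] r(1) by (simp add: m_def npt_0)
     finally have "2 * r \<le> dist x m" using x(2) by (simp add: dist_commute)
     then have "1 / (dist x m)\<^sup>2 \<le> 1 / (2 * r)\<^sup>2" using r(1) by (intro frac_le power_mono) auto
     then have "A * (1 / r\<^sup>2 - 1 / (dist x m)\<^sup>2) \<ge> A * (1 / r\<^sup>2 - 1 / (2 * r)\<^sup>2)" using A by (intro mult_left_mono) auto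
     also have "A * (1 / r\<^sup>2 - 1 / (2 * r)\<^sup>2) = c0" unfolding A_def diff using r(1) by simp
     finally show ?thesis using tau_bounds[OF x(1)] e by (simp add: w_def)
    qed
    then show ?thesis unfolding eventually_at using r(1) by blast
   qed
  qed (use open\<Omega> bounded\<Omega> z in auto)
  then show ?thesis by (simp add: w_def m_def)
 qed
 obtain e where e: "e > 0" "\<And>z. z \<in> \<Omega> ==> tau z < e ==> infdist z curve < r / 4" using T2[of "r / 4"] r(1) by auto
 \<comment> \<open>The lower barrier equals \<open>e\<close> on the circle of half radius, where the
   distance to the curve forces \<open>tau\<close> to be at least \<open>e\<close>.\<close>
 define a where "a = e / (1 / (r / 2)\<^sup>2 - 1 / r\<^sup>2)"
 have diff2: "1 / (r / 2)\<^sup>2 - 1 / r\<^sup>2 = 3 / r\<^sup>2" using r(1) by (simp add: field_simps power2_eq_square)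
 have a: "a > 0" unfolding a_def diff2 using e(1) r(1) by simp
 \<comment> \<open>barrier from the interior tangent disc\<close>
 have lower: "a * (1 / (dist z (npt s r))\<^sup>2 - 1 / r\<^sup>2) \<le> tau z" if z: "r / 2 < dist z (npt s r)" "dist z (npt s r) < r" for z s
 proof -
  define m where "m = npt s r"
  define S where "S = {z. r / 2 < dist z m} \<inter> ball m r"
  have S\<Omega>: "S \<subseteq> \<Omega>" using r(2)[of s] by (auto simp: S_def m_def)
  have openS: "open S" unfolding S_def by (intro open_Int open_ball open_Collect_less continuous_intros)
  define w where "w x = a * (1 / (dist x m)\<^sup>2 - 1 / r\<^sup>2) - tau x" for x
  have "w z \<le> 0"
  proof (rule max_principle[of S w])
   show "open S" by (rule openS)
   show "bounded S" by (rule bounded_subset[OF bounded_ball]) (auto simp: S_def)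
   have nz: "dist x m \<noteq> 0" if "x \<in> S" for x using that r(1) by (auto simp: S_def)
   then show "continuous_on S w" unfolding w_def by (intro continuous_intros continuous_on_subset[OF cont_tau S\<Omega>]) auto
   show "z \<in> S" using z by (auto simp: S_def m_def dist_commute)
   show "\<exists>p1 p2 l. has_laplacian w x p1 p2 l \<and> 0 < l" if x: "x \<in> S" for x
   proof -
    have xm: "x \<noteq> m" using nz[OF x] by auto
    obtain p1 p2 where p: "has_laplacian tau x p1 p2 0" using tau_laplacian x S\<Omega> by blast
    obtain q1 q2 where q: "has_laplacian (%z. 1 / (dist z m)\<^sup>2) x q1 q2 (4 / (dist x m) ^ 4)"
     by (rule has_laplacian_inverse_square[OF xm])
    have "has_laplacian (%x. (a * (1 / (dist x m)\<^sup>2) - tau x) + (- a / r\<^sup>2)) x (a * q1 - p1) (a * q2 - p2) (a * (4 / (dist x m) ^ 4) - 0)"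
     by (rule has_laplacian_add_const[OF has_laplacian_diff[OF has_laplacian_cmult[OF q] p]])
    moreover have "w = (%x. (a * (1 / (dist x m)\<^sup>2) - tau x) + (- a / r\<^sup>2))"
     by (simp add: w_def fun_eq_iff right_diff_distrib)
    moreover have "a * (4 / (dist x m) ^ 4) - 0 > 0" using a xm by simp
    ultimately show ?thesis by metis
   qed
   show "\<forall>\<^sub>F x in at y within S. w x < ep" if y: "y \<in> frontier S" and ep: "ep > 0" for y ep
   proof -
    have "closure S \<subseteq> {z. r / 2 \<le> dist z m} \<inter> cball m r"
     by (rule closure_minimal) (auto simp: S_def intro!: closed_Int closed_Collect_le continuous_intros)
    then have y1: "r / 2 \<le> dist y m" "dist y m \<le> r" "y \<notin> S"
     using y openS by (auto simp: frontier_def interior_open dist_commute)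
    have cw: "isCont (%x. a * (1 / (dist x m)\<^sup>2 - 1 / r\<^sup>2)) y" using y1 r(1) by (intro continuous_intros) auto
    show ?thesis
    proof (cases "dist y m = r")
     case True
     have "((%x. a * (1 / (dist x m)\<^sup>2 - 1 / r\<^sup>2)) \<longlongrightarrow> 0) (at y within S)"
      using cw True unfolding isCont_def by (auto intro: tendsto_within_subset)
     then have "\<forall>\<^sub>F x in at y within S. a * (1 / (dist x m)\<^sup>2 - 1 / r\<^sup>2) < ep" using ep order_tendstoD(2) by blast
     moreover have "\<forall>\<^sub>F x in at y within S. x \<in> S" by (simp add: eventually_at_filter)
     ultimately show ?thesis
     proof eventually_elim
      case (elim x)
      then show ?case using tau_bounds[of x] S\<Omega> by (auto simp: w_def)
     qed
    next
     case False
     then have y2: "dist y m = r / 2" using y1 by (auto simp: S_def dist_commute)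
     then have y\<Omega>: "y \<in> \<Omega>" using r(1) r(2)[of s] by (auto simp: m_def dist_commute)
     have "tau y \<ge> e"
     proof (rule ccontr)
      assume "\<not> tau y \<ge> e"
      then have "infdist y curve < r / 4" using e(2)[OF y\<Omega>] by simp
      then have "infdist m curve < r / 4 + r / 2" using infdist_triangle[of m curve y] y2 by (simp add: dist_commute)
      then show False using r(5)[of r s] r(1) by (simp add: m_def)
     qed
     have "isCont tau y" using cont_tau open\<Omega> y\<Omega> continuous_on_eq_continuous_at by blast
     then have "isCont w y" unfolding w_def by (intro continuous_intros cw)
     then have "(w \<longlongrightarrow> w y) (at y within S)" unfolding isCont_def by (auto intro: tendsto_within_subset)
     moreover have "w y \<le> 0"
     proof -
      have "a * (1 / (dist y m)\<^sup>2 - 1 / r\<^sup>2) = e" unfolding y2 a_def diff2 using r(1) by simp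
      then show ?thesis using \<open>tau y \<ge> e\<close> by (simp add: w_def)
     qed
     ultimately show ?thesis using order_tendstoD(2)[of w "w y" "at y within S" ep] ep by simp
    qed
   qed
  qed
  then show ?thesis by (simp add: w_def m_def)
 qed
 have lin: "x / r ^ 3 \<le> 1 / (r - x)\<^sup>2 - 1 / r\<^sup>2" if x: "0 < x" "x < r / 2" for x
 proof -
  have "1 / (r - x)\<^sup>2 - 1 / r\<^sup>2 = (1 * r\<^sup>2 - 1 * (r - x)\<^sup>2) / ((r - x)\<^sup>2 * r\<^sup>2)"
   using x r(1) by (intro diff_frac_eq) auto
  also have "1 * r\<^sup>2 - 1 * (r - x)\<^sup>2 = x * (2 * r - x)" by (simp add: power2_eq_square algebra_simps)
  finally have "1 / (r - x)\<^sup>2 - 1 / r\<^sup>2 = x * (2 * r - x) / ((r - x)\<^sup>2 * r\<^sup>2)" .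
  moreover have "x * (2 * r - x) / ((r - x)\<^sup>2 * r\<^sup>2) \<ge> x * r / (r\<^sup>2 * r\<^sup>2)"
   using x r(1) by (intro frac_le mult_mono power_mono) auto
  moreover have "x * r / (r\<^sup>2 * r\<^sup>2) = x / r ^ 3" using r(1) by (simp add: power2_eq_square power3_eq_cube)
  ultimately show ?thesis by linarith
 qed
 have lin2: "1 / r\<^sup>2 - 1 / (r + x)\<^sup>2 \<le> 3 * x / r ^ 3" if x: "0 < x" "x < r / 2" for x
 proof -
  have "1 / r\<^sup>2 - 1 / (r + x)\<^sup>2 = (1 * (r + x)\<^sup>2 - 1 * r\<^sup>2) / (r\<^sup>2 * (r + x)\<^sup>2)"
   using x r(1) by (intro diff_frac_eq) auto
  also have "1 * (r + x)\<^sup>2 - 1 * r\<^sup>2 = x * (2 * r + x)" by (simp add: power2_eq_square algebra_simps)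
  finally have "1 / r\<^sup>2 - 1 / (r + x)\<^sup>2 = x * (2 * r + x) / ((r + x)\<^sup>2 * r\<^sup>2)" by (simp add: mult.commute)
  moreover have "x * (2 * r + x) / ((r + x)\<^sup>2 * r\<^sup>2) \<le> x * (3 * r) / (r\<^sup>2 * r\<^sup>2)"
   using x r(1) by (intro frac_le mult_mono power_mono) auto
  moreover have "x * (3 * r) / (r\<^sup>2 * r\<^sup>2) = 3 * x / r ^ 3" using r(1) by (simp add: power2_eq_square power3_eq_cube mult_ac)
  ultimately show ?thesis by linarith
 qed
 show ?thesis
 proof (rule that[of "a / r ^ 3" "3 * A / r ^ 3" "r / 2"])
  show "a / r ^ 3 * infdist z curve \<le> tau z \<and> tau z \<le> 3 * A / r ^ 3 * infdist z curve"
   if z: "z \<in> \<Omega>" "infdist z curve < r / 2" for z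
  proof -
   define x where "x = infdist z curve"
   obtain s where s: "z = npt s x" using r(4)[of z] z r(1) by (auto simp: x_def)
   have "z \<notin> curve" using z(1) fr open\<Omega> by (auto simp: frontier_def interior_open)
   then have x: "0 < x" "x < r / 2"
    using z(2) infdist_pos_not_in_closed[of curve z] compact_curve compact_imp_closed by (auto simp: x_def)
   have dm: "dist z (npt s r) = r - x" "dist z (npt s (- r)) = r + x" using x r(1) by (auto simp: s npt_dist)
   have "tau z \<le> A * (1 / r\<^sup>2 - 1 / (r + x)\<^sup>2)" using upper[OF z(1), of s] by (simp add: dm)
   also have "\<dots> \<le> A * (3 * x / r ^ 3)" using lin2[OF x] A by (intro mult_left_mono) auto
   finally have u: "tau z \<le> 3 * A / r ^ 3 * x" by (simp add: mult_ac)
   have "a * (x / r ^ 3) \<le> a * (1 / (r - x)\<^sup>2 - 1 / r\<^sup>2)" using lin[OF x] a by (intro mult_left_mono) auto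
   also have "\<dots> \<le> tau z" using lower[of z s] x by (simp add: dm)
   finally have "a / r ^ 3 * x \<le> tau z" by simp
   then show ?thesis using u by (simp add: x_def)
  qed
 qed (use a A r(1) in auto)
qed

end

section \<open>Schwarzian derivatives and near isometries on the strip\<close>

lemma deriv_eq_on_open:
 assumes "open S" "z \<in> S" "\<And>x. x \<in> S ==> f x = h x" "(h has_field_derivative d) (at z)"
 shows "deriv f z = d"
proof -
 have "deriv f z = deriv h z"
  by (rule deriv_cong_ev[OF eventually_mono[OF eventually_nhds_in_open[OF assms(1,2)]] refl]) (rule assms(3))
 then show ?thesis using DERIV_imp_deriv[OF assms(4)] by simp
qed

lemma has_derivatives_imp_holomorphic:
 assumes "open S" "\<And>x. x \<in> S ==> (f has_field_derivative D x) (at x)"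
 shows "f holomorphic_on S"
 unfolding holomorphic_on_open[OF assms(1)] using assms(2) by blast

lemma schwarzian_moebius:
 fixes a b c d z :: complex
 assumes D: "a * d - b * c \<noteq> 0" and z: "c * z + d \<noteq> 0"
 shows "schwarzian (%x. (a * x + b) / (c * x + d)) z = 0"
  "((%x. (a * x + b) / (c * x + d)) has_field_derivative (a * d - b * c) / (c * z + d)\<^sup>2) (at z)"
proof -
 define S where "S = {x. c * x + d \<noteq> 0}"
 have S: "open S" "z \<in> S" unfolding S_def using z by (auto intro!: open_Collect_neq continuous_intros)
 define E where "E = a * d - b * c"
 have 0: "((%x. (a * x + b) / (c * x + d)) has_field_derivative E / (c * x + d)\<^sup>2) (at x)" if "x \<in> S" for x
 proof -
  define q where "q = c * x + d"
  have "q \<noteq> 0" using that by (simp add: S_def q_def)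
  have "((%x. (a * x + b) / (c * x + d)) has_field_derivative (a * q - (a * x + b) * c) / (q * q)) (at x)"
   unfolding q_def using that by (auto intro!: derivative_eq_intros simp: S_def)
  moreover have "a * q - (a * x + b) * c = E" by (simp add: q_def E_def algebra_simps)
  ultimately show ?thesis by (simp add: q_def power2_eq_square)
 qed
 have pw: "((%x. K / (c * x + d) ^ n) has_field_derivative - (of_nat n * K * c) / (c * x + d) ^ Suc n) (at x)" if "x \<in> S" for x K n
 proof -
  have q: "c * x + d \<noteq> 0" using that by (simp add: S_def)
  have "((%x. (c * x + d) ^ n) has_field_derivative of_nat n * (c * x + d) ^ (n - Suc 0) * c) (at x)"
   by (auto intro!: derivative_eq_intros)
  from DERIV_cmult[OF DERIV_inverse'[OF this], of K]
  have "((%x. K / (c * x + d) ^ n) has_field_derivative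
    K * - (inverse ((c * x + d) ^ n) * (of_nat n * (c * x + d) ^ (n - Suc 0) * c) * inverse ((c * x + d) ^ n))) (at x)"
   using q by (simp add: divide_inverse)
  moreover have "K * - (inverse ((c * x + d) ^ n) * (of_nat n * (c * x + d) ^ (n - Suc 0) * c) * inverse ((c * x + d) ^ n))
    = - (of_nat n * K * c) / (c * x + d) ^ Suc n"
  proof -
   define q where "q = c * x + d"
   have "q \<noteq> 0" using q by (simp add: q_def)
   then show ?thesis unfolding q_def[symmetric] by (cases n) (auto simp: field_simps)
  qed
  ultimately show ?thesis by simp
 qed
 have 1: "deriv (%x. (a * x + b) / (c * x + d)) x = E / (c * x + d) ^ 2" if "x \<in> S" for x
  using 0[OF that] by (rule DERIV_imp_deriv)
 have 2: "deriv (deriv (%x. (a * x + b) / (c * x + d))) x = - (2 * E * c) / (c * x + d) ^ 3" if "x \<in> S" for x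
  using deriv_eq_on_open[OF S(1) that 1 pw[OF that, of E 2]] by (simp add: eval_nat_numeral)
 have 3: "deriv (deriv (deriv (%x. (a * x + b) / (c * x + d)))) z = 6 * E * c\<^sup>2 / (c * z + d) ^ 4"
 proof -
  have "deriv (deriv (deriv (%x. (a * x + b) / (c * x + d)))) z = - (of_nat 3 * (- (2 * E * c)) * c) / (c * z + d) ^ Suc 3"
   by (rule deriv_eq_on_open[OF S 2 pw[OF S(2)]])
  then show ?thesis by (simp add: power2_eq_square)
 qed
 define q where "q = c * z + d"
 have "q \<noteq> 0" "E \<noteq> 0" using z D by (auto simp: q_def E_def)
 have r: "(- (2 * E * c) / q ^ 3) / (E / q ^ 2) = - (2 * c / q)" "(6 * E * c\<^sup>2 / q ^ 4) / (E / q ^ 2) = 6 * (c / q)\<^sup>2"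
  using \<open>q \<noteq> 0\<close> \<open>E \<noteq> 0\<close> by (simp_all add: field_simps eval_nat_numeral)
 show "schwarzian (%x. (a * x + b) / (c * x + d)) z = 0"
  unfolding schwarzian_def 1[OF S(2)] 2[OF S(2)] 3 unfolding q_def[symmetric] r
  by (simp add: power2_eq_square)
 show "((%x. (a * x + b) / (c * x + d)) has_field_derivative (a * d - b * c) / (c * z + d)\<^sup>2) (at z)"
  using 0[OF S(2)] by (simp add: E_def)
qed

text \<open>Used for the map from the half plane to the strip, inverse to
  \<open>exp (k * z)\<close>; it is the source of the constant \<open>k\<^sup>2 / 2\<close>.\<close>

lemma schwarzian_Ln_scaled:
 fixes K b :: complex
 assumes "z \<notin> \<real>\<^sub>\<le>\<^sub>0" "K \<noteq> 0"
 shows "schwarzian (%x. b + K * Ln x) z = 1 / (2 * z\<^sup>2)" "((%x. b + K * Ln x) has_field_derivative K / z) (at z)"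
proof -
 define S :: "complex set" where "S = - \<real>\<^sub>\<le>\<^sub>0"
 have S: "open S" "z \<in> S" using assms by (auto simp: S_def closed_nonpos_Reals_complex)
 have nz: "x \<noteq> 0" if "x \<in> S" for x using that by (auto simp: S_def)
 have 0: "((%x. b + K * Ln x) has_field_derivative K / x) (at x)" if "x \<in> S" for x
  using that by (auto intro!: derivative_eq_intros simp: S_def divide_inverse)
 have 1: "deriv (%x. b + K * Ln x) x = K / x" if "x \<in> S" for x using 0[OF that] by (rule DERIV_imp_deriv)
 have p1: "((%x. K / x) has_field_derivative - K / x\<^sup>2) (at x)" if "x \<in> S" for x
  using nz[OF that] by (auto intro!: derivative_eq_intros simp: power2_eq_square)
 have p2: "((%x. - K / x\<^sup>2) has_field_derivative 2 * K / x ^ 3) (at x)" if "x \<in> S" for x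
  using nz[OF that] by (auto intro!: derivative_eq_intros simp: eval_nat_numeral field_simps)
 have 2: "deriv (deriv (%x. b + K * Ln x)) x = - K / x\<^sup>2" if "x \<in> S" for x
  by (rule deriv_eq_on_open[OF S(1) that 1 p1[OF that]])
 have 3: "deriv (deriv (deriv (%x. b + K * Ln x))) z = 2 * K / z ^ 3"
  by (rule deriv_eq_on_open[OF S 2 p2[OF S(2)]])
 have r: "(2 * K / z ^ 3) / (K / z) = 2 / z\<^sup>2" "(- K / z\<^sup>2) / (K / z) = - (1 / z)"
  using nz[OF S(2)] assms by (simp_all add: field_simps eval_nat_numeral)
 show "schwarzian (%x. b + K * Ln x) z = 1 / (2 * z\<^sup>2)"
  unfolding schwarzian_def 1[OF S(2)] 2[OF S(2)] 3 r by (simp add: power2_eq_square)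
 show "((%x. b + K * Ln x) has_field_derivative K / z) (at z)" by (rule 0[OF S(2)])
qed

text \<open>Transplants the disc estimate: \<open>c\<close> is a hyperbolic isometry from the disc
  to the strip centred at \<open>ze0\<close>, and \<open>cay\<close> one from the half plane to the
  disc centred at \<open>H ze0\<close>. Moebius maps have zero Schwarzian, so only the logarithm in
  \<open>c\<close> contributes, and the factor \<open>2 sin / k\<close> is the modulus of the
  derivative of \<open>c\<close> at 0.\<close>

lemma strip_near_isometry_schwarzian:
 fixes H :: "complex \<Rightarrow> complex" and k rh e :: real
 assumes k: "k > 0" and z0: "0 < Im ze0" "k * Im ze0 < pi" and rh: "0 < rh" "rh \<le> 1/4"
  and H: "H holomorphic_on ball ze0 (4 * Im ze0 * rh)"
  and e: "0 < e" "e \<le> 1/2"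
  and pos: "\<And>ze. ze \<in> ball ze0 (4 * Im ze0 * rh) ==> Im (H ze) > 0"
  and rat: "\<And>ze. ze \<in> ball ze0 (4 * Im ze0 * rh) ==> \<bar>norm (deriv H ze) * (sin (k * Im ze) / k) / Im (H ze) - 1\<bar> \<le> e"
 shows "norm (schwarzian H ze0 + of_real (k\<^sup>2 / 2)) * (2 * sin (k * Im ze0) / k)\<^sup>2 \<le> 40000 / rh\<^sup>2 * e"
proof -
 define ta where "ta = Im ze0"
 define p where "p = exp (\<i> * of_real (k * ta))"
 define sn where "sn = sin (k * ta)"
 have sn: "sn > 0" unfolding sn_def ta_def using z0 k by (intro sin_gt_zero) auto
 have snk: "sn / k \<le> ta" using sin_x_le_x[of "k * ta"] z0 k by (simp add: sn_def ta_def field_simps)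
 have np: "norm p = 1" by (simp add: p_def)
 have ppc: "p * cnj p = 1" using np by (simp add: complex_norm_square[symmetric])
 have pp: "p - cnj p = 2 * \<i> * of_real sn"
  by (simp add: p_def sn_def complex_eq_iff Re_exp Im_exp)
 \<comment> \<open>Moebius map of the disc onto the upper half plane with \<open>m 0 = p\<close>,
   the image of \<open>ze0\<close> up to a horizontal translation.\<close>
 define m where "m x = (- cnj p * x + p) / (- 1 * x + 1)" for x
 have one: "- 1 * x + 1 \<noteq> 0" if "norm x < 1" for x :: complex using that by auto
 have Dm: "(m has_field_derivative (2 * \<i> * of_real sn) / (1 - x)\<^sup>2) (at x)" "schwarzian m x = 0" if x: "norm x < 1" for x
 proof -
  have ne: "- cnj p * 1 - p * - 1 \<noteq> 0" using pp sn by simp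
  have "(m has_field_derivative (- cnj p * 1 - p * - 1) / (- 1 * x + 1)\<^sup>2) (at x)"
   unfolding m_def[abs_def] by (rule schwarzian_moebius(2)[OF ne one[OF x]])
  then show "(m has_field_derivative (2 * \<i> * of_real sn) / (1 - x)\<^sup>2) (at x)" using pp by simp
  show "schwarzian m x = 0" unfolding m_def[abs_def] by (rule schwarzian_moebius(1)[OF ne one[OF x]])
 qed
 have Imm: "Im (m x) = sn * (1 - (norm x)\<^sup>2) / (norm (1 - x))\<^sup>2" if x: "norm x < 1" for x
 proof -
  have "m x = (p - cnj p * x) / (1 - x)" by (simp add: m_def)
  also have "\<dots> = (p - cnj p * x) * cnj (1 - x) / of_real ((norm (1 - x))\<^sup>2)"
   by (subst complex_div_cnj) simp
  also have "Im \<dots> = Im ((p - cnj p * x) * cnj (1 - x)) / (norm (1 - x))\<^sup>2" by (simp only: Im_divide_of_real)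
  also have "Im ((p - cnj p * x) * cnj (1 - x)) = Im p * (1 - (norm x)\<^sup>2)"
   unfolding cmod_power2 by (simp add: power2_eq_square algebra_simps)
  also have "Im p = sn" by (simp add: p_def sn_def Im_exp)
  finally show ?thesis .
 qed
 have Impos: "Im (m x) > 0" if x: "norm x < 1" for x
 proof -
  have "(norm x)\<^sup>2 < 1" using x by (simp add: abs_square_less_1)
  moreover have "1 - x \<noteq> 0" using x by auto
  ultimately show ?thesis unfolding Imm[OF x] using sn by simp
 qed
 have mnr: "m x \<notin> \<real>\<^sub>\<le>\<^sub>0" if "norm x < 1" for x using Impos[OF that] by (auto simp: complex_nonpos_Reals_iff)
 define K where "K = complex_of_real (1 / k)"
 define c where "c x = of_real (Re ze0) + K * Ln (m x)" for x
 have K: "K \<noteq> 0" using k by (simp add: K_def)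
 have Dc: "(c has_field_derivative K / m x * ((2 * \<i> * of_real sn) / (1 - x)\<^sup>2)) (at x)" if x: "norm x < 1" for x
  unfolding c_def by (rule DERIV_chain2[OF schwarzian_Ln_scaled(2)[OF mnr[OF x] K] Dm(1)[OF x]])
 have sinc: "sin (k * Im (c x)) = Im (m x) / norm (m x)" if x: "norm x < 1" for x
 proof -
  have nz: "m x \<noteq> 0" using Impos[OF x] by auto
  have "Im (exp (Ln (m x))) = exp (Re (Ln (m x))) * sin (Im (Ln (m x)))" by (rule Im_exp)
  then have "Im (m x) = norm (m x) * sin (Im (Ln (m x)))" using nz by simp
  moreover have "k * Im (c x) = Im (Ln (m x))" using k by (simp add: c_def K_def)
  ultimately show ?thesis using nz by simp
 qed
 have m0: "m 0 = p" by (simp add: m_def)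
 have c0: "c 0 = ze0"
 proof -
  have "Ln p = \<i> * of_real (k * ta)"
   unfolding p_def by (rule Ln_exp) (use z0 k in \<open>auto simp: ta_def intro: less_trans[of _ 0]\<close>)
  then show ?thesis using k by (simp add: c_def m0 K_def complex_eq_iff ta_def)
 qed
 define dc where "dc x = K / m x * ((2 * \<i> * of_real sn) / (1 - x)\<^sup>2)" for x
 \<comment> \<open>Equality of the metrics \<open>2 / (1 - |x|^2)\<close> on the disc and
   \<open>k / sin (k * Im z)\<close> on the strip.\<close>
 have dcn: "norm (dc x) * (1 - (norm x)\<^sup>2) = 2 * (sin (k * Im (c x)) / k)" if x: "norm x < 1" for x
 proof -
  have "1 - x \<noteq> 0" using x by auto
  then show ?thesis
   unfolding dc_def sinc[OF x] Imm[OF x] using k sn by (simp add: norm_mult norm_divide norm_power K_def field_simps)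
 qed
 \<comment> \<open>Explains the radius \<open>4 * Im ze0 * rh\<close> of the hypothesis: the disc of
   radius \<open>rh\<close> is mapped into that Euclidean disc.\<close>
 have dcb: "norm (dc x) \<le> 4 * ta" if x: "norm x \<le> rh" for x
 proof -
  have x1: "norm x < 1" using x rh by simp
  have n1: "3/4 \<le> norm (1 - x)" using norm_triangle_ineq2[of 1 x] x rh by simp
  have n2: "3/4 \<le> norm (p - cnj p * x)"
   using norm_triangle_ineq2[of p "cnj p * x"] x rh np by (simp add: norm_mult)
  have nz: "1 - x \<noteq> 0" using n1 by auto
  have mx: "m x = (p - cnj p * x) / (1 - x)" by (simp add: m_def)
  have "dc x = of_real (1 / k) * (2 * \<i> * of_real sn) / ((p - cnj p * x) * (1 - x))"
   unfolding dc_def mx K_def using nz by (simp add: power2_eq_square)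
  then have "norm (dc x) = 2 * (sn / k) / (norm (p - cnj p * x) * norm (1 - x))"
   using k sn by (simp add: norm_mult norm_divide)
  also have "\<dots> \<le> 2 * ta / (3/4 * (3/4))"
   using n1 n2 snk z0 sn k by (intro frac_le mult_mono) (auto simp: ta_def)
  also have "\<dots> \<le> 4 * ta" using z0 by (simp add: ta_def)
  finally show ?thesis .
 qed
 have cball: "c x \<in> ball ze0 (4 * Im ze0 * rh)" if x: "norm x < rh" for x
 proof -
  have "norm (c x - c 0) \<le> (4 * ta) * norm (x - 0)"
  proof (rule field_differentiable_bound[where S = "cball 0 rh" and f' = dc and f = c and x = x and y = 0])
   fix z :: complex assume z: "z \<in> cball 0 rh"
   then have "norm z < 1" using rh by simp
   from Dc[OF this] show "(c has_field_derivative dc z) (at z within cball 0 rh)"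
    unfolding dc_def by (rule has_field_derivative_at_within)
   show "norm (dc z) \<le> 4 * ta" using dcb[of z] z by simp
  qed (use x rh in auto)
  also have "\<dots> < 4 * ta * rh" using x z0 by (simp add: ta_def)
  finally show ?thesis by (simp add: c0 dist_norm norm_minus_commute ta_def)
 qed
 define N0 where "N0 = H ze0"
 have z0b: "ze0 \<in> ball ze0 (4 * Im ze0 * rh)" using z0 rh by simp
 have N0: "Im N0 > 0" using pos[OF z0b] by (simp add: N0_def)
 define cay where "cay w = (1 * w + (- N0)) / (1 * w + (- cnj N0))" for w
 have cne: "1 * (- cnj N0) - (- N0) * 1 \<noteq> 0" using N0 by (simp add: complex_eq_iff)
 have den: "1 * w + (- cnj N0) \<noteq> 0" if "Im w > 0" for w using that N0 by (auto simp: complex_eq_iff)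
 have Dcay: "(cay has_field_derivative (2 * \<i> * of_real (Im N0)) / (w - cnj N0)\<^sup>2) (at w)" "schwarzian cay w = 0" if w: "Im w > 0" for w
 proof -
  have "(cay has_field_derivative (1 * (- cnj N0) - (- N0) * 1) / (1 * w + (- cnj N0))\<^sup>2) (at w)"
   unfolding cay_def[abs_def] by (rule schwarzian_moebius(2)[OF cne den[OF w]])
  moreover have "1 * (- cnj N0) - (- N0) * 1 = 2 * \<i> * of_real (Im N0)" by (simp add: complex_eq_iff)
  ultimately show "(cay has_field_derivative (2 * \<i> * of_real (Im N0)) / (w - cnj N0)\<^sup>2) (at w)" by simp
  show "schwarzian cay w = 0" unfolding cay_def[abs_def] by (rule schwarzian_moebius(1)[OF cne den[OF w]])
 qed
 have cayn: "1 - (norm (cay w))\<^sup>2 = 4 * Im w * Im N0 / (norm (w - cnj N0))\<^sup>2" if w: "Im w > 0" for w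
 proof -
  have nz: "w - cnj N0 \<noteq> 0" using den[OF w] by simp
  have "(norm (w - cnj N0))\<^sup>2 - (norm (w - N0))\<^sup>2 = 4 * Im w * Im N0"
   unfolding cmod_power2 by (simp add: power2_eq_square algebra_simps)
  moreover have "1 - (norm (cay w))\<^sup>2 = ((norm (w - cnj N0))\<^sup>2 - (norm (w - N0))\<^sup>2) / (norm (w - cnj N0))\<^sup>2"
  proof -
   have "(norm (cay w))\<^sup>2 = (norm (w - N0))\<^sup>2 / (norm (w - cnj N0))\<^sup>2" by (simp add: cay_def norm_divide power_divide)
   moreover have "(norm (w - cnj N0))\<^sup>2 \<noteq> 0" using nz by simp
   ultimately show ?thesis by (simp add: diff_divide_distrib)
  qed
  ultimately show ?thesis by simp
 qed
 define Y where "Y x = cay (H (c x))" for x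
 have DH: "(H has_field_derivative deriv H ze) (at ze)" if "ze \<in> ball ze0 (4 * Im ze0 * rh)" for ze
  using holomorphic_derivI[OF H open_ball that] by simp
 have DY: "(Y has_field_derivative (2 * \<i> * of_real (Im N0)) / (H (c x) - cnj N0)\<^sup>2 * (deriv H (c x) * dc x)) (at x)" if x: "norm x < rh" for x
 proof -
  have "norm x < 1" using x rh by simp
  then have "((%x. H (c x)) has_field_derivative deriv H (c x) * dc x) (at x)"
   unfolding dc_def by (rule DERIV_chain2[where g = c, OF DH[OF cball[OF x]] Dc])
  then show ?thesis
   unfolding Y_def by (rule DERIV_chain2[where g = "%x. H (c x)", OF Dcay(1)[OF pos[OF cball[OF x]]]])
 qed
 have holY: "Y holomorphic_on ball 0 rh"
  by (rule has_derivatives_imp_holomorphic[OF open_ball DY]) simp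
 \<comment> \<open>Since \<open>c\<close> and \<open>cay\<close> are isometries, the hyperbolic
   derivative of \<open>Y\<close> is exactly the ratio of densities that the hypothesis
   bounds.\<close>
 have ratio: "(1 - (norm x)\<^sup>2) * norm (deriv Y x) = (norm (deriv H (c x)) * (sin (k * Im (c x)) / k) / Im (H (c x))) * (1 - (norm (Y x))\<^sup>2)"
  if x: "norm x < rh" for x
 proof -
  have x1: "norm x < 1" using x rh by simp
  define w where "w = H (c x)"
  have w: "Im w > 0" using pos[OF cball[OF x]] by (simp add: w_def)
  have nz: "w - cnj N0 \<noteq> 0" using den[OF w] by simp
  have "norm (deriv Y x) = 2 * Im N0 / (norm (w - cnj N0))\<^sup>2 * (norm (deriv H (c x)) * norm (dc x))"
   using DERIV_imp_deriv[OF DY[OF x]] N0 by (simp add: norm_mult norm_divide norm_power w_def)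
  then have "(1 - (norm x)\<^sup>2) * norm (deriv Y x) = 2 * Im N0 / (norm (w - cnj N0))\<^sup>2 * (norm (deriv H (c x)) * (norm (dc x) * (1 - (norm x)\<^sup>2)))"
   by (simp add: mult_ac)
  also have "\<dots> = 2 * Im N0 / (norm (w - cnj N0))\<^sup>2 * (norm (deriv H (c x)) * (2 * (sin (k * Im (c x)) / k)))"
   by (simp only: dcn[OF x1])
  also have "\<dots> = (norm (deriv H (c x)) * (sin (k * Im (c x)) / k) / Im w) * (4 * Im w * Im N0 / (norm (w - cnj N0))\<^sup>2)"
   using w by (simp add: field_simps)
  finally show ?thesis unfolding Y_def w_def[symmetric] cayn[OF w] .
 qed
 have S: "norm (schwarzian Y 0) \<le> 40000 / rh\<^sup>2 * e"
 proof (rule near_isometry_schwarzian[OF holY _ rh(1) _ e])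
  show "Y 0 = 0" by (simp add: Y_def c0 cay_def N0_def)
  show "rh < 1" using rh by simp
  fix x :: complex assume x: "norm x < rh"
  have w: "Im (H (c x)) > 0" using pos[OF cball[OF x]] .
  have "1 - (norm (Y x))\<^sup>2 > 0" unfolding Y_def cayn[OF w] using w N0 den[OF w] by (intro divide_pos_pos) auto
  then have n1: "norm (Y x) < 1" by (simp add: abs_square_less_1)
  have "norm (deriv H (c x)) * (sin (k * Im (c x)) / k) / Im (H (c x)) \<le> 1 + e" using rat[OF cball[OF x]] by linarith
  then show "norm (Y x) < 1 \<and> (1 - (norm x)\<^sup>2) * norm (deriv Y x) \<le> (1 + e) * (1 - (norm (Y x))\<^sup>2)"
   using n1 \<open>1 - (norm (Y x))\<^sup>2 > 0\<close> unfolding ratio[OF x] by (intro conjI mult_right_mono) auto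
 next
  have "norm (deriv H (c 0)) * (sin (k * Im (c 0)) / k) / Im (H (c 0)) \<ge> 1 - e"
  proof -
   have "c 0 \<in> ball ze0 (4 * Im ze0 * rh)" using cball[of 0] rh by simp
   from rat[OF this] show ?thesis by linarith
  qed
  moreover have "Y 0 = 0" by (simp add: Y_def c0 cay_def N0_def)
  ultimately show "1 - e \<le> norm (deriv Y 0)" using ratio[of 0] rh by simp
 qed
 have dH0: "deriv H ze0 \<noteq> 0" using rat[OF z0b] e by auto
 have holc: "c holomorphic_on ball 0 rh"
  unfolding holomorphic_on_open[OF open_ball]
 proof
  fix x :: complex assume "x \<in> ball 0 rh"
  then have "norm x < 1" using rh by simp
  then show "\<exists>d. (c has_field_derivative d) (at x)" using Dc by blast
 qed
 have holm: "m holomorphic_on ball 0 1" by (rule has_derivatives_imp_holomorphic[OF open_ball Dm(1)]) simp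
 have dm0: "deriv m 0 = 2 * \<i> * of_real sn" using DERIV_imp_deriv[OF Dm(1)[of 0]] by simp
 have p_nr: "p \<notin> \<real>\<^sub>\<le>\<^sub>0" using mnr[of 0] m0 by simp
 \<comment> \<open>\<open>m\<close> contributes nothing, and \<open>1 / (2 * p\<^sup>2)\<close> for
   the logarithm becomes \<open>k\<^sup>2 / 2\<close> once measured in the derivative of
   \<open>c\<close>.\<close>
 have Sc: "schwarzian c 0 = of_real (k\<^sup>2 / 2) * (dc 0)\<^sup>2"
 proof -
  have hL: "(%x. of_real (Re ze0) + K * Ln x) holomorphic_on - \<real>\<^sub>\<le>\<^sub>0" by (intro holomorphic_intros) auto
  have "schwarzian (%x. of_real (Re ze0) + K * Ln (m x)) 0 =
    schwarzian (%x. of_real (Re ze0) + K * Ln x) (m 0) * (deriv m 0)\<^sup>2 + schwarzian m 0"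
  proof (rule schwarzian_compose[OF holm open_ball hL])
   show "open (- \<real>\<^sub>\<le>\<^sub>0 :: complex set)" by (simp add: closed_nonpos_Reals_complex open_Compl)
   show "m ` ball 0 1 \<subseteq> - \<real>\<^sub>\<le>\<^sub>0" using mnr by auto
   show "deriv m 0 \<noteq> 0" using dm0 sn by simp
   show "deriv (%x. of_real (Re ze0) + K * Ln x) (m 0) \<noteq> 0"
    using DERIV_imp_deriv[OF schwarzian_Ln_scaled(2)[OF p_nr K]] K m0 np by auto
  qed auto
  also have "\<dots> = 1 / (2 * p\<^sup>2) * (2 * \<i> * of_real sn)\<^sup>2"
   using schwarzian_Ln_scaled(1)[OF p_nr K] Dm(2)[of 0] by (simp add: m0 dm0)
  also have "\<dots> = of_real (k\<^sup>2 / 2) * (dc 0)\<^sup>2"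
   unfolding dc_def m0 K_def using k np by (simp add: power_mult_distrib power_divide field_simps)
  finally show ?thesis by (simp add: c_def[abs_def])
 qed
 have SY: "schwarzian Y 0 = schwarzian H ze0 * (dc 0)\<^sup>2 + schwarzian c 0"
 proof -
  define HH where "HH = {w::complex. Im w > 0}"
  have oHH: "open HH" unfolding HH_def by (intro open_Collect_less continuous_intros)
  have hcay: "cay holomorphic_on HH" by (rule has_derivatives_imp_holomorphic[OF oHH Dcay(1)]) (simp add: HH_def)
  define BB where "BB = ball ze0 (4 * Im ze0 * rh)"
  have HB: "H ` BB \<subseteq> HH" using pos by (auto simp: HH_def BB_def)
  have dc0: "dc 0 \<noteq> 0" unfolding dc_def m0 using K sn np by auto
  have ddc: "deriv c 0 = dc 0" using DERIV_imp_deriv[OF Dc[of 0]] by (simp add: dc_def)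
  have dcay: "deriv cay (H ze0) \<noteq> 0"
   using DERIV_imp_deriv[OF Dcay(1)[OF N0]] N0 den[OF N0] by (simp add: N0_def)
  have 1: "schwarzian (%x. cay (H x)) ze0 = schwarzian cay (H ze0) * (deriv H ze0)\<^sup>2 + schwarzian H ze0"
   by (rule schwarzian_compose[OF H[folded BB_def] _ hcay oHH HB]) (use z0b dH0 dcay in \<open>auto simp: BB_def\<close>)
  have DcH: "((%x. cay (H x)) has_field_derivative deriv cay (H x) * deriv H x) (at x)" if "x \<in> BB" for x
  proof -
   have P: "Im (H x) > 0" using pos[of x] that by (simp add: BB_def)
   have "((%x. cay (H x)) has_field_derivative (2 * \<i> * of_real (Im N0)) / (H x - cnj N0)\<^sup>2 * deriv H x) (at x)"
    using DERIV_chain2[where g = H, OF Dcay(1)[OF P] DH[of x]] that by (simp add: BB_def)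
   then show ?thesis using DERIV_imp_deriv[OF Dcay(1)[OF P]] by simp
  qed
  have hcH: "(%x. cay (H x)) holomorphic_on BB"
   by (rule has_derivatives_imp_holomorphic[OF _ DcH]) (simp_all add: BB_def)
  have "schwarzian (%x. (%x. cay (H x)) (c x)) 0 = schwarzian (%x. cay (H x)) (c 0) * (deriv c 0)\<^sup>2 + schwarzian c 0"
  proof (rule schwarzian_compose[OF holc open_ball hcH])
   show "c ` ball 0 rh \<subseteq> BB" using cball by (auto simp: BB_def)
   show "deriv (%x. cay (H x)) (c 0) \<noteq> 0"
    using DERIV_imp_deriv[OF DcH[of ze0]] z0b dH0 dcay by (simp add: c0 BB_def)
  qed (use rh dc0 ddc in \<open>auto simp: BB_def\<close>)
  then show ?thesis using 1 Dcay(2)[OF N0] ddc by (simp add: Y_def[abs_def] c0 N0_def)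
 qed
 have "schwarzian Y 0 = (schwarzian H ze0 + of_real (k\<^sup>2 / 2)) * (dc 0)\<^sup>2"
  unfolding SY Sc by (simp add: algebra_simps)
 moreover have "norm (dc 0) = 2 * sn / k" using dcn[of 0] by (simp add: c0 sn_def ta_def)
 ultimately show ?thesis using S unfolding sn_def ta_def by (simp add: norm_mult norm_power)
qed

section \<open>The boundary limit of the Schwarzian derivative\<close>

lemma sin_ge_half: assumes "0 \<le> x" "x \<le> 1" shows "x / 2 \<le> sin (x :: real)"
proof -
 have "sin 0 - 0 / 2 \<le> sin x - x / 2"
 proof (rule DERIV_nonneg_imp_nondecreasing[OF assms(1)])
  fix y assume y: "0 \<le> y" "y \<le> x"
  have "cos (pi / 3) \<le> cos y" using y assms pi_gt3 by (intro cos_monotone_0_pi_le) auto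
  then have "0 \<le> cos y - 1 / 2" by (simp add: cos_60)
  moreover have "((%y. sin y - y / 2) has_real_derivative cos y - 1 / 2) (at y)" by (auto intro!: derivative_eq_intros)
  ultimately show "\<exists>d. ((%y. sin y - y / 2) has_real_derivative d) (at y) \<and> 0 \<le> d" by blast
 qed
 then show ?thesis by simp
qed

lemma model_map_deriv: "(model_map ka ka' c has_field_derivative model_deriv ka ka' c et) (at et)"
 unfolding model_map_def[abs_def] model_deriv_def
 by (auto intro!: derivative_eq_intros simp: algebra_simps)

lemma model_map_holomorphic: "model_map ka ka' c holomorphic_on S"
 by (rule holomorphic_on_subset[OF has_derivatives_imp_holomorphic[OF open_UNIV model_map_deriv]]) auto

lemma model_schwarzian:
 "schwarzian (model_map ka ka' c) et = 6 * model_coeff ka ka' c / model_deriv ka ka' c et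
   - 3/2 * ((- \<i> * of_real ka + 6 * model_coeff ka ka' c * et) / model_deriv ka ka' c et)\<^sup>2"
proof -
 have 1: "deriv (model_map ka ka' c) = model_deriv ka ka' c" by (intro ext DERIV_imp_deriv model_map_deriv)
 have 2: "deriv (model_deriv ka ka' c) = (%et. - \<i> * of_real ka + 6 * model_coeff ka ka' c * et)"
  unfolding model_deriv_def[abs_def]
  by (intro ext DERIV_imp_deriv) (auto intro!: derivative_eq_intros simp: algebra_simps)
 have 3: "deriv (%et. - \<i> * of_real ka + 6 * model_coeff ka ka' c * et) = (%et. 6 * model_coeff ka ka' c)"
  by (intro ext DERIV_imp_deriv) (auto intro!: derivative_eq_intros)
 show ?thesis unfolding schwarzian_def 1 2 3 ..
qed

text \<open>At the origin the Schwarzian is six times the cubic coefficient plus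
  \<open>3/2 * ka\<^sup>2\<close>; the squares of the curvature cancel and
  \<open>3 * c - \<i> * ka'\<close> remains. Uniform continuity on a compact parameter set does the
  rest.\<close>

lemma model_schwarzian_limit:
 fixes B ep :: real
 assumes B: "B \<ge> 0" and ep: "ep > 0"
 obtains dt where "dt > 0"
  "\<And>ka ka' c et. \<bar>ka\<bar> \<le> B ==> \<bar>ka'\<bar> \<le> B ==> \<bar>c\<bar> \<le> B ==> norm et \<le> dt ==>
    norm (model_deriv ka ka' c et - 1) \<le> 1/2 \<and>
    norm (schwarzian (model_map ka ka' c) et - (of_real (3 * c) - \<i> * of_real ka')) < ep"
proof -
 define Q where "Q = {-B..B} \<times> {-B..B} \<times> {-B..B}"
 have cQ: "compact Q" unfolding Q_def by (intro compact_Times compact_Icc)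
 define D where "D y = model_deriv (fst (fst y)) (fst (snd (fst y))) (snd (snd (fst y))) (snd y)" for y :: "(real \<times> real \<times> real) \<times> complex"
 have cD: "continuous_on S D" for S
  unfolding D_def model_deriv_def model_coeff_def by (intro continuous_intros) auto
 have "uniformly_continuous_on (Q \<times> cball 0 1) D"
  by (intro compact_uniformly_continuous cD compact_Times cQ compact_cball)
 then obtain d1 where d1: "d1 > 0" "\<And>y y'. y \<in> Q \<times> cball 0 1 ==> y' \<in> Q \<times> cball 0 1 ==> dist y' y < d1 ==> dist (D y') (D y) < 1/2"
  unfolding uniformly_continuous_on_def by (metis half_gt_zero zero_less_one)
 define d2 where "d2 = min (d1 / 2) 1"
 have d2: "d2 > 0" "d2 < d1" "d2 \<le> 1" using d1 by (auto simp: d2_def)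
 have D1: "norm (D (q, et) - 1) < 1/2" if "q \<in> Q" "norm et \<le> d2" for q et
 proof -
  have "dist (D (q, et)) (D (q, 0)) < 1/2" using that d2 by (intro d1(2)) (auto simp: dist_Pair_Pair)
  moreover have "D (q, 0) = 1" by (simp add: D_def model_deriv_def)
  ultimately show ?thesis by (simp add: dist_norm)
 qed
 define S where "S y = 6 * model_coeff (fst (fst y)) (fst (snd (fst y))) (snd (snd (fst y))) / D y
   - 3/2 * ((- \<i> * of_real (fst (fst y)) + 6 * model_coeff (fst (fst y)) (fst (snd (fst y))) (snd (snd (fst y))) * snd y) / D y)\<^sup>2" for y
 have cS: "continuous_on (Q \<times> cball 0 d2) S"
 proof -
  have "D y \<noteq> 0" if "y \<in> Q \<times> cball 0 d2" for y using D1[of "fst y" "snd y"] that by auto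
  then show ?thesis unfolding S_def model_coeff_def by (intro continuous_intros cD) auto
 qed
 then have "uniformly_continuous_on (Q \<times> cball 0 d2) S"
  by (intro compact_uniformly_continuous compact_Times cQ compact_cball)
 then obtain d3 where d3: "d3 > 0" "\<And>y y'. y \<in> Q \<times> cball 0 d2 ==> y' \<in> Q \<times> cball 0 d2 ==> dist y' y < d3 ==> dist (S y') (S y) < ep"
  using ep unfolding uniformly_continuous_on_def by metis
 show ?thesis
 proof (rule that[of "min (d3 / 2) d2"])
  fix ka ka' c :: real and et :: complex
  assume as: "\<bar>ka\<bar> \<le> B" "\<bar>ka'\<bar> \<le> B" "\<bar>c\<bar> \<le> B" "norm et \<le> min (d3 / 2) d2"
  have q: "(ka, ka', c) \<in> Q" using as by (auto simp: Q_def)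
  have "dist (S ((ka, ka', c), et)) (S ((ka, ka', c), 0)) < ep"
   using q as d2 d3(1) by (intro d3(2)) (auto simp: dist_Pair_Pair)
  moreover have "S ((ka, ka', c), 0) = of_real (3 * c) - \<i> * of_real ka'"
   by (simp add: S_def D_def model_deriv_def model_coeff_def power2_eq_square field_simps)
  moreover have "S ((ka, ka', c), et) = schwarzian (model_map ka ka' c) et" by (simp add: S_def D_def model_schwarzian)
  moreover have "norm (model_deriv ka ka' c et - 1) \<le> 1/2" using D1[OF q, of et] as by (simp add: D_def)
  ultimately show "norm (model_deriv ka ka' c et - 1) \<le> 1/2 \<and>
    norm (schwarzian (model_map ka ka' c) et - (of_real (3 * c) - \<i> * of_real ka')) < ep" by (simp add: dist_norm)
 qed (use d2 d3 in auto)
qed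

locale liouville_collar = annular_collar \<Omega> \<beta> f g \<gamma> g1 g2 g3 L B
 for \<Omega> \<beta> f g \<gamma> g1 g2 g3 L B +
 fixes u :: "complex \<Rightarrow> real" and cc :: "real \<Rightarrow> real" and r a A :: real
 assumes conf: "\<And>ze. ze \<in> strip ==> exp (- u (G ze)) = norm (deriv G ze) * (sin (k * Im ze) / k)"
  and cc: "continuous_on UNIV cc" "\<And>s. cc (s + L) = cc s"
  and vv: "\<And>e. e > 0 ==> \<exists>d>0. \<forall>s x. 0 < x \<longrightarrow> x \<le> d \<longrightarrow> \<bar>exp (- u (npt s x)) - (x - kap s * x\<^sup>2 / 2 + cc s * x ^ 3)\<bar> \<le> e * x ^ 3"
  and r: "r > 0" and inball: "\<And>s. ball (npt s r) r \<subseteq> \<Omega>" and outball: "\<And>s. ball (npt s (- r)) r \<inter> \<Omega> = {}"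
  and near: "\<And>z. z \<in> \<Omega> ==> infdist z (range \<gamma>) < r ==> \<exists>s. z = npt s (infdist z (range \<gamma>))"
  and a: "a > 0" and A: "A > 0"
  and lin: "\<And>z. z \<in> \<Omega> ==> infdist z (range \<gamma>) < r ==> a * infdist z (range \<gamma>) \<le> tau z \<and> tau z \<le> A * infdist z (range \<gamma>)"
begin

lemma coeff_bounds: obtains M where "M \<ge> 1" "\<And>s. \<bar>kap s\<bar> \<le> M" "\<And>s. \<bar>kap' s\<bar> \<le> M" "\<And>s. \<bar>cc s\<bar> \<le> M"
proof -
 obtain B1 where B1: "B1 \<ge> 1" "\<And>s. \<bar>kap s\<bar> \<le> B1" "\<And>s. \<bar>kap' s\<bar> \<le> B1" using bounds by metis
 obtain B2 where B2: "B2 > 0" "\<And>s. norm (cc s) \<le> B2" using periodic_bounded[OF cc] by blast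
 show ?thesis
 proof (rule that[of "max B1 B2"])
  show "\<bar>kap s\<bar> \<le> max B1 B2" "\<bar>kap' s\<bar> \<le> max B1 B2" "\<bar>cc s\<bar> \<le> max B1 B2" for s
   using B1(2)[of s] B1(3)[of s] B2(2)[of s] by auto
 qed (use B1 in auto)
qed

lemma v_bounds: obtains d where "d > 0" "\<And>s x. 0 < x ==> x \<le> d ==> x / 2 \<le> exp (- u (npt s x)) \<and> exp (- u (npt s x)) \<le> 2 * x"
proof -
 obtain M where M: "M \<ge> 1" "\<And>s. \<bar>kap s\<bar> \<le> M" "\<And>s. \<bar>cc s\<bar> \<le> M" using coeff_bounds by metis
 obtain d where d: "d > 0" "\<And>s x. 0 < x ==> x \<le> d ==> \<bar>exp (- u (npt s x)) - (x - kap s * x\<^sup>2 / 2 + cc s * x ^ 3)\<bar> \<le> 1 * x ^ 3"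
  using vv[of 1] by auto
 define D where "D = min d (1 / (2 * (2 * M + 1)))"
 have D: "D > 0" using d M by (simp add: D_def)
 have "\<bar>exp (- u (npt s x)) - x\<bar> \<le> x / 2" if x: "0 < x" "x \<le> D" for s x
 proof -
  have xd: "x \<le> d" "x \<le> 1 / (2 * (2 * M + 1))" using x by (auto simp: D_def)
  have "1 / (2 * (2 * M + 1)) \<le> 1" using M(1) by simp
  then have x1: "x \<le> 1" using xd by linarith
  have x32: "x ^ 3 \<le> x\<^sup>2" using x x1 by (intro power_decreasing) auto
  have k2: "\<bar>kap s * x\<^sup>2 / 2\<bar> \<le> M * x\<^sup>2"
  proof -
   have "\<bar>kap s\<bar> * x\<^sup>2 \<le> M * x\<^sup>2" by (rule mult_right_mono[OF M(2)]) simp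
   moreover have "0 \<le> M * x\<^sup>2" using M(1) by simp
   ultimately have "\<bar>kap s\<bar> * x\<^sup>2 / 2 \<le> M * x\<^sup>2" by linarith
   then show ?thesis by (simp add: abs_mult)
  qed
  have c3: "\<bar>cc s * x ^ 3\<bar> \<le> M * x\<^sup>2"
   unfolding abs_mult using M(1,3) x32 x by (intro mult_mono) auto
  have "\<bar>exp (- u (npt s x)) - x\<bar> \<le> \<bar>exp (- u (npt s x)) - (x - kap s * x\<^sup>2 / 2 + cc s * x ^ 3)\<bar> + \<bar>kap s * x\<^sup>2 / 2\<bar> + \<bar>cc s * x ^ 3\<bar>"
   by linarith
  also have "\<dots> \<le> x\<^sup>2 + M * x\<^sup>2 + M * x\<^sup>2" using d(2)[OF x(1) xd(1), of s] x32 k2 c3 by linarith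
  also have "\<dots> = ((2 * M + 1) * x) * x" by (simp add: power2_eq_square algebra_simps)
  also have "\<dots> \<le> 1/2 * x"
  proof (rule mult_right_mono)
   have "(2 * M + 1) * x \<le> (2 * M + 1) * (1 / (2 * (2 * M + 1)))" using xd M(1) by (intro mult_left_mono) auto
   also have "\<dots> = 1/2" using M(1) by (simp add: field_simps)
   finally show "(2 * M + 1) * x \<le> 1/2" .
  qed (use x in auto)
  finally show ?thesis by simp
 qed
 then have "x / 2 \<le> exp (- u (npt s x)) \<and> exp (- u (npt s x)) \<le> 2 * x" if x: "0 < x" "x \<le> D" for s x
  using that by (smt (verit) field_sum_of_halves)
 then show ?thesis using that D by blast
qed

lemma infdist_pos: "z \<in> \<Omega> ==> infdist z curve > 0"
 using infdist_pos_not_in_closed[of curve z] compact_curve compact_imp_closed fr open\<Omega>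
 by (auto simp: frontier_def interior_open)

text \<open>\<open>v\<close> and \<open>tau\<close> are both comparable to the distance from the
  curve, and \<open>v = |G'| * sin (k * tau) / k\<close> is comparable to \<open>|G'| * tau\<close>.
  This takes the place of a boundary regularity theorem for conformal maps. The condition
  \<open>k * h \<le> 1\<close> lets the sine be bounded below by half its argument.\<close>

lemma G_bounds:
 obtains h b1 b2 where "h > 0" "h \<le> c0" "k * h \<le> 1" "b1 > 0" "b2 > 0"
  "\<And>ze. 0 < Im ze ==> Im ze < h ==> infdist (G ze) curve < r \<and> b1 \<le> norm (deriv G ze) \<and> norm (deriv G ze) \<le> b2"
proof -
 obtain d where d: "d > 0" "\<And>s x. 0 < x ==> x \<le> d ==> x / 2 \<le> exp (- u (npt s x)) \<and> exp (- u (npt s x)) \<le> 2 * x"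
  using v_bounds by blast
 obtain e where e: "e > 0" "\<And>z. z \<in> \<Omega> ==> tau z < e ==> infdist z curve < min d r"
  using T2[of "min d r"] d(1) r by auto
 define h where "h = Min {e, c0, 1 / k}"
 have h: "h > 0" "h \<le> e" "h \<le> c0" "h \<le> 1 / k" using e c0 k by (auto simp: h_def)
 have kh: "k * h \<le> 1" using mult_left_mono[OF h(4), of k] k by simp
 show ?thesis
 proof (rule that[OF h(1,3) kh, of "1 / (2 * A)" "4 / a"])
  fix ze assume ze: "0 < Im ze" "Im ze < h"
  have st: "ze \<in> strip" using ze h by (simp add: strip_def)
  define t where "t = Im ze"
  define x where "x = infdist (G ze) curve"
  have xr: "x < d" "x < r" using e(2)[OF G_in[OF st]] ze h by (auto simp: x_def tau_G[OF st])
  have x0: "x > 0" using infdist_pos[OF G_in[OF st]] by (simp add: x_def)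
  obtain s where s: "G ze = npt s x" using near[OF G_in[OF st]] xr by (auto simp: x_def)
  have v: "x / 2 \<le> exp (- u (G ze))" "exp (- u (G ze)) \<le> 2 * x" using d(2)[of x s] x0 xr unfolding s by auto
  have l: "a * x \<le> t" "t \<le> A * x" using lin[OF G_in[OF st]] xr tau_G[OF st] by (auto simp: x_def t_def)
  define q where "q = sin (k * t) / k"
  have t0: "t > 0" using ze by (simp add: t_def)
  have kt0: "0 \<le> k * t" using k t0 by simp
  have "k * t \<le> k * h" using k ze by (intro mult_left_mono) (auto simp: t_def)
  then have kt: "0 \<le> k * t" "k * t \<le> 1" using kh kt0 by linarith+
  have q: "t / 2 \<le> q" "q \<le> t"
  proof -
   have "k * t / 2 \<le> sin (k * t)" by (rule sin_ge_half[OF kt])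
   then show "t / 2 \<le> q" using k by (simp add: q_def field_simps)
   show "q \<le> t" using sin_x_le_x[OF kt(1)] k by (simp add: q_def field_simps)
  qed
  define D where "D = norm (deriv G ze)"
  have Dq: "D * q = exp (- u (G ze))" using conf[OF st] by (simp add: D_def q_def t_def)
  have D0: "D \<ge> 0" by (simp add: D_def)
  have "D * (t / 2) \<le> D * q" using q D0 by (intro mult_left_mono) auto
  also have "\<dots> \<le> 2 * x" using Dq v by simp
  also have "\<dots> \<le> 2 * (t / a)" using l a by (simp add: field_simps)
  finally have "D * (t / 2) \<le> 4 / a * (t / 2)" by simp
  then have up: "D \<le> 4 / a" using t0 by (subst (asm) mult_le_cancel_right) auto
  have "D * q \<le> D * t" using q D0 by (intro mult_left_mono) auto
  moreover have "t / (2 * A) \<le> x / 2" using l A by (simp add: field_simps)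
  ultimately have "1 / (2 * A) * t \<le> D * t" using Dq v by (simp add: mult.commute)
  then have "1 / (2 * A) \<le> D" using t0 by (subst (asm) mult_le_cancel_right) auto
  then show "infdist (G ze) curve < r \<and> 1 / (2 * A) \<le> norm (deriv G ze) \<and> norm (deriv G ze) \<le> 4 / a"
   using up xr by (simp add: x_def D_def)
 qed (use a A in auto)
qed

end

locale regular_collar = liouville_collar \<Omega> \<beta> f g \<gamma> g1 g2 g3 L B u cc r a A
 for \<Omega> \<beta> f g \<gamma> g1 g2 g3 L B u cc r a A +
 fixes h b1 b2 :: real
 assumes h: "h > 0" "h \<le> c0" "k * h \<le> 1" and b: "b1 > 0" "b2 > 0"
  and Gb: "\<And>ze. 0 < Im ze ==> Im ze < h ==> infdist (G ze) (range \<gamma>) < r \<and> b1 \<le> norm (deriv G ze) \<and> norm (deriv G ze) \<le> b2"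
begin

lemma collar_strip: "0 < Im ze ==> Im ze < h ==> ze \<in> strip"
 using h by (simp add: strip_def)

lemma convex_collar: "convex {ze. 0 < Im ze \<and> Im ze < h'}"
proof -
 have "{ze. 0 < Im ze \<and> Im ze < h'} = {z. 0 < Im z} \<inter> {z. Im z < h'}" by auto
 then show ?thesis by (simp add: convex_Int convex_halfspace_Im_gt convex_halfspace_Im_lt)
qed

lemma collar_lipschitz:
 assumes "\<And>ze. 0 < Im ze ==> Im ze < h' ==> (W has_field_derivative W' ze) (at ze)"
  and "\<And>ze. 0 < Im ze ==> Im ze < h' ==> norm (W' ze) \<le> K"
  and "0 < Im x" "Im x < h'" "0 < Im y" "Im y < h'"
 shows "norm (W x - W y) \<le> K * norm (x - y)"
 by (rule field_differentiable_bound[OF convex_collar[of h'], of W W' K])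
   (use assms in \<open>auto intro: has_field_derivative_at_within\<close>)

lemma G_lipschitz: "0 < Im x ==> Im x < h ==> 0 < Im y ==> Im y < h ==> norm (G x - G y) \<le> b2 * norm (x - y)"
 by (rule collar_lipschitz[where h' = h and W = G and W' = "deriv G"]) (use derivG(1) collar_strip Gb in auto)

lemma schwarzian_model_comp:
 assumes ze: "ze \<in> strip" and D: "model_deriv ka ka' c ((G ze - p) / e) \<noteq> 0" and e: "e \<noteq> 0"
 shows "schwarzian (%ze. model_map ka ka' c ((G ze - p) / e)) ze =
  schwarzian (model_map ka ka' c) ((G ze - p) / e) * (deriv G ze / e)\<^sup>2 + schwarzian G ze"
proof -
 define T where "T w = (1 * w + (- p)) / (0 * w + e)" for w
 have ne: "1 * e - (- p) * 0 \<noteq> 0" using e by simp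
 have DT: "(T has_field_derivative 1 / e) (at w)" "schwarzian T w = 0" for w
 proof -
  have q: "0 * w + e \<noteq> 0" using e by simp
  have "(T has_field_derivative (1 * e - (- p) * 0) / (0 * w + e)\<^sup>2) (at w)"
   unfolding T_def[abs_def] by (rule schwarzian_moebius(2)[OF ne q])
  then show "(T has_field_derivative 1 / e) (at w)" using e by (simp add: power2_eq_square)
  show "schwarzian T w = 0" unfolding T_def[abs_def] by (rule schwarzian_moebius(1)[OF ne q])
 qed
 have Teq: "T w = (w - p) / e" for w by (simp add: T_def)
 have hT: "T holomorphic_on UNIV" by (rule has_derivatives_imp_holomorphic[OF open_UNIV DT(1)])
 define X where "X ze = T (G ze)" for ze
 have DX: "(X has_field_derivative 1 / e * deriv G w) (at w)" if "w \<in> strip" for w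
  unfolding X_def by (rule DERIV_chain2[where g = G, OF DT(1) derivG(1)[OF that]])
 have hX: "X holomorphic_on strip" by (rule has_derivatives_imp_holomorphic[OF open_strip DX])
 have SX: "schwarzian X ze = schwarzian G ze"
  unfolding X_def
  by (subst schwarzian_compose[OF holG open_strip hT open_UNIV _ ze derivG(3)[OF ze]])
    (use DT e in \<open>auto simp: DERIV_imp_deriv[OF DT(1)]\<close>)
 have dX: "deriv X ze = deriv G ze / e" using DERIV_imp_deriv[OF DX[OF ze]] by simp
 have "schwarzian (%ze. model_map ka ka' c (X ze)) ze = schwarzian (model_map ka ka' c) (X ze) * (deriv X ze)\<^sup>2 + schwarzian X ze"
  by (rule schwarzian_compose[OF hX open_strip model_map_holomorphic open_UNIV _ ze])
    (use dX derivG(3)[OF ze] e D in \<open>auto simp: X_def Teq DERIV_imp_deriv[OF model_map_deriv]\<close>)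
 then show ?thesis unfolding SX dX by (simp add: X_def Teq)
qed

text \<open>On a disc of radius proportional to \<open>Im ze0\<close> the map \<open>G\<close> moves
  by at most half of \<open>d0\<close>, by the Lipschitz bound and the choice of \<open>rh\<close>.
  So everything happens at scale \<open>d0\<close> around one boundary point, both along the curve
  and normal to it.\<close>

lemma local_param:
 assumes A0: "A0 > 0" "\<forall>s. \<forall>z\<in>curve. \<exists>t. z = \<gamma> t \<and> \<bar>t - s\<bar> \<le> A0 * norm (z - \<gamma> s) \<and> \<bar>t - s\<bar> \<le> L / 2"
  and z0: "0 < Im ze0" "Im ze0 < h / 2" and s0: "G ze0 = npt s0 d0" and d0: "d0 = infdist (G ze0) curve"
  and rh: "0 < rh" "rh \<le> 1/8" "rh \<le> 1 / (8 * b2 * A)"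
  and ze: "ze \<in> ball ze0 (4 * Im ze0 * rh)"
 shows "0 < Im ze \<and> Im ze < h" "d0 > 0" "norm (G ze - \<gamma> s0) \<le> 3/2 * d0"
  "\<exists>t x. G ze = npt t x \<and> d0 / 2 \<le> x \<and> x \<le> 3/2 * d0 \<and> \<bar>t - s0\<bar> \<le> 3 * A0 * d0"
proof -
 define ta where "ta = Im ze0"
 have z0s: "ze0 \<in> strip" using z0 h by (intro collar_strip) auto
 have dist: "norm (ze - ze0) \<le> 4 * ta * rh" using ze by (simp add: ta_def dist_norm norm_minus_commute)
 have "4 * ta * rh \<le> 4 * ta * (1/8)" using rh z0 by (intro mult_left_mono) (auto simp: ta_def)
 then have "\<bar>Im ze - Im ze0\<bar> \<le> ta / 2" using abs_Im_le_cmod[of "ze - ze0"] dist by simp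
 then show I: "0 < Im ze \<and> Im ze < h" using z0 unfolding ta_def by linarith
 show d0p: "d0 > 0" unfolding d0 by (rule infdist_pos[OF G_in[OF z0s]])
 have "infdist (G ze0) curve < r" using Gb[of ze0] z0 h by auto
 then have taA: "ta \<le> A * d0" using lin[OF G_in[OF z0s]] tau_G[OF z0s] by (auto simp: d0 ta_def)
 have "norm (G ze - G ze0) \<le> b2 * norm (ze - ze0)" using I z0 h by (intro G_lipschitz) auto
 also have "\<dots> \<le> b2 * (4 * (A * d0) * (1 / (8 * b2 * A)))"
 proof (rule mult_left_mono)
  have "4 * ta * rh \<le> 4 * (A * d0) * (1 / (8 * b2 * A))"
   using taA rh b A d0p by (intro mult_mono mult_left_mono) auto
  then show "norm (ze - ze0) \<le> 4 * (A * d0) * (1 / (8 * b2 * A))" using dist by linarith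
 qed (use b in auto)
 also have "\<dots> = d0 / 2" using b A by (simp add: field_simps)
 finally have GG: "norm (G ze - G ze0) \<le> d0 / 2" .
 have z0d: "norm (G ze0 - \<gamma> s0) = d0" using npt_dist[of s0 d0 0] d0p by (simp add: s0 npt_0 dist_norm)
 show "norm (G ze - \<gamma> s0) \<le> 3/2 * d0"
  using norm_triangle_ineq[of "G ze - G ze0" "G ze0 - \<gamma> s0"] GG z0d by simp
 define x where "x = infdist (G ze) curve"
 have x: "d0 / 2 \<le> x" "x \<le> 3/2 * d0"
  using infdist_triangle[of "G ze" curve "G ze0"] infdist_triangle[of "G ze0" curve "G ze"] GG
  by (auto simp: x_def d0[symmetric] dist_norm norm_minus_commute)
 obtain s where s: "G ze = npt s x" using near[OF G_in[OF collar_strip]] I Gb[of ze] by (auto simp: x_def)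
 have sx: "norm (\<gamma> s - G ze) = x" using npt_dist[of s 0 x] x d0p by (simp add: s npt_0 dist_norm)
 obtain t where t: "\<gamma> s = \<gamma> t" "\<bar>t - s0\<bar> \<le> A0 * norm (\<gamma> s - \<gamma> s0)" using A0(2)[rule_format, of "\<gamma> s" s0] by auto
 have "norm (\<gamma> s - \<gamma> s0) \<le> norm (\<gamma> s - G ze) + (norm (G ze - G ze0) + norm (G ze0 - \<gamma> s0))"
  using norm_triangle_ineq[of "\<gamma> s - G ze" "G ze - \<gamma> s0"] norm_triangle_ineq[of "G ze - G ze0" "G ze0 - \<gamma> s0"] by simp
 then have "norm (\<gamma> s - \<gamma> s0) \<le> 3 * d0" using sx GG z0d x by linarith
 then have "A0 * norm (\<gamma> s - \<gamma> s0) \<le> A0 * (3 * d0)" using A0 by (intro mult_left_mono) auto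
 then have "\<bar>t - s0\<bar> \<le> 3 * A0 * d0" using t by (simp add: algebra_simps)
 moreover have "G ze = npt t x" using s t frame_eq(1)[OF t(1)] by (simp add: npt_def)
 ultimately show "\<exists>t x. G ze = npt t x \<and> d0 / 2 \<le> x \<and> x \<le> 3/2 * d0 \<and> \<bar>t - s0\<bar> \<le> 3 * A0 * d0" using x by blast
qed

text \<open>An absolute error \<open>m * d ^ 3\<close> in a quantity of size \<open>d\<close> is a
  relative error of order \<open>m * d\<^sup>2\<close>; these two powers pay for the squared
  hyperbolic scale in the Schwarzian estimate.\<close>

lemma ratio_bound:
 fixes p q m d :: real
 assumes "\<bar>p - q\<bar> \<le> m * d ^ 3" "d / 8 \<le> p" "0 < d" "d \<le> 1" "0 < m" "m \<le> 1/32"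
 shows "q > 0" "\<bar>p / q - 1\<bar> \<le> 16 * m * d\<^sup>2"
proof -
 have d2: "d\<^sup>2 \<le> 1" using assms by (simp add: power_le_one)
 have "m * d\<^sup>2 \<le> 1/32 * 1" using assms d2 by (intro mult_mono) auto
 then have "m * d\<^sup>2 * d \<le> 1/32 * d" using assms by (intro mult_right_mono) auto
 then have "m * d ^ 3 \<le> d / 32" by (simp add: power3_eq_cube power2_eq_square algebra_simps)
 then have q: "d / 16 \<le> q" using assms by linarith
 then show q0: "q > 0" using assms by linarith
 have "\<bar>p / q - 1\<bar> = \<bar>p - q\<bar> / q" using q0 by (simp add: field_simps)
 also have "\<dots> \<le> m * d ^ 3 / (d / 16)" using assms q q0 by (intro frac_le) auto
 also have "\<dots> = 16 * m * d\<^sup>2" using assms by (simp add: power3_eq_cube power2_eq_square field_simps)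
 finally show "\<bar>p / q - 1\<bar> \<le> 16 * m * d\<^sup>2" .
qed

text \<open>The composition \<open>H\<close> of \<open>G\<close> with the model map is a near
  isometry from the strip to the half plane with relative error o(d^2) on a disc of fixed hyperbolic
  size. Dividing by the squared scale shows that its Schwarzian tends to
  \<open>- k\<^sup>2 / 2\<close>, and removing the known Schwarzian of the model map leaves that of
  \<open>G\<close>.\<close>

lemma schwarzian_limit:
 assumes ep: "ep > 0"
 obtains h' where "0 < h'" "h' \<le> h"
  "\<And>ze s. 0 < Im ze ==> Im ze < h' ==> G ze = npt s (infdist (G ze) curve) ==>
   norm (schwarzian G ze + of_real (k\<^sup>2 / 2) + (of_real (3 * cc s) - \<i> * of_real (kap' s)) * (deriv G ze / g1 s)\<^sup>2) \<le> ep"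
proof -
 obtain M where M: "M \<ge> 1" "\<And>s. \<bar>kap s\<bar> \<le> M" "\<And>s. \<bar>kap' s\<bar> \<le> M" "\<And>s. \<bar>cc s\<bar> \<le> M" using coeff_bounds by blast
 have "M \<ge> 0" "ep / (2 * b2\<^sup>2) > 0" using M ep b by auto
 from model_schwarzian_limit[OF this] obtain dt where dt: "dt > 0"
  "\<And>ka ka' c et. \<bar>ka\<bar> \<le> M ==> \<bar>ka'\<bar> \<le> M ==> \<bar>c\<bar> \<le> M ==> norm et \<le> dt ==>
    norm (model_deriv ka ka' c et - 1) \<le> 1/2 \<and>
    norm (schwarzian (model_map ka ka' c) et - (of_real (3 * c) - \<i> * of_real ka')) < ep / (2 * b2\<^sup>2)" by blast
 obtain A0 where A0': "A0 > 0" "\<And>s z. z \<in> curve ==> \<exists>t. z = \<gamma> t \<and> \<bar>t - s\<bar> \<le> A0 * norm (z - \<gamma> s) \<and> \<bar>t - s\<bar> \<le> L / 2"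
  using near_param by blast
 have A0: "A0 > 0" "\<forall>s. \<forall>z\<in>curve. \<exists>t. z = \<gamma> t \<and> \<bar>t - s\<bar> \<le> A0 * norm (z - \<gamma> s) \<and> \<bar>t - s\<bar> \<le> L / 2"
  by (rule A0'(1)) (intro allI ballI A0'(2))
 obtain dv where dv: "dv > 0" "\<And>s x. 0 < x ==> x \<le> dv ==> x / 2 \<le> exp (- u (npt s x)) \<and> exp (- u (npt s x)) \<le> 2 * x"
  using v_bounds by blast
 \<comment> \<open>\<open>K * d0\<close> dominates both the shift along the curve and the normal
   distance, so it can serve as the scale in the expansion lemma.\<close>
 define K where "K = max (3 * A0) (3/2)"
 have K: "K > 0" "3 * A0 \<le> K" "3/2 \<le> K" by (auto simp: K_def)
 define rh where "rh = min (1/8) (1 / (8 * b2 * A))"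
 have rh: "0 < rh" "rh \<le> 1/8" "rh \<le> 1 / (8 * b2 * A)" using b A by (auto simp: rh_def)
 \<comment> \<open>Calibrated so that \<open>40000 / rh\<^sup>2 * (16 * m * d0\<^sup>2)\<close> is
   at most \<open>ep / 2 * (a * d0)\<^sup>2\<close>; the bound 1/32 serves
   \<open>ratio_bound\<close>.\<close>
 define m where "m = min (1/32) (ep * rh\<^sup>2 * a\<^sup>2 / 1280000)"
 have m: "0 < m" "m \<le> 1/32" "m \<le> ep * rh\<^sup>2 * a\<^sup>2 / 1280000" using ep rh a by (auto simp: m_def)
 have "m / K ^ 3 > 0" using m K by simp
 from boundary_expansion_model[OF cc vv this] obtain de where de: "de > 0"
  "\<And>s0 s x h. 0 < h ==> h \<le> de ==> \<bar>s - s0\<bar> \<le> h ==> 0 < x ==> x \<le> h ==>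
   \<bar>exp (- u (npt s x)) * norm (model_deriv (kap s0) (kap' s0) (cc s0) ((\<gamma> s + \<i> * of_real x * g1 s - \<gamma> s0) / g1 s0))
    - Im (model_map (kap s0) (kap' s0) (cc s0) ((\<gamma> s + \<i> * of_real x * g1 s - \<gamma> s0) / g1 s0))\<bar> \<le> m / K ^ 3 * h ^ 3" by blast
 define dm where "dm = Min {dv / 2, de / K, dt / 2, 1}"
 have dm0: "dm > 0" using dv(1) de(1) dt(1) K by (simp add: dm_def)
 have dm1: "dm \<le> dv / 2" unfolding dm_def by (rule Min_le; simp)
 have dm2: "dm \<le> de / K" unfolding dm_def by (rule Min_le; simp)
 have dm3: "dm \<le> dt / 2" unfolding dm_def by (rule Min_le; simp)
 have dm4: "dm \<le> 1" unfolding dm_def by (rule Min_le; simp)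
 note dm = dm0 dm1 dm2 dm3 dm4
 define h' where "h' = min (h / 2) (a * dm)"
 have h': "h' > 0" "h' \<le> h / 2" "h' \<le> a * dm" using h a dm by (auto simp: h'_def)
 show ?thesis
 proof (rule that[of h'])
  fix ze0 s0 assume z0: "0 < Im ze0" "Im ze0 < h'" and s00: "G ze0 = npt s0 (infdist (G ze0) curve)"
  define d0 where "d0 = infdist (G ze0) curve"
  define ta where "ta = Im ze0"
  have s0: "G ze0 = npt s0 d0" using s00 by (simp add: d0_def)
  have z0h: "Im ze0 < h / 2" using z0 h' by linarith
  note lp = local_param[OF A0 z0(1) z0h s0 d0_def rh]
  have z0s: "ze0 \<in> strip" using z0 z0h h by (intro collar_strip) auto
  have self: "ze0 \<in> ball ze0 (4 * Im ze0 * rh)" using z0 rh by simp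
  have d0: "d0 > 0" by (rule lp(2)[OF self])
  have "infdist (G ze0) curve < r" using Gb[of ze0] z0 z0h h by auto
  then have ad: "a * d0 \<le> ta" using lin[OF G_in[OF z0s]] tau_G[OF z0s] by (auto simp: d0_def ta_def)
  then have "a * d0 \<le> a * dm" using z0 h' by (simp add: ta_def)
  then have d0m: "d0 \<le> dm" using a by simp
  define Q where "Q = model_map (kap s0) (kap' s0) (cc s0)"
  define Qd where "Qd = model_deriv (kap s0) (kap' s0) (cc s0)"
  define et where "et ze = (G ze - \<gamma> s0) / g1 s0" for ze
  define H where "H ze = Q (et ze)" for ze
  have g10: "g1 s0 \<noteq> 0" using unit[of s0] by auto
  have net: "norm (et ze) \<le> dt" if "ze \<in> ball ze0 (4 * Im ze0 * rh)" for ze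
   using lp(3)[OF that] d0m dm d0 by (simp add: et_def norm_divide unit)
  note mm = dt(2)[OF M(2)[of s0] M(3)[of s0] M(4)[of s0] net]
  have Qd: "norm (Qd (et ze)) \<ge> 1/2" if "ze \<in> ball ze0 (4 * Im ze0 * rh)" for ze
   using mm[OF that] norm_triangle_ineq2[of 1 "1 - Qd (et ze)"] by (simp add: Qd_def norm_minus_commute)
  have Det: "(et has_field_derivative deriv G ze / g1 s0) (at ze)" if "ze \<in> strip" for ze
   unfolding et_def[abs_def] using derivG(1)[OF that] g10 by (auto intro!: derivative_eq_intros)
  have DH: "(H has_field_derivative Qd (et ze) * (deriv G ze / g1 s0)) (at ze)" if "ze \<in> strip" for ze
   unfolding H_def[abs_def] Q_def Qd_def by (rule DERIV_chain2[where g = et, OF model_map_deriv Det[OF that]])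
  have bs: "ball ze0 (4 * Im ze0 * rh) \<subseteq> strip" using lp(1) collar_strip by blast
  \<comment> \<open>By the conformal factor formula the numerator is \<open>v\<close> times the
    modulus of the model derivative, which is the quantity compared with the height in the expansion
    lemma.\<close>
  have ratio: "0 < Im (H ze) \<and> \<bar>norm (deriv H ze) * (sin (k * Im ze) / k) / Im (H ze) - 1\<bar> \<le> 16 * m * d0\<^sup>2"
   if ze: "ze \<in> ball ze0 (4 * Im ze0 * rh)" for ze
  proof -
   have zes: "ze \<in> strip" using ze bs by blast
   obtain t x where tx: "G ze = npt t x" "d0 / 2 \<le> x" "x \<le> 3/2 * d0" "\<bar>t - s0\<bar> \<le> 3 * A0 * d0" using lp(4)[OF ze] by blast
   have x0: "x > 0" using tx d0 by linarith
   have Kd: "0 < K * d0" "K * d0 \<le> de"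
    using K d0 mult_left_mono[OF order_trans[OF d0m dm(3)], of K] by auto
   have tK: "\<bar>t - s0\<bar> \<le> K * d0" "x \<le> K * d0"
    using mult_right_mono[OF K(2), of d0] mult_right_mono[OF K(3), of d0] d0 tx by linarith+
   have e1: "\<gamma> t + \<i> * of_real x * g1 t = G ze" using tx(1) by (simp add: npt_def)
   define p where "p = exp (- u (G ze)) * norm (Qd (et ze))"
   have "\<bar>p - Im (H ze)\<bar> \<le> m / K ^ 3 * (K * d0) ^ 3"
    using de(2)[OF Kd tK(1) x0 tK(2)] unfolding e1 tx(1)[symmetric] by (simp add: p_def H_def Q_def Qd_def et_def)
   then have pq: "\<bar>p - Im (H ze)\<bar> \<le> m * d0 ^ 3" using K by (simp add: power_mult_distrib)
   have "x \<le> dv" using tx d0m dm d0 by linarith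
   then have "d0 / 4 \<le> exp (- u (G ze))" using dv(2)[OF x0, of t] tx by auto
   then have "d0 / 4 * (1/2) \<le> p" unfolding p_def using Qd[OF ze] d0 by (intro mult_mono) auto
   then have p8: "d0 / 8 \<le> p" by simp
   have d01: "d0 \<le> 1" using d0m dm by linarith
   have "norm (deriv H ze) * (sin (k * Im ze) / k) = norm (Qd (et ze)) * (norm (deriv G ze) * (sin (k * Im ze) / k))"
    using DERIV_imp_deriv[OF DH[OF zes]] by (simp add: norm_mult norm_divide unit)
   also have "\<dots> = p" unfolding conf[OF zes, symmetric] by (simp add: p_def)
   finally have pe: "norm (deriv H ze) * (sin (k * Im ze) / k) = p" .
   show ?thesis unfolding pe using ratio_bound[OF pq p8 d0 d01 m(1,2)] by blast
  qed
  have kpi: "k * Im ze0 < pi"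
  proof -
   have "k * Im ze0 \<le> k * h" using k z0h z0 by (intro mult_left_mono) auto
   then show ?thesis using h pi_gt3 by linarith
  qed
  have d02: "d0\<^sup>2 \<le> 1" using d0 d0m dm by (intro power_le_one) auto
  have e: "0 < 16 * m * d0\<^sup>2" "16 * m * d0\<^sup>2 \<le> 1/2"
   using m d0 mult_mono[of "16 * m" "1/2" "d0\<^sup>2" 1] d02 by auto
  have HH: "H holomorphic_on ball ze0 (4 * Im ze0 * rh)"
   by (rule has_derivatives_imp_holomorphic[OF open_ball DH]) (use bs in blast)
  have rh4: "rh \<le> 1/4" using rh by simp
  define X where "X = schwarzian H ze0 + of_real (k\<^sup>2 / 2)"
  have "norm X * (2 * sin (k * Im ze0) / k)\<^sup>2 \<le> 40000 / rh\<^sup>2 * (16 * m * d0\<^sup>2)"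
   unfolding X_def by (rule strip_near_isometry_schwarzian[OF k z0(1) kpi rh(1) rh4 HH e]) (use ratio in auto)
  \<comment> \<open>The hyperbolic scale \<open>2 sin / k\<close> is at least \<open>Im ze0\<close>,
    hence at least \<open>a * d0\<close>; this allows the factor \<open>d0\<^sup>2\<close> to be
    cancelled.\<close>
  moreover have "norm X * (a * d0)\<^sup>2 \<le> norm X * (2 * sin (k * Im ze0) / k)\<^sup>2"
  proof (rule mult_left_mono[OF power_mono])
   have "k * ta \<le> k * h" using k z0h z0 by (intro mult_left_mono) (auto simp: ta_def)
   then have "k * ta \<le> 1" using h by linarith
   moreover have "0 \<le> k * ta" using k z0 by (simp add: ta_def)
   ultimately have "k * ta / 2 \<le> sin (k * ta)" by (intro sin_ge_half)
   then have "ta \<le> 2 * sin (k * ta) / k" using k by (simp add: field_simps)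
   then show "a * d0 \<le> 2 * sin (k * Im ze0) / k" using ad by (simp add: ta_def)
  qed (use a d0 in auto)
  ultimately have "norm X * (a * d0)\<^sup>2 \<le> 40000 / rh\<^sup>2 * (16 * m * d0\<^sup>2)" by linarith
  also have "\<dots> \<le> 40000 / rh\<^sup>2 * (16 * (ep * rh\<^sup>2 * a\<^sup>2 / 1280000) * d0\<^sup>2)" using m by (intro mult_left_mono mult_right_mono) auto
  also have "\<dots> = ep / 2 * (a * d0)\<^sup>2" using rh by (simp add: field_simps)
  finally have X: "norm X \<le> ep / 2" using a d0 by (subst (asm) mult_le_cancel_right) auto
  define q where "q = of_real (3 * cc s0) - \<i> * complex_of_real (kap' s0)"
  define D where "D = (deriv G ze0 / g1 s0)\<^sup>2"
  have nD: "norm D \<le> b2\<^sup>2" using Gb[of ze0] z0 z0h h by (simp add: D_def norm_power norm_divide unit power_mono)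
  have "model_deriv (kap s0) (kap' s0) (cc s0) ((G ze0 - \<gamma> s0) / g1 s0) \<noteq> 0"
   using Qd[OF self] by (auto simp: Qd_def et_def)
  from schwarzian_model_comp[OF z0s this g10]
  have SH: "schwarzian H ze0 = schwarzian Q (et ze0) * D + schwarzian G ze0"
   by (simp add: H_def[abs_def] Q_def et_def D_def)
  have "norm (schwarzian Q (et ze0) - q) * norm D \<le> ep / (2 * b2\<^sup>2) * b2\<^sup>2"
   using mm[OF self] nD ep by (intro mult_mono) (auto simp: Q_def q_def)
  also have "\<dots> = ep / 2" using b by simp
  finally have Y: "norm ((schwarzian Q (et ze0) - q) * D) \<le> ep / 2" by (simp add: norm_mult)
  have "schwarzian G ze0 + of_real (k\<^sup>2 / 2) + q * D = X - (schwarzian Q (et ze0) - q) * D"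
   by (simp add: X_def SH algebra_simps)
  then have "norm (schwarzian G ze0 + of_real (k\<^sup>2 / 2) + q * D) \<le> ep"
   using norm_triangle_ineq4[of X "(schwarzian Q (et ze0) - q) * D"] X Y by simp
  then show "norm (schwarzian G ze0 + of_real (k\<^sup>2 / 2) + (of_real (3 * cc s0) - \<i> * of_real (kap' s0)) * (deriv G ze0 / g1 s0)\<^sup>2) \<le> ep"
   by (simp add: q_def D_def)
 qed (use h' h in auto)
qed

end

section \<open>Boundary values of Lipschitz functions on a strip\<close>

lemma le_all_small_imp_le:
 fixes x y K h :: real
 assumes h: "h > 0" and le: "\<And>t. 0 < t ==> t < h ==> x \<le> y + K * t"
 shows "x \<le> y"
proof (rule tendsto_lowerbound[where F = "at_right (0 :: real)" and f = "%t. y + K * t"])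
 have "((%t. y + K * t) \<longlongrightarrow> y + K * 0) (at_right 0)" by (intro tendsto_intros)
 then show "((%t. y + K * t) \<longlongrightarrow> y) (at_right 0)" by simp
 show "\<forall>\<^sub>F t in at_right 0. x \<le> y + K * t"
  using eventually_at_right_real[OF h] by eventually_elim (use le in auto)
qed auto

text \<open>Values along a vertical sequence are Cauchy, and the Lipschitz bound gives the linear
  rate for every height.\<close>

lemma lipschitz_boundary_values:
 fixes W :: "complex \<Rightarrow> complex"
 assumes h: "h > 0"
  and lip: "\<And>x y. 0 < Im x ==> Im x < h ==> 0 < Im y ==> Im y < h ==> norm (W x - W y) \<le> K * norm (x - y)"
 obtains W0 where "\<And>th t. 0 < t ==> t < h ==> norm (W (Complex th t) - W0 th) \<le> K * t"
proof -
 \<comment> \<open>The summand 2 keeps every height strictly below \<open>h\<close>, including the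
   first.\<close>
 define Y where "Y n = h / (real n + 2)" for n
 have Y: "0 < Y n" "Y n < h" for n using h by (auto simp: Y_def field_simps intro: add_pos_nonneg)
 have Y0: "Y \<longlonglongrightarrow> 0"
 proof -
  have "filterlim (%n. 2 + real n) at_top sequentially"
   by (rule filterlim_tendsto_add_at_top[OF tendsto_const filterlim_real_sequentially])
  then show ?thesis unfolding Y_def[abs_def] by (intro real_tendsto_divide_at_top[OF tendsto_const]) (simp add: add.commute)
 qed
 have vert: "norm (W (Complex th s) - W (Complex th t)) \<le> K * \<bar>s - t\<bar>" if "0 < s" "s < h" "0 < t" "t < h" for th s t
 proof -
  have "norm (Complex th s - Complex th t) = \<bar>s - t\<bar>" by (simp add: cmod_def)
  then show ?thesis using lip[of "Complex th s" "Complex th t"] that by simp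
 qed
 have K: "K \<ge> 0" using order_trans[OF norm_ge_zero vert[of "h/2" "h/3" 0]] h by (simp add: zero_le_mult_iff)
 have ex: "\<exists>l. (%n. W (Complex th (Y n))) \<longlonglongrightarrow> l" for th
 proof -
  have "Cauchy (%n. W (Complex th (Y n)))"
  proof (rule metric_CauchyI)
   fix e :: real assume e: "e > 0"
   have "Cauchy Y" using Y0 by (intro convergent_Cauchy) (auto simp: convergent_def)
   then obtain M where M: "\<And>m n. m \<ge> M ==> n \<ge> M ==> dist (Y m) (Y n) < e / (K + 1)"
    using e K unfolding Cauchy_def by (metis add_nonneg_pos divide_pos_pos zero_less_one)
   have "dist (W (Complex th (Y m))) (W (Complex th (Y n))) < e" if mn: "m \<ge> M" "n \<ge> M" for m n
   proof -
    have "dist (W (Complex th (Y m))) (W (Complex th (Y n))) \<le> K * dist (Y m) (Y n)"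
     using vert[OF Y Y] by (simp add: dist_norm)
    also have "\<dots> \<le> (K + 1) * dist (Y m) (Y n)" by (simp add: mult_right_mono)
    also have "\<dots> < (K + 1) * (e / (K + 1))" using M[OF mn] K by (intro mult_strict_left_mono) auto
    also have "\<dots> = e" using K by simp
    finally show ?thesis .
   qed
   then show "\<exists>M. \<forall>m\<ge>M. \<forall>n\<ge>M. dist (W (Complex th (Y m))) (W (Complex th (Y n))) < e" by blast
  qed
  then show ?thesis using Cauchy_convergent convergent_def by blast
 qed
 then obtain W0 where W0: "\<And>th. (%n. W (Complex th (Y n))) \<longlonglongrightarrow> W0 th" by metis
 show ?thesis
 proof (rule that[of W0])
  fix th t :: real assume t: "0 < t" "t < h"
  have "(%n. norm (W (Complex th t) - W (Complex th (Y n)))) \<longlonglongrightarrow> norm (W (Complex th t) - W0 th)"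
   by (intro tendsto_norm tendsto_diff tendsto_const W0)
  moreover have "(%n. K * \<bar>t - Y n\<bar>) \<longlonglongrightarrow> K * \<bar>t - 0\<bar>"
   by (intro tendsto_mult tendsto_const tendsto_rabs tendsto_diff Y0)
  ultimately have "norm (W (Complex th t) - W0 th) \<le> K * \<bar>t - 0\<bar>"
   by (rule LIMSEQ_le) (use vert[OF t Y] in auto)
  then show "norm (W (Complex th t) - W0 th) \<le> K * t" using t by simp
 qed
qed

lemma boundary_values_lipschitz:
 fixes W :: "complex \<Rightarrow> complex"
 assumes h: "h > 0"
  and lip: "\<And>x y. 0 < Im x ==> Im x < h ==> 0 < Im y ==> Im y < h ==> norm (W x - W y) \<le> K * norm (x - y)"
  and W0: "\<And>th t. 0 < t ==> t < h ==> norm (W (Complex th t) - W0 th) \<le> K * t"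
 shows "norm (W0 x - W0 y) \<le> K * \<bar>x - y\<bar>" "continuous_on UNIV W0"
proof -
 show *: "norm (W0 x - W0 y) \<le> K * \<bar>x - y\<bar>" for x y
 proof (rule le_all_small_imp_le[OF h, where K = "2 * K"])
  fix t :: real assume t: "0 < t" "t < h"
  have "Complex x t - Complex y t = of_real (x - y)" by (simp add: complex_eq_iff)
  then have "norm (Complex x t - Complex y t) = \<bar>x - y\<bar>" by (simp only: norm_of_real)
  then have "norm (W (Complex x t) - W (Complex y t)) \<le> K * \<bar>x - y\<bar>" using lip[of "Complex x t" "Complex y t"] t by simp
  moreover have "norm (W0 x - W0 y) \<le> norm (W (Complex x t) - W0 x) + norm (W (Complex x t) - W (Complex y t)) + norm (W (Complex y t) - W0 y)"
   using norm_triangle_ineq4[of "W (Complex x t) - W0 x" "W (Complex x t) - W (Complex y t)"]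
    norm_triangle_ineq4[of "(W (Complex x t) - W0 x) - (W (Complex x t) - W (Complex y t))" "W (Complex y t) - W0 y"]
   by (simp add: norm_minus_commute)
  ultimately show "norm (W0 x - W0 y) \<le> K * \<bar>x - y\<bar> + 2 * K * t" using W0[OF t, of x] W0[OF t, of y] by linarith
 qed
 have K: "K \<ge> 0" using order_trans[OF norm_ge_zero *[of 1 0]] by simp
 show "continuous_on UNIV W0"
  by (rule lipschitz_on_continuous_on[of K]) (auto simp: lipschitz_on_def K dist_norm *)
qed

lemma has_vector_derivative_quadratic:
 fixes f :: "real \<Rightarrow> complex"
 assumes "\<And>y. norm (f y - f x - of_real (y - x) * D) \<le> K * (y - x)\<^sup>2"
 shows "(f has_vector_derivative D) (at x)"
 unfolding has_vector_derivative_def has_derivative_at2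
proof (intro conjI bounded_linear_scaleR_left)
 show "((%y. (1 / norm (y - x)) *\<^sub>R (f y - (f x + (y - x) *\<^sub>R D))) \<longlongrightarrow> 0) (at x)"
 proof (rule Lim_null_comparison[where g = "%y. K * \<bar>y - x\<bar>"])
  show "\<forall>\<^sub>F y in at x. norm ((1 / norm (y - x)) *\<^sub>R (f y - (f x + (y - x) *\<^sub>R D))) \<le> K * \<bar>y - x\<bar>"
   unfolding eventually_at_filter
  proof (rule always_eventually, intro allI impI)
   fix y assume "y \<noteq> x"
   then have p: "\<bar>y - x\<bar> > 0" by simp
   have "norm (f y - (f x + (y - x) *\<^sub>R D)) \<le> K * (y - x)\<^sup>2" using assms[of y] by (simp add: scaleR_conv_of_real algebra_simps)
   also have "\<dots> = K * \<bar>y - x\<bar> * \<bar>y - x\<bar>" by (simp add: power2_eq_square mult.assoc abs_mult_self_eq)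
   finally show "norm ((1 / norm (y - x)) *\<^sub>R (f y - (f x + (y - x) *\<^sub>R D))) \<le> K * \<bar>y - x\<bar>"
    using p by (simp add: pos_divide_le_eq del: scaleR_right_diff_distrib scaleR_right_distrib scaleR_left_diff_distrib)
  qed
  have "((%y. K * \<bar>y - x\<bar>) \<longlongrightarrow> K * \<bar>x - x\<bar>) (at x)" by (intro tendsto_intros)
  then show "((%y. K * \<bar>y - x\<bar>) \<longlongrightarrow> 0) (at x)" by simp
 qed
qed

lemma has_vector_derivative_horizontal:
 assumes "(W has_field_derivative W') (at (Complex x t))"
 shows "((%x. W (Complex x t)) has_vector_derivative W') (at x)"
proof -
 have e: "Complex y t = of_real y + Complex 0 t" for y by (simp add: complex_eq_iff)
 have "((%y. of_real y + Complex 0 t) has_vector_derivative 1) (at x)"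
  using has_vector_derivative_of_real[OF DERIV_ident] by (simp add: has_vector_derivative_add_const)
 then have "((%y. Complex y t) has_vector_derivative 1) (at x)" unfolding e[symmetric] .
 from field_vector_diff_chain_at[OF this assms] show ?thesis by (simp add: o_def)
qed

text \<open>The mean value inequality on the line at height \<open>t\<close> has an error linear in
  \<open>t\<close>; letting \<open>t\<close> tend to 0 leaves a quadratic remainder for the boundary
  values.\<close>

lemma boundary_values_derivative:
 fixes W W' :: "complex \<Rightarrow> complex"
 assumes h: "h > 0"
  and D: "\<And>ze. 0 < Im ze ==> Im ze < h ==> (W has_field_derivative W' ze) (at ze)"
  and W0: "\<And>th t. 0 < t ==> t < h ==> norm (W (Complex th t) - W0 th) \<le> K * t"
  and V0: "\<And>th t. 0 < t ==> t < h ==> norm (W' (Complex th t) - V0 th) \<le> K' * t"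
  and lipV: "\<And>x y. norm (V0 x - V0 y) \<le> K' * \<bar>x - y\<bar>"
 shows "(W0 has_vector_derivative V0 th) (at th)"
proof (rule has_vector_derivative_quadratic)
 fix y
 have K': "K' \<ge> 0" using order_trans[OF norm_ge_zero lipV[of 1 0]] by simp
 show "norm (W0 y - W0 th - of_real (y - th) * V0 th) \<le> K' * (y - th)\<^sup>2"
 proof (rule le_all_small_imp_le[OF h, where K = "2 * K + K' * \<bar>y - th\<bar>"])
  fix t :: real assume t: "0 < t" "t < h"
  have "norm (W (Complex y t) - W (Complex th t) - (y - th) *\<^sub>R V0 th) \<le> (K' * t + K' * \<bar>y - th\<bar>) * \<bar>y - th\<bar>"
  proof (rule vector_mean_value_bound)
   fix x assume x: "x \<in> closed_segment th y"
   show "((%x. W (Complex x t)) has_vector_derivative W' (Complex x t)) (at x)"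
    by (rule has_vector_derivative_horizontal[OF D]) (use t in auto)
   have "\<bar>x - th\<bar> \<le> \<bar>y - th\<bar>" using x by (auto simp: closed_segment_eq_real_ivl split: if_splits)
   then have "K' * \<bar>x - th\<bar> \<le> K' * \<bar>y - th\<bar>" using K' by (rule mult_left_mono)
   then show "norm (W' (Complex x t) - V0 th) \<le> K' * t + K' * \<bar>y - th\<bar>"
    using V0[OF t, of x] lipV[of x th] norm_triangle_ineq[of "W' (Complex x t) - V0 x" "V0 x - V0 th"] by simp
  qed
  moreover define E where "E = W (Complex y t) - W (Complex th t) - (y - th) *\<^sub>R V0 th"
  ultimately have E: "norm E \<le> (K' * t + K' * \<bar>y - th\<bar>) * \<bar>y - th\<bar>" by simp
  define R where "R = (W (Complex y t) - W0 y) - (W (Complex th t) - W0 th)"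
  have R: "norm R \<le> 2 * K * t"
   unfolding R_def using norm_triangle_ineq4[of "W (Complex y t) - W0 y" "W (Complex th t) - W0 th"] W0[OF t, of y] W0[OF t, of th] by linarith
  have "W0 y - W0 th - of_real (y - th) * V0 th = E - R"
   by (simp add: E_def R_def scaleR_conv_of_real)
  then have "norm (W0 y - W0 th - of_real (y - th) * V0 th) \<le> (K' * t + K' * \<bar>y - th\<bar>) * \<bar>y - th\<bar> + 2 * K * t"
   using norm_triangle_ineq4[of E R] E R by (simp only:)
  also have "\<dots> = K' * (\<bar>y - th\<bar> * \<bar>y - th\<bar>) + (2 * K + K' * \<bar>y - th\<bar>) * t" by (simp add: algebra_simps)
  also have "\<bar>y - th\<bar> * \<bar>y - th\<bar> = (y - th)\<^sup>2" by (simp add: power2_eq_square abs_mult_self_eq)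
  finally show "norm (W0 y - W0 th - of_real (y - th) * V0 th) \<le> K' * (y - th)\<^sup>2 + (2 * K + K' * \<bar>y - th\<bar>) * t" .
 qed
qed

lemma integral_uniform_limit_eq:
 fixes X Y :: "real \<Rightarrow> real \<Rightarrow> real" and X0 Y0 :: "real \<Rightarrow> real"
 assumes ab: "a \<le> b" and h: "h > 0"
  and c0: "continuous_on {a..b} X0" "continuous_on {a..b} Y0"
  and c: "\<And>t. 0 < t ==> t < h ==> continuous_on {a..b} (X t)" "\<And>t. 0 < t ==> t < h ==> continuous_on {a..b} (Y t)"
  and eq: "\<And>t. 0 < t ==> t < h ==> integral {a..b} (X t) = integral {a..b} (Y t)"
  and lX: "uniform_limit {a..b} X X0 (at_right 0)" and lY: "uniform_limit {a..b} Y Y0 (at_right 0)"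
 shows "integral {a..b} X0 = integral {a..b} Y0"
proof -
 have "\<bar>integral {a..b} X0 - integral {a..b} Y0\<bar> \<le> 0"
 proof (rule le_all_small_imp_le[of 1 _ _ "2 * (b - a)"])
  fix e :: real assume e: "0 < e" "e < 1"
  have "\<forall>\<^sub>F t in at_right 0. 0 < t \<and> t < h" using eventually_at_right_real[OF h] by simp
  then have "\<forall>\<^sub>F t in at_right 0. (\<forall>x\<in>{a..b}. dist (X t x) (X0 x) < e) \<and> (\<forall>x\<in>{a..b}. dist (Y t x) (Y0 x) < e) \<and> 0 < t \<and> t < h"
   using uniform_limitD[OF lX e(1)] uniform_limitD[OF lY e(1)] by eventually_elim auto
  then obtain t where t: "\<And>x. x\<in>{a..b} ==> dist (X t x) (X0 x) < e" "\<And>x. x\<in>{a..b} ==> dist (Y t x) (Y0 x) < e" "0 < t" "t < h"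
   using eventually_happens'[OF trivial_limit_at_right_real] by blast
  note ct = c[OF t(3,4)]
  have iX: "X t integrable_on {a..b}" "X0 integrable_on {a..b}" "Y t integrable_on {a..b}" "Y0 integrable_on {a..b}"
   using c0 ct by (auto intro: integrable_continuous_interval)
  have "norm (integral {a..b} (%x. X t x - X0 x)) \<le> e * (b - a)"
   by (rule integral_bound[OF ab]) (use c0 ct t(1) in \<open>auto intro!: continuous_intros simp: dist_norm less_imp_le\<close>)
  moreover have "norm (integral {a..b} (%x. Y t x - Y0 x)) \<le> e * (b - a)"
   by (rule integral_bound[OF ab]) (use c0 ct t(2) in \<open>auto intro!: continuous_intros simp: dist_norm less_imp_le\<close>)
  moreover have "integral {a..b} (%x. X t x - X0 x) = integral {a..b} (X t) - integral {a..b} X0"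
   "integral {a..b} (%x. Y t x - Y0 x) = integral {a..b} (Y t) - integral {a..b} Y0"
   using iX by (auto intro: integral_diff)
  ultimately have "\<bar>integral {a..b} X0 - integral {a..b} Y0\<bar> \<le> e * (b - a) + e * (b - a)"
   using eq[OF t(3,4)] unfolding real_norm_def by linarith
  then show "\<bar>integral {a..b} X0 - integral {a..b} Y0\<bar> \<le> 0 + 2 * (b - a) * e" by (simp add: algebra_simps)
 qed simp
 then show ?thesis by simp
qed

lemma periodic_integral_shift:
 fixes f :: "real \<Rightarrow> real"
 assumes c: "continuous_on UNIV f" and p: "\<And>s. f (s + L) = f s" and s: "0 \<le> s" "s \<le> L"
 shows "integral {s..s + L} f = integral {0..L} f"
proof -
 have i: "f integrable_on {x..y}" for x y by (intro integrable_continuous_interval continuous_on_subset[OF c]) auto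
 have "integral {0..s} f = integral {0..s} (f \<circ> (%x. x + L))" using p by (simp add: o_def)
 also have "\<dots> = integral {0 + L..s + L} f" by (rule integral_shift[OF continuous_on_subset[OF c]]) auto
 finally have "integral {0..s} f = integral {L..s + L} f" by simp
 moreover have "integral {0..s} f + integral {s..L} f = integral {0..L} f"
  by (rule Henstock_Kurzweil_Integration.integral_combine[OF s i])
 moreover have "integral {s..L} f + integral {L..s + L} f = integral {s..s + L} f"
  by (rule Henstock_Kurzweil_Integration.integral_combine) (use s i in auto)
 ultimately show ?thesis by simp
qed

context regular_collar
begin

lemma nearest: assumes "0 < Im ze" "Im ze < h" obtains s where "G ze = npt s (infdist (G ze) curve)"
 using near[OF G_in[OF collar_strip[OF assms]]] Gb[OF assms] by blast

lemma infdist_G_le: assumes "0 < Im ze" "Im ze < h" shows "infdist (G ze) curve \<le> Im ze / a"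
 using lin[OF G_in[OF collar_strip[OF assms]]] Gb[OF assms] tau_G[OF collar_strip[OF assms]] a by (simp add: field_simps)

lemma schwarzian_bounded:
 obtains h1 C where "0 < h1" "h1 \<le> h" "C > 0" "\<And>ze. 0 < Im ze ==> Im ze < h1 ==> norm (schwarzian G ze) \<le> C"
proof -
 obtain M where M: "M \<ge> 1" "\<And>s. \<bar>kap s\<bar> \<le> M" "\<And>s. \<bar>kap' s\<bar> \<le> M" "\<And>s. \<bar>cc s\<bar> \<le> M" using coeff_bounds by blast
 obtain h1 where h1: "0 < h1" "h1 \<le> h"
  "\<And>ze s. 0 < Im ze ==> Im ze < h1 ==> G ze = npt s (infdist (G ze) curve) ==>
   norm (schwarzian G ze + of_real (k\<^sup>2 / 2) + (of_real (3 * cc s) - \<i> * of_real (kap' s)) * (deriv G ze / g1 s)\<^sup>2) \<le> 1"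
  using schwarzian_limit[of 1] by (metis zero_less_one)
 show ?thesis
 proof (rule that[OF h1(1,2), of "1 + k\<^sup>2 / 2 + 4 * M * b2\<^sup>2"])
  show "1 + k\<^sup>2 / 2 + 4 * M * b2\<^sup>2 > 0" using M by (intro add_pos_nonneg) auto
  fix ze assume ze: "0 < Im ze" "Im ze < h1"
  then have zeh: "Im ze < h" using h1 by simp
  obtain s where s: "G ze = npt s (infdist (G ze) curve)" using nearest[OF ze(1) zeh] by blast
  define q where "q = of_real (3 * cc s) - \<i> * complex_of_real (kap' s)"
  define D where "D = (deriv G ze / g1 s)\<^sup>2"
  have nD: "norm D \<le> b2\<^sup>2" using Gb[OF ze(1) zeh] by (simp add: D_def norm_power norm_divide unit power_mono)
  have "norm q \<le> \<bar>3 * cc s\<bar> + \<bar>kap' s\<bar>"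
   unfolding q_def using norm_triangle_ineq4[of "of_real (3 * cc s) :: complex" "\<i> * of_real (kap' s)"]
   by (simp only: norm_of_real norm_mult) simp
  also have "\<dots> \<le> 4 * M" using M(3)[of s] M(4)[of s] by simp
  finally have "norm (q * D) \<le> 4 * M * b2\<^sup>2" unfolding norm_mult using nD M by (intro mult_mono) auto
  moreover have "norm (schwarzian G ze + of_real (k\<^sup>2 / 2) + q * D) \<le> 1" using h1(3)[OF ze s] by (simp add: q_def D_def)
  moreover have "norm (complex_of_real (k\<^sup>2 / 2)) = k\<^sup>2 / 2" by (simp only: norm_of_real) simp
  moreover have "norm (schwarzian G ze) \<le> norm (schwarzian G ze + of_real (k\<^sup>2 / 2) + q * D) + (norm (complex_of_real (k\<^sup>2 / 2)) + norm (q * D))"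
   using norm_triangle_ineq4[of "schwarzian G ze + of_real (k\<^sup>2 / 2) + q * D" "of_real (k\<^sup>2 / 2) + q * D"]
    norm_triangle_ineq[of "complex_of_real (k\<^sup>2 / 2)" "q * D"] by (simp add: algebra_simps)
  ultimately show "norm (schwarzian G ze) \<le> 1 + k\<^sup>2 / 2 + 4 * M * b2\<^sup>2" by linarith
 qed
qed

text \<open>\<open>G'\<close> has no zero and the strip is convex, so a logarithm and hence an
  inverse square root of \<open>G'\<close> exist. The nonlinear Schwarzian equation becomes linear
  for this root, whose boundary behaviour can then be controlled by a bounded coefficient.\<close>

lemma derivative_root:
 obtains ph ps where "\<And>ze. ze \<in> strip ==> (ph has_field_derivative ps ze) (at ze)"
  "\<And>ze. ze \<in> strip ==> (ps has_field_derivative - (schwarzian G ze * ph ze / 2)) (at ze)"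
  "\<And>ze. ze \<in> strip ==> (ph ze)\<^sup>2 * deriv G ze = 1"
proof -
 have hG': "deriv G holomorphic_on strip" by (rule holomorphic_deriv[OF holG open_strip])
 obtain l where l: "l holomorphic_on strip" "\<And>ze. ze \<in> strip ==> deriv G ze = exp (l ze)"
  using contractible_imp_holomorphic_log[OF hG' convex_imp_contractible[OF convex_strip] derivG(3)] by metis
 have Dl: "(l has_field_derivative deriv (deriv G) ze / deriv G ze) (at ze)" if ze: "ze \<in> strip" for ze
 proof -
  have d: "(l has_field_derivative deriv l ze) (at ze)" using holomorphic_derivI[OF l(1) open_strip ze] by simp
  have "((%ze. exp (l ze)) has_field_derivative exp (l ze) * deriv l ze) (at ze)"
   by (rule DERIV_chain2[where g = l, OF DERIV_exp d])
  moreover have "((%ze. exp (l ze)) has_field_derivative deriv (deriv G) ze) (at ze)"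
   by (rule has_field_derivative_transform_within_open[OF derivG(2)[OF ze] open_strip ze l(2)])
  ultimately have "exp (l ze) * deriv l ze = deriv (deriv G) ze" by (rule DERIV_unique)
  then have "deriv l ze = deriv (deriv G) ze / deriv G ze" using l(2)[OF ze] derivG(3)[OF ze] by (simp add: field_simps)
  then show ?thesis using d by simp
 qed
 define p where "p ze = deriv (deriv G) ze / deriv G ze" for ze
 define ph where "ph ze = exp (- l ze / 2)" for ze
 define ps where "ps ze = - (p ze / 2) * ph ze" for ze
 have Dph: "(ph has_field_derivative ps ze) (at ze)" if ze: "ze \<in> strip" for ze
 proof -
  have "((%ze. - l ze / 2) has_field_derivative - (p ze / 2)) (at ze)"
   using DERIV_cmult[OF Dl[OF ze], of "- (1/2)"] by (simp add: p_def field_simps)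
  from DERIV_chain2[where g = "%ze. - l ze / 2", OF DERIV_exp this]
  show ?thesis by (simp add: ph_def[abs_def] ps_def mult.commute)
 qed
 have Dp: "(p has_field_derivative deriv (deriv (deriv G)) ze / deriv G ze - (p ze)\<^sup>2) (at ze)" if ze: "ze \<in> strip" for ze
 proof -
  have "(deriv (deriv G) has_field_derivative deriv (deriv (deriv G)) ze) (at ze)"
   using holomorphic_derivI[OF holomorphic_deriv[OF hG' open_strip] open_strip ze] by simp
  from DERIV_divide[OF this derivG(2)[OF ze] derivG(3)[OF ze]]
  show ?thesis unfolding p_def[abs_def]
   by (rule DERIV_cong) (use derivG(3)[OF ze] in \<open>simp add: field_simps power2_eq_square\<close>)
 qed
 show ?thesis
 proof (rule that[of ph ps])
  fix ze assume ze: "ze \<in> strip"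
  show "(ph has_field_derivative ps ze) (at ze)" by (rule Dph[OF ze])
  have "((%ze. - (p ze / 2) * ph ze) has_field_derivative
    (- ((deriv (deriv (deriv G)) ze / deriv G ze - (p ze)\<^sup>2) / 2)) * ph ze + ps ze * (- (p ze / 2))) (at ze)"
   by (rule DERIV_mult[OF DERIV_minus[OF DERIV_cdivide[OF Dp[OF ze]]] Dph[OF ze]])
  then show "(ps has_field_derivative - (schwarzian G ze * ph ze / 2)) (at ze)"
   unfolding ps_def[abs_def]
   by (rule DERIV_cong) (simp add: ps_def schwarzian_def p_def[symmetric] field_simps power2_eq_square)
  have "(ph ze)\<^sup>2 = exp (- l ze)" by (simp add: ph_def exp_double[symmetric] flip: exp_of_nat_mult)
  then show "(ph ze)\<^sup>2 * deriv G ze = 1" using l(2)[OF ze] by (simp flip: exp_add)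
 qed
qed

end

section \<open>Boundary values of the uniformising map\<close>

lemma has_vector_derivative_vertical:
 assumes "(W has_field_derivative W') (at (Complex th t))"
 shows "((%t. W (Complex th t)) has_vector_derivative \<i> * W') (at t)"
proof -
 have e: "Complex th y = \<i> * of_real y + of_real th" for y by (simp add: complex_eq_iff)
 have "((%y. \<i> * of_real y + of_real th) has_vector_derivative \<i> * 1) (at t)"
  using has_vector_derivative_mult_right[OF has_vector_derivative_of_real[OF DERIV_ident], of \<i>]
  by (simp add: has_vector_derivative_add_const)
 then have "((%y. Complex th y) has_vector_derivative \<i>) (at t)" unfolding e[symmetric] by simp
 from field_vector_diff_chain_at[OF this assms] show ?thesis by (simp add: o_def)
qed

lemma tendsto_boundary_value:
 fixes W :: "complex \<Rightarrow> complex"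
 assumes "h > 0" "\<And>t. 0 < t ==> t < h ==> norm (W (Complex th t) - w) \<le> K * t"
 shows "((%t. W (Complex th t)) \<longlongrightarrow> w) (at_right 0)"
proof (rule LIM_zero_cancel, rule Lim_null_comparison[where g = "%t. K * t"])
 show "\<forall>\<^sub>F t in at_right 0. norm (W (Complex th t) - w) \<le> K * t"
  using eventually_at_right_real[OF assms(1)] by eventually_elim (use assms(2) in auto)
 have "((%t. K * t) \<longlongrightarrow> K * 0) (at_right 0)" by (intro tendsto_intros)
 then show "((%t. K * t) \<longlongrightarrow> 0) (at_right 0)" by simp
qed

text \<open>The squared norm times exp (-2 M x) does not increase and starts at 0.\<close>

lemma gronwall_zero:
 fixes e :: "real \<Rightarrow> complex"
 assumes d: "\<And>x. 0 \<le> x ==> x \<le> b ==> (e has_vector_derivative e' x) (at x)"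
  and le: "\<And>x. 0 \<le> x ==> x \<le> b ==> norm (e' x) \<le> M * norm (e x)"
  and e0: "e 0 = 0" and y: "0 \<le> y" "y \<le> b"
 shows "e y = 0"
proof -
 define q where "q x = (e x \<bullet> e x) * exp (- (2 * M) * x)" for x
 have "q y \<le> q 0"
 proof (rule DERIV_nonpos_imp_nonincreasing[OF y(1)])
  fix x assume x: "0 \<le> x" "x \<le> y"
  then have xb: "x \<le> b" using y by simp
  have 1: "((%x. e x \<bullet> e x) has_real_derivative 2 * (e x \<bullet> e' x)) (at x)"
   using bounded_bilinear.has_vector_derivative[OF bounded_bilinear_inner d[OF x(1) xb] d[OF x(1) xb]]
   by (simp add: has_real_derivative_iff_has_vector_derivative inner_commute)
  have 2: "((%x. exp (- (2 * M) * x)) has_real_derivative - (2 * M) * exp (- (2 * M) * x)) (at x)"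
   by (auto intro!: derivative_eq_intros)
  have D: "(q has_real_derivative 2 * (e x \<bullet> e' x) * exp (- (2 * M) * x) + (- (2 * M) * exp (- (2 * M) * x)) * (e x \<bullet> e x)) (at x)"
   unfolding q_def by (rule DERIV_mult[OF 1 2])
  have "e x \<bullet> e' x \<le> norm (e x) * norm (e' x)" using Cauchy_Schwarz_ineq2[of "e x" "e' x"] by linarith
  also have "\<dots> \<le> norm (e x) * (M * norm (e x))" using le[OF x(1) xb] by (intro mult_left_mono) auto
  finally have c: "e x \<bullet> e' x \<le> M * (e x \<bullet> e x)" by (simp add: dot_square_norm power2_eq_square algebra_simps)
  have "2 * (e x \<bullet> e' x) * exp (- (2 * M) * x) + (- (2 * M) * exp (- (2 * M) * x)) * (e x \<bullet> e x)
    = 2 * exp (- (2 * M) * x) * (e x \<bullet> e' x - M * (e x \<bullet> e x))" by (simp add: algebra_simps)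
  also have "\<dots> \<le> 0" using c by (intro mult_nonneg_nonpos) auto
  finally show "\<exists>D. (q has_real_derivative D) (at x) \<and> D \<le> 0" using D by blast
 qed
 then have "(e y \<bullet> e y) * exp (- (2 * M) * y) \<le> 0" by (simp add: q_def e0)
 then have "e y \<bullet> e y \<le> 0" by (simp add: mult_le_0_iff)
 then have "e y \<bullet> e y = 0" using inner_ge_zero[of "e y"] by linarith
 then show ?thesis by simp
qed

text \<open>\<open>Ga\<close>, \<open>G1\<close>, \<open>ph0\<close>, \<open>ph1\<close> are the
  boundary values of \<open>G\<close>, its derivative, \<open>ph\<close> and \<open>ps\<close>,
  approached at a linear rate with one common constant.\<close>

locale boundary_regular = regular_collar \<Omega> \<beta> f g \<gamma> g1 g2 g3 L B u cc r a A h b1 b2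
 for \<Omega> \<beta> f g \<gamma> g1 g2 g3 L B u cc r a A h b1 b2 +
 fixes ph ps :: "complex \<Rightarrow> complex" and h1 K :: real and Ga G1 ph0 ph1 :: "real \<Rightarrow> complex"
 assumes Dph: "\<And>ze. ze \<in> strip ==> (ph has_field_derivative ps ze) (at ze)"
  and Dps: "\<And>ze. ze \<in> strip ==> (ps has_field_derivative - (schwarzian G ze * ph ze / 2)) (at ze)"
  and root: "\<And>ze. ze \<in> strip ==> (ph ze)\<^sup>2 * deriv G ze = 1"
  and h1: "0 < h1" "h1 \<le> h" and K: "K > 0"
  and bGa: "\<And>th t. 0 < t ==> t < h1 ==> norm (G (Complex th t) - Ga th) \<le> K * t"
  and bG1: "\<And>th t. 0 < t ==> t < h1 ==> norm (deriv G (Complex th t) - G1 th) \<le> K * t"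
  and bph0: "\<And>th t. 0 < t ==> t < h1 ==> norm (ph (Complex th t) - ph0 th) \<le> K * t"
  and bph1: "\<And>th t. 0 < t ==> t < h1 ==> norm (ps (Complex th t) - ph1 th) \<le> K * t"
  and dGa: "\<And>th. (Ga has_vector_derivative G1 th) (at th)" and dph0: "\<And>th. (ph0 has_vector_derivative ph1 th) (at th)"
  and cG1: "continuous_on UNIV G1" and cph1: "continuous_on UNIV ph1"

text \<open>The bounds on \<open>|G'|\<close> control \<open>ph\<close>, the bounded Schwarzian
  makes \<open>ps\<close> Lipschitz through the linear equation, and a single interior value then
  bounds \<open>ps\<close>. This bounds the second derivative of \<open>G\<close>, so all four
  functions are Lipschitz up to the boundary.\<close>

lemma (in regular_collar) boundary_regularity:
 obtains ph ps h1 K Ga G1 ph0 ph1 where "boundary_regular \<Omega> \<beta> f g \<gamma> g1 g2 g3 L B u cc r a A h b1 b2 ph ps h1 K Ga G1 ph0 ph1"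
proof -
 obtain h1 C where h1: "0 < h1" "h1 \<le> h" and C: "C > 0" "\<And>ze. 0 < Im ze ==> Im ze < h1 ==> norm (schwarzian G ze) \<le> C"
  using schwarzian_bounded by metis
 obtain ph ps where ph: "\<And>ze. ze \<in> strip ==> (ph has_field_derivative ps ze) (at ze)"
  "\<And>ze. ze \<in> strip ==> (ps has_field_derivative - (schwarzian G ze * ph ze / 2)) (at ze)"
  "\<And>ze. ze \<in> strip ==> (ph ze)\<^sup>2 * deriv G ze = 1" using derivative_root by metis
 have st: "ze \<in> strip" "Im ze < h" if "0 < Im ze" "Im ze < h1" for ze
  using that h1 by (auto intro: collar_strip)
 define Cp where "Cp = sqrt (1 / b1)"
 define cp where "cp = sqrt (1 / b2)"
 have Cp: "Cp > 0" "cp > 0" using b by (auto simp: Cp_def cp_def)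
 have nph: "norm (ph ze) \<le> Cp" "cp \<le> norm (ph ze)" if "0 < Im ze" "Im ze < h1" for ze
 proof -
  have "norm ((ph ze)\<^sup>2 * deriv G ze) = 1" unfolding ph(3)[OF st(1)[OF that]] by simp
  then have e: "(norm (ph ze))\<^sup>2 * norm (deriv G ze) = 1" by (simp add: norm_mult norm_power)
  have "(norm (ph ze))\<^sup>2 * b1 \<le> 1" "1 \<le> (norm (ph ze))\<^sup>2 * b2"
   unfolding e[symmetric] using Gb[OF that(1) st(2)[OF that]] by (auto intro: mult_left_mono)
  then have "(norm (ph ze))\<^sup>2 \<le> 1 / b1" "1 / b2 \<le> (norm (ph ze))\<^sup>2" using b by (auto simp: field_simps)
  then show "norm (ph ze) \<le> Cp" "cp \<le> norm (ph ze)" unfolding Cp_def cp_def by (auto intro: real_le_rsqrt real_le_lsqrt)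
 qed
 define C2 where "C2 = C * Cp / 2"
 have nps': "norm (- (schwarzian G ze * ph ze / 2)) \<le> C2" if "0 < Im ze" "Im ze < h1" for ze
 proof -
  have "norm (schwarzian G ze) * norm (ph ze) \<le> C * Cp" using C nph(1)[OF that] that by (intro mult_mono) auto
  then show ?thesis by (simp add: C2_def norm_mult norm_divide)
 qed
 have C2: "C2 > 0" using C Cp by (simp add: C2_def)
 have lipps: "norm (ps x - ps y) \<le> C2 * norm (x - y)" if "0 < Im x" "Im x < h1" "0 < Im y" "Im y < h1" for x y
  by (rule collar_lipschitz[where h' = h1, OF _ nps' that]) (use ph(2) st in auto)
 \<comment> \<open>Cauchy's bound for \<open>ps\<close> at height \<open>h1 / 2\<close>, plus the
   variation along the vertical segment to the given point.\<close>
 define C1 where "C1 = Cp / (h1 / 4) + C2 * h1"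
 have C1: "C1 > 0" using C2 Cp h1 by (auto simp: C1_def intro!: add_pos_pos)
 have nps: "norm (ps ze) \<le> C1" if ze: "0 < Im ze" "Im ze < h1" for ze
 proof -
  define m where "m = Complex (Re ze) (h1 / 2)"
  have sub: "0 < Im w \<and> Im w < h1" if "w \<in> cball m (h1 / 4)" for w
   using that abs_Im_le_cmod[of "w - m"] h1 by (auto simp: m_def dist_norm norm_minus_commute)
  have "norm ((deriv ^^ 1) ph m) \<le> fact 1 * Cp / (h1 / 4) ^ 1"
  proof (rule Cauchy_inequality)
   have D: "(ph has_field_derivative ps w) (at w)" if "w \<in> cball m (h1 / 4)" for w using sub[OF that] st ph(1) by blast
   show "ph holomorphic_on ball m (h1 / 4)" by (rule has_derivatives_imp_holomorphic[OF open_ball D]) auto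
   show "continuous_on (cball m (h1 / 4)) ph" using D by (meson DERIV_isCont continuous_at_imp_continuous_on)
   show "norm (ph x) \<le> Cp" if "norm (m - x) = h1 / 4" for x using sub[of x] that nph(1) by (auto simp: dist_norm)
  qed (use h1 in auto)
  moreover have "deriv ph m = ps m" using h1 by (intro DERIV_imp_deriv ph(1) st) (auto simp: m_def)
  ultimately have "norm (ps m) \<le> Cp / (h1 / 4)" by simp
  moreover have "norm (ps ze - ps m) \<le> C2 * norm (ze - m)" using ze h1 by (intro lipps) (auto simp: m_def)
  moreover have "norm (ze - m) \<le> h1" using ze by (simp add: m_def cmod_def)
  then have "C2 * norm (ze - m) \<le> C2 * h1" using C2 by (intro mult_left_mono) auto
  ultimately show ?thesis using norm_triangle_ineq[of "ps ze - ps m" "ps m"] by (simp add: C1_def)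
 qed
 \<comment> \<open>Obtained by differentiating the relation \<open>ph\<^sup>2 * G' = 1\<close>, not
   by an interior estimate, which would degenerate at the boundary.\<close>
 have nG2: "norm (deriv (deriv G) ze) \<le> 2 * C1 * b2 / cp" if ze: "0 < Im ze" "Im ze < h1" for ze
 proof -
  note zes = st(1)[OF ze]
  have "((%ze. ph ze * ph ze * deriv G ze) has_field_derivative
    (ps ze * ph ze + ps ze * ph ze) * deriv G ze + deriv (deriv G) ze * (ph ze * ph ze)) (at ze)"
   by (rule DERIV_mult[OF DERIV_mult[OF ph(1)[OF zes] ph(1)[OF zes]] derivG(2)[OF zes]])
  moreover have "((%ze. ph ze * ph ze * deriv G ze) has_field_derivative 0) (at ze)"
   by (rule has_field_derivative_transform_within_open[OF DERIV_const[of 1] open_strip zes])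
     (use ph(3) in \<open>simp add: power2_eq_square\<close>)
  ultimately have "(ps ze * ph ze + ps ze * ph ze) * deriv G ze + deriv (deriv G) ze * (ph ze * ph ze) = 0" by (rule DERIV_unique)
  then have "ph ze * (2 * ps ze * deriv G ze + deriv (deriv G) ze * ph ze) = 0" by (simp add: algebra_simps)
  moreover have "ph ze \<noteq> 0" using nph(2)[OF ze] Cp by auto
  ultimately have "deriv (deriv G) ze * ph ze = - (2 * ps ze * deriv G ze)" by (simp add: eq_neg_iff_add_eq_0 add.commute)
  then have "norm (deriv (deriv G) ze) * norm (ph ze) = 2 * norm (ps ze) * norm (deriv G ze)"
   by (metis norm_minus_cancel norm_mult norm_numeral)
  also have "\<dots> \<le> 2 * C1 * b2" using nps[OF ze] Gb[OF ze(1) st(2)[OF ze]] C1 by (intro mult_mono) auto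
  finally have "norm (deriv (deriv G) ze) * norm (ph ze) \<le> 2 * C1 * b2" .
  moreover have "norm (deriv (deriv G) ze) * cp \<le> norm (deriv (deriv G) ze) * norm (ph ze)"
   using nph(2)[OF ze] by (intro mult_left_mono) auto
  ultimately show ?thesis using Cp by (simp add: pos_le_divide_eq)
 qed
 define K where "K = b2 + 2 * C1 * b2 / cp + C1 + C2"
 have "2 * C1 * b2 / cp > 0" using C1 b Cp by simp
 then have K: "K > 0" "b2 \<le> K" "2 * C1 * b2 / cp \<le> K" "C1 \<le> K" "C2 \<le> K" using b C1 C2 by (auto simp: K_def)
 have nGK: "norm (deriv G ze) \<le> K" if "0 < Im ze" "Im ze < h1" for ze using Gb[OF that(1) st(2)[OF that]] K(2) by linarith
 have nG2K: "norm (deriv (deriv G) ze) \<le> K" if "0 < Im ze" "Im ze < h1" for ze using nG2[OF that] K(3) by linarith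
 have npsK: "norm (ps ze) \<le> K" if "0 < Im ze" "Im ze < h1" for ze using nps[OF that] K(4) by linarith
 have lG: "norm (G x - G y) \<le> K * norm (x - y)" if "0 < Im x" "Im x < h1" "0 < Im y" "Im y < h1" for x y
  by (rule collar_lipschitz[where h' = h1 and W' = "deriv G", OF _ _ that]) (use derivG(1) st nGK in auto)
 have lG': "norm (deriv G x - deriv G y) \<le> K * norm (x - y)" if "0 < Im x" "Im x < h1" "0 < Im y" "Im y < h1" for x y
  by (rule collar_lipschitz[where h' = h1 and W' = "deriv (deriv G)", OF _ _ that]) (use derivG(2) st nG2K in auto)
 have lph: "norm (ph x - ph y) \<le> K * norm (x - y)" if "0 < Im x" "Im x < h1" "0 < Im y" "Im y < h1" for x y
  by (rule collar_lipschitz[where h' = h1 and W' = ps, OF _ _ that]) (use ph(1) st npsK in auto)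
 have lps: "norm (ps x - ps y) \<le> K * norm (x - y)" if "0 < Im x" "Im x < h1" "0 < Im y" "Im y < h1" for x y
  using lipps[OF that] mult_right_mono[OF K(5) norm_ge_zero[of "x - y"]] by linarith
 obtain Ga where Ga: "\<And>th t. 0 < t ==> t < h1 ==> norm (G (Complex th t) - Ga th) \<le> K * t" using lipschitz_boundary_values[OF h1(1) lG] by blast
 obtain G1 where G1: "\<And>th t. 0 < t ==> t < h1 ==> norm (deriv G (Complex th t) - G1 th) \<le> K * t" using lipschitz_boundary_values[OF h1(1) lG'] by blast
 obtain ph0 where ph0: "\<And>th t. 0 < t ==> t < h1 ==> norm (ph (Complex th t) - ph0 th) \<le> K * t" using lipschitz_boundary_values[OF h1(1) lph] by blast
 obtain ph1 where ph1: "\<And>th t. 0 < t ==> t < h1 ==> norm (ps (Complex th t) - ph1 th) \<le> K * t" using lipschitz_boundary_values[OF h1(1) lps] by blast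
 note bG = boundary_values_lipschitz[OF h1(1) lG' G1] and bps = boundary_values_lipschitz[OF h1(1) lps ph1]
 have dGa: "(Ga has_vector_derivative G1 th) (at th)" for th
  by (rule boundary_values_derivative[OF h1(1) _ Ga G1 bG(1)]) (use derivG(1) st in auto)
 have dph: "(ph0 has_vector_derivative ph1 th) (at th)" for th
  by (rule boundary_values_derivative[OF h1(1) _ ph0 ph1 bps(1)]) (use ph(1) st in auto)
 have cG: "continuous_on UNIV G1" by (rule bG(2))
 have cps: "continuous_on UNIV ph1" by (rule bps(2))
 have "boundary_regular \<Omega> \<beta> f g \<gamma> g1 g2 g3 L B u cc r a A h b1 b2 ph ps h1 K Ga G1 ph0 ph1"
  by (rule boundary_regular.intro[OF regular_collar_axioms boundary_regular_axioms.intro])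
    (fact ph h1 K(1) Ga G1 ph0 ph1 dGa dph cG cps)+
 then show ?thesis by (rule that)
qed

context boundary_regular
begin

lemma level: assumes "0 < t" "t < h1" shows "Complex th t \<in> strip" "t < h"
 using assms h1 by (auto intro: collar_strip)

lemma cph0: "continuous_on S ph0"
 using dph0 by (meson continuous_at_imp_continuous_on has_vector_derivative_continuous)

lemma G_line_periodic: "G (Complex (th + 2 * pi) t) = G (Complex th t)"
proof -
 have "Complex (th + 2 * pi) t = Complex th t + 2 * of_real pi" by (simp add: complex_eq_iff)
 then show ?thesis using G_periodic by simp
qed

lemma Ga_periodic: "Ga (th + 2 * pi) = Ga th"
proof -
 have "norm (Ga (th + 2 * pi) - Ga th) \<le> 0"
 proof (rule le_all_small_imp_le[OF h1(1), of _ _ "2 * K"])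
  fix t :: real assume t: "0 < t" "t < h1"
  show "norm (Ga (th + 2 * pi) - Ga th) \<le> 0 + 2 * K * t"
   using bGa[OF t, of "th + 2 * pi"] bGa[OF t, of th] G_line_periodic[of th t]
    norm_triangle_ineq4[of "G (Complex th t) - Ga th" "G (Complex th t) - Ga (th + 2 * pi)"] by simp
 qed
 then show ?thesis by simp
qed

lemma exp_line_inj: assumes "0 < s" "s < 2 * pi" shows "exp (\<i> * of_real (th + s)) \<noteq> exp (\<i> * complex_of_real th)"
proof
 assume "exp (\<i> * of_real (th + s)) = exp (\<i> * complex_of_real th)"
 then have "exp (\<i> * complex_of_real s) = 1" by (simp add: distrib_left exp_add)
 then obtain n :: int where n: "s = of_int (2 * n) * pi" by (auto simp: exp_eq_1)
 then have "0 < pi * of_int n" "pi * of_int n < pi * 1" using assms by (auto simp: mult.commute)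
 then have "0 < (of_int n :: real)" "(of_int n :: real) < 1" by (simp_all only: mult_less_cancel_left_pos[OF pi_gt_zero] zero_less_mult_iff) auto
 then show False by simp
qed

text \<open>The levels inside the strip are smooth simple closed curves, injective because
  \<open>f\<close> inverts \<open>G\<close>, so the rotation lemma applies to each of them. The
  boundary statement follows by a limit.\<close>

lemma ph_antiperiodic: assumes t: "0 < t" "t < h1"
 shows "ph (Complex (th + 2 * pi) t) = - ph (Complex th t)"
proof (rule simple_closed_curve_tangent_root_antiperiodic[where Ga = "%x. G (Complex x t)" and D = "%x. deriv G (Complex x t)"])
 show "((%x. G (Complex x t)) has_vector_derivative deriv G (Complex th t)) (at th)" for th
  by (rule has_vector_derivative_horizontal[OF derivG(1)[OF level(1)[OF t]]])
 have "((%x. deriv G (Complex x t)) has_vector_derivative deriv (deriv G) (Complex th t)) (at th)" for th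
  by (rule has_vector_derivative_horizontal[OF derivG(2)[OF level(1)[OF t]]])
 then show "continuous_on UNIV (%x. deriv G (Complex x t))"
  by (meson continuous_at_imp_continuous_on has_vector_derivative_continuous)
 have "((%x. ph (Complex x t)) has_vector_derivative ps (Complex th t)) (at th)" for th
  by (rule has_vector_derivative_horizontal[OF Dph[OF level(1)[OF t]]])
 then show "continuous_on UNIV (%x. ph (Complex x t))"
  by (meson continuous_at_imp_continuous_on has_vector_derivative_continuous)
 show "(ph (Complex th t))\<^sup>2 * deriv G (Complex th t) = 1" for th by (rule root[OF level(1)[OF t]])
 show "G (Complex (th + 2 * pi) t) = G (Complex th t)" for th by (rule G_line_periodic)
 show "G (Complex (th + s) t) \<noteq> G (Complex th t)" if s: "0 < s" "s < 2 * pi" for th s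
 proof
  assume "G (Complex (th + s) t) = G (Complex th t)"
  then have "exp (\<i> * Complex (th + s) t) = exp (\<i> * Complex th t)" by (rule G_eqD[OF level(1)[OF t] level(1)[OF t]])
  moreover have "exp (\<i> * Complex x t) = exp (\<i> * of_real x) * exp (- of_real t)" for x
  proof -
   have "\<i> * Complex x t = \<i> * of_real x + - of_real t" by (simp add: complex_eq_iff)
   then show ?thesis by (simp only: exp_add)
  qed
  ultimately show False using exp_line_inj[OF s, of th] by simp
 qed
qed

lemma ps_antiperiodic: assumes t: "0 < t" "t < h1"
 shows "ps (Complex (th + 2 * pi) t) = - ps (Complex th t)"
proof -
 have d: "((%x. ph (Complex x t)) has_vector_derivative ps (Complex th t)) (at th)" for th
  by (rule has_vector_derivative_horizontal[OF Dph[OF level(1)[OF t]]])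
 have "((%x. ph (Complex (2 * pi + x * 1) t)) has_vector_derivative 1 *\<^sub>R ps (Complex (2 * pi + th * 1) t)) (at th)"
  by (rule has_vector_derivative_affine[OF d])
 then have "((%x. - ph (Complex x t)) has_vector_derivative ps (Complex (th + 2 * pi) t)) (at th)"
  using ph_antiperiodic[OF t] by (simp add: add.commute)
 moreover have "((%x. - ph (Complex x t)) has_vector_derivative - ps (Complex th t)) (at th)"
  by (rule has_vector_derivative_minus[OF d])
 ultimately show ?thesis by (rule vector_derivative_unique_at)
qed

lemma ph0_antiperiodic: "ph0 (th + 2 * pi) = - ph0 th"
proof -
 have "norm (ph0 (th + 2 * pi) + ph0 th) \<le> 0"
 proof (rule le_all_small_imp_le[OF h1(1), of _ _ "2 * K"])
  fix t :: real assume t: "0 < t" "t < h1"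
  have "ph0 (th + 2 * pi) + ph0 th = - ((ph (Complex (th + 2 * pi) t) - ph0 (th + 2 * pi)) + (ph (Complex th t) - ph0 th))"
   by (simp add: ph_antiperiodic[OF t])
  then show "norm (ph0 (th + 2 * pi) + ph0 th) \<le> 0 + 2 * K * t"
   using bph0[OF t, of "th + 2 * pi"] bph0[OF t, of th]
    norm_triangle_ineq[of "ph (Complex (th + 2 * pi) t) - ph0 (th + 2 * pi)" "ph (Complex th t) - ph0 th"]
   by (simp only: norm_minus_cancel)
 qed
 then show ?thesis by (simp add: add_eq_0_iff2)
qed

lemma G1_tendsto: "((%t. deriv G (Complex th t)) \<longlongrightarrow> G1 th) (at_right 0)"
 by (rule tendsto_boundary_value[OF h1(1) bG1])

lemma ph0_root: "(ph0 th)\<^sup>2 * G1 th = 1"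
proof (rule tendsto_unique[of "at_right (0::real)"])
 show "((%t. (ph (Complex th t))\<^sup>2 * deriv G (Complex th t)) \<longlongrightarrow> (ph0 th)\<^sup>2 * G1 th) (at_right 0)"
  by (intro tendsto_mult tendsto_power tendsto_boundary_value[OF h1(1) bph0] G1_tendsto)
 show "((%t. (ph (Complex th t))\<^sup>2 * deriv G (Complex th t)) \<longlongrightarrow> 1) (at_right 0)"
  by (rule tendsto_eventually) (use eventually_at_right_real[OF h1(1)] in eventually_elim, use root[OF level(1)] in auto)
qed auto

lemma G1_bounds: "b1 \<le> norm (G1 th)" "norm (G1 th) \<le> b2"
proof -
 have ev: "\<forall>\<^sub>F t in at_right 0. 0 < t \<and> t < h1" using eventually_at_right_real[OF h1(1)] by simp
 have l: "((%t. norm (deriv G (Complex th t))) \<longlongrightarrow> norm (G1 th)) (at_right 0)" by (intro tendsto_norm G1_tendsto)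
 show "b1 \<le> norm (G1 th)"
  by (rule tendsto_lowerbound[OF l]) (use ev in eventually_elim, use Gb level in auto)
 show "norm (G1 th) \<le> b2"
  by (rule tendsto_upperbound[OF l]) (use ev in eventually_elim, use Gb level in auto)
qed

lemma ph0_norm: "(norm (ph0 th))\<^sup>2 * norm (G1 th) = 1"
 using arg_cong[OF ph0_root[of th], of norm] by (simp add: norm_mult norm_power)

lemma Ga_in_curve: "Ga th \<in> curve"
proof -
 have "infdist (Ga th) curve \<le> 0"
 proof (rule le_all_small_imp_le[OF h1(1), of _ _ "1 / a + K"])
  fix t :: real assume t: "0 < t" "t < h1"
  have "infdist (Ga th) curve \<le> infdist (G (Complex th t)) curve + dist (Ga th) (G (Complex th t))" by (rule infdist_triangle)
  also have "\<dots> \<le> t / a + K * t"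
   using infdist_G_le[of "Complex th t"] t level bGa[OF t, of th] by (simp add: dist_norm norm_minus_commute add_mono)
  finally show "infdist (Ga th) curve \<le> 0 + (1 / a + K) * t" by (simp add: algebra_simps)
 qed
 then have "infdist (Ga th) curve = 0" using infdist_nonneg[of "Ga th" curve] by linarith
 then show ?thesis using in_closed_iff_infdist_zero[OF compact_imp_closed[OF compact_curve]] by simp
qed

lemma vertical_expansion: assumes t: "0 < t" "t < h1"
 shows "norm (G (Complex th t) - Ga th - \<i> * of_real t * G1 th) \<le> K * t\<^sup>2"
proof (rule le_all_small_imp_le[OF t(1), of _ _ "K + b2"])
 fix e :: real assume e: "0 < e" "e < t"
 have "norm (G (Complex th t) - G (Complex th e) - (t - e) *\<^sub>R (\<i> * G1 th)) \<le> (K * t) * \<bar>t - e\<bar>"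
 proof (rule vector_mean_value_bound)
  fix x assume "x \<in> closed_segment e t"
  then have x: "0 < x" "x \<le> t" "x < h1" using e t by (auto simp: closed_segment_eq_real_ivl)
  show "((%t. G (Complex th t)) has_vector_derivative \<i> * deriv G (Complex th x)) (at x)"
   by (rule has_vector_derivative_vertical[OF derivG(1)[OF level(1)]]) (use x in auto)
  have "\<i> * deriv G (Complex th x) - \<i> * G1 th = \<i> * (deriv G (Complex th x) - G1 th)" by (simp add: algebra_simps)
  then have "norm (\<i> * deriv G (Complex th x) - \<i> * G1 th) = norm (deriv G (Complex th x) - G1 th)" by (simp add: norm_mult)
  also have "\<dots> \<le> K * x" by (rule bG1) (use x in auto)
  also have "\<dots> \<le> K * t" using K x by simp
  finally show "norm (\<i> * deriv G (Complex th x) - \<i> * G1 th) \<le> K * t" .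
 qed
 moreover have "(K * t) * \<bar>t - e\<bar> \<le> (K * t) * t" using e t K by (intro mult_left_mono) auto
 moreover define X where "X = G (Complex th t) - G (Complex th e) - (t - e) *\<^sub>R (\<i> * G1 th)"
 ultimately have X: "norm X \<le> K * t\<^sup>2" by (simp add: power2_eq_square)
 define Y where "Y = G (Complex th e) - Ga th"
 have Y: "norm Y \<le> K * e" unfolding Y_def by (rule bGa) (use e t in auto)
 define Z where "Z = \<i> * of_real e * G1 th"
 have Z: "norm Z \<le> b2 * e" using G1_bounds(2)[of th] e by (simp add: Z_def norm_mult)
 have "G (Complex th t) - Ga th - \<i> * of_real t * G1 th = (X + Y) - Z"
  by (simp add: X_def Y_def Z_def scaleR_conv_of_real algebra_simps)
 then have "norm (G (Complex th t) - Ga th - \<i> * of_real t * G1 th) \<le> norm X + norm Y + norm Z"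
  using norm_triangle_ineq4[of "X + Y" Z] norm_triangle_ineq[of X Y] by simp
 then show "norm (G (Complex th t) - Ga th - \<i> * of_real t * G1 th) \<le> K * t\<^sup>2 + (K + b2) * e"
  using X Y Z by (simp add: distrib_right)
qed

text \<open>Up to \<open>K * t\<^sup>2\<close> the map leaves the boundary along the normal with
  speed \<open>al\<close>, so distances to points of that normal are known.\<close>

lemma normal_offset:
 assumes t: "0 < t" "t < h1" and s: "\<gamma> s = Ga th" and al: "G1 th = of_real al * g1 s"
 shows "\<bar>norm (G (Complex th t) - npt s x) - \<bar>t * al - x\<bar>\<bar> \<le> K * t\<^sup>2"
proof -
 define E where "E = G (Complex th t) - Ga th - \<i> * of_real t * G1 th"
 have E: "norm E \<le> K * t\<^sup>2" unfolding E_def by (rule vertical_expansion[OF t])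
 have "G (Complex th t) - npt s x - E = \<i> * of_real (t * al - x) * g1 s" by (simp add: E_def npt_def s al algebra_simps)
 then have "norm (G (Complex th t) - npt s x - E) = \<bar>t * al - x\<bar>" by (simp only: norm_mult unit norm_of_real) simp
 then show ?thesis
  using norm_triangle_ineq3[of "G (Complex th t) - npt s x" "G (Complex th t) - npt s x - E"] E by (simp only: diff_diff_eq2) (simp add: algebra_simps)
qed

text \<open>Points of the curve leave its tangent only quadratically, so the normal component of
  \<open>G1\<close> vanishes. A negative tangential component would drive \<open>G\<close> into the
  exterior tangent disc.\<close>

lemma tangent: assumes s: "\<gamma> s = Ga th" shows "G1 th = of_real (norm (G1 th)) * g1 s"
proof -
 obtain K2 where K2: "K2 > 0" "\<And>s z. z \<in> curve ==> \<bar>Re (cnj (\<i> * g1 s) * (z - \<gamma> s))\<bar> \<le> K2 * (norm (z - \<gamma> s))\<^sup>2"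
  using normal_chord by metis
 define al where "al = cnj (g1 s) * G1 th"
 have uu: "g1 s * cnj (g1 s) = 1" using unit[of s] by (simp add: complex_norm_square[symmetric])
 have al: "G1 th = al * g1 s" using uu by (simp add: al_def algebra_simps)
 have Im0: "Im al = 0"
 proof -
  define w where "w y = Re (cnj (\<i> * g1 s) * (Ga y - Ga th))" for y
  have "((%y. cnj (\<i> * g1 s) * (Ga y - Ga th)) has_vector_derivative cnj (\<i> * g1 s) * (G1 th - 0)) (at th)"
   by (intro has_vector_derivative_mult_right has_vector_derivative_diff dGa has_vector_derivative_const)
  from bounded_linear.has_vector_derivative[OF bounded_linear_of_real bounded_linear.has_vector_derivative[OF bounded_linear_Re this]]
  have 1: "((%y. complex_of_real (w y)) has_vector_derivative of_real (Im al)) (at th)"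
   by (simp add: w_def al_def)
  have "((%y. complex_of_real (w y)) has_vector_derivative 0) (at th)"
  proof (rule has_vector_derivative_quadratic[where K = "K2 * b2\<^sup>2"])
   fix y
   have "norm (Ga y - Ga th - (y - th) *\<^sub>R 0) \<le> b2 * \<bar>y - th\<bar>"
    by (rule vector_mean_value_bound[where f' = G1]) (use dGa G1_bounds in auto)
   then have "(norm (Ga y - Ga th))\<^sup>2 \<le> (b2 * \<bar>y - th\<bar>)\<^sup>2" by (intro power_mono) auto
   then have "K2 * (norm (Ga y - Ga th))\<^sup>2 \<le> K2 * (b2 * \<bar>y - th\<bar>)\<^sup>2" using K2 by (intro mult_left_mono) auto
   moreover have "\<bar>w y\<bar> \<le> K2 * (norm (Ga y - Ga th))\<^sup>2" unfolding w_def s[symmetric] by (rule K2(2)[OF Ga_in_curve])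
   ultimately have "\<bar>w y\<bar> \<le> K2 * b2\<^sup>2 * (y - th)\<^sup>2" by (simp add: power_mult_distrib mult.assoc)
   moreover have "w th = 0" by (simp add: w_def)
   ultimately show "norm (complex_of_real (w y) - complex_of_real (w th) - of_real (y - th) * 0) \<le> K2 * b2\<^sup>2 * (y - th)\<^sup>2" by simp
  qed
  with 1 have "complex_of_real (Im al) = 0" by (rule vector_derivative_unique_at)
  then show ?thesis by simp
 qed
 then have alR: "al = of_real (Re al)" by (simp add: complex_eq_iff)
 have G1R: "G1 th = of_real (Re al) * g1 s" using al alR by simp
 have nal: "norm (G1 th) = \<bar>Re al\<bar>" using arg_cong[OF G1R, of norm] by (simp only: norm_mult norm_of_real unit mult_1_right)
 have "Re al \<ge> 0"
 proof (rule ccontr)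
  assume neg: "\<not> Re al \<ge> 0"
  have "0 \<le> Re al"
  \<comment> \<open>The exterior disc inequality
    \<open>r \<le> \<bar>t * Re al + r\<bar> + K * t\<^sup>2\<close>, divided by
    \<open>t\<close>.\<close>
  proof (rule le_all_small_imp_le[of "min h1 (r / b2)" _ _ K])
   show "0 < min h1 (r / b2)" using h1 r b by simp
   fix t assume t: "0 < t" "t < min h1 (r / b2)"
   then have t1: "t < h1" "t * b2 < r" using b by (auto simp: field_simps)
   have "G (Complex th t) \<in> \<Omega>" by (rule G_in[OF level(1)[OF t(1) t1(1)]])
   then have "r \<le> norm (G (Complex th t) - npt s (- r))"
    using outball[of s] by (force simp: dist_norm norm_minus_commute)
   then have "r \<le> \<bar>t * Re al - - r\<bar> + K * t\<^sup>2" using normal_offset[OF t(1) t1(1) s G1R, of "- r"] by linarith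
   moreover have "t * \<bar>Re al\<bar> \<le> t * b2" using G1_bounds(2)[of th] nal t by (intro mult_left_mono) auto
   then have "t * Re al + r > 0" using t1 neg by (auto simp: abs_if)
   ultimately have "0 \<le> t * (Re al + K * t)" by (simp add: power2_eq_square algebra_simps)
   then show "0 \<le> Re al + K * t" using t by (simp add: zero_le_mult_iff)
  qed
  then show False using neg by simp
 qed
 then show ?thesis using G1R nal by simp
qed

end

lemma (in arclength_curve) periodic_uniform_limit:
 fixes q :: "real \<Rightarrow> 'b::metric_space"
 assumes q: "continuous_on UNIV q" "\<And>s. q (s + L) = q s" and lim: "uniform_limit X si S F"
 shows "uniform_limit X (%t th. q (si t th)) (%th. q (S th)) F"
proof (rule uniform_limitI)
 fix e :: real assume e: "e > 0"
 obtain d where d: "d > 0" "\<And>s t. \<bar>s - t\<bar> < d ==> dist (q s) (q t) < e" using periodic_uniformly_continuous[OF q e] by blast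
 show "\<forall>\<^sub>F t in F. \<forall>th\<in>X. dist (q (si t th)) (q (S th)) < e"
  using uniform_limitD[OF lim d(1)] by eventually_elim (use d(2) in \<open>auto simp: dist_real_def\<close>)
qed

lemma uniform_limit_linear_bound:
 fixes q :: "real \<Rightarrow> real \<Rightarrow> 'b::metric_space"
 assumes h: "h > 0" and K: "K > 0" and le: "\<And>th t. 0 < t ==> t < h ==> th \<in> X ==> dist (q t th) (q0 th) \<le> K * t"
 shows "uniform_limit X q q0 (at_right 0)"
proof (rule uniform_limitI)
 fix e :: real assume e: "e > 0"
 have "0 < min h (e / K)" using h K e by simp
 from eventually_at_right_real[OF this]
 show "\<forall>\<^sub>F t in at_right 0. \<forall>th\<in>X. dist (q t th) (q0 th) < e"
 proof eventually_elim
  fix t assume "t \<in> {0<..<min h (e / K)}"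
  then have t: "0 < t" "t < h" "K * t < e" using K by (auto simp: field_simps)
  then show "\<forall>th\<in>X. dist (q t th) (q0 th) < e" using le[OF t(1,2)] by (meson order_le_less_trans)
 qed
qed

context boundary_regular
begin

lemma f_derivative_bound:
 assumes w: "w \<in> \<Omega>" "tau w < h" shows "norm (deriv f w) \<le> 1 / b1"
proof -
 obtain ze where ze: "ze \<in> strip" "G ze = w" "Im ze = tau w" using G_surj[OF w(1)] by blast
 have "norm (F w) * norm (deriv G ze) = 1" using arg_cong[OF F_G[OF ze(1)], of norm] ze(2) by (simp add: norm_mult)
 moreover have "b1 \<le> norm (deriv G ze)" using Gb[of ze] ze w tau_bounds[OF w(1)] by auto
 then have "norm (F w) * b1 \<le> norm (F w) * norm (deriv G ze)" by (intro mult_left_mono) auto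
 ultimately have "norm (F w) * b1 \<le> 1" by simp
 then have Fb: "norm (F w) \<le> 1 / b1" using b by (simp add: field_simps)
 have "deriv f w = F w * f w" using f_nz[OF w(1)] by (simp add: F_def)
 then have "norm (deriv f w) = norm (F w) * norm (f w)" by (simp add: norm_mult)
 also have "\<dots> \<le> norm (F w) * 1" using f_in[OF w(1)] by (intro mult_left_mono) auto
 finally show ?thesis using Fb by simp
qed

text \<open>The interior tangent disc is a convex part of \<open>\<Omega>\<close> reached from every
  preimage of the boundary point, so nearby points of \<open>\<Omega>\<close> can be joined by a
  segment.\<close>

lemma enters_ball:
 assumes t: "0 < t" "t < h1" "K * t < b1" "t * b2 < r" and s: "\<gamma> s = Ga th"
 shows "G (Complex th t) \<in> ball (npt s r) r"
proof -
 define al where "al = norm (G1 th)"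
 have al: "b1 \<le> al" "al \<le> b2" using G1_bounds[of th] by (auto simp: al_def)
 have "t * al \<le> t * b2" using al t by (intro mult_left_mono) auto
 then have "\<bar>t * al - r\<bar> = r - t * al" using t by linarith
 then have "norm (G (Complex th t) - npt s r) \<le> r - t * al + K * t\<^sup>2"
  using normal_offset[OF t(1,2) s tangent[OF s, folded al_def], of r] by linarith
 also have "\<dots> = r - t * (al - K * t)" by (simp add: power2_eq_square algebra_simps)
 also have "\<dots> < r" using t al by simp
 finally show ?thesis by (simp add: dist_norm norm_minus_commute)
qed

text \<open>If two boundary values agree, the corresponding points at height \<open>t\<close> lie in
  one tangent disc at distance O(t). There \<open>f\<close> is Lipschitz along the segment, so its
  two values are O(t) apart, and these values recover the two exponentials in the limit.\<close>

lemma Ga_inj: assumes eq: "Ga th = Ga th'" shows "exp (\<i> * of_real th) = exp (\<i> * complex_of_real th')"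
proof -
 obtain s where s: "\<gamma> s = Ga th" using Ga_in_curve[of th] by auto
 have s': "\<gamma> s = Ga th'" using s eq by simp
 define H where "H = Min {h1, b1 / K, r / b2, r / K, h / (A * K), 1}"
 have H: "H > 0" using h1 b K r h A by (simp add: H_def)
 have "norm (exp (\<i> * of_real th) - exp (\<i> * complex_of_real th')) \<le> 0"
 proof (rule le_all_small_imp_le[OF H, of _ _ "3 * (1 / b1 * (2 * K))"])
  fix t assume t0: "0 < t" "t < H"
  have tt: "t < h1" "t < b1 / K" "t < r / b2" "t < r / K" "t < h / (A * K)" "t < 1" using t0(2) by (auto simp: H_def)
  have t: "0 < t" "t < h1" "K * t < b1" "t * b2 < r" "K * t < r" "A * (K * t) < h" "t < 1"
   using t0 tt b K A by (auto simp: field_simps)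
  define z where "z = G (Complex th t)"
  define z' where "z' = G (Complex th' t)"
  have zb: "z \<in> ball (npt s r) r" "z' \<in> ball (npt s r) r"
   unfolding z_def z'_def by (rule enters_ball[OF t(1-4) s], rule enters_ball[OF t(1-4) s'])
  have zG: "norm (z - Ga th) \<le> K * t" "norm (z' - Ga th) \<le> K * t"
   unfolding z_def z'_def using bGa[OF t(1,2)] eq by metis+
  have seg: "w \<in> \<Omega> \<and> tau w < h" if w: "w \<in> closed_segment z z'" for w
  proof -
   have "closed_segment z z' \<subseteq> ball (npt s r) r" using zb by (simp add: closed_segment_subset)
   then have w1: "w \<in> \<Omega>" using w inball by blast
   have "closed_segment z z' \<subseteq> cball (Ga th) (K * t)"
    using zG by (intro closed_segment_subset) (auto simp: dist_norm norm_minus_commute)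
   then have "dist w (Ga th) \<le> K * t" using w by (auto simp: dist_commute)
   then have i: "infdist w curve \<le> K * t" using infdist_le2[OF Ga_in_curve] by blast
   then have "infdist w curve < r" using t by linarith
   then have "tau w \<le> A * infdist w curve" using lin[OF w1] by blast
   also have "\<dots> \<le> A * (K * t)" using i A by (intro mult_left_mono) auto
   finally show ?thesis using w1 t by simp
  qed
  have fd: "(f has_field_derivative deriv f w) (at w within closed_segment z z')" if "w \<in> closed_segment z z'" for w
   using holomorphic_derivI[OF f open\<Omega>] seg[OF that] has_field_derivative_at_within by blast
  have "norm (f z - f z') \<le> 1 / b1 * norm (z - z')"
   by (rule field_differentiable_bound[OF convex_closed_segment fd]) (use f_derivative_bound seg in auto)
  also have "\<dots> \<le> 1 / b1 * (2 * K * t)"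
   using norm_triangle_ineq4[of "z - Ga th" "z' - Ga th"] zG b by (intro mult_left_mono) auto
  finally have fz: "norm (f z - f z') \<le> 1 / b1 * (2 * K * t)" .
  have ex: "exp (\<i> * of_real x) = exp (of_real t) * f (G (Complex x t))" for x
  proof -
   have "\<i> * complex_of_real x = of_real t + \<i> * Complex x t" by (simp add: complex_eq_iff)
   then show ?thesis unfolding f_G[OF level(1)[OF t(1,2)]] by (simp only: exp_add)
  qed
  have "exp (\<i> * of_real th) - exp (\<i> * complex_of_real th') = exp (of_real t) * (f z - f z')"
   unfolding ex z_def z'_def by (simp add: algebra_simps)
  then have "norm (exp (\<i> * of_real th) - exp (\<i> * complex_of_real th')) = exp t * norm (f z - f z')"
   by (simp add: norm_mult)
  also have "\<dots> \<le> 3 * (1 / b1 * (2 * K * t))"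
  proof (rule mult_mono[OF _ fz])
   have "exp t \<le> exp 1" using t by simp
   then show "exp t \<le> 3" using exp_le by linarith
  qed auto
  finally show "norm (exp (\<i> * of_real th) - exp (\<i> * complex_of_real th')) \<le> 0 + 3 * (1 / b1 * (2 * K)) * t" by simp
 qed
 then show ?thesis by simp
qed

text \<open>\<open>Ga\<close> and \<open>\<gamma> \<circ> S\<close> solve the same equation, since
  the tangent is a Lipschitz function of the point; Gronwall's lemma identifies them. Injectivity of
  the boundary values ensures that the curve is traversed exactly once.\<close>

lemma arclength_lift:
 obtains S where "\<And>th. 0 \<le> th ==> th \<le> 2 * pi ==> (S has_real_derivative norm (G1 th)) (at th)"
  "\<And>th. 0 \<le> th ==> th \<le> 2 * pi ==> \<gamma> (S th) = Ga th" "0 \<le> S 0" "S 0 \<le> L" "S (2 * pi) = S 0 + L"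
proof -
 obtain s0 where s0: "s0 \<in> {0..L}" "\<gamma> s0 = Ga 0" using Ga_in_curve[of 0] unfolding image_period by force
 \<comment> \<open>Starting the integral at -1 makes 0 an interior point, so that the derivative
   there is two-sided.\<close>
 define I where "I th = integral {-1..th} (%x. norm (G1 x))" for th
 define S where "S th = s0 - I 0 + I th" for th
 have S0: "S 0 = s0" by (simp add: S_def)
 have dS: "(S has_real_derivative norm (G1 th)) (at th)" if th: "0 \<le> th" "th \<le> 2 * pi" for th
 proof -
  have "continuous_on {-1..2 * pi + 1} (%x. norm (G1 x))" by (intro continuous_on_norm continuous_on_subset[OF cG1]) auto
  then have "(I has_real_derivative norm (G1 th)) (at th within {-1..2 * pi + 1})"
   unfolding I_def by (rule integral_has_real_derivative) (use th in auto)
  moreover have "at th within {-1..2 * pi + 1} = at th" using th by (intro at_within_interior) auto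
  ultimately have "(I has_real_derivative norm (G1 th)) (at th)" by simp
  then show ?thesis unfolding S_def using DERIV_add[OF DERIV_const[of "s0 - I 0"]] by fastforce
 qed
 obtain K2 where K2: "K2 > 0" "\<And>s t. norm (g1 t - g1 s) \<le> K2 * norm (\<gamma> t - \<gamma> s)" using normal_chord by metis
 have lift: "\<gamma> (S th) = Ga th" if th: "0 \<le> th" "th \<le> 2 * pi" for th
 proof -
  have "Ga th - \<gamma> (S th) = 0"
  proof (rule gronwall_zero[where e = "%x. Ga x - \<gamma> (S x)" and y = th and b = "2 * pi" and M = "b2 * K2" and e' = "%x. G1 x - norm (G1 x) *\<^sub>R g1 (S x)"])
   fix x assume x: "0 \<le> x" "x \<le> 2 * pi"
   have "(S has_vector_derivative norm (G1 x)) (at x)" using dS[OF x] by (simp add: has_real_derivative_iff_has_vector_derivative)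
   from vector_diff_chain_at[OF this d1]
   have "((%x. \<gamma> (S x)) has_vector_derivative norm (G1 x) *\<^sub>R g1 (S x)) (at x)" by (simp add: o_def)
   then show "((%x. Ga x - \<gamma> (S x)) has_vector_derivative G1 x - norm (G1 x) *\<^sub>R g1 (S x)) (at x)"
    by (rule has_vector_derivative_diff[OF dGa])
   obtain s where s: "\<gamma> s = Ga x" using Ga_in_curve[of x] by auto
   have "G1 x - norm (G1 x) *\<^sub>R g1 (S x) = of_real (norm (G1 x)) * (g1 s - g1 (S x))"
    by (subst tangent[OF s]) (simp add: scaleR_conv_of_real algebra_simps)
   then have "norm (G1 x - norm (G1 x) *\<^sub>R g1 (S x)) = norm (G1 x) * norm (g1 s - g1 (S x))" by (simp add: norm_mult)
   also have "\<dots> \<le> b2 * (K2 * norm (\<gamma> s - \<gamma> (S x)))" using G1_bounds K2 b by (intro mult_mono) auto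
   finally show "norm (G1 x - norm (G1 x) *\<^sub>R g1 (S x)) \<le> b2 * K2 * norm (Ga x - \<gamma> (S x))" by (simp add: s)
  qed (use th S0 s0 in auto)
  then show ?thesis by simp
 qed
 have cS: "continuous_on {0..2 * pi} S" using dS by (meson DERIV_isCont atLeastAtMost_iff continuous_at_imp_continuous_on)
 have "\<gamma> (S 0) = \<gamma> (S (2 * pi))" using lift[of 0] lift[of "2 * pi"] Ga_periodic[of 0] by simp
 then obtain n :: int where n: "S (2 * pi) = S 0 + of_int n * L" using \<gamma>_eqD by blast
 have inc: "S 0 < S (2 * pi)"
  by (rule DERIV_pos_imp_increasing) (use dS G1_bounds(1) b in \<open>auto intro: order_less_le_trans\<close>)
 then have "0 < of_int n * L" using n by simp
 then have n1: "n \<ge> 1" using L by (simp add: zero_less_mult_iff)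
 \<comment> \<open>With two or more turns \<open>S\<close> would pass \<open>S 0 + L\<close>
   strictly inside the period, and \<open>Ga\<close> would repeat a value there.\<close>
 have "n = 1"
 proof (rule ccontr)
  assume "n \<noteq> 1"
  then have "n \<ge> 2" using n1 by simp
  then have n2: "2 * L \<le> of_int n * L" using L by (intro mult_right_mono) auto
  obtain th where th: "0 \<le> th" "th \<le> 2 * pi" "S th = S 0 + L"
   using IVT'[of S 0 "S 0 + L" "2 * pi"] n n2 L cS by auto
  have ne: "th \<noteq> 0" "th \<noteq> 2 * pi" using th n n2 L by auto
  have "Ga th = Ga 0" using lift[OF th(1,2)] lift[of 0] th(3) per by simp
  from Ga_inj[OF this] show False using exp_line_inj[of th 0] th ne by simp
 qed
 then show ?thesis using that[of S, OF dS lift] n S0 s0 by simp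
qed

text \<open>Integrates the derivative of \<open>ps * cnj ph\<close> over a period; the end terms
  agree because both factors change sign. The identity is taken inside the strip, where everything
  is smooth, and only afterwards moved to the boundary.\<close>

lemma level_energy:
 assumes t: "0 < t" "t < h1"
 shows "continuous_on {0..2 * pi} (%th. Re (ps (Complex th t) * cnj (ps (Complex th t))))"
  "continuous_on {0..2 * pi} (%th. Re (schwarzian G (Complex th t) * (ph (Complex th t) * cnj (ph (Complex th t)))) / 2)"
  "integral {0..2 * pi} (%th. Re (ps (Complex th t) * cnj (ps (Complex th t)))) =
   integral {0..2 * pi} (%th. Re (schwarzian G (Complex th t) * (ph (Complex th t) * cnj (ph (Complex th t)))) / 2)"
proof -
 define p where "p th = ph (Complex th t)" for th
 define q where "q th = ps (Complex th t)" for th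
 define z where "z th = deriv ps (Complex th t)" for th
 have zeq: "z th = - (schwarzian G (Complex th t) * p th / 2)" for th
  unfolding z_def p_def by (rule DERIV_imp_deriv[OF Dps[OF level(1)[OF t]]])
 have dp: "(p has_vector_derivative q th) (at th)" for th
  unfolding p_def q_def by (rule has_vector_derivative_horizontal[OF Dph[OF level(1)[OF t]]])
 have dq: "(q has_vector_derivative z th) (at th)" for th
  unfolding zeq p_def q_def by (rule has_vector_derivative_horizontal[OF Dps[OF level(1)[OF t]]])
 have hps: "ps holomorphic_on strip" by (rule has_derivatives_imp_holomorphic[OF open_strip Dps])
 have dz: "(z has_vector_derivative deriv (deriv ps) (Complex th t)) (at th)" for th
  unfolding z_def
  by (rule has_vector_derivative_horizontal)
    (rule holomorphic_derivI[OF holomorphic_deriv[OF hps open_strip] open_strip level(1)[OF t], where T = UNIV])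
 have c: "continuous_on X p" "continuous_on X q" "continuous_on X z" for X
  using dp dq dz by (meson continuous_at_imp_continuous_on has_vector_derivative_continuous)+
 have c1: "continuous_on {0..2 * pi} (%th. Re (q th * cnj (q th)))" by (intro continuous_intros c)
 have e2: "Re (schwarzian G (Complex th t) * (p th * cnj (p th))) / 2 = - Re (z th * cnj (p th))" for th
  unfolding zeq by (simp add: algebra_simps)
 have c2: "continuous_on {0..2 * pi} (%th. - Re (z th * cnj (p th)))" by (intro continuous_intros c)
 have "((%th. Re (q th * cnj (p th))) has_vector_derivative Re (q th * cnj (q th) + z th * cnj (p th))) (at th)" for th
  by (rule bounded_linear.has_vector_derivative[OF bounded_linear_Re has_vector_derivative_mult[OF dq has_vector_derivative_cnj[OF dp]]])
 then have "((%th. Re (q th * cnj (q th) + z th * cnj (p th))) has_integral Re (q (2 * pi) * cnj (p (2 * pi))) - Re (q 0 * cnj (p 0))) {0..2 * pi}"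
  by (intro fundamental_theorem_of_calculus) (auto intro: has_vector_derivative_at_within)
 moreover have "Re (q (2 * pi) * cnj (p (2 * pi))) = Re (q 0 * cnj (p 0))"
  using ph_antiperiodic[OF t, of 0] ps_antiperiodic[OF t, of 0] by (simp add: p_def q_def)
 ultimately have "((%th. Re (q th * cnj (q th) + z th * cnj (p th))) has_integral 0) {0..2 * pi}" by (simp only: diff_self)
 then have "((%th. Re (q th * cnj (q th)) - (- Re (z th * cnj (p th)))) has_integral 0) {0..2 * pi}"
  by (simp only: plus_complex.sel diff_minus_eq_add)
 then have "integral {0..2 * pi} (%th. Re (q th * cnj (q th)) - (- Re (z th * cnj (p th)))) = 0"
  by (rule integral_unique)
 moreover have "integral {0..2 * pi} (%th. Re (q th * cnj (q th)) - (- Re (z th * cnj (p th)))) =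
   integral {0..2 * pi} (%th. Re (q th * cnj (q th))) - integral {0..2 * pi} (%th. - Re (z th * cnj (p th)))"
  by (rule integral_diff[OF integrable_continuous_interval[OF c1] integrable_continuous_interval[OF c2]])
 ultimately have i: "integral {0..2 * pi} (%th. Re (q th * cnj (q th))) = integral {0..2 * pi} (%th. - Re (z th * cnj (p th)))" by linarith
 show "continuous_on {0..2 * pi} (%th. Re (ps (Complex th t) * cnj (ps (Complex th t))))" using c1 by (simp only: q_def)
 show "continuous_on {0..2 * pi} (%th. Re (schwarzian G (Complex th t) * (ph (Complex th t) * cnj (ph (Complex th t)))) / 2)"
  unfolding p_def[symmetric] e2 by (rule c2)
 show "integral {0..2 * pi} (%th. Re (ps (Complex th t) * cnj (ps (Complex th t)))) =
   integral {0..2 * pi} (%th. Re (schwarzian G (Complex th t) * (ph (Complex th t) * cnj (ph (Complex th t)))) / 2)"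
  unfolding p_def[symmetric] q_def[symmetric] e2 by (rule i)
qed

text \<open>On the boundary \<open>G1 = |G1| * g1 (S th)\<close>, so the unit tangent cancels from
  the limit of the Schwarzian.\<close>

lemma schwarzian_uniform_limit:
 assumes S: "\<And>th. th \<in> X ==> \<gamma> (S th) = Ga th"
 shows "uniform_limit X (%t th. schwarzian G (Complex th t))
  (%th. - of_real (k\<^sup>2 / 2) - (of_real (3 * cc (S th)) - \<i> * of_real (kap' (S th))) * (of_real (norm (G1 th)))\<^sup>2) (at_right 0)"
proof -
 obtain A0 where A0: "A0 > 0" "\<And>s z. z \<in> curve ==> \<exists>t. z = \<gamma> t \<and> \<bar>t - s\<bar> \<le> A0 * norm (z - \<gamma> s) \<and> \<bar>t - s\<bar> \<le> L / 2"
  using near_param by blast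
 define K3 where "K3 = A0 * (1 / a + K)"
 have K3: "K3 > 0" using A0 a K by (simp add: K3_def add_pos_pos)
 have "\<exists>s. G (Complex th t) = npt s (infdist (G (Complex th t)) curve) \<and> \<bar>s - S th\<bar> \<le> K3 * t" if th: "th \<in> X" and t: "0 < t" "t < h1" for th t
 proof -
  define x where "x = infdist (G (Complex th t)) curve"
  have x: "0 \<le> x" "x \<le> t / a" using infdist_G_le[of "Complex th t"] t level(2)[OF t] by (auto simp: x_def infdist_nonneg)
  obtain s where s: "G (Complex th t) = npt s x" using nearest[of "Complex th t"] t level(2)[OF t] unfolding x_def by auto
  obtain s' where s': "\<gamma> s = \<gamma> s'" "\<bar>s' - S th\<bar> \<le> A0 * norm (\<gamma> s - \<gamma> (S th))" using A0(2)[of "\<gamma> s" "S th"] by auto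
  have "norm (\<gamma> s - G (Complex th t)) = x" using npt_dist[of s 0 x] x by (simp add: s npt_0 dist_norm)
  then have "norm (\<gamma> s - Ga th) \<le> t / a + K * t"
   using norm_triangle_ineq[of "\<gamma> s - G (Complex th t)" "G (Complex th t) - Ga th"] bGa[OF t, of th] x by simp
  then have "A0 * norm (\<gamma> s - \<gamma> (S th)) \<le> A0 * (t / a + K * t)" using A0 S[OF th] by (intro mult_left_mono) auto
  also have "\<dots> = K3 * t" by (simp add: K3_def algebra_simps)
  finally have "\<bar>s' - S th\<bar> \<le> K3 * t" using s' by linarith
  moreover have "G (Complex th t) = npt s' x" using s s' frame_eq(1)[OF s'(1)] by (simp add: npt_def)
  ultimately show ?thesis by (auto simp: x_def)
 qed
 then have ex: "th \<in> X ==> 0 < t ==> t < h1 ==> \<exists>s. G (Complex th t) = npt s (infdist (G (Complex th t)) curve) \<and> \<bar>s - S th\<bar> \<le> K3 * t" for th t .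
 \<comment> \<open>A parameter of the foot point chosen within O(t) of \<open>S th\<close>, so that
   periodic functions of it converge uniformly.\<close>
 define si where "si t th = (SOME s. G (Complex th t) = npt s (infdist (G (Complex th t)) curve) \<and> \<bar>s - S th\<bar> \<le> K3 * t)" for t th
 have si: "G (Complex th t) = npt (si t th) (infdist (G (Complex th t)) curve) \<and> \<bar>si t th - S th\<bar> \<le> K3 * t"
  if "th \<in> X" "0 < t" "t < h1" for th t
  unfolding si_def by (rule someI_ex[OF ex[OF that]])
 have usi: "uniform_limit X si S (at_right 0)"
  by (rule uniform_limit_linear_bound[OF h1(1) K3]) (use si in \<open>auto simp: dist_real_def\<close>)
 have ucc: "uniform_limit X (%t th. cc (si t th)) (%th. cc (S th)) (at_right 0)" by (rule periodic_uniform_limit[OF cc usi])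
 have ukap: "uniform_limit X (%t th. kap' (si t th)) (%th. kap' (S th)) (at_right 0)" by (rule periodic_uniform_limit[OF kap'_props usi])
 have ug: "uniform_limit X (%t th. g1 (si t th)) (%th. g1 (S th)) (at_right 0)" by (rule periodic_uniform_limit[OF cont1 per1 usi])
 have uG: "uniform_limit X (%t th. deriv G (Complex th t)) G1 (at_right 0)"
  by (rule uniform_limit_linear_bound[OF h1(1) K]) (use bG1 in \<open>auto simp: dist_norm\<close>)
 \<comment> \<open>The conjugate of the unit tangent replaces its reciprocal, so that only products
   of uniform limits occur.\<close>
 define Q where "Q t th = (of_real (3 * cc (si t th)) - \<i> * of_real (kap' (si t th))) * (deriv G (Complex th t) * cnj (g1 (si t th)))\<^sup>2" for t th
 have ur: "uniform_limit X (%t th. schwarzian G (Complex th t) + of_real (k\<^sup>2 / 2) + Q t th) (%th. 0) (at_right 0)"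
 proof (rule uniform_limitI)
  fix e :: real assume e: "e > 0"
  then have "e / 2 > 0" by simp
  from schwarzian_limit[OF this] obtain h' where h': "0 < h'" "h' \<le> h"
   "\<And>ze s. 0 < Im ze ==> Im ze < h' ==> G ze = npt s (infdist (G ze) curve) ==>
   norm (schwarzian G ze + of_real (k\<^sup>2 / 2) + (of_real (3 * cc s) - \<i> * of_real (kap' s)) * (deriv G ze / g1 s)\<^sup>2) \<le> e / 2"
   by blast
  have "0 < min h1 h'" using h1 h' by simp
  from eventually_at_right_real[OF this]
  show "\<forall>\<^sub>F t in at_right 0. \<forall>th\<in>X. dist (schwarzian G (Complex th t) + of_real (k\<^sup>2 / 2) + Q t th) 0 < e"
  proof eventually_elim
   fix t assume "t \<in> {0<..<min h1 h'}"
   then have t: "0 < t" "t < h1" "t < h'" by auto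
   show "\<forall>th\<in>X. dist (schwarzian G (Complex th t) + of_real (k\<^sup>2 / 2) + Q t th) 0 < e"
   proof
    fix th assume th: "th \<in> X"
    have "inverse (g1 s) = cnj (g1 s)" for s
     using unit[of s] by (simp add: inverse_complex_def complex_eq_iff cmod_def)
    then have "deriv G (Complex th t) / g1 (si t th) = deriv G (Complex th t) * cnj (g1 (si t th))" by (simp add: divide_inverse)
    then show "dist (schwarzian G (Complex th t) + of_real (k\<^sup>2 / 2) + Q t th) 0 < e"
     using h'(3)[of "Complex th t" "si t th"] t si[OF th t(1,2)] e by (simp add: Q_def)
   qed
  qed
 qed
 have bcc: "bounded ((%th. cc (S th)) ` X)" "bounded ((%th. kap' (S th)) ` X)"
 proof -
  obtain M where M: "M \<ge> 1" "\<And>s. \<bar>kap' s\<bar> \<le> M" "\<And>s. \<bar>cc s\<bar> \<le> M" using coeff_bounds by metis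
  then show "bounded ((%th. cc (S th)) ` X)" "bounded ((%th. kap' (S th)) ` X)" by (auto simp: bounded_iff)
 qed
 have bg: "bounded ((%th. cnj (g1 (S th))) ` X)" by (auto simp: bounded_iff unit intro!: exI[of _ 1])
 have bG: "bounded (G1 ` X)" using G1_bounds(2) by (auto simp: bounded_iff)
 define c where "c th = of_real (3 * cc (S th)) - \<i> * complex_of_real (kap' (S th))" for th
 have uc: "uniform_limit X (%t th. of_real (3 * cc (si t th)) - \<i> * complex_of_real (kap' (si t th))) c (at_right 0)"
  unfolding c_def
  by (intro uniform_limit_minus bounded_linear.uniform_limit[OF bounded_linear_mult_right[of \<i>]]
     bounded_linear.uniform_limit[OF bounded_linear_of_real] bounded_linear.uniform_limit[OF bounded_linear_mult_right[of "3::real"]] ucc ukap)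
 have bc: "bounded (c ` X)"
 proof -
  obtain M where M: "M \<ge> 1" "\<And>s. \<bar>kap' s\<bar> \<le> M" "\<And>s. \<bar>cc s\<bar> \<le> M" using coeff_bounds by metis
  have "norm (c th) \<le> 4 * M" for th
  proof -
   have "norm (c th) \<le> \<bar>3 * cc (S th)\<bar> + \<bar>kap' (S th)\<bar>"
    unfolding c_def using norm_triangle_ineq4[of "of_real (3 * cc (S th)) :: complex" "\<i> * of_real (kap' (S th))"]
    by (simp only: norm_of_real norm_mult) simp
   then show ?thesis using M(2)[of "S th"] M(3)[of "S th"] by simp
  qed
  then show ?thesis by (auto simp: bounded_iff)
 qed
 define d where "d th = G1 th * cnj (g1 (S th))" for th
 have bd: "bounded (d ` X)"
  using G1_bounds(2) by (auto simp: bounded_iff d_def norm_mult unit)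
 have ud: "uniform_limit X (%t th. deriv G (Complex th t) * cnj (g1 (si t th))) d (at_right 0)"
  unfolding d_def by (intro uniform_lim_mult uG bounded_linear.uniform_limit[OF bounded_linear_cnj] ug bG bg)
 have ud2: "uniform_limit X (%t th. (deriv G (Complex th t) * cnj (g1 (si t th)))\<^sup>2) (%th. (d th)\<^sup>2) (at_right 0)"
  unfolding power2_eq_square by (intro uniform_lim_mult ud bd)
 have bd2: "bounded ((%th. (d th)\<^sup>2) ` X)"
  using G1_bounds(2) by (auto simp: bounded_iff d_def norm_mult norm_power unit intro!: exI[of _ "b2\<^sup>2"] power_mono)
 have uQ: "uniform_limit X Q (%th. c th * (d th)\<^sup>2) (at_right 0)"
  unfolding Q_def by (intro uniform_lim_mult uc ud2 bc bd2)
 have "uniform_limit X (%t th. (schwarzian G (Complex th t) + of_real (k\<^sup>2 / 2) + Q t th) - of_real (k\<^sup>2 / 2) - Q t th)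
   (%th. 0 - of_real (k\<^sup>2 / 2) - c th * (d th)\<^sup>2) (at_right 0)"
  by (intro uniform_limit_minus ur uQ uniform_limit_const)
 then have fin: "uniform_limit X (%t th. schwarzian G (Complex th t)) (%th. 0 - of_real (k\<^sup>2 / 2) - c th * (d th)\<^sup>2) (at_right 0)" by simp
 have "d th = of_real (norm (G1 th))" if "th \<in> X" for th
 proof -
  have uu: "g1 s * cnj (g1 s) = 1" for s using unit[of s] by (simp add: complex_norm_square[symmetric])
  have "d th = of_real (norm (G1 th)) * (g1 (S th) * cnj (g1 (S th)))"
   unfolding d_def by (subst tangent[OF S[OF that]]) (simp add: mult.assoc)
  then show ?thesis by (simp add: uu)
 qed
 then show ?thesis
  by (intro uniform_limit_cong'[THEN iffD1, OF _ _ fin]) (auto simp: c_def)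
qed

text \<open>In the limit the derivative of the curvature drops out of the real part. The relation
  \<open>|ph0|^2 * |G1| = 1\<close> turns the factor \<open>|ph0|^2 * |G1|^2\<close> in front of
  \<open>c3\<close> into the arc length element, and the substitution by \<open>S\<close> gives the
  integral over the curve.\<close>

lemma boundary_energy:
 shows "integral {0..2 * pi} (%th. norm (G1 th)) = L"
  "4 * integral {0..2 * pi} (%th. (norm (ph1 th))\<^sup>2) + k\<^sup>2 * integral {0..2 * pi} (%th. (norm (ph0 th))\<^sup>2) = - 6 * integral {0..L} cc"
proof -
 obtain S where S: "\<And>th. 0 \<le> th ==> th \<le> 2 * pi ==> (S has_real_derivative norm (G1 th)) (at th)"
  "\<And>th. 0 \<le> th ==> th \<le> 2 * pi ==> \<gamma> (S th) = Ga th" "0 \<le> S 0" "S 0 \<le> L" "S (2 * pi) = S 0 + L"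
  using arclength_lift by metis
 let ?I = "{0..2 * pi}"
 have cS: "continuous_on ?I S" using S(1) by (meson DERIV_isCont atLeastAtMost_iff continuous_at_imp_continuous_on)
 have mono: "S x \<le> S y" if "0 \<le> x" "x \<le> y" "y \<le> 2 * pi" for x y
  by (rule DERIV_nonneg_imp_nondecreasing[OF that(2)]) (use S(1) that in \<open>meson norm_ge_zero order_trans\<close>)
 have sub: "S ` ?I \<subseteq> {S 0..S (2 * pi)}" using mono by auto
 have subst: "((%x. norm (G1 x) *\<^sub>R q (S x)) has_integral integral {S 0..S (2 * pi)} q) ?I" if "continuous_on UNIV q" for q :: "real \<Rightarrow> real"
  by (rule has_integral_substitution[OF _ _ sub])
    (use that S(1) L S(5) in \<open>auto intro: continuous_on_subset has_field_derivative_at_within\<close>)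
 have "((%x. norm (G1 x) *\<^sub>R 1) has_integral integral {S 0..S (2 * pi)} (%x. 1 :: real)) ?I" by (rule subst) simp
 then have "integral ?I (%x. norm (G1 x) *\<^sub>R 1) = S (2 * pi) - S 0" using L S(5) by (simp add: integral_unique)
 then show "integral ?I (%th. norm (G1 th)) = L" using S(5) by simp
 have icc: "integral ?I (%x. norm (G1 x) * cc (S x)) = integral {0..L} cc"
  using integral_unique[OF subst[OF cc(1)]] periodic_integral_shift[OF cc S(3,4)] S(5) by simp
 have cG: "continuous_on ?I (%x. norm (G1 x))" by (intro continuous_on_norm continuous_on_subset[OF cG1]) auto
 have ccS: "continuous_on ?I (%x. cc (S x))" by (rule continuous_on_compose2[OF cc(1) cS]) auto
 have ckS: "continuous_on ?I (%x. kap' (S x))" by (rule continuous_on_compose2[OF kap'_props(1) cS]) auto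
 have c1: "continuous_on ?I ph1" by (rule continuous_on_subset[OF cph1]) auto
 have bnd: "bounded (q ` ?I)" if "continuous_on ?I q" for q :: "real \<Rightarrow> complex"
  by (intro compact_imp_bounded compact_continuous_image that compact_Icc)
 define S0 where "S0 th = - of_real (k\<^sup>2 / 2) - (of_real (3 * cc (S th)) - \<i> * of_real (kap' (S th))) * (complex_of_real (norm (G1 th)))\<^sup>2" for th
 have cS0: "continuous_on ?I S0" unfolding S0_def by (intro continuous_intros ccS ckS cG)
 have uS: "uniform_limit ?I (%t th. schwarzian G (Complex th t)) S0 (at_right 0)"
  unfolding S0_def by (rule schwarzian_uniform_limit) (use S(2) in auto)
 have u0: "uniform_limit ?I (%t th. ph (Complex th t)) ph0 (at_right 0)"
  by (rule uniform_limit_linear_bound[OF h1(1) K]) (use bph0 in \<open>auto simp: dist_norm\<close>)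
 have u1: "uniform_limit ?I (%t th. ps (Complex th t)) ph1 (at_right 0)"
  by (rule uniform_limit_linear_bound[OF h1(1) K]) (use bph1 in \<open>auto simp: dist_norm\<close>)
 note uRe = bounded_linear.uniform_limit[OF bounded_linear_Re] and ucnj = bounded_linear.uniform_limit[OF bounded_linear_cnj]
 have "integral ?I (%th. Re (ph1 th * cnj (ph1 th))) = integral ?I (%th. Re (S0 th * (ph0 th * cnj (ph0 th))) / 2)"
 proof (rule integral_uniform_limit_eq[OF _ h1(1) _ _ level_energy])
  show "uniform_limit ?I (%t th. Re (ps (Complex th t) * cnj (ps (Complex th t)))) (%th. Re (ph1 th * cnj (ph1 th))) (at_right 0)"
   by (intro uRe uniform_lim_mult u1 ucnj bnd continuous_on_cnj c1)
  show "uniform_limit ?I (%t th. Re (schwarzian G (Complex th t) * (ph (Complex th t) * cnj (ph (Complex th t)))) / 2)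
    (%th. Re (S0 th * (ph0 th * cnj (ph0 th))) / 2) (at_right 0)"
   by (intro bounded_linear.uniform_limit[OF bounded_linear_divide[of "2::real"]] uRe uniform_lim_mult uS u0 ucnj bnd continuous_on_cnj cS0 cph0 continuous_on_mult)
  show "continuous_on ?I (%th. Re (ph1 th * cnj (ph1 th)))" by (intro continuous_intros c1)
  show "continuous_on ?I (%th. Re (S0 th * (ph0 th * cnj (ph0 th))) / 2)" by (intro continuous_intros cS0 cph0) auto
 qed auto
 moreover have "Re (ph1 th * cnj (ph1 th)) = (norm (ph1 th))\<^sup>2" for th by (simp add: complex_norm_square[symmetric] del: complex_mult_cnj)
 moreover have "Re (S0 th * (ph0 th * cnj (ph0 th))) / 2 = - (k\<^sup>2 / 4) * (norm (ph0 th))\<^sup>2 - 3/2 * (norm (G1 th) * cc (S th))" for th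
 proof -
  define N where "N = norm (G1 th)"
  define P where "P = (norm (ph0 th))\<^sup>2"
  have PN: "P * N = 1" using ph0_norm[of th] by (simp add: P_def N_def)
  have R: "Re (S0 th) = - (k\<^sup>2 / 2) - 3 * cc (S th) * N\<^sup>2"
   by (simp add: S0_def N_def flip: of_real_power)
  have "Re (S0 th * (ph0 th * cnj (ph0 th))) = Re (S0 th * of_real P)"
   unfolding P_def by (simp only: complex_norm_square)
  also have "\<dots> = Re (S0 th) * P" by simp
  also have "\<dots> = - (k\<^sup>2 / 2) * P - 3 * cc (S th) * N * (P * N)" unfolding R by (simp add: algebra_simps power2_eq_square)
  finally have E: "Re (S0 th * (ph0 th * cnj (ph0 th))) = - (k\<^sup>2 / 2) * P - 3 * cc (S th) * N * 1" unfolding PN .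
  show ?thesis unfolding E N_def[symmetric] P_def[symmetric] by (simp add: field_simps)
 qed
 ultimately have e: "integral ?I (%th. (norm (ph1 th))\<^sup>2) = integral ?I (%th. - (k\<^sup>2 / 4) * (norm (ph0 th))\<^sup>2 - 3/2 * (norm (G1 th) * cc (S th)))" by (simp only:)
 have i1: "(%th. (norm (ph0 th))\<^sup>2) integrable_on ?I" by (intro integrable_continuous_interval continuous_intros cph0)
 have i2: "(%th. norm (G1 th) * cc (S th)) integrable_on ?I" by (intro integrable_continuous_interval continuous_on_mult cG ccS)
 have "integral ?I (%th. - (k\<^sup>2 / 4) * (norm (ph0 th))\<^sup>2 - 3/2 * (norm (G1 th) * cc (S th)))
   = - (k\<^sup>2 / 4) * integral ?I (%th. (norm (ph0 th))\<^sup>2) - 3/2 * integral {0..L} cc"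
  unfolding icc[symmetric]
  by (rule integral_unique) (intro has_integral_diff has_integral_mult_right integrable_integral i1 i2)
 then show "4 * integral ?I (%th. (norm (ph1 th))\<^sup>2) + k\<^sup>2 * integral ?I (%th. (norm (ph0 th))\<^sup>2) = - 6 * integral {0..L} cc"
  unfolding e by (simp add: algebra_simps)
qed

text \<open>The reciprocal of \<open>|ph0|^2\<close> integrates to \<open>L\<close>. Six times the
  hypothesis is then the critical energy bound, and squaring the resulting exponential for
  \<open>ph0\<close> gives \<open>G1\<close>.\<close>

lemma boundary_rigidity:
 assumes hyp: "- L * integral {0..L} cc \<le> 2 * pi\<^sup>2 / 3 * (k\<^sup>2 + 1)"
 obtains C s where "s = 1 \<or> s = -1" "C \<noteq> 0" "\<And>th. 0 \<le> th ==> th \<le> 2 * pi ==> G1 th = C * exp (- (\<i> * of_real s * of_real th))"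
proof -
 have nz: "ph0 th \<noteq> 0" for th using ph0_root[of th] by auto
 have anti: "ph0 (2 * pi) = - ph0 0" using ph0_antiperiodic[of 0] by simp
 have k0: "k \<noteq> 0" using k by simp
 have "1 / (norm (ph0 th))\<^sup>2 = norm (G1 th)" for th using ph0_norm[of th] nz[of th] by (simp add: field_simps)
 then have iL: "integral {0..2 * pi} (%th. 1 / (norm (ph0 th))\<^sup>2) = L" using boundary_energy(1) by simp
 have "L * (4 * integral {0..2 * pi} (%th. (norm (ph1 th))\<^sup>2) + k\<^sup>2 * integral {0..2 * pi} (%th. (norm (ph0 th))\<^sup>2)) = 6 * (- L * integral {0..L} cc)"
  unfolding boundary_energy(2) by simp
 also have "\<dots> \<le> 6 * (2 * pi\<^sup>2 / 3 * (k\<^sup>2 + 1))" using hyp by (intro mult_left_mono) auto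
 also have "\<dots> = 4 * pi\<^sup>2 * (1 + k\<^sup>2)" by (simp add: algebra_simps)
 finally have en: "L * (4 * integral {0..2 * pi} (%th. (norm (ph1 th))\<^sup>2) + k\<^sup>2 * integral {0..2 * pi} (%th. (norm (ph0 th))\<^sup>2)) \<le> 4 * pi\<^sup>2 * (1 + k\<^sup>2)" .
 obtain c s where cs: "s = 1 \<or> s = -1" "c \<noteq> 0" "\<And>th. 0 \<le> th ==> th \<le> 2 * pi ==> ph0 th = c * exp (\<i> * of_real s * of_real th / 2)"
  using antiperiodic_energy_rigidity[OF dph0 cph1 nz anti k0 iL en] by metis
 show ?thesis
 proof (rule that[OF cs(1), of "1 / c\<^sup>2"])
  fix th assume th: "0 \<le> th" "th \<le> 2 * pi"
  have "(exp (\<i> * of_real s * of_real th / 2))\<^sup>2 = exp (\<i> * of_real s * complex_of_real th)" by (simp flip: exp_double)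
  then have "c\<^sup>2 * exp (\<i> * of_real s * of_real th) * G1 th = 1" using ph0_root[of th] by (simp add: cs(3)[OF th] power_mult_distrib)
  then show "G1 th = 1 / c\<^sup>2 * exp (- (\<i> * of_real s * of_real th))" using cs(2) by (simp add: exp_minus field_simps)
 qed (use cs in auto)
qed

text \<open>The difference of \<open>G'\<close> and the exponential is holomorphic on the strip and
  tends to 0 along an interval of the real axis.\<close>

lemma strip_rigidity:
 assumes hyp: "- L * integral {0..L} cc \<le> 2 * pi\<^sup>2 / 3 * (k\<^sup>2 + 1)"
 obtains C s where "s = 1 \<or> s = -1" "C \<noteq> 0" "\<And>ze. ze \<in> strip ==> deriv G ze = C * exp (- (\<i> * of_real s * ze))"
proof -
 obtain C s where Cs: "s = 1 \<or> s = -1" "C \<noteq> 0" "\<And>th. 0 \<le> th ==> th \<le> 2 * pi ==> G1 th = C * exp (- (\<i> * of_real s * of_real th))"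
  using boundary_rigidity[OF hyp] by metis
 define R where "R ze = deriv G ze - C * exp (- (\<i> * of_real s * ze))" for ze
 have holR: "R holomorphic_on {z. 0 < Im z \<and> Im z < c0}"
  unfolding R_def strip_def[symmetric] by (intro holomorphic_intros holomorphic_deriv[OF holG open_strip])
 have lim: "(R \<longlongrightarrow> 0) (at (of_real x) within {z. 0 < Im z})" if x: "0 < x" "x < 2 * pi" for x
 proof -
  let ?F = "at (complex_of_real x) within {z. 0 < Im z}"
  have idl: "((%ze. ze) \<longlongrightarrow> complex_of_real x) ?F" by (rule tendsto_ident_at)
  have Iml: "(Im \<longlongrightarrow> 0) ?F" using tendsto_Im[OF idl] by simp
  have Rel: "(Re \<longlongrightarrow> x) ?F" using tendsto_Re[OF idl] by simp
  have ev1: "\<forall>\<^sub>F ze in ?F. 0 < Im ze" by (simp add: eventually_at_filter)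
  have ev2: "\<forall>\<^sub>F ze in ?F. Im ze < h1" using order_tendstoD(2)[OF Iml h1(1)] .
  have 1: "((%ze. deriv G ze - G1 (Re ze)) \<longlongrightarrow> 0) ?F"
  proof (rule Lim_null_comparison[where g = "%ze. K * Im ze"])
   show "\<forall>\<^sub>F ze in ?F. norm (deriv G ze - G1 (Re ze)) \<le> K * Im ze"
    using ev1 ev2 by eventually_elim (metis bG1 complex_surj)
   show "((%ze. K * Im ze) \<longlongrightarrow> 0) ?F" using tendsto_mult_left[OF Iml, of K] by simp
  qed
  have "isCont G1 x" using cG1 by (simp add: continuous_on_eq_continuous_at)
  then have "((%ze. G1 (Re ze)) \<longlongrightarrow> G1 x) ?F" by (rule isCont_tendsto_compose[OF _ Rel])
  moreover have "((%ze. C * exp (- (\<i> * of_real s * ze))) \<longlongrightarrow> C * exp (- (\<i> * of_real s * of_real x))) ?F"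
   by (intro tendsto_intros idl)
  ultimately have "((%ze. (deriv G ze - G1 (Re ze)) + (G1 (Re ze) - C * exp (- (\<i> * of_real s * ze)))) \<longlongrightarrow>
    0 + (G1 x - C * exp (- (\<i> * of_real s * of_real x)))) ?F"
   by (intro tendsto_add 1 tendsto_diff)
  then show ?thesis using Cs(3)[of x] x by (simp add: R_def[abs_def])
 qed
 have "R ze = 0" if "ze \<in> strip" for ze
  by (rule holomorphic_zero_from_boundary[OF holR c0 _ lim, of 0 "2 * pi"]) (use that in \<open>auto simp: strip_def\<close>)
 then show ?thesis using that[OF Cs(1,2)] by (simp add: R_def)
qed

end

section \<open>Rigidity\<close>

lemma (in arclength_curve) curv_eq_kap: "curv g1 g2 s = kap s" by (simp add: curv_def kap_def)

context annular_collar
begin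

text \<open>The error exponent \<open>3 + \<alpha>\<close> exceeds 3, and the point
  \<open>npt s x\<close> has frontier distance \<open>x\<close> with foot \<open>\<gamma> s\<close>,
  so the hypothesis applies to it.\<close>

lemma third_order_expansion:
 assumes \<alpha>: "\<alpha> > 0" and tc: "third_coeff \<Omega> (%z. exp (- u z)) \<alpha> \<gamma> g1 g2 c3" and e: "e > 0"
 shows "\<exists>d>0. \<forall>s x. 0 < x \<longrightarrow> x \<le> d \<longrightarrow> npt s x \<in> \<Omega> \<and>
  \<bar>exp (- u (npt s x)) - (x - kap s * x\<^sup>2 / 2 + c3 (\<gamma> s) * x ^ 3)\<bar> \<le> e * x ^ 3"
proof -
 obtain r where r: "r > 0" "\<And>s. ball (npt s r) r \<subseteq> \<Omega>"
  "\<And>s x. \<bar>x\<bar> \<le> r ==> infdist (npt s x) curve = \<bar>x\<bar>"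
  "\<And>z. infdist z curve < r ==> infdist z (frontier \<Omega>) = infdist z curve" using collar by metis
 obtain dt M where dt: "dt > 0" and M: "\<forall>z\<in>\<Omega>. \<forall>s. let d = infdist z (frontier \<Omega>) in
    d < dt \<and> dist z (\<gamma> s) = d \<longrightarrow>
    \<bar>exp (- u z) - (d - curv g1 g2 s / 2 * d ^ 2 + c3 (\<gamma> s) * d ^ 3)\<bar> \<le> M * d powr (3 + \<alpha>)"
  using tc unfolding third_coeff_def by blast
 \<comment> \<open>Chosen so that \<open>q powr \<alpha>\<close> is
   \<open>e / (\<bar>M\<bar> + 1)\<close>; the summand 1 avoids a division by zero.\<close>
 define q where "q = (e / (\<bar>M\<bar> + 1)) powr (1 / \<alpha>)"
 have q: "q > 0" using e by (simp add: q_def add_nonneg_pos)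
 have qa: "q powr \<alpha> = e / (\<bar>M\<bar> + 1)" using \<alpha> e by (simp add: q_def powr_powr)
 define d where "d = min (r / 2) (min (dt / 2) q)"
 have d: "d > 0" "d \<le> r / 2" "d \<le> dt / 2" "d \<le> q" using r(1) dt q by (auto simp: d_def)
 have "npt s x \<in> \<Omega> \<and> \<bar>exp (- u (npt s x)) - (x - kap s * x\<^sup>2 / 2 + c3 (\<gamma> s) * x ^ 3)\<bar> \<le> e * x ^ 3" if x: "0 < x" "x \<le> d" for s x
 proof -
  have xr: "x < r" "x < dt" using x d r(1) dt by linarith+
  have in\<Omega>: "npt s x \<in> \<Omega>" using r(2)[of s] npt_dist[of s r x] x xr by auto
  have i: "infdist (npt s x) curve = x" using r(3)[of x s] x xr by simp
  have fi: "infdist (npt s x) (frontier \<Omega>) = x" using r(4)[of "npt s x"] i xr by simp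
  have dd: "dist (npt s x) (\<gamma> s) = x" using npt_dist[of s x 0] x by (simp add: npt_0)
  have "\<bar>exp (- u (npt s x)) - (x - kap s / 2 * x ^ 2 + c3 (\<gamma> s) * x ^ 3)\<bar> \<le> M * x powr (3 + \<alpha>)"
   using M[rule_format, OF in\<Omega>, of s] unfolding Let_def fi dd curv_eq_kap using xr by blast
  also have "\<dots> \<le> \<bar>M\<bar> * (x ^ 3 * x powr \<alpha>)"
  proof -
   have "x powr (3 + \<alpha>) = x ^ 3 * x powr \<alpha>" using x by (simp add: powr_add powr_numeral)
   then show ?thesis using x by (simp add: mult_right_mono)
  qed
  also have "\<dots> \<le> \<bar>M\<bar> * (x ^ 3 * (e / (\<bar>M\<bar> + 1)))"
  proof -
   have "x powr \<alpha> \<le> q powr \<alpha>" using x d \<alpha> by (intro powr_mono2) auto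
   then show ?thesis using x unfolding qa by (intro mult_left_mono) auto
  qed
  also have "\<dots> = (\<bar>M\<bar> / (\<bar>M\<bar> + 1)) * (e * x ^ 3)" by simp
  also have "\<dots> \<le> 1 * (e * x ^ 3)" using e x by (intro mult_right_mono) (auto simp: divide_le_eq)
  finally show ?thesis using in\<Omega> by simp
 qed
 then show ?thesis using d(1) by blast
qed

text \<open>Continuity of the coefficient is derived: solved for \<open>c3\<close>, the expansion
  exhibits it as a uniform limit of continuous functions of the boundary parameter.\<close>

lemma third_coeff_continuous:
 assumes \<alpha>: "\<alpha> > 0" and tc: "third_coeff \<Omega> (%z. exp (- u z)) \<alpha> \<gamma> g1 g2 c3" and cu: "continuous_on \<Omega> u"
 shows "continuous_on UNIV (%s. c3 (\<gamma> s))"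
proof (rule uniform_limit_theorem[where F = "at_right (0::real)"])
 define q where "q x s = (exp (- u (npt s x)) - x + kap s * x\<^sup>2 / 2) / x ^ 3" for x s
 show "uniform_limit UNIV q (%s. c3 (\<gamma> s)) (at_right 0)"
 proof (rule uniform_limitI)
  fix e :: real assume e: "e > 0"
  then have e2: "e / 2 > 0" by simp
  obtain d where d: "d > 0" "\<And>s x. 0 < x ==> x \<le> d ==> \<bar>exp (- u (npt s x)) - (x - kap s * x\<^sup>2 / 2 + c3 (\<gamma> s) * x ^ 3)\<bar> \<le> e / 2 * x ^ 3"
   using third_order_expansion[OF \<alpha> tc e2] by blast
  from eventually_at_right_real[OF d(1)]
  show "\<forall>\<^sub>F x in at_right 0. \<forall>s\<in>UNIV. dist (q x s) (c3 (\<gamma> s)) < e"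
  proof eventually_elim
   fix x assume "x \<in> {0<..<d}"
   then have x: "0 < x" "x \<le> d" by auto
   have x3: "x ^ 3 > 0" using x by simp
   have "dist (q x s) (c3 (\<gamma> s)) \<le> e / 2" for s
   proof -
    have "q x s - c3 (\<gamma> s) = (exp (- u (npt s x)) - (x - kap s * x\<^sup>2 / 2 + c3 (\<gamma> s) * x ^ 3)) / x ^ 3"
     using x3 by (simp add: q_def field_simps)
    then have "dist (q x s) (c3 (\<gamma> s)) = \<bar>exp (- u (npt s x)) - (x - kap s * x\<^sup>2 / 2 + c3 (\<gamma> s) * x ^ 3)\<bar> / x ^ 3"
     using x3 by (simp add: dist_real_def)
    also have "\<dots> \<le> e / 2" using d(2)[OF x, of s] x3 by (simp only: pos_divide_le_eq)
    finally show ?thesis .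
   qed
   moreover have "e / 2 < e" using e by simp
   ultimately show "\<forall>s\<in>UNIV. dist (q x s) (c3 (\<gamma> s)) < e" by (blast intro: order_le_less_trans)
  qed
 qed
 obtain d where d: "d > 0" "\<And>s x. 0 < x ==> x \<le> d ==> npt s x \<in> \<Omega>" using third_order_expansion[OF \<alpha> tc zero_less_one] by blast
 from eventually_at_right_real[OF d(1)]
 show "\<forall>\<^sub>F x in at_right 0. continuous_on UNIV (q x)"
 proof eventually_elim
  fix x assume "x \<in> {0<..<d}"
  then have x: "0 < x" "x \<le> d" by auto
  have "continuous_on UNIV (%s. npt s x)" unfolding npt_def by (intro continuous_intros cont0 cont1)
  then have "continuous_on UNIV (%s. u (npt s x))" by (rule continuous_on_compose2[OF cu]) (use d(2)[OF x] in auto)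
  then show "continuous_on UNIV (q x)" unfolding q_def using x by (intro continuous_intros kap_continuous) auto
 qed
qed auto

lemma liouville_strip_rigidity:
 assumes \<alpha>: "\<alpha> > 0" and tc: "third_coeff \<Omega> (%z. exp (- u z)) \<alpha> \<gamma> g1 g2 c3"
  and u: "solves_liouville \<Omega> u" "blows_up_at_boundary \<Omega> u"
  and hyp: "- L * integral {0..L} (%s. c3 (\<gamma> s)) \<le> 2 * pi\<^sup>2 / 3 * (k\<^sup>2 + 1)"
 obtains C s where "s = 1 \<or> s = -1" "C \<noteq> 0" "\<And>ze. ze \<in> strip ==> deriv G ze = C * exp (- (\<i> * of_real s * ze))"
proof -
 have cu: "continuous_on \<Omega> u"
  by (rule continuous_at_imp_continuous_on) (use solves_liouville_laplacian[OF u(1) open\<Omega>] in blast)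
 obtain r0 where r0: "r0 > 0"
  "\<And>s. ball (npt s r0) r0 \<subseteq> \<Omega>"
  "\<And>s. ball (npt s (- r0)) r0 \<inter> \<Omega> = {}"
  "\<And>z. z \<in> \<Omega> ==> infdist z curve < r0 ==> \<exists>s. z = npt s (infdist z curve)" using collar by metis
 obtain a A d where a: "a > 0" "A > 0" "d > 0"
  "\<And>z. z \<in> \<Omega> ==> infdist z curve < d ==> a * infdist z curve \<le> tau z \<and> tau z \<le> A * infdist z curve"
  using tau_linear by metis
 define r where "r = min r0 d"
 have r: "r > 0" "r \<le> r0" "r \<le> d" using r0(1) a(3) by (auto simp: r_def)
 have sub: "ball (npt s r) r \<subseteq> ball (npt s r0) r0" "ball (npt s (- r)) r \<subseteq> ball (npt s (- r0)) r0" for s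
  using npt_dist[of s r r0] npt_dist[of s "- r" "- r0"] r by (simp_all add: ball_subset_ball_iff)
 interpret lc: liouville_collar \<Omega> \<beta> f g \<gamma> g1 g2 g3 L B u "%s. c3 (\<gamma> s)" r a A
 proof unfold_locales
  show "exp (- u (G ze)) = norm (deriv G ze) * (sin (k * Im ze) / k)" if "ze \<in> strip" for ze
   by (rule conformal_factor_strip[OF u that])
  show "continuous_on UNIV (%s. c3 (\<gamma> s))" by (rule third_coeff_continuous[OF \<alpha> tc cu])
  show "c3 (\<gamma> (s + L)) = c3 (\<gamma> s)" for s by (simp add: per)
  show "\<exists>d>0. \<forall>s x. 0 < x \<longrightarrow> x \<le> d \<longrightarrow> \<bar>exp (- u (npt s x)) - (x - kap s * x\<^sup>2 / 2 + c3 (\<gamma> s) * x ^ 3)\<bar> \<le> e * x ^ 3" if "e > 0" for e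
   using third_order_expansion[OF \<alpha> tc that] by blast
  show "ball (npt s r) r \<subseteq> \<Omega>" for s using sub(1)[of s] r0(2)[of s] by (rule order_trans)
  show "ball (npt s (- r)) r \<inter> \<Omega> = {}" for s using sub(2)[of s] r0(3)[of s] by blast
  show "\<exists>s. z = npt s (infdist z curve)" if "z \<in> \<Omega>" "infdist z curve < r" for z using r0(4)[of z] that r by auto
  show "a * infdist z curve \<le> tau z \<and> tau z \<le> A * infdist z curve" if "z \<in> \<Omega>" "infdist z curve < r" for z using a(4)[of z] that r by auto
 qed (use r a in auto)
 obtain h b1 b2 where hb: "h > 0" "h \<le> c0" "k * h \<le> 1" "b1 > 0" "b2 > 0"
  "\<And>ze. 0 < Im ze ==> Im ze < h ==> infdist (G ze) curve < r \<and> b1 \<le> norm (deriv G ze) \<and> norm (deriv G ze) \<le> b2"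
  using lc.G_bounds by blast
 interpret rc: regular_collar \<Omega> \<beta> f g \<gamma> g1 g2 g3 L B u "%s. c3 (\<gamma> s)" r a A h b1 b2
  by unfold_locales (use hb in auto)
 obtain ph ps h1 K Ga G1 ph0 ph1 where *: "boundary_regular \<Omega> \<beta> f g \<gamma> g1 g2 g3 L B u (%s. c3 (\<gamma> s)) r a A h b1 b2 ph ps h1 K Ga G1 ph0 ph1"
  using rc.boundary_regularity by blast
 obtain C s where Cs: "s = 1 \<or> s = -1" "C \<noteq> 0" "\<And>ze. ze \<in> strip ==> deriv G ze = C * exp (- (\<i> * of_real s * ze))"
  using boundary_regular.strip_rigidity[OF * hyp] by metis
 show ?thesis by (rule that[OF Cs])
qed

end

lemma (in annular_domain) G_eq_exp:
 assumes s: "s = 1 \<or> s = (-1 :: real)" and C: "C \<noteq> 0" and D: "\<And>ze. ze \<in> strip ==> deriv G ze = C * exp (- (\<i> * of_real s * ze))"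
 obtains a D where "D \<noteq> 0" "\<And>ze. ze \<in> strip ==> G ze = a + D * exp (- (\<i> * of_real s * ze))"
proof -
 define E where "E = \<i> * of_real s * C"
 have ss: "of_real s * of_real s = (1 :: complex)" using s by auto
 have d0: "((%ze. G ze - E * exp (- (\<i> * of_real s * ze))) has_field_derivative 0) (at ze within strip)" if ze: "ze \<in> strip" for ze
 proof -
  have "((%ze. E * exp (- (\<i> * of_real s * ze))) has_field_derivative E * (exp (- (\<i> * of_real s * ze)) * (- (\<i> * of_real s)))) (at ze)"
   by (auto intro!: derivative_eq_intros)
  moreover have "E * (exp (- (\<i> * of_real s * ze)) * (- (\<i> * of_real s))) = C * (of_real s * of_real s) * exp (- (\<i> * of_real s * ze))"
   by (simp add: E_def algebra_simps)
  ultimately have "((%ze. E * exp (- (\<i> * of_real s * ze))) has_field_derivative deriv G ze) (at ze)" by (simp add: ss D[OF ze])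
  from DERIV_diff[OF derivG(1)[OF ze] this] show ?thesis by (simp add: has_field_derivative_at_within)
 qed
 have "\<exists>c. \<forall>ze\<in>strip. G ze - E * exp (- (\<i> * of_real s * ze)) = c"
  by (rule has_field_derivative_zero_constant[OF convex_strip d0])
 then obtain a where a: "\<And>ze. ze \<in> strip ==> G ze - E * exp (- (\<i> * of_real s * ze)) = a" by blast
 show ?thesis
 proof (rule that[of E a])
  show "E \<noteq> 0" using s C by (auto simp: E_def)
  show "G ze = a + E * exp (- (\<i> * of_real s * ze))" if "ze \<in> strip" for ze using a[OF that] by (simp only: diff_eq_eq)
 qed
qed

text \<open>The annulus is invariant under rotation, so the argument of \<open>D\<close> can be
  discarded, leaving a homothety and a translation.\<close>

lemma affine_annulus_rotation:
 assumes "D \<noteq> (0 :: complex)"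
 shows "(%w. a + D * w) ` annulus \<beta> = (%w. a + of_real (norm D) * w) ` annulus \<beta>"
proof -
 define N where "N = complex_of_real (norm D)"
 define e where "e = D / N"
 have N: "N \<noteq> 0" using assms by (simp add: N_def)
 have e: "norm e = 1" "e \<noteq> 0" using assms by (auto simp: e_def N_def norm_divide)
 have D: "D = N * e" using N by (simp add: e_def)
 have "(%w. a + D * w) ` annulus \<beta> = (%w. a + N * w) ` annulus \<beta>"
 proof (intro equalityI subsetI)
  fix z assume "z \<in> (%w. a + D * w) ` annulus \<beta>"
  then obtain w where w: "w \<in> annulus \<beta>" "z = a + D * w" by auto
  show "z \<in> (%w. a + N * w) ` annulus \<beta>"
  proof (rule image_eqI[of _ _ "e * w"])
   show "z = a + N * (e * w)" unfolding w(2) D by (simp only: mult.assoc)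
   show "e * w \<in> annulus \<beta>" using w(1) e by (simp add: annulus_def norm_mult)
  qed
 next
  fix z assume "z \<in> (%w. a + N * w) ` annulus \<beta>"
  then obtain w where w: "w \<in> annulus \<beta>" "z = a + N * w" by auto
  show "z \<in> (%w. a + D * w) ` annulus \<beta>"
  proof (rule image_eqI[of _ _ "w / e"])
   show "z = a + D * (w / e)" unfolding w(2) D using e(2) by simp
   show "w / e \<in> annulus \<beta>" using w(1) e by (simp add: annulus_def norm_divide)
  qed
 qed
 then show ?thesis by (simp add: N_def)
qed

context annular_collar
begin

lemma domain_of_outer_exp:
 assumes D: "D \<noteq> 0" and G: "\<And>ze. ze \<in> strip ==> G ze = a + D * exp (\<i> * ze)"
 shows "\<Omega> = (%w. a + of_real (norm D) * w) ` annulus \<beta>"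
proof -
 have z: "z = a + D * f z" if zin: "z \<in> \<Omega>" for z
 proof -
  obtain ze where ze: "ze \<in> strip" "G ze = z" using G_surj[OF zin] by blast
  then show ?thesis using G[OF ze(1)] f_G[OF ze(1)] by simp
 qed
 have "\<Omega> = (%w. a + D * w) ` annulus \<beta>"
 proof (intro equalityI subsetI)
  fix x assume "x \<in> \<Omega>" then show "x \<in> (%w. a + D * w) ` annulus \<beta>" using z fim by blast
 next
  fix x assume "x \<in> (%w. a + D * w) ` annulus \<beta>"
  then obtain w where w: "w \<in> annulus \<beta>" "x = a + D * w" by auto
  have "g w \<in> \<Omega>" using gim w by blast
  then show "x \<in> \<Omega>" using z[of "g w"] fg[OF w(1)] w(2) by simp
 qed
 then show ?thesis using affine_annulus_rotation[OF D] by simp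
qed

text \<open>For this sign \<open>z = a + D / f z\<close>, so \<open>\<Omega>\<close> is a round
  annulus turned inside out: its outer circle is the end \<open>tau = c0\<close>. But the outer
  boundary is the curve, where \<open>tau\<close> tends to 0.\<close>

lemma not_inner_exp:
 assumes D: "D \<noteq> 0" and G: "\<And>ze. ze \<in> strip ==> G ze = a + D * exp (- (\<i> * ze))"
  and K0: "curve = frontier K0" "K0 \<in> components (- \<Omega>)" "\<not> bounded K0"
 shows False
proof -
 \<comment> \<open>Radius of the outer circle, approached as \<open>|f|\<close> tends to
   \<open>\<beta>\<close>.\<close>
 define R where "R = norm D / \<beta>"
 have R: "R > 0" using D \<beta> by (simp add: R_def)
 have z: "z = a + D / f z" if zin: "z \<in> \<Omega>" for z
 proof -
  obtain ze where ze: "ze \<in> strip" "G ze = z" using G_surj[OF zin] by blast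
  then show ?thesis using G[OF ze(1)] f_G[OF ze(1)] by (simp add: exp_minus divide_inverse)
 qed
 have out: "norm (z - a) < R" if "z \<in> \<Omega>" for z
 proof -
  have "norm (z - a) = norm (D / f z)" using z[OF that] by (metis add_diff_cancel_left')
  also have "\<dots> < R" unfolding R_def norm_divide using f_in[OF that] f_nz[OF that] \<beta> D by (intro divide_strict_left_mono) auto
  finally show ?thesis .
 qed
 have inn: "a + of_real (t * R) \<in> \<Omega> \<and> tau (a + of_real (t * R)) = c0 + ln t" if t: "\<beta> < t" "t < 1" for t
 proof -
  define w where "w = D / of_real (t * R)"
  have t0: "t > 0" using t \<beta> by linarith
  have nw: "norm w = \<beta> / t"
   using t0 D \<beta> by (simp add: w_def R_def norm_divide norm_mult field_simps)
  have w: "w \<in> annulus \<beta>" using t t0 \<beta> by (simp add: annulus_def nw field_simps)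
  have gw: "g w \<in> \<Omega>" using gim w by blast
  have "D / w = of_real (t * R)" using D t0 R by (simp add: w_def)
  then have e: "a + of_real (t * R) = g w" using z[OF gw] fg[OF w] by simp
  have "tau (g w) = c0 + ln t" using fg[OF w] t0 \<beta> by (simp add: tau_def nw c0_def ln_div)
  then show ?thesis using e gw by simp
 qed
 define p where "p = a + of_real R"
 \<comment> \<open>The exterior of the disc is connected, misses \<open>\<Omega>\<close> and is met
   by the unbounded component \<open>K0\<close>; so it lies in \<open>K0\<close>, together with the
   circle of radius \<open>R\<close>.\<close>
 have "connected (- ball a R)"
  by (rule connected_complement_bounded_convex) auto
 moreover have "- ball a R \<subseteq> - \<Omega>" using out by (fastforce simp: dist_norm norm_minus_commute)
 moreover have "K0 \<inter> - ball a R \<noteq> {}"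
 proof
  assume "K0 \<inter> - ball a R = {}"
  then have "K0 \<subseteq> ball a R" by blast
  then show False using K0(3) bounded_ball bounded_subset by blast
 qed
 ultimately have sub: "- ball a R \<subseteq> K0" using components_maximal[OF K0(2)] by blast
 have p: "p \<in> K0" using sub R by (auto simp: p_def dist_norm)
 have K0\<Omega>: "K0 \<inter> \<Omega> = {}" using in_components_subset[OF K0(2)] by blast
 have near: "\<exists>t. \<beta> < t \<and> t < 1 \<and> 1 - et < t" if "et > 0" for et :: real
  using \<beta> that by (intro exI[of _ "(1 + max \<beta> (1 - et)) / 2"]) (auto simp: max_def)
 have dp: "dist p (a + of_real (t * R)) = (1 - t) * R" if "t < 1" for t
 proof -
  have "p - (a + of_real (t * R)) = of_real ((1 - t) * R)" by (simp add: p_def algebra_simps)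
  then have "norm (p - (a + of_real (t * R))) = \<bar>(1 - t) * R\<bar>" by (simp only: norm_of_real)
  then show ?thesis using that R by (simp add: dist_norm)
 qed
 have "p \<notin> interior K0"
 proof
  assume "p \<in> interior K0"
  then obtain ep where ep: "ep > 0" "ball p ep \<subseteq> K0" by (meson mem_interior)
  obtain t where t: "\<beta> < t" "t < 1" "1 - ep / R < t" using near[of "ep / R"] ep R by auto
  have "1 - t < ep / R" using t by linarith
  then have "(1 - t) * R < ep" using R by (simp add: pos_less_divide_eq)
  then have "a + of_real (t * R) \<in> K0" using ep(2) dp[OF t(2)] by (metis mem_ball subsetD)
  then show False using inn[OF t(1,2)] K0\<Omega> by blast
 qed
 then have pc: "p \<in> curve" unfolding K0(1) frontier_def using p closure_subset by blast
 obtain d where d: "d > 0" "\<And>z. z \<in> \<Omega> ==> infdist z curve < d ==> tau z < c0 / 2" using T1[of "c0 / 2"] c0 by auto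
 \<comment> \<open>For \<open>t > 1 - et\<close> the radial point is within \<open>d\<close> of
   \<open>p\<close>, and \<open>ln t > - c0 / 2\<close> makes its \<open>tau\<close> exceed
   \<open>c0 / 2\<close>.\<close>
 define et where "et = min (d / R) (1 - exp (- c0 / 2))"
 have et: "et > 0" using d R c0 by (simp add: et_def)
 obtain t where t: "\<beta> < t" "t < 1" "1 - et < t" using near[OF et] by blast
 have "1 - t < d / R" "exp (- c0 / 2) < t" using t(3) by (auto simp: et_def min_def split: if_splits)
 moreover have "t > 0" using t \<beta> by linarith
 ultimately have t1: "(1 - t) * R < d" and "ln (exp (- c0 / 2)) < ln t"
  using R t \<beta> by (simp_all only: pos_less_divide_eq ln_less_cancel_iff exp_gt_zero)
 then have t2: "- c0 / 2 < ln t" by simp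
 have "infdist (a + of_real (t * R)) curve \<le> dist (a + of_real (t * R)) p" by (rule infdist_le[OF pc])
 then have "infdist (a + of_real (t * R)) curve < d" using dp[OF t(2)] t1 by (simp add: dist_commute)
 then show False using d(2)[of "a + of_real (t * R)"] inn[OF t(1,2)] t2 by auto
qed

lemma domain_is_annulus:
 assumes \<alpha>: "\<alpha> > 0" and tc: "third_coeff \<Omega> (%z. exp (- u z)) \<alpha> \<gamma> g1 g2 c3"
  and u: "solves_liouville \<Omega> u" "blows_up_at_boundary \<Omega> u"
  and hyp: "- L * integral {0..L} (%s. c3 (\<gamma> s)) = 2 * pi ^ 2 / 3 * ((pi / ln \<beta>) ^ 2 + 1)"
  and K0: "curve = frontier K0" "K0 \<in> components (- \<Omega>)" "\<not> bounded K0"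
 shows "\<exists>a::complex. \<exists>r::real. 0 < r \<and> \<Omega> = (%z. a + of_real r * z) ` annulus \<beta>"
proof -
 have "(pi / ln \<beta>)\<^sup>2 = k\<^sup>2" by (simp add: k_def c0_def power_divide)
 then have hyp': "- L * integral {0..L} (%s. c3 (\<gamma> s)) \<le> 2 * pi\<^sup>2 / 3 * (k\<^sup>2 + 1)" using hyp by simp
 obtain C s where Cs: "s = 1 \<or> s = -1" "C \<noteq> 0" "\<And>ze. ze \<in> strip ==> deriv G ze = C * exp (- (\<i> * of_real s * ze))"
  using liouville_strip_rigidity[OF \<alpha> tc u hyp'] by metis
 obtain a D where D: "D \<noteq> 0" "\<And>ze. ze \<in> strip ==> G ze = a + D * exp (- (\<i> * of_real s * ze))"
  using G_eq_exp[OF Cs] by metis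
 show ?thesis
 proof (cases "s = 1")
  case True
  then show ?thesis using not_inner_exp[OF D(1) _ K0, of a] D(2) by simp
 next
  case False
  then have "s = -1" using Cs by simp
  then have "\<Omega> = (%w. a + of_real (norm D) * w) ` annulus \<beta>" using domain_of_outer_exp[OF D(1), of a] D(2) by simp
  then show ?thesis using D(1) by (intro exI[of _ a] exI[of _ "norm D"]) simp
 qed
qed

end

theorem theorem4p3:
  fixes \<Omega> :: "complex set" and \<beta> \<alpha> L :: real
    and u :: "complex \<Rightarrow> real" and c3 :: "complex \<Rightarrow> real"
    and \<gamma> g1 g2 g3 :: "real \<Rightarrow> complex"
  assumes "0 < \<beta>" "\<beta> < 1"
    and "bounded \<Omega>" "doubly_connected_domain \<Omega>"
    and "0 < \<alpha>" "\<alpha> < 1"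
    and "C3alpha_arclength_param \<Omega> (outer_boundary \<Omega>) \<alpha> \<gamma> L g1 g2 g3"
    and "biholomorphic \<Omega> (annulus \<beta>)"
    and "solves_liouville \<Omega> u" "blows_up_at_boundary \<Omega> u"
    and "third_coeff \<Omega> (\<lambda>z. exp (- u z)) \<alpha> \<gamma> g1 g2 c3"
    and "- L * integral {0..L} (\<lambda>s. c3 (\<gamma> s))
           = 2 * pi ^ 2 / 3 * ((pi / ln \<beta>) ^ 2 + 1)"
  shows "\<exists>a::complex. \<exists>r::real. 0 < r \<and> \<Omega> = (\<lambda>z. a + of_real r * z) ` annulus \<beta>"
proof -
 have dc: "open \<Omega>" using assms(4) by (simp add: doubly_connected_domain_def)
 have par: "0 < L" "\<And>s. \<gamma> (s + L) = \<gamma> s" "inj_on \<gamma> {0..<L}"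
  "\<And>s. (\<gamma> has_vector_derivative g1 s) (at s)" "\<And>s. (g1 has_vector_derivative g2 s) (at s)"
  "\<And>s. (g2 has_vector_derivative g3 s) (at s)" "\<And>s. norm (g1 s) = 1"
  and im: "\<gamma> ` {0..L} = outer_boundary \<Omega>"
  and hoelder: "\<exists>H. \<forall>s t. norm (g3 s - g3 t) \<le> H * \<bar>s - t\<bar> powr \<alpha>"
  and inward: "\<And>s. \<exists>e>0. \<forall>t. 0 < t \<and> t < e \<longrightarrow> \<gamma> s + of_real t * \<i> * g1 s \<in> \<Omega>"
  using assms(7) by (simp_all only: C3alpha_arclength_param_def)
 obtain H where H: "\<And>s t. norm (g3 s - g3 t) \<le> H * \<bar>s - t\<bar> powr \<alpha>" using hoelder by blast
 have cont_g3: "continuous_on UNIV g3"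
 proof (rule continuous_at_imp_continuous_on, rule ballI)
  fix s
  have "((%t. H * \<bar>t - s\<bar> powr \<alpha>) \<longlongrightarrow> H * 0) (at s)"
  proof (rule tendsto_mult_left)
   have "((%t. \<bar>t - s\<bar>) \<longlongrightarrow> \<bar>s - s\<bar>) (at s)" by (intro tendsto_intros)
   then have "((%t. \<bar>t - s\<bar>) \<longlongrightarrow> 0) (at s)" by simp
   then have "((%t. \<bar>t - s\<bar> powr \<alpha>) \<longlongrightarrow> 0 powr \<alpha>) (at s)"
    by (rule tendsto_powr') (use assms(5) in auto)
   then show "((%t. \<bar>t - s\<bar> powr \<alpha>) \<longlongrightarrow> 0) (at s)" by simp
  qed
  then have lim: "((%t. H * \<bar>t - s\<bar> powr \<alpha>) \<longlongrightarrow> 0) (at s)" by (simp only: mult_zero_right)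
  have "((%t. g3 t - g3 s) \<longlongrightarrow> 0) (at s)"
   by (rule Lim_null_comparison[OF always_eventually lim]) (rule allI, rule H)
  then show "isCont g3 s" unfolding isCont_def by (rule LIM_zero_cancel)
 qed
 interpret cv: arclength_curve \<gamma> g1 g2 g3 L
  by (rule arclength_curve.intro) (fact par cont_g3)+
 have curve: "range \<gamma> = outer_boundary \<Omega>" unfolding cv.image_period by (rule im)
 obtain K0 B where KB: "outer_boundary \<Omega> = frontier K0" "K0 \<in> components (- \<Omega>)" "\<not> bounded K0"
  "frontier \<Omega> = outer_boundary \<Omega> \<union> B" "compact (outer_boundary \<Omega>)" "compact B"
  "outer_boundary \<Omega> \<noteq> {}" "B \<noteq> {}" "outer_boundary \<Omega> \<inter> B = {}"
  by (fact doubly_connected_frontier[OF assms(4,3)])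
 obtain f g where fg: "f holomorphic_on \<Omega>" "g holomorphic_on annulus \<beta>" "f ` \<Omega> \<subseteq> annulus \<beta>" "g ` annulus \<beta> \<subseteq> \<Omega>"
   "\<And>z. z \<in> \<Omega> ==> g (f z) = z" "\<And>w. w \<in> annulus \<beta> ==> f (g w) = w"
  using assms(8) unfolding biholomorphic_def by blast
 interpret ad: annular_domain \<Omega> \<beta> f g
  by (rule annular_domain.intro) (fact assms(1,2,3) dc fg)+
 have con1: "connected {z \<in> \<Omega>. ad.tau z < e}" if "e \<le> ad.c0" for e
 proof -
  have "{z \<in> \<Omega>. ad.tau z < e} = {z \<in> \<Omega>. 0 < ad.tau z \<and> ad.tau z < e}" using ad.tau_bounds by blast
  then show ?thesis using ad.connected_level_band[of 0 e] that by simp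
 qed
 have con2: "connected {z \<in> \<Omega>. ad.c0 - e < ad.tau z}" if "e \<le> ad.c0" for e
 proof -
  have "{z \<in> \<Omega>. ad.c0 - e < ad.tau z} = {z \<in> \<Omega>. ad.c0 - e < ad.tau z \<and> ad.tau z < ad.c0}" using ad.tau_bounds by blast
  then show ?thesis using ad.connected_level_band[of "ad.c0 - e" ad.c0] that by simp
 qed
 have ends: "((\<forall>e>0. \<exists>d>0. \<forall>z\<in>\<Omega>. infdist z (range \<gamma>) < d \<longrightarrow> ad.tau z < e) \<and> (\<forall>d>0. \<exists>e>0. \<forall>z\<in>\<Omega>. ad.tau z < e \<longrightarrow> infdist z (range \<gamma>) < d) \<and>
     (\<forall>e>0. \<exists>d>0. \<forall>z\<in>\<Omega>. infdist z B < d \<longrightarrow> ad.c0 - e < ad.tau z))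
    \<or> ((\<forall>e>0. \<exists>d>0. \<forall>z\<in>\<Omega>. infdist z (range \<gamma>) < d \<longrightarrow> ad.c0 - e < ad.tau z) \<and> (\<forall>d>0. \<exists>e>0. \<forall>z\<in>\<Omega>. ad.c0 - e < ad.tau z \<longrightarrow> infdist z (range \<gamma>) < d) \<and>
     (\<forall>e>0. \<exists>d>0. \<forall>z\<in>\<Omega>. infdist z B < d \<longrightarrow> ad.tau z < e))"
  unfolding curve
  by (rule ends_correspond[OF dc assms(3) ad.cont_tau ad.c0 ad.tau_bounds ad.compact_levels con1 con2 KB(4-9)])
 have fr: "frontier \<Omega> = range \<gamma> \<union> B" "range \<gamma> \<inter> B = {}" "range \<gamma> = frontier K0" using KB curve by auto
 from ends show ?thesis
 proof (elim disjE conjE)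
  assume T: "\<forall>e>0. \<exists>d>0. \<forall>z\<in>\<Omega>. infdist z (range \<gamma>) < d \<longrightarrow> ad.tau z < e"
   "\<forall>d>0. \<exists>e>0. \<forall>z\<in>\<Omega>. ad.tau z < e \<longrightarrow> infdist z (range \<gamma>) < d"
   "\<forall>e>0. \<exists>d>0. \<forall>z\<in>\<Omega>. infdist z B < d \<longrightarrow> ad.c0 - e < ad.tau z"
  interpret ac: annular_collar \<Omega> \<beta> f g \<gamma> g1 g2 g3 L B
   by unfold_locales (use fr KB(6,8) inward T in blast)+
  show ?thesis by (rule ac.domain_is_annulus[OF assms(5,11,9,10,12) fr(3) KB(2,3)])
 next
  assume T: "\<forall>e>0. \<exists>d>0. \<forall>z\<in>\<Omega>. infdist z (range \<gamma>) < d \<longrightarrow> ad.c0 - e < ad.tau z"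
   "\<forall>d>0. \<exists>e>0. \<forall>z\<in>\<Omega>. ad.c0 - e < ad.tau z \<longrightarrow> infdist z (range \<gamma>) < d"
   "\<forall>e>0. \<exists>d>0. \<forall>z\<in>\<Omega>. infdist z B < d \<longrightarrow> ad.tau z < e"
  \<comment> \<open>If the curve corresponds to the end \<open>tau = c0\<close>, then
    \<open>f\<close> is replaced by \<open>\<beta> / f\<close>: this involution of the annulus
    exchanges its ends and turns \<open>tau\<close> into \<open>c0 - tau\<close>, so the previous
    case applies.\<close>
  have inv: "of_real \<beta> / w \<in> annulus \<beta>" "w \<noteq> 0" if "w \<in> annulus \<beta>" for w
  proof -
   have n: "0 < norm w" "\<beta> < norm w" "norm w < 1" using that assms(1) by (auto simp: annulus_def)
   then have "\<beta> * norm w < \<beta> * 1" using assms(1) by (intro mult_strict_left_mono) auto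
   then have "\<beta> < \<beta> / norm w" "\<beta> / norm w < 1" using n by (auto simp: pos_less_divide_eq pos_divide_less_eq)
   then show "of_real \<beta> / w \<in> annulus \<beta>" using assms(1) by (simp add: annulus_def norm_divide)
   show "w \<noteq> 0" using n by auto
  qed
  have hol_inv: "(%w. of_real \<beta> / w) holomorphic_on annulus \<beta>" by (intro holomorphic_intros) (use inv in auto)
  interpret ad': annular_domain \<Omega> \<beta> "%z. of_real \<beta> / f z" "%w. g (of_real \<beta> / w)"
  proof unfold_locales
   show "(%z. of_real \<beta> / f z) holomorphic_on \<Omega>" by (intro holomorphic_intros fg(1)) (use ad.f_nz in auto)
   have "g \<circ> (%w. of_real \<beta> / w) holomorphic_on annulus \<beta>"
    by (rule holomorphic_on_compose_gen[OF hol_inv fg(2)]) (use inv in auto)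
   then show "(%w. g (of_real \<beta> / w)) holomorphic_on annulus \<beta>" by (simp add: o_def)
   show "(%z. of_real \<beta> / f z) ` \<Omega> \<subseteq> annulus \<beta>" using fg(3) inv by auto
   show "(%w. g (of_real \<beta> / w)) ` annulus \<beta> \<subseteq> \<Omega>" using fg(4) inv by auto
   show "g (of_real \<beta> / (of_real \<beta> / f z)) = z" if "z \<in> \<Omega>" for z using fg(5)[OF that] assms(1) by simp
   show "of_real \<beta> / f (g (of_real \<beta> / w)) = w" if "w \<in> annulus \<beta>" for w
    using fg(6)[OF inv(1)[OF that]] assms(1) by simp
  qed (fact assms(1,2,3) dc)+
  have tau': "ad'.tau z = ad.c0 - ad.tau z" if "z \<in> \<Omega>" for z
   using ad.f_nz[OF that] assms(1) by (simp add: ad'.tau_def ad.tau_def ad.c0_def norm_divide ln_div)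
  interpret ac: annular_collar \<Omega> \<beta> "%z. of_real \<beta> / f z" "%w. g (of_real \<beta> / w)" \<gamma> g1 g2 g3 L B
  proof unfold_locales
   show "\<exists>d>0. \<forall>z\<in>\<Omega>. infdist z (range \<gamma>) < d \<longrightarrow> ad'.tau z < e" if "e > 0" for e
   proof -
    obtain d where d: "d > 0" "\<And>z. z \<in> \<Omega> ==> infdist z (range \<gamma>) < d ==> ad.c0 - e < ad.tau z" using T(1) \<open>e > 0\<close> by blast
    show ?thesis
    proof (intro exI[of _ d] conjI ballI impI d(1))
     show "ad'.tau z < e" if "z \<in> \<Omega>" "infdist z (range \<gamma>) < d" for z using d(2)[OF that] tau'[OF that(1)] by linarith
    qed
   qed
   show "\<exists>e>0. \<forall>z\<in>\<Omega>. ad'.tau z < e \<longrightarrow> infdist z (range \<gamma>) < d" if "d > 0" for d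
   proof -
    obtain e where e: "e > 0" "\<And>z. z \<in> \<Omega> ==> ad.c0 - e < ad.tau z ==> infdist z (range \<gamma>) < d" using T(2) \<open>d > 0\<close> by blast
    show ?thesis
    proof (intro exI[of _ e] conjI ballI impI e(1))
     show "infdist z (range \<gamma>) < d" if "z \<in> \<Omega>" "ad'.tau z < e" for z
      by (rule e(2)[OF that(1)]) (use tau'[OF that(1)] that(2) in linarith)
    qed
   qed
   show "\<exists>d>0. \<forall>z\<in>\<Omega>. infdist z B < d \<longrightarrow> ad.c0 - e < ad'.tau z" if "e > 0" for e
   proof -
    obtain d where d: "d > 0" "\<And>z. z \<in> \<Omega> ==> infdist z B < d ==> ad.tau z < e" using T(3) \<open>e > 0\<close> by blast
    show ?thesis
    proof (intro exI[of _ d] conjI ballI impI d(1))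
     show "ad.c0 - e < ad'.tau z" if "z \<in> \<Omega>" "infdist z B < d" for z using d(2)[OF that] tau'[OF that(1)] by linarith
    qed
   qed
  qed (fact fr(1,2) KB(6,8) inward)+
  show ?thesis by (rule ac.domain_is_annulus[OF assms(5,11,9,10,12) fr(3) KB(2,3)])
 qed
qed

end
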